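(* Let $\mathcal{C}$ be a stable model category. Then the cokernel is a Quillen equivalence from the projective model structure on $\mathrm{Arr}\,\mathcal{C}$ to the injective model structure on $\mathrm{Arr}\,\mathcal{C}$.
   Context: A model category $\mathcal{C}$ is stable if it is pointed and its homotopy category is triangulated (in the sense of Chapter 7 of Hovey's book "Model Categories"), i.e. the suspension functor on $\mathrm{ho}\,\mathcal{C}$ is an equivalence. $\mathrm{Arr}\,\mathcal{C}$ is the category of morphisms of $\mathcal{C}$ and commutative squares; $\mathrm{Ev}_0,\mathrm{Ev}_1$ send $X_0\to X_1$ to $X_0$, $X_1$. In the projective model structure a map $\alpha$ is a weak equivalence (resp. fibration) iff $\mathrm{Ev}_0\alpha$ and $\mathrm{Ev}_1\alpha$ are weak equivalences (resp. fibrations) in $\mathcal{C}$. In the injective model structure $\alpha$ is a weak equivalence (resp. cofibration) iff $\mathrm{Ev}_0\alpha$ and $\mathrm{Ev}_1\alpha$ are weak equivalences (resp. cofibrations) in $\mathcal{C}$. The cokernel functor sends $f\colon A\to B$ to the map $B\to B/A$, where $B/A$ is the pushout of $0\leftarrow A\to B$; its right adjoint, the kernel, sends $p\colon X\to Y$ to $\ker p\to X$, where $\ker p$ is the pullback of $0\to Y\leftarrow X$. *)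

theory Defs
  imports "HOL-Library.Infinite_Typeclass"
begin

section \<open>Categories, functors, natural isomorphisms\<close>

record ('o, 'm) cat =
  Obj :: "'o set"
  Mor :: "'m set"
  Dom :: "'m \<Rightarrow> 'o"
  Cod :: "'m \<Rightarrow> 'o"
  Ident :: "'o \<Rightarrow> 'm"
  Comp :: "'m \<Rightarrow> 'm \<Rightarrow> 'm"  (infixr "\<cdot>\<index>" 70)

definition hom :: "('o, 'm) cat \<Rightarrow> 'o \<Rightarrow> 'o \<Rightarrow> 'm set" where
  "hom C X Y = {f \<in> Mor C. Dom C f = X \<and> Cod C f = Y}"

locale category =
  fixes C :: "('o, 'm) cat" (structure)
  assumes Dom_in: "f \<in> Mor C \<Longrightarrow> Dom C f \<in> Obj C"
    and Cod_in: "f \<in> Mor C \<Longrightarrow> Cod C f \<in> Obj C"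
    and Ident_in: "X \<in> Obj C \<Longrightarrow> Ident C X \<in> hom C X X"
    and Comp_in: "\<lbrakk>f \<in> hom C X Y; g \<in> hom C Y Z\<rbrakk> \<Longrightarrow> g \<cdot> f \<in> hom C X Z"
    and Comp_Ident_right: "f \<in> hom C X Y \<Longrightarrow> f \<cdot> Ident C X = f"
    and Comp_Ident_left: "f \<in> hom C X Y \<Longrightarrow> Ident C Y \<cdot> f = f"
    and Comp_assoc: "\<lbrakk>f \<in> hom C W X; g \<in> hom C X Y; h \<in> hom C Y Z\<rbrakk>
          \<Longrightarrow> (h \<cdot> g) \<cdot> f = h \<cdot> (g \<cdot> f)"

record ('o, 'm, 'p, 'n) cfunctor =
  onobj :: "'o \<Rightarrow> 'p"
  onmor :: "'m \<Rightarrow> 'n"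

definition is_functor ::
    "('o, 'm) cat \<Rightarrow> ('p, 'n) cat \<Rightarrow> ('o, 'm, 'p, 'n) cfunctor \<Rightarrow> bool" where
  "is_functor C D F \<longleftrightarrow>
     (\<forall>X \<in> Obj C. onobj F X \<in> Obj D) \<and>
     (\<forall>f \<in> Mor C. onmor F f \<in> hom D (onobj F (Dom C f)) (onobj F (Cod C f))) \<and>
     (\<forall>X \<in> Obj C. onmor F (Ident C X) = Ident D (onobj F X)) \<and>
     (\<forall>f \<in> Mor C. \<forall>g \<in> Mor C. Cod C f = Dom C g \<longrightarrow>
        onmor F (g \<cdot>\<^bsub>C\<^esub> f) = onmor F g \<cdot>\<^bsub>D\<^esub> onmor F f)"

definition id_functor :: "('o, 'm, 'o, 'm) cfunctor" where
  "id_functor = \<lparr>onobj = (\<lambda>X. X), onmor = (\<lambda>f. f)\<rparr>"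

definition comp_functor ::
    "('p, 'n, 'q, 'k) cfunctor \<Rightarrow> ('o, 'm, 'p, 'n) cfunctor \<Rightarrow> ('o, 'm, 'q, 'k) cfunctor"
    (infixr "\<circ>\<^sub>F" 55) where
  "G \<circ>\<^sub>F F = \<lparr>onobj = onobj G \<circ> onobj F, onmor = onmor G \<circ> onmor F\<rparr>"

definition is_iso :: "('o, 'm) cat \<Rightarrow> 'm \<Rightarrow> bool" where
  "is_iso C f \<longleftrightarrow> f \<in> Mor C \<and>
     (\<exists>g \<in> hom C (Cod C f) (Dom C f).
        g \<cdot>\<^bsub>C\<^esub> f = Ident C (Dom C f) \<and> f \<cdot>\<^bsub>C\<^esub> g = Ident C (Cod C f))"

definition is_natural_iso ::
    "('o, 'm) cat \<Rightarrow> ('p, 'n) cat \<Rightarrow> ('o, 'm, 'p, 'n) cfunctor \<Rightarrow> ('o, 'm, 'p, 'n) cfunctor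
      \<Rightarrow> ('o \<Rightarrow> 'n) \<Rightarrow> bool" where
  "is_natural_iso C D F G \<tau> \<longleftrightarrow>
     (\<forall>X \<in> Obj C. \<tau> X \<in> hom D (onobj F X) (onobj G X) \<and> is_iso D (\<tau> X)) \<and>
     (\<forall>f \<in> Mor C. onmor G f \<cdot>\<^bsub>D\<^esub> \<tau> (Dom C f) = \<tau> (Cod C f) \<cdot>\<^bsub>D\<^esub> onmor F f)"

definition is_equivalence ::
    "('o, 'm) cat \<Rightarrow> ('p, 'n) cat \<Rightarrow> ('o, 'm, 'p, 'n) cfunctor \<Rightarrow> bool" where
  "is_equivalence C D F \<longleftrightarrow> is_functor C D F \<and>
     (\<exists>G \<eta> \<epsilon>. is_functor D C G \<and>
        is_natural_iso C C id_functor (G \<circ>\<^sub>F F) \<eta> \<and>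
        is_natural_iso D D (F \<circ>\<^sub>F G) id_functor \<epsilon>)"

text \<open>
  In an adjunction \<open>(F, U, \<phi>)\<close> the natural bijection
  \<open>hom D (F X) Y \<rightarrow> hom C X (U Y)\<close> is \<open>\<phi> X Y\<close>.
\<close>

definition is_adjunction ::
    "('o, 'm) cat \<Rightarrow> ('p, 'n) cat \<Rightarrow> ('o, 'm, 'p, 'n) cfunctor \<Rightarrow> ('p, 'n, 'o, 'm) cfunctor
      \<Rightarrow> ('o \<Rightarrow> 'p \<Rightarrow> 'n \<Rightarrow> 'm) \<Rightarrow> bool" where
  "is_adjunction C D F U \<phi> \<longleftrightarrow>
     is_functor C D F \<and> is_functor D C U \<and>
     (\<forall>X \<in> Obj C. \<forall>Y \<in> Obj D.
        bij_betw (\<phi> X Y) (hom D (onobj F X) Y) (hom C X (onobj U Y))) \<and>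
     (\<forall>a \<in> Mor C. \<forall>Y \<in> Obj D. \<forall>h \<in> hom D (onobj F (Cod C a)) Y.
        \<phi> (Dom C a) Y (h \<cdot>\<^bsub>D\<^esub> onmor F a) = \<phi> (Cod C a) Y h \<cdot>\<^bsub>C\<^esub> a) \<and>
     (\<forall>X \<in> Obj C. \<forall>b \<in> Mor D. \<forall>h \<in> hom D (onobj F X) (Dom D b).
        \<phi> X (Cod D b) (b \<cdot>\<^bsub>D\<^esub> h) = onmor U b \<cdot>\<^bsub>C\<^esub> \<phi> X (Dom D b) h)"

section \<open>Limits and colimits\<close>

definition is_cone ::
    "('i, 'j) cat \<Rightarrow> ('o, 'm) cat \<Rightarrow> ('i, 'j, 'o, 'm) cfunctor \<Rightarrow> 'o \<Rightarrow> ('i \<Rightarrow> 'm) \<Rightarrow> bool" where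
  "is_cone J C F L p \<longleftrightarrow> L \<in> Obj C \<and>
     (\<forall>i \<in> Obj J. p i \<in> hom C L (onobj F i)) \<and>
     (\<forall>a \<in> Mor J. onmor F a \<cdot>\<^bsub>C\<^esub> p (Dom J a) = p (Cod J a))"

definition is_limit ::
    "('i, 'j) cat \<Rightarrow> ('o, 'm) cat \<Rightarrow> ('i, 'j, 'o, 'm) cfunctor \<Rightarrow> 'o \<Rightarrow> ('i \<Rightarrow> 'm) \<Rightarrow> bool" where
  "is_limit J C F L p \<longleftrightarrow> is_cone J C F L p \<and>
     (\<forall>X q. is_cone J C F X q \<longrightarrow>
        (\<exists>!h. h \<in> hom C X L \<and> (\<forall>i \<in> Obj J. p i \<cdot>\<^bsub>C\<^esub> h = q i)))"

definition is_cocone ::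
    "('i, 'j) cat \<Rightarrow> ('o, 'm) cat \<Rightarrow> ('i, 'j, 'o, 'm) cfunctor \<Rightarrow> 'o \<Rightarrow> ('i \<Rightarrow> 'm) \<Rightarrow> bool" where
  "is_cocone J C F L p \<longleftrightarrow> L \<in> Obj C \<and>
     (\<forall>i \<in> Obj J. p i \<in> hom C (onobj F i) L) \<and>
     (\<forall>a \<in> Mor J. p (Cod J a) \<cdot>\<^bsub>C\<^esub> onmor F a = p (Dom J a))"

definition is_colimit ::
    "('i, 'j) cat \<Rightarrow> ('o, 'm) cat \<Rightarrow> ('i, 'j, 'o, 'm) cfunctor \<Rightarrow> 'o \<Rightarrow> ('i \<Rightarrow> 'm) \<Rightarrow> bool" where
  "is_colimit J C F L p \<longleftrightarrow> is_cocone J C F L p \<and>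
     (\<forall>X q. is_cocone J C F X q \<longrightarrow>
        (\<exists>!h. h \<in> hom C L X \<and> (\<forall>i \<in> Obj J. h \<cdot>\<^bsub>C\<^esub> p i = q i)))"

text \<open>
  HOL has no built-in notion of a small set. A type \<open>'u\<close> plays the role of the universe:
  a category is small if its objects and morphisms are elements of \<open>'u\<close>. The type is
  arbitrary apart from being infinite, so that all finite shapes are small.
\<close>

definition has_small_limits :: "'u::infinite itself \<Rightarrow> ('o, 'm) cat \<Rightarrow> bool" where
  "has_small_limits _ C \<longleftrightarrow>
     (\<forall>(J :: ('u, 'u) cat) F. category J \<and> is_functor J C F \<longrightarrow> (\<exists>L p. is_limit J C F L p))"

definition has_small_colimits :: "'u::infinite itself \<Rightarrow> ('o, 'm) cat \<Rightarrow> bool" where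
  "has_small_colimits _ C \<longleftrightarrow>
     (\<forall>(J :: ('u, 'u) cat) F. category J \<and> is_functor J C F \<longrightarrow> (\<exists>L p. is_colimit J C F L p))"

definition is_initial :: "('o, 'm) cat \<Rightarrow> 'o \<Rightarrow> bool" where
  "is_initial C I \<longleftrightarrow> I \<in> Obj C \<and> (\<forall>X \<in> Obj C. \<exists>!f. f \<in> hom C I X)"

definition is_terminal :: "('o, 'm) cat \<Rightarrow> 'o \<Rightarrow> bool" where
  "is_terminal C T \<longleftrightarrow> T \<in> Obj C \<and> (\<forall>X \<in> Obj C. \<exists>!f. f \<in> hom C X T)"

definition is_coproduct :: "('o, 'm) cat \<Rightarrow> 'o \<Rightarrow> 'o \<Rightarrow> 'm \<Rightarrow> 'm \<Rightarrow> bool" where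
  "is_coproduct C X Y i j \<longleftrightarrow>
     (\<exists>P. i \<in> hom C X P \<and> j \<in> hom C Y P \<and>
        (\<forall>Z. \<forall>u \<in> hom C X Z. \<forall>v \<in> hom C Y Z.
           \<exists>!h. h \<in> hom C P Z \<and> h \<cdot>\<^bsub>C\<^esub> i = u \<and> h \<cdot>\<^bsub>C\<^esub> j = v))"

text \<open>\<open>B -i\<rightarrow> P \<leftarrow>j- D\<close> is a pushout of \<open>B \<leftarrow>f- A -g\<rightarrow> D\<close>.\<close>

definition is_pushout :: "('o, 'm) cat \<Rightarrow> 'm \<Rightarrow> 'm \<Rightarrow> 'm \<Rightarrow> 'm \<Rightarrow> bool" where
  "is_pushout C f g i j \<longleftrightarrow>
     (\<exists>A B D P. f \<in> hom C A B \<and> g \<in> hom C A D \<and> i \<in> hom C B P \<and> j \<in> hom C D P \<and>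
        i \<cdot>\<^bsub>C\<^esub> f = j \<cdot>\<^bsub>C\<^esub> g \<and>
        (\<forall>Z. \<forall>u \<in> hom C B Z. \<forall>v \<in> hom C D Z. u \<cdot>\<^bsub>C\<^esub> f = v \<cdot>\<^bsub>C\<^esub> g \<longrightarrow>
           (\<exists>!h. h \<in> hom C P Z \<and> h \<cdot>\<^bsub>C\<^esub> i = u \<and> h \<cdot>\<^bsub>C\<^esub> j = v)))"

text \<open>\<open>B \<leftarrow>i- P -j\<rightarrow> D\<close> is a pullback of \<open>B -f\<rightarrow> A \<leftarrow>g- D\<close>.\<close>

definition is_pullback :: "('o, 'm) cat \<Rightarrow> 'm \<Rightarrow> 'm \<Rightarrow> 'm \<Rightarrow> 'm \<Rightarrow> bool" where
  "is_pullback C f g i j \<longleftrightarrow>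
     (\<exists>A B D P. f \<in> hom C B A \<and> g \<in> hom C D A \<and> i \<in> hom C P B \<and> j \<in> hom C P D \<and>
        f \<cdot>\<^bsub>C\<^esub> i = g \<cdot>\<^bsub>C\<^esub> j \<and>
        (\<forall>Z. \<forall>u \<in> hom C Z B. \<forall>v \<in> hom C Z D. f \<cdot>\<^bsub>C\<^esub> u = g \<cdot>\<^bsub>C\<^esub> v \<longrightarrow>
           (\<exists>!h. h \<in> hom C Z P \<and> i \<cdot>\<^bsub>C\<^esub> h = u \<and> j \<cdot>\<^bsub>C\<^esub> h = v)))"

section \<open>The category of arrows\<close>

text \<open>\<open>Sq f g u v\<close> is the square from \<open>f\<close> to \<open>g\<close> with components \<open>u = Ev\<^sub>0\<close> and \<open>v = Ev\<^sub>1\<close>.\<close>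

datatype 'm square = Sq (src: 'm) (tgt: 'm) (ev0: 'm) (ev1: 'm)

definition Arr :: "('o, 'm) cat \<Rightarrow> ('m, 'm square) cat" where
  "Arr C = \<lparr>
     Obj = Mor C,
     Mor = {Sq f g u v | f g u v. f \<in> Mor C \<and> g \<in> Mor C \<and>
              u \<in> hom C (Dom C f) (Dom C g) \<and> v \<in> hom C (Cod C f) (Cod C g) \<and>
              g \<cdot>\<^bsub>C\<^esub> u = v \<cdot>\<^bsub>C\<^esub> f},
     Dom = src,
     Cod = tgt,
     Ident = (\<lambda>f. Sq f f (Ident C (Dom C f)) (Ident C (Cod C f))),
     Comp = (\<lambda>t s. Sq (src s) (tgt t) (ev0 t \<cdot>\<^bsub>C\<^esub> ev0 s) (ev1 t \<cdot>\<^bsub>C\<^esub> ev1 s))\<rparr>"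

definition Ev0 :: "('o, 'm) cat \<Rightarrow> ('m, 'm square, 'o, 'm) cfunctor" where
  "Ev0 C = \<lparr>onobj = Dom C, onmor = ev0\<rparr>"

definition Ev1 :: "('o, 'm) cat \<Rightarrow> ('m, 'm square, 'o, 'm) cfunctor" where
  "Ev1 C = \<lparr>onobj = Cod C, onmor = ev1\<rparr>"

section \<open>Model categories\<close>

record 'm model_structure =
  Weq :: "'m set"
  Cof :: "'m set"
  Fib :: "'m set"

definition is_wide_subcategory :: "('o, 'm) cat \<Rightarrow> 'm set \<Rightarrow> bool" where
  "is_wide_subcategory C S \<longleftrightarrow> S \<subseteq> Mor C \<and> (\<forall>X \<in> Obj C. Ident C X \<in> S) \<and>
     (\<forall>f \<in> S. \<forall>g \<in> S. Cod C f = Dom C g \<longrightarrow> g \<cdot>\<^bsub>C\<^esub> f \<in> S)"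

definition is_retract :: "('o, 'm) cat \<Rightarrow> 'm \<Rightarrow> 'm \<Rightarrow> bool" where
  "is_retract C f g \<longleftrightarrow>
     (\<exists>s \<in> hom (Arr C) f g. \<exists>r \<in> hom (Arr C) g f. r \<cdot>\<^bsub>Arr C\<^esub> s = Ident (Arr C) f)"

definition closed_under_retracts :: "('o, 'm) cat \<Rightarrow> 'm set \<Rightarrow> bool" where
  "closed_under_retracts C S \<longleftrightarrow> (\<forall>f \<in> Mor C. \<forall>g \<in> S. is_retract C f g \<longrightarrow> f \<in> S)"

definition has_lifting :: "('o, 'm) cat \<Rightarrow> 'm \<Rightarrow> 'm \<Rightarrow> bool" where
  "has_lifting C i p \<longleftrightarrow>
     (\<forall>s \<in> hom (Arr C) i p.
        \<exists>h \<in> hom C (Cod C i) (Dom C p). h \<cdot>\<^bsub>C\<^esub> i = ev0 s \<and> p \<cdot>\<^bsub>C\<^esub> h = ev1 s)"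

text \<open>
  A functorial factorization is a pair of endofunctors \<open>\<alpha>, \<beta>\<close> of \<open>Arr C\<close> with
  \<open>f = \<beta> f \<circ> \<alpha> f\<close>. Compatibility of domains and codomains is required on squares as well:
  both functors agree on the middle object and its maps, and are the identity on the outer ends.
\<close>

definition functorial_factorization ::
    "('o, 'm) cat \<Rightarrow> ('m, 'm square, 'm, 'm square) cfunctor
      \<Rightarrow> ('m, 'm square, 'm, 'm square) cfunctor \<Rightarrow> bool" where
  "functorial_factorization C \<alpha> \<beta> \<longleftrightarrow>
     is_functor (Arr C) (Arr C) \<alpha> \<and> is_functor (Arr C) (Arr C) \<beta> \<and>
     (\<forall>f \<in> Mor C.
        Dom C (onobj \<alpha> f) = Dom C f \<and> Cod C (onobj \<alpha> f) = Dom C (onobj \<beta> f) \<and>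
        Cod C (onobj \<beta> f) = Cod C f \<and> f = onobj \<beta> f \<cdot>\<^bsub>C\<^esub> onobj \<alpha> f) \<and>
     (\<forall>s \<in> Mor (Arr C).
        ev0 (onmor \<alpha> s) = ev0 s \<and> ev1 (onmor \<alpha> s) = ev0 (onmor \<beta> s) \<and>
        ev1 (onmor \<beta> s) = ev1 s)"

definition factors_into ::
    "('o, 'm) cat \<Rightarrow> 'm set \<Rightarrow> 'm set \<Rightarrow> ('m, 'm square, 'm, 'm square) cfunctor
      \<Rightarrow> ('m, 'm square, 'm, 'm square) cfunctor \<Rightarrow> bool" where
  "factors_into C L R \<alpha> \<beta> \<longleftrightarrow> functorial_factorization C \<alpha> \<beta> \<and>
     (\<forall>f \<in> Mor C. onobj \<alpha> f \<in> L \<and> onobj \<beta> f \<in> R)"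

locale model_category = category C for C :: "('o, 'm) cat" (structure) +
  fixes U :: "'u::infinite itself" and M :: "'m model_structure"
  assumes limits: "has_small_limits U C"
    and colimits: "has_small_colimits U C"
    and Weq_subcat: "is_wide_subcategory C (Weq M)"
    and Cof_subcat: "is_wide_subcategory C (Cof M)"
    and Fib_subcat: "is_wide_subcategory C (Fib M)"
    and two_of_three: "\<lbrakk>f \<in> hom C X Y; g \<in> hom C Y Z\<rbrakk> \<Longrightarrow>
          (f \<in> Weq M \<and> g \<in> Weq M \<longrightarrow> g \<cdot> f \<in> Weq M) \<and>
          (f \<in> Weq M \<and> g \<cdot> f \<in> Weq M \<longrightarrow> g \<in> Weq M) \<and>
          (g \<in> Weq M \<and> g \<cdot> f \<in> Weq M \<longrightarrow> f \<in> Weq M)"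
    and Weq_retracts: "closed_under_retracts C (Weq M)"
    and Cof_retracts: "closed_under_retracts C (Cof M)"
    and Fib_retracts: "closed_under_retracts C (Fib M)"
    and lifting_tcof_fib: "\<lbrakk>i \<in> Cof M \<inter> Weq M; p \<in> Fib M\<rbrakk> \<Longrightarrow> has_lifting C i p"
    and lifting_cof_tfib: "\<lbrakk>i \<in> Cof M; p \<in> Fib M \<inter> Weq M\<rbrakk> \<Longrightarrow> has_lifting C i p"
    and factor_cof_tfib: "\<exists>\<alpha> \<beta>. factors_into C (Cof M) (Fib M \<inter> Weq M) \<alpha> \<beta>"
    and factor_tcof_fib: "\<exists>\<gamma> \<delta>. factors_into C (Cof M \<inter> Weq M) (Fib M) \<gamma> \<delta>"

definition is_cofibrant :: "('o, 'm) cat \<Rightarrow> 'm model_structure \<Rightarrow> 'o \<Rightarrow> bool" where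
  "is_cofibrant C M X \<longleftrightarrow> (\<exists>I f. is_initial C I \<and> f \<in> hom C I X \<and> f \<in> Cof M)"

definition is_fibrant :: "('o, 'm) cat \<Rightarrow> 'm model_structure \<Rightarrow> 'o \<Rightarrow> bool" where
  "is_fibrant C M X \<longleftrightarrow> (\<exists>T f. is_terminal C T \<and> f \<in> hom C X T \<and> f \<in> Fib M)"

locale quillen_adjunction =
  dom: model_category C U M + cod: model_category D U N
  for C :: "('o, 'm) cat" and D :: "('p, 'n) cat" and U :: "'u::infinite itself"
    and M :: "'m model_structure" and N :: "'n model_structure" +
  fixes F :: "('o, 'm, 'p, 'n) cfunctor" and G :: "('p, 'n, 'o, 'm) cfunctor"
    and \<phi> :: "'o \<Rightarrow> 'p \<Rightarrow> 'n \<Rightarrow> 'm"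
  assumes adjunction: "is_adjunction C D F G \<phi>"
    and preserves_cof: "f \<in> Cof M \<Longrightarrow> onmor F f \<in> Cof N"
    and preserves_tcof: "f \<in> Cof M \<inter> Weq M \<Longrightarrow> onmor F f \<in> Cof N \<inter> Weq N"

locale quillen_equivalence = quillen_adjunction +
  assumes weq_iff: "\<lbrakk>is_cofibrant C M X; is_fibrant D N Y; h \<in> hom D (onobj F X) Y\<rbrakk> \<Longrightarrow>
            h \<in> Weq N \<longleftrightarrow> \<phi> X Y h \<in> Weq M"

section \<open>Projective and injective model structures\<close>

definition levelwise :: "('o, 'm) cat \<Rightarrow> 'm set \<Rightarrow> 'm square set" where
  "levelwise C S =
     {s \<in> Mor (Arr C). onmor (Ev0 C) s \<in> S \<and> onmor (Ev1 C) s \<in> S}"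

text \<open>
  Two of the three classes of a model structure determine the third one by a lifting property.
\<close>

definition projective :: "('o, 'm) cat \<Rightarrow> 'm model_structure \<Rightarrow> 'm square model_structure" where
  "projective C M = \<lparr>
     Weq = levelwise C (Weq M),
     Cof = {i \<in> Mor (Arr C). \<forall>p \<in> levelwise C (Fib M) \<inter> levelwise C (Weq M).
              has_lifting (Arr C) i p},
     Fib = levelwise C (Fib M)\<rparr>"

definition injective :: "('o, 'm) cat \<Rightarrow> 'm model_structure \<Rightarrow> 'm square model_structure" where
  "injective C M = \<lparr>
     Weq = levelwise C (Weq M),
     Cof = levelwise C (Cof M),
     Fib = {p \<in> Mor (Arr C). \<forall>i \<in> levelwise C (Cof M) \<inter> levelwise C (Weq M).
              has_lifting (Arr C) i p}\<rparr>"

section \<open>Cokernel and kernel\<close>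

definition is_zero :: "('o, 'm) cat \<Rightarrow> 'o \<Rightarrow> bool" where
  "is_zero C Z \<longleftrightarrow> is_initial C Z \<and> is_terminal C Z"

definition pointed :: "('o, 'm) cat \<Rightarrow> bool" where
  "pointed C \<longleftrightarrow> (\<exists>Z. is_zero C Z)"

definition zero_obj :: "('o, 'm) cat \<Rightarrow> 'o" where
  "zero_obj C = (SOME Z. is_zero C Z)"

text \<open>A chosen map \<open>B \<rightarrow> B/A\<close>, for \<open>f : A \<rightarrow> B\<close>.\<close>

definition cok_map :: "('o, 'm) cat \<Rightarrow> 'm \<Rightarrow> 'm" where
  "cok_map C f =
     (SOME q. \<exists>t z. t \<in> hom C (Dom C f) (zero_obj C) \<and> is_pushout C f t q z)"

definition cokernel_functor :: "('o, 'm) cat \<Rightarrow> ('m, 'm square, 'm, 'm square) cfunctor" where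
  "cokernel_functor C = \<lparr>
     onobj = cok_map C,
     onmor = (\<lambda>s. Sq (cok_map C (src s)) (cok_map C (tgt s)) (ev1 s)
        (THE w. w \<in> hom C (Cod C (cok_map C (src s))) (Cod C (cok_map C (tgt s))) \<and>
                w \<cdot>\<^bsub>C\<^esub> cok_map C (src s) = cok_map C (tgt s) \<cdot>\<^bsub>C\<^esub> ev1 s))\<rparr>"

text \<open>A chosen map \<open>ker p \<rightarrow> X\<close>, for \<open>p : X \<rightarrow> Y\<close>.\<close>

definition ker_map :: "('o, 'm) cat \<Rightarrow> 'm \<Rightarrow> 'm" where
  "ker_map C p =
     (SOME k. \<exists>t z. t \<in> hom C (zero_obj C) (Cod C p) \<and> is_pullback C p t k z)"

definition kernel_functor :: "('o, 'm) cat \<Rightarrow> ('m, 'm square, 'm, 'm square) cfunctor" where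
  "kernel_functor C = \<lparr>
     onobj = ker_map C,
     onmor = (\<lambda>s. Sq (ker_map C (src s)) (ker_map C (tgt s))
        (THE w. w \<in> hom C (Dom C (ker_map C (src s))) (Dom C (ker_map C (tgt s))) \<and>
                ker_map C (tgt s) \<cdot>\<^bsub>C\<^esub> w = ev0 s \<cdot>\<^bsub>C\<^esub> ker_map C (src s))
        (ev0 s))\<rparr>"

text \<open>
  For \<open>f : A \<rightarrow> B\<close> and \<open>p : X \<rightarrow> Y\<close>, a square \<open>cok f \<rightarrow> p\<close> with components \<open>b : B \<rightarrow> X\<close> and
  \<open>B/A \<rightarrow> Y\<close> corresponds to the square \<open>f \<rightarrow> ker p\<close> whose components are the map
  \<open>A \<rightarrow> ker p\<close> induced by \<open>b \<circ> f\<close>, and \<open>b\<close>.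
\<close>

definition cok_ker_adj :: "('o, 'm) cat \<Rightarrow> 'm \<Rightarrow> 'm \<Rightarrow> 'm square \<Rightarrow> 'm square" where
  "cok_ker_adj C f p s = Sq f (ker_map C p)
     (THE a. a \<in> hom C (Dom C f) (Dom C (ker_map C p)) \<and>
             ker_map C p \<cdot>\<^bsub>C\<^esub> a = ev0 s \<cdot>\<^bsub>C\<^esub> f)
     (ev0 s)"

section \<open>The homotopy category\<close>

text \<open>
  \<open>Ho C W\<close> is the localization of \<open>C\<close> at \<open>W\<close>: its morphisms are strings of morphisms of \<open>C\<close>
  and formal inverses of morphisms in \<open>W\<close>, modulo the evident relations. A string is
  written in the order in which it is traversed, so composition is concatenation.
\<close>

datatype 'm step = Fwd 'm | Bwd 'm

fun zigzag :: "('o, 'm) cat \<Rightarrow> 'm set \<Rightarrow> 'o \<Rightarrow> 'm step list \<Rightarrow> 'o \<Rightarrow> bool" where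
  "zigzag C W X [] Y \<longleftrightarrow> X \<in> Obj C \<and> X = Y"
| "zigzag C W X (Fwd f # xs) Y \<longleftrightarrow> f \<in> Mor C \<and> Dom C f = X \<and> zigzag C W (Cod C f) xs Y"
| "zigzag C W X (Bwd w # xs) Y \<longleftrightarrow> w \<in> W \<and> Cod C w = X \<and> zigzag C W (Dom C w) xs Y"

inductive zigzag_eq ::
    "('o, 'm) cat \<Rightarrow> 'm set \<Rightarrow> 'o \<Rightarrow> 'o \<Rightarrow> 'm step list \<Rightarrow> 'm step list \<Rightarrow> bool"
  for C :: "('o, 'm) cat" and W :: "'m set" where
  refl: "zigzag C W X xs Y \<Longrightarrow> zigzag_eq C W X Y xs xs"
| sym: "zigzag_eq C W X Y xs ys \<Longrightarrow> zigzag_eq C W X Y ys xs"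
| trans: "\<lbrakk>zigzag_eq C W X Y xs ys; zigzag_eq C W X Y ys zs\<rbrakk> \<Longrightarrow> zigzag_eq C W X Y xs zs"
| append: "\<lbrakk>zigzag_eq C W X Y xs xs'; zigzag_eq C W Y Z ys ys'\<rbrakk>
    \<Longrightarrow> zigzag_eq C W X Z (xs @ ys) (xs' @ ys')"
| ident: "X \<in> Obj C \<Longrightarrow> zigzag_eq C W X X [Fwd (Ident C X)] []"
| comp: "\<lbrakk>f \<in> hom C X Y; g \<in> hom C Y Z\<rbrakk>
    \<Longrightarrow> zigzag_eq C W X Z [Fwd f, Fwd g] [Fwd (g \<cdot>\<^bsub>C\<^esub> f)]"
| inv_right: "\<lbrakk>w \<in> W; w \<in> hom C X Y\<rbrakk> \<Longrightarrow> zigzag_eq C W X X [Fwd w, Bwd w] []"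
| inv_left: "\<lbrakk>w \<in> W; w \<in> hom C X Y\<rbrakk> \<Longrightarrow> zigzag_eq C W Y Y [Bwd w, Fwd w] []"

type_synonym ('o, 'm) ho_mor = "'o \<times> 'o \<times> 'm step list set"

definition ho_class :: "('o, 'm) cat \<Rightarrow> 'm set \<Rightarrow> 'o \<Rightarrow> 'o \<Rightarrow> 'm step list \<Rightarrow> ('o, 'm) ho_mor" where
  "ho_class C W X Y xs = (X, Y, {ys. zigzag_eq C W X Y xs ys})"

definition Ho :: "('o, 'm) cat \<Rightarrow> 'm set \<Rightarrow> ('o, ('o, 'm) ho_mor) cat" where
  "Ho C W = \<lparr>
     Obj = Obj C,
     Mor = {ho_class C W X Y xs | X Y xs. zigzag C W X xs Y},
     Dom = fst,
     Cod = fst \<circ> snd,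
     Ident = (\<lambda>X. ho_class C W X X []),
     Comp = (\<lambda>(Y', Z, d) (X, Y, c).
        (X, Z, {zs. \<exists>xs \<in> c. \<exists>ys \<in> d. zigzag_eq C W X Z (xs @ ys) zs}))\<rparr>"

text \<open>
  The functor \<open>Ho C W \<rightarrow> Ho D V\<close> induced by a functor \<open>F : C \<rightarrow> D\<close> that maps \<open>W\<close> to \<open>V\<close>.
\<close>

definition ho_functor ::
    "('p, 'n) cat \<Rightarrow> 'n set \<Rightarrow> ('o, 'm, 'p, 'n) cfunctor
      \<Rightarrow> ('o, ('o, 'm) ho_mor, 'p, ('p, 'n) ho_mor) cfunctor" where
  "ho_functor D V F = \<lparr>
     onobj = onobj F,
     onmor = (\<lambda>(X, Y, c). (onobj F X, onobj F Y,
        {ys. \<exists>xs \<in> c. zigzag_eq D V (onobj F X) (onobj F Y) (map (map_step (onmor F)) xs) ys}))\<rparr>"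

section \<open>Suspension and stability\<close>

text \<open>\<open>X \<mapsto> (0 \<rightarrow> X)\<close>\<close>

definition from_zero :: "('o, 'm) cat \<Rightarrow> ('o, 'm, 'm, 'm square) cfunctor" where
  "from_zero C = (let z = (\<lambda>X. THE t. t \<in> hom C (zero_obj C) X) in \<lparr>
     onobj = z,
     onmor = (\<lambda>f. Sq (z (Dom C f)) (z (Cod C f)) (Ident C (zero_obj C)) f)\<rparr>)"

text \<open>\<open>X \<mapsto> (\<nabla> : X \<squnion> X \<rightarrow> X)\<close>, for chosen coproducts\<close>

definition copair :: "('o, 'm) cat \<Rightarrow> 'o \<Rightarrow> 'm \<times> 'm" where
  "copair C X = (SOME (i, j). is_coproduct C X X i j)"

definition copair_map :: "('o, 'm) cat \<Rightarrow> 'o \<Rightarrow> 'm \<Rightarrow> 'm \<Rightarrow> 'm" where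
  "copair_map C X u v = (THE h. h \<in> hom C (Cod C (fst (copair C X))) (Cod C u) \<and>
     h \<cdot>\<^bsub>C\<^esub> fst (copair C X) = u \<and> h \<cdot>\<^bsub>C\<^esub> snd (copair C X) = v)"

definition fold_functor :: "('o, 'm) cat \<Rightarrow> ('o, 'm, 'm, 'm square) cfunctor" where
  "fold_functor C = (let nabla = (\<lambda>X. copair_map C X (Ident C X) (Ident C X)) in \<lparr>
     onobj = nabla,
     onmor = (\<lambda>f. Sq (nabla (Dom C f)) (nabla (Cod C f))
        (copair_map C (Dom C f) (fst (copair C (Cod C f)) \<cdot>\<^bsub>C\<^esub> f)
                                (snd (copair C (Cod C f)) \<cdot>\<^bsub>C\<^esub> f))
        f)\<rparr>)"

definition cof_tfib_factorization ::
    "('o, 'm) cat \<Rightarrow> 'm model_structure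
      \<Rightarrow> ('m, 'm square, 'm, 'm square) cfunctor \<times> ('m, 'm square, 'm, 'm square) cfunctor" where
  "cof_tfib_factorization C M =
     (SOME (\<alpha>, \<beta>). factors_into C (Cof M) (Fib M \<inter> Weq M) \<alpha> \<beta>)"

text \<open>Functorial cofibrant replacement: \<open>0 \<rightarrow> Q X \<rightarrow> X\<close> is the chosen factorization of \<open>0 \<rightarrow> X\<close>.\<close>

definition cof_repl :: "('o, 'm) cat \<Rightarrow> 'm model_structure \<Rightarrow> ('o, 'm, 'o, 'm) cfunctor" where
  "cof_repl C M = Ev0 C \<circ>\<^sub>F snd (cof_tfib_factorization C M) \<circ>\<^sub>F from_zero C"

text \<open>
  \<open>X \<mapsto> (X \<squnion> X \<rightarrow> Cyl X)\<close>, where \<open>X \<squnion> X \<rightarrow> Cyl X \<rightarrow> X\<close> is the chosen factorization of \<open>\<nabla>\<close>.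
\<close>

definition cylinder :: "('o, 'm) cat \<Rightarrow> 'm model_structure \<Rightarrow> ('o, 'm, 'm, 'm square) cfunctor" where
  "cylinder C M = fst (cof_tfib_factorization C M) \<circ>\<^sub>F fold_functor C"

text \<open>
  The suspension of \<open>X\<close> in the homotopy category is the cokernel of \<open>Q X \<squnion> Q X \<rightarrow> Cyl (Q X)\<close>,
  as in Quillen's definition.
\<close>

definition suspension ::
    "('o, 'm) cat \<Rightarrow> 'm model_structure
      \<Rightarrow> ('o, ('o, 'm) ho_mor, 'o, ('o, 'm) ho_mor) cfunctor" where
  "suspension C M = ho_functor C (Weq M) (Ev1 C \<circ>\<^sub>F cokernel_functor C \<circ>\<^sub>F cylinder C M \<circ>\<^sub>F cof_repl C M)"

locale stable_model_category = model_category +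
  assumes has_zero: "pointed C"
    and suspension_equivalence:
      "is_equivalence (Ho C (Weq M)) (Ho C (Weq M)) (suspension C M)"

end

theory Submission
  imports Defs
begin

text \<open>
  For a cone \<open>x : A \<rightarrow> E\<close> (a cofibration with \<open>E\<close> contractible) and a path fibration \<open>p : P \<rightarrow> Y\<close>
  (\<open>P\<close> contractible), a square \<open>cok x \<rightarrow> p\<close> has second component \<open>\<Sigma> A \<rightarrow> Y\<close> and its adjoint has
  first component \<open>A \<rightarrow> \<Omega> Y\<close>; stability says that one is a weak equivalence iff the other is.
  After replacing the target of \<open>cok f \<rightarrow> p\<close>, the theorem splits into two claims.

  (1) For a cofibration \<open>f : A \<rightarrow> B\<close> with \<open>A\<close> cofibrant, \<open>A\<close> is the homotopy fibre of \<open>B \<rightarrow> B/A\<close>.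
  Let \<open>E\<close> be a cone on \<open>B\<close> and \<open>E'\<close> a contractible object with \<open>E/A \<rightarrow> E'\<close> a cofibration. The claim is
  known for the cones \<open>A \<rightarrow> E\<close>, \<open>B \<rightarrow> E\<close>, \<open>0 \<rightarrow> E'\<close>, \<open>B/A \<rightarrow> E'\<close>. The comparison map of \<open>f\<close> is the first
  of three composable maps of which both consecutive composites are equivalences, because taking
  fibres commutes with taking fibres, so two-out-of-six applies.

  (2) A map of fibrations \<open>p' \<rightarrow> p\<close> that is a weak equivalence on total objects and on fibres is one on
  the bases. Pulling back along path fibrations turns \<open>F \<rightarrow> X \<rightarrow> Y\<close> into \<open>\<Omega> Y \<rightarrow> F \<rightarrow> X\<close>, hence
  \<open>\<Omega> Y' \<rightarrow> \<Omega> Y\<close> is a weak equivalence, and stability delivers the claim.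
\<close>

section \<open>Categories and functors\<close>

text \<open>Stability is given only as an equivalence on the localization, whose morphisms are
  strings of arrows, while the claims concern honest weak equivalences. The bridge is threefold: a
  morphism of the localization from a cofibrant to a fibrant object is the class of a map, two
  parallel maps of this kind have the same class only if they are homotopic, and a map that becomes
  invertible is a weak equivalence. Loops are never made into a functor on the homotopy category.
  The correspondence between maps out of a suspension and maps into a loop object is read off from
  squares \<open>cok x -> p\<close>, with the homotopies supplied by path objects and cylinders of
  \<open>Arr C\<close> itself; fullness, faithfulness and essential surjectivity of the suspension
  take the place of an inverse. The hypothesis speaks of suspensions only, so claims (1) and (2) are
  not obtained from each other by duality. General facts on model categories are by contrast proved
  once and dualized, and the injective structure is the projective one of the opposite
  category.\<close>

lemma hom_iff: "f \<in> hom C X Y \<longleftrightarrow> f \<in> Mor C \<and> Dom C f = X \<and> Cod C f = Y"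
  by (auto simp: hom_def)

lemma homD:
  assumes "f \<in> hom C X Y"
  shows "f \<in> Mor C" "Dom C f = X" "Cod C f = Y"
  using assms by (auto simp: hom_def)

context category
begin

lemma Mor_hom: "f \<in> Mor C \<Longrightarrow> f \<in> hom C (Dom C f) (Cod C f)"
  by (simp add: hom_def)

lemma Dom_Obj [simp]: "f \<in> Mor C \<Longrightarrow> Dom C f \<in> Obj C"
  and Cod_Obj [simp]: "f \<in> Mor C \<Longrightarrow> Cod C f \<in> Obj C"
  by (auto intro: Dom_in Cod_in)

lemma hom_Obj:
  assumes "f \<in> hom C X Y"
  shows "X \<in> Obj C" "Y \<in> Obj C"
  using assms by (auto simp: hom_def)

lemma Comp_Mor [simp]: "\<lbrakk>f \<in> Mor C; g \<in> Mor C; Cod C f = Dom C g\<rbrakk> \<Longrightarrow> g \<cdot> f \<in> Mor C"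
  and Dom_Comp [simp]: "\<lbrakk>f \<in> Mor C; g \<in> Mor C; Cod C f = Dom C g\<rbrakk> \<Longrightarrow> Dom C (g \<cdot> f) = Dom C f"
  and Cod_Comp [simp]: "\<lbrakk>f \<in> Mor C; g \<in> Mor C; Cod C f = Dom C g\<rbrakk> \<Longrightarrow> Cod C (g \<cdot> f) = Cod C g"
  using Comp_in[of f "Dom C f" "Cod C f" g "Cod C g"] by (auto simp: hom_def)

lemma Ident_Mor [simp]: "X \<in> Obj C \<Longrightarrow> Ident C X \<in> Mor C"
  and Dom_Ident [simp]: "X \<in> Obj C \<Longrightarrow> Dom C (Ident C X) = X"
  and Cod_Ident [simp]: "X \<in> Obj C \<Longrightarrow> Cod C (Ident C X) = X"
  using Ident_in[of X] by (auto simp: hom_def)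

lemma Ident_right [simp]: "\<lbrakk>f \<in> Mor C; Dom C f = X\<rbrakk> \<Longrightarrow> f \<cdot> Ident C X = f"
  and Ident_left [simp]: "\<lbrakk>f \<in> Mor C; Cod C f = Y\<rbrakk> \<Longrightarrow> Ident C Y \<cdot> f = f"
  by (auto intro: Comp_Ident_right Comp_Ident_left simp: hom_def)

lemma assoc [simp]:
  "\<lbrakk>f \<in> Mor C; g \<in> Mor C; h \<in> Mor C; Cod C f = Dom C g; Cod C g = Dom C h\<rbrakk>
    \<Longrightarrow> (h \<cdot> g) \<cdot> f = h \<cdot> (g \<cdot> f)"
  using Comp_assoc[of f "Dom C f" "Cod C f" g "Cod C g" h "Cod C h"] by (simp add: hom_def)

text \<open>Composites are normalized to the right by \<open>assoc\<close>, so an equation between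
  two-fold composites no longer matches inside a longer string. This form, and
  \<open>reassoc2\<close> for commuting squares, restate it with a further map on the right.\<close>

lemma reassoc:
  assumes "g \<cdot> f = k" "f \<in> Mor C" "g \<in> Mor C" "Cod C f = Dom C g"
    and "x \<in> Mor C" "Cod C x = Dom C f"
  shows "g \<cdot> (f \<cdot> x) = k \<cdot> x"
  using assms assoc[of x f g] by simp

lemma reassoc2:
  assumes "g \<cdot> f = k \<cdot> l" "f \<in> Mor C" "g \<in> Mor C" "Cod C f = Dom C g"
    and "l \<in> Mor C" "k \<in> Mor C" "Cod C l = Dom C k"
    and "x \<in> Mor C" "Cod C x = Dom C f" "Dom C l = Dom C f"
  shows "g \<cdot> (f \<cdot> x) = k \<cdot> (l \<cdot> x)"
  using assms assoc[of x f g] assoc[of x l k] by simp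

end

section \<open>Opposite categories and functors\<close>

definition op_cat :: "('o, 'm) cat \<Rightarrow> ('o, 'm) cat" where
  "op_cat C = \<lparr>Obj = Obj C, Mor = Mor C, Dom = Cod C, Cod = Dom C, Ident = Ident C,
     Comp = (\<lambda>g f. f \<cdot>\<^bsub>C\<^esub> g)\<rparr>"

lemma op_cat_simps [simp]:
  "Obj (op_cat C) = Obj C" "Mor (op_cat C) = Mor C" "Dom (op_cat C) = Cod C"
  "Cod (op_cat C) = Dom C" "Ident (op_cat C) = Ident C" "g \<cdot>\<^bsub>op_cat C\<^esub> f = f \<cdot>\<^bsub>C\<^esub> g"
  by (simp_all add: op_cat_def)

lemma hom_op [simp]: "hom (op_cat C) X Y = hom C Y X"
  by (auto simp: hom_def)

lemma op_op [simp]: "op_cat (op_cat C) = C"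
  by (simp add: op_cat_def)

lemma (in category) category_op: "category (op_cat C)"
  by unfold_locales (auto simp: hom_iff)

lemma pullback_op: "is_pullback (op_cat C) = is_pushout C"
  and pushout_op: "is_pushout (op_cat C) = is_pullback C"
  by (simp_all add: is_pullback_def is_pushout_def fun_eq_iff)

lemma initial_op: "is_initial (op_cat C) = is_terminal C"
  and terminal_op: "is_terminal (op_cat C) = is_initial C"
  by (simp_all add: is_initial_def is_terminal_def fun_eq_iff)

lemma zero_op: "is_zero (op_cat C) = is_zero C"
  by (auto simp: is_zero_def initial_op terminal_op fun_eq_iff)

lemma zero_obj_op [simp]: "zero_obj (op_cat C) = zero_obj C"
  by (simp add: zero_obj_def zero_op)

lemma is_iso_op: "is_iso (op_cat C) = is_iso C"
  by (auto simp: is_iso_def fun_eq_iff)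

lemma functorD:
  assumes "is_functor C D F"
  shows "X \<in> Obj C \<Longrightarrow> onobj F X \<in> Obj D"
    and "f \<in> Mor C \<Longrightarrow> onmor F f \<in> Mor D"
    and "f \<in> Mor C \<Longrightarrow> Dom D (onmor F f) = onobj F (Dom C f)"
    and "f \<in> Mor C \<Longrightarrow> Cod D (onmor F f) = onobj F (Cod C f)"
    and "X \<in> Obj C \<Longrightarrow> onmor F (Ident C X) = Ident D (onobj F X)"
    and "\<lbrakk>f \<in> Mor C; g \<in> Mor C; Cod C f = Dom C g\<rbrakk>
          \<Longrightarrow> onmor F (g \<cdot>\<^bsub>C\<^esub> f) = onmor F g \<cdot>\<^bsub>D\<^esub> onmor F f"
  using assms by (auto simp: is_functor_def hom_def)

lemma functor_hom: "\<lbrakk>is_functor C D F; f \<in> hom C X Y\<rbrakk> \<Longrightarrow> onmor F f \<in> hom D (onobj F X) (onobj F Y)"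
  by (auto simp: is_functor_def hom_def)

lemma functorI:
  assumes "\<And>X. X \<in> Obj C \<Longrightarrow> onobj F X \<in> Obj D"
    and "\<And>f. f \<in> Mor C \<Longrightarrow> onmor F f \<in> hom D (onobj F (Dom C f)) (onobj F (Cod C f))"
    and "\<And>X. X \<in> Obj C \<Longrightarrow> onmor F (Ident C X) = Ident D (onobj F X)"
    and "\<And>f g. \<lbrakk>f \<in> Mor C; g \<in> Mor C; Cod C f = Dom C g\<rbrakk>
          \<Longrightarrow> onmor F (g \<cdot>\<^bsub>C\<^esub> f) = onmor F g \<cdot>\<^bsub>D\<^esub> onmor F f"
  shows "is_functor C D F"
  using assms by (simp add: is_functor_def)

lemma comp_functor_simps [simp]:
  "onobj (G \<circ>\<^sub>F F) X = onobj G (onobj F X)" "onmor (G \<circ>\<^sub>F F) f = onmor G (onmor F f)"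
  by (simp_all add: comp_functor_def)

lemma comp_is_functor:
  assumes C: "category C" and F: "is_functor C D F" and G: "is_functor D E G"
  shows "is_functor C E (G \<circ>\<^sub>F F)"
proof -
  interpret category C by fact
  show ?thesis
    by (rule functorI) (simp_all add: functorD[OF F] functorD[OF G] hom_iff)
qed

lemma functor_op: "is_functor (op_cat C) (op_cat D) F = is_functor C D F"
  by (auto simp: is_functor_def)

section \<open>Isomorphisms\<close>

lemma (in category) iso_comp:
  assumes f: "is_iso C f" and g: "is_iso C g" and "Cod C f = Dom C g"
  shows "is_iso C (g \<cdot> f)"
proof -
  obtain f' where f': "f' \<in> hom C (Cod C f) (Dom C f)" "f' \<cdot> f = Ident C (Dom C f)"
      "f \<cdot> f' = Ident C (Cod C f)" and [simp]: "f \<in> Mor C"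
    using f by (auto simp: is_iso_def)
  obtain g' where g': "g' \<in> hom C (Cod C g) (Dom C g)" "g' \<cdot> g = Ident C (Dom C g)"
      "g \<cdot> g' = Ident C (Cod C g)" and [simp]: "g \<in> Mor C"
    using g by (auto simp: is_iso_def)
  note [simp] = homD[OF f'(1)] homD[OF g'(1)] assms(3)
  have "f' \<cdot> g' \<in> hom C (Cod C (g \<cdot> f)) (Dom C (g \<cdot> f))"
    by (auto simp: hom_iff)
  moreover have "(f' \<cdot> g') \<cdot> g \<cdot> f = Ident C (Dom C (g \<cdot> f))" "(g \<cdot> f) \<cdot> f' \<cdot> g' = Ident C (Cod C (g \<cdot> f))"
    by (simp_all add: reassoc[OF g'(2)] reassoc[OF f'(3)] f' g')
  ultimately show ?thesis
    unfolding is_iso_def by (intro conjI bexI[of _ "f' \<cdot> g'"]) simp_all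
qed

lemma (in category) iso_inverse:
  assumes "is_iso C f"
  obtains g where "g \<in> hom C (Cod C f) (Dom C f)" "g \<cdot> f = Ident C (Dom C f)"
    "f \<cdot> g = Ident C (Cod C f)" "is_iso C g"
proof -
  obtain g where "f \<in> Mor C" "g \<in> hom C (Cod C f) (Dom C f)" "g \<cdot> f = Ident C (Dom C f)"
    "f \<cdot> g = Ident C (Cod C f)"
    using assms by (auto simp: is_iso_def)
  then show ?thesis
    by (intro that[of g]) (auto simp: is_iso_def hom_iff)
qed

lemma (in category) iso_cancel_left:
  assumes "is_iso C f" "f \<cdot> g = f \<cdot> h" "g \<in> hom C X (Dom C f)" "h \<in> hom C X (Dom C f)"
  shows "g = h"
proof -
  obtain k where k: "k \<in> hom C (Cod C f) (Dom C f)" "k \<cdot> f = Ident C (Dom C f)" and [simp]: "f \<in> Mor C"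
    using assms by (auto simp: is_iso_def)
  note [simp] = homD[OF k(1)] homD[OF assms(3)] homD[OF assms(4)]
  have "k \<cdot> (f \<cdot> g) = g" "k \<cdot> (f \<cdot> h) = h"
    by (simp_all add: reassoc[OF k(2)])
  then show ?thesis using assms(2) by metis
qed

lemma (in category) iso_cancel_right:
  assumes "is_iso C f" "g \<cdot> f = h \<cdot> f" "g \<in> hom C (Cod C f) X" "h \<in> hom C (Cod C f) X"
  shows "g = h"
proof -
  interpret op: category "op_cat C" by (rule category_op)
  show ?thesis
    using op.iso_cancel_left[of f g h X] assms by (simp add: is_iso_op)
qed

lemma (in category) iso_two_of_three_left:
  assumes "is_iso C (g \<cdot> f)" "is_iso C g" "f \<in> Mor C" "Cod C f = Dom C g"
  shows "is_iso C f"
proof -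
  obtain k where k: "k \<in> hom C (Cod C g) (Dom C g)" "k \<cdot> g = Ident C (Dom C g)" "is_iso C k"
    using iso_inverse[OF assms(2)] by metis
  have [simp]: "g \<in> Mor C" using assms by (auto simp: is_iso_def)
  note [simp] = homD[OF k(1)] assms(3,4)
  have "k \<cdot> (g \<cdot> f) = f" by (simp add: reassoc[OF k(2)])
  moreover have "is_iso C (k \<cdot> (g \<cdot> f))"
    using iso_comp[OF assms(1) k(3)] by simp
  ultimately show ?thesis by simp
qed

lemma (in category) iso_two_of_three_right:
  assumes "is_iso C (g \<cdot> f)" "is_iso C f" "g \<in> Mor C" "Cod C f = Dom C g"
  shows "is_iso C g"
proof -
  interpret op: category "op_cat C" by (rule category_op)
  show ?thesis
    using op.iso_two_of_three_left[of f g] assms by (simp add: is_iso_op)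
qed

text \<open>The map \<open>g\<close> has a left inverse and a right inverse, built from the inverses
  of \<open>h \<cdot> g\<close> and \<open>g \<cdot> f\<close>; hence it is invertible, and so is
  \<open>f\<close>.\<close>

lemma (in category) iso_two_of_six:
  assumes "is_iso C (g \<cdot> f)" "is_iso C (h \<cdot> g)"
    and "f \<in> Mor C" "g \<in> Mor C" "h \<in> Mor C" "Cod C f = Dom C g" "Cod C g = Dom C h"
  shows "is_iso C f"
proof -
  note [simp] = assms(3-7)
  obtain l where l: "l \<in> hom C (Cod C h) (Dom C g)" "l \<cdot> (h \<cdot> g) = Ident C (Dom C g)"
    using iso_inverse[OF assms(2)] by auto
  obtain r where r: "r \<in> hom C (Cod C g) (Dom C f)" "(g \<cdot> f) \<cdot> r = Ident C (Cod C g)"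
    using iso_inverse[OF assms(1)] by auto
  have [simp]: "l \<in> Mor C" "Dom C l = Cod C h" "Cod C l = Dom C g"
    "r \<in> Mor C" "Dom C r = Cod C g" "Cod C r = Dom C f"
    using l r by (auto simp: hom_iff)
  have "l \<cdot> h = (l \<cdot> h) \<cdot> ((g \<cdot> f) \<cdot> r)" using r by simp
  also have "\<dots> = (l \<cdot> (h \<cdot> g)) \<cdot> (f \<cdot> r)" by simp
  also have "\<dots> = f \<cdot> r" by (simp only: l(2)) simp
  finally have "(f \<cdot> r) \<cdot> g = Ident C (Dom C g)" using l(2) by (metis \<open>l \<in> Mor C\<close> \<open>Dom C l = Cod C h\<close> assms(4,5,7) assoc)
  then have "is_iso C g"
    using r by (auto simp: is_iso_def hom_iff intro!: bexI[of _ "f \<cdot> r"])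
  then show ?thesis
    using iso_two_of_three_left[OF assms(1)] by simp
qed

section \<open>Limits of small shapes\<close>

text \<open>The shape of a cospan has three identities and two further morphisms, which must be
  distinct elements of the universe type \<open>'u\<close>; here its infinity enters.\<close>

lemma five_elements:
  obtains a b c d e :: "'u::infinite" where "distinct [a, b, c, d, e]"
proof -
  obtain S :: "'u set" where "finite S" "card S = 5"
    using infinite_arbitrarily_large[of "UNIV :: 'u set" 5] infinite_UNIV by blast
  then obtain xs where xs: "distinct xs" "set xs = S" "length xs = 5"
    by (metis finite_distinct_list distinct_card)
  then obtain a b c d e where "xs = [a, b, c, d, e]"
    by (auto simp: numeral_eq_Suc length_Suc_conv)
  with xs that show thesis by blast
qed

text \<open>Over the empty diagram a cone is just an object, so a limit is a terminal
  object.\<close>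

lemma (in category) ex_terminal:
  assumes "has_small_limits (U :: 'u::infinite itself) C"
  shows "\<exists>T. is_terminal C T"
proof -
  let ?J = "\<lparr>Obj = {}, Mor = {}, Dom = id, Cod = id, Ident = id, Comp = (\<lambda>x y. x)\<rparr> :: ('u, 'u) cat"
  let ?F = "\<lparr>onobj = undefined, onmor = undefined\<rparr> :: ('u, 'u, 'o, 'm) cfunctor"
  have "category ?J" by unfold_locales (auto simp: hom_def)
  moreover have "is_functor ?J C ?F" by (auto simp: is_functor_def)
  ultimately obtain L p where "is_limit ?J C ?F L p"
    using assms unfolding has_small_limits_def by blast
  then have "is_terminal C L"
    by (simp add: is_limit_def is_cone_def is_terminal_def)
  then show ?thesis ..
qed

lemma (in category) ex_pullback:
  assumes lim: "has_small_limits (U :: 'u::infinite itself) C"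
    and f: "f \<in> hom C B A" and g: "g \<in> hom C D A"
  shows "\<exists>i j. is_pullback C f g i j"
proof -
  obtain a b c d e :: 'u where "distinct [a, b, c, d, e]" by (rule five_elements)
  then have ne [simp]: "a \<noteq> b" "a \<noteq> c" "a \<noteq> d" "a \<noteq> e" "b \<noteq> c" "b \<noteq> d" "b \<noteq> e" "c \<noteq> d" "c \<noteq> e" "d \<noteq> e"
    "b \<noteq> a" "c \<noteq> a" "d \<noteq> a" "e \<noteq> a" "c \<noteq> b" "d \<noteq> b" "e \<noteq> b" "d \<noteq> c" "e \<noteq> c" "e \<noteq> d"
    by auto
  \<comment> \<open>The cospan \<open>a -> c <- b\<close>: an object doubles as its identity,
    \<open>d\<close> runs from \<open>a\<close> to \<open>c\<close> and \<open>e\<close> from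
    \<open>b\<close> to \<open>c\<close>. In a composite of \<open>y\<close> after \<open>x\<close>
    with \<open>x\<close> equal to \<open>d\<close> or \<open>e\<close>, the map \<open>y\<close>
    can only be the identity \<open>c\<close>, so the value is \<open>x\<close>.\<close>
  let ?J = "\<lparr>Obj = {a, b, c}, Mor = {a, b, c, d, e},
    Dom = (\<lambda>x. if x = d then a else if x = e then b else x),
    Cod = (\<lambda>x. if x = d \<or> x = e then c else x), Ident = id,
    Comp = (\<lambda>y x. if x \<in> {a, b, c} then y else x)\<rparr> :: ('u, 'u) cat"
  let ?F = "\<lparr>onobj = (\<lambda>x. if x = a then B else if x = b then D else A),
    onmor = (\<lambda>x. if x = a then Ident C B else if x = b then Ident C D else if x = c then Ident C A
      else if x = d then f else g)\<rparr> :: ('u, 'u, 'o, 'm) cfunctor"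
  have O [simp]: "A \<in> Obj C" "B \<in> Obj C" "D \<in> Obj C"
    and M [simp]: "f \<in> Mor C" "Dom C f = B" "Cod C f = A" "g \<in> Mor C" "Dom C g = D" "Cod C g = A"
    using f g by (auto simp: hom_iff)
  have "category ?J"
    by unfold_locales (auto simp: hom_def split: if_splits)
  moreover have "is_functor ?J C ?F"
    by (auto simp: is_functor_def hom_iff)
  ultimately obtain L p where L: "is_limit ?J C ?F L p"
    using lim unfolding has_small_limits_def by blast
  then have p: "L \<in> Obj C" "p a \<in> hom C L B" "p b \<in> hom C L D" "p c \<in> hom C L A" "f \<cdot> p a = p c" "g \<cdot> p b = p c"
    by (simp_all add: is_limit_def is_cone_def)
  have "is_pullback C f g (p a) (p b)"
    unfolding is_pullback_def
  proof (intro exI conjI allI ballI impI)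
    show "f \<in> hom C B A" "g \<in> hom C D A" "p a \<in> hom C L B" "p b \<in> hom C L D" "f \<cdot> p a = g \<cdot> p b"
      using f g p by auto
    fix Z u v assume uv: "u \<in> hom C Z B" "v \<in> hom C Z D" "f \<cdot> u = g \<cdot> v"
    define q where "q = (\<lambda>x. if x = a then u else if x = b then v else f \<cdot> u)"
    have "is_cone ?J C ?F Z q"
      using uv by (auto simp: is_cone_def q_def hom_iff)
    then have "\<exists>!h. h \<in> hom C Z L \<and> (\<forall>i \<in> {a, b, c}. p i \<cdot> h = q i)"
      using L by (simp add: is_limit_def)
    \<comment> \<open>The leg at \<open>c\<close> is \<open>f\<close> after the leg at
      \<open>a\<close>, so its condition follows from that at \<open>a\<close>.\<close>
    moreover have "(\<forall>i \<in> {a, b, c}. p i \<cdot> h = q i) \<longleftrightarrow> p a \<cdot> h = u \<and> p b \<cdot> h = v" if "h \<in> hom C Z L" for h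
    proof -
      note [simp] = homD[OF that] homD[OF p(2)] homD[OF p(4)]
      have "p c \<cdot> h = f \<cdot> (p a \<cdot> h)"
        by (simp add: reassoc[OF p(5)])
      then show ?thesis by (auto simp: q_def)
    qed
    ultimately show "\<exists>!h. h \<in> hom C Z L \<and> p a \<cdot> h = u \<and> p b \<cdot> h = v"
      by (metis (no_types, lifting))
  qed
  then show ?thesis by blast
qed

lemma limits_op:
  assumes "has_small_colimits U C" "category C"
  shows "has_small_limits U (op_cat C)"
  unfolding has_small_limits_def
proof (intro allI impI, elim conjE)
  fix J :: "('a, 'a) cat" and F assume J: "category J" "is_functor J (op_cat C) F"
  have "category (op_cat J)" "is_functor (op_cat J) C F"
    using J category.category_op functor_op[of J "op_cat C" F] by auto
  then obtain L p where "is_colimit (op_cat J) C F L p"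
    using assms unfolding has_small_colimits_def by blast
  then have "is_limit J (op_cat C) F L p"
    by (simp add: is_limit_def is_colimit_def is_cone_def is_cocone_def)
  then show "\<exists>L p. is_limit J (op_cat C) F L p" by blast
qed

lemma (in category) ex_pushout:
  assumes "has_small_colimits U C" "f \<in> hom C A B" "g \<in> hom C A D"
  shows "\<exists>i j. is_pushout C f g i j"
  using category.ex_pullback[OF category_op limits_op, of U f B A g D] assms category_axioms
  by (simp add: pullback_op)

section \<open>The category of arrows\<close>

lemma Arr_simps [simp]:
  "Obj (Arr C) = Mor C" "Dom (Arr C) = src" "Cod (Arr C) = tgt"
  "Ident (Arr C) f = Sq f f (Ident C (Dom C f)) (Ident C (Cod C f))"
  "t \<cdot>\<^bsub>Arr C\<^esub> s = Sq (src s) (tgt t) (ev0 t \<cdot>\<^bsub>C\<^esub> ev0 s) (ev1 t \<cdot>\<^bsub>C\<^esub> ev1 s)"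
  by (simp_all add: Arr_def)

lemma Arr_Mor: "s \<in> Mor (Arr C) \<longleftrightarrow> src s \<in> Mor C \<and> tgt s \<in> Mor C \<and>
    ev0 s \<in> Mor C \<and> Dom C (ev0 s) = Dom C (src s) \<and> Cod C (ev0 s) = Dom C (tgt s) \<and>
    ev1 s \<in> Mor C \<and> Dom C (ev1 s) = Cod C (src s) \<and> Cod C (ev1 s) = Cod C (tgt s) \<and>
    tgt s \<cdot>\<^bsub>C\<^esub> ev0 s = ev1 s \<cdot>\<^bsub>C\<^esub> src s"
  by (cases s) (auto simp: Arr_def hom_iff)

lemma Arr_hom: "s \<in> hom (Arr C) f g \<longleftrightarrow> f \<in> Mor C \<and> g \<in> Mor C \<and> src s = f \<and> tgt s = g \<and>
    ev0 s \<in> Mor C \<and> Dom C (ev0 s) = Dom C f \<and> Cod C (ev0 s) = Dom C g \<and>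
    ev1 s \<in> Mor C \<and> Dom C (ev1 s) = Cod C f \<and> Cod C (ev1 s) = Cod C g \<and>
    g \<cdot>\<^bsub>C\<^esub> ev0 s = ev1 s \<cdot>\<^bsub>C\<^esub> f"
  by (auto simp: hom_iff Arr_Mor)

lemma square_eq_iff: "s = t \<longleftrightarrow> src s = src t \<and> tgt s = tgt t \<and> ev0 s = ev0 t \<and> ev1 s = ev1 t"
  by (cases s; cases t) auto

lemma square_eqI: "\<lbrakk>src s = src t; tgt s = tgt t; ev0 s = ev0 t; ev1 s = ev1 t\<rbrakk> \<Longrightarrow> s = t"
  by (simp add: square_eq_iff)

lemma (in category) category_Arr: "category (Arr C)"
proof (unfold_locales, goal_cases)
  case (4 s f g t h)
  then have [simp]: "f \<in> Mor C" "g \<in> Mor C" "h \<in> Mor C"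
    "src s = f" "tgt s = g" "src t = g" "tgt t = h" "ev0 s \<in> Mor C" "ev1 s \<in> Mor C"
    "Dom C (ev0 s) = Dom C f" "Cod C (ev0 s) = Dom C g" "Dom C (ev1 s) = Cod C f" "Cod C (ev1 s) = Cod C g"
    "ev0 t \<in> Mor C" "ev1 t \<in> Mor C"
    "Dom C (ev0 t) = Dom C g" "Cod C (ev0 t) = Dom C h" "Dom C (ev1 t) = Cod C g" "Cod C (ev1 t) = Cod C h"
    and s: "g \<cdot> ev0 s = ev1 s \<cdot> f" and t: "h \<cdot> ev0 t = ev1 t \<cdot> g"
    by (auto simp: Arr_hom)
  show ?case
    by (auto simp: Arr_hom reassoc2[OF t] s)
qed (auto simp: Arr_hom Arr_Mor intro!: square_eqI)

lemma Ev_simps [simp]: "onobj (Ev0 C) = Dom C" "onmor (Ev0 C) = ev0" "onobj (Ev1 C) = Cod C" "onmor (Ev1 C) = ev1"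
  by (simp_all add: Ev0_def Ev1_def)

lemma (in category) Ev0_functor: "is_functor (Arr C) C (Ev0 C)"
  and Ev1_functor: "is_functor (Arr C) C (Ev1 C)"
  by (auto simp: is_functor_def Arr_Mor hom_iff)

text \<open>Limits of arrows are formed on domains and codomains separately. The arrow
  \<open>l\<close> between the two limits, and the commutativity of every induced square, come from
  the universal property of the limit of the codomains.\<close>

lemma (in category) limits_Arr:
  assumes lim: "has_small_limits U C"
  shows "has_small_limits U (Arr C)"
  unfolding has_small_limits_def
proof (intro allI impI, elim conjE)
  fix J :: "('a, 'a) cat" and F :: "('a, 'a, 'm, 'm square) cfunctor"
  assume J: "category J" and F: "is_functor J (Arr C) F"
  interpret J: category J by fact
  note FF = functorD[OF F]
  have Fobj [simp]: "onobj F i \<in> Mor C" if "i \<in> Obj J" for i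
    using FF(1)[OF that] by simp
  have Fmor: "src (onmor F a) = onobj F (Dom J a)" "tgt (onmor F a) = onobj F (Cod J a)"
    "ev0 (onmor F a) \<in> Mor C" "Dom C (ev0 (onmor F a)) = Dom C (onobj F (Dom J a))"
    "Cod C (ev0 (onmor F a)) = Dom C (onobj F (Cod J a))"
    "ev1 (onmor F a) \<in> Mor C" "Dom C (ev1 (onmor F a)) = Cod C (onobj F (Dom J a))"
    "Cod C (ev1 (onmor F a)) = Cod C (onobj F (Cod J a))"
    "onobj F (Cod J a) \<cdot> ev0 (onmor F a) = ev1 (onmor F a) \<cdot> onobj F (Dom J a)" if "a \<in> Mor J" for a
    using FF(2-4)[OF that] by (auto simp: Arr_Mor)
  have "is_functor J C (Ev0 C \<circ>\<^sub>F F)" "is_functor J C (Ev1 C \<circ>\<^sub>F F)"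
    using comp_is_functor[OF J F] Ev0_functor Ev1_functor by auto
  then obtain L0 p0 L1 p1 where L0: "is_limit J C (Ev0 C \<circ>\<^sub>F F) L0 p0"
    and L1: "is_limit J C (Ev1 C \<circ>\<^sub>F F) L1 p1"
    using lim J unfolding has_small_limits_def by blast
  have p0: "L0 \<in> Obj C" "\<And>i. i \<in> Obj J \<Longrightarrow> p0 i \<in> Mor C" "\<And>i. i \<in> Obj J \<Longrightarrow> Dom C (p0 i) = L0"
    "\<And>i. i \<in> Obj J \<Longrightarrow> Cod C (p0 i) = Dom C (onobj F i)"
    "\<And>a. a \<in> Mor J \<Longrightarrow> ev0 (onmor F a) \<cdot> p0 (Dom J a) = p0 (Cod J a)"
    using L0 by (auto simp: is_limit_def is_cone_def hom_iff)
  have p1: "L1 \<in> Obj C" "\<And>i. i \<in> Obj J \<Longrightarrow> p1 i \<in> Mor C" "\<And>i. i \<in> Obj J \<Longrightarrow> Dom C (p1 i) = L1"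
    "\<And>i. i \<in> Obj J \<Longrightarrow> Cod C (p1 i) = Cod C (onobj F i)"
    "\<And>a. a \<in> Mor J \<Longrightarrow> ev1 (onmor F a) \<cdot> p1 (Dom J a) = p1 (Cod J a)"
    using L1 by (auto simp: is_limit_def is_cone_def hom_iff)
  \<comment> \<open>A cone over the domains becomes a cone over the codomains by composing with the
    arrows of the diagram. It is stated for the domain of an arrow \<open>x\<close>, so that both
    the identity of \<open>L0\<close> and an arbitrary competing cone can be put in.\<close>
  have cone1: "is_cone J C (Ev1 C \<circ>\<^sub>F F) (Dom C x) (\<lambda>i. onobj F i \<cdot> q i)"
    if "x \<in> Mor C" "\<And>i. i \<in> Obj J \<Longrightarrow> q i \<in> Mor C" "\<And>i. i \<in> Obj J \<Longrightarrow> Dom C (q i) = Dom C x"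
      "\<And>i. i \<in> Obj J \<Longrightarrow> Cod C (q i) = Dom C (onobj F i)"
      "\<And>a. a \<in> Mor J \<Longrightarrow> ev0 (onmor F a) \<cdot> q (Dom J a) = q (Cod J a)" for x q
    unfolding is_cone_def
  proof (intro conjI ballI)
    fix a assume a: "a \<in> Mor J"
    show "onmor (Ev1 C \<circ>\<^sub>F F) a \<cdot> onobj F (Dom J a) \<cdot> q (Dom J a) = onobj F (Cod J a) \<cdot> q (Cod J a)"
      using a by (simp add: reassoc2[OF Fmor(9)[OF a], symmetric] that Fmor)
  qed (use that in \<open>auto simp: hom_iff\<close>)
  have "is_cone J C (Ev1 C \<circ>\<^sub>F F) (Dom C (Ident C L0)) (\<lambda>i. onobj F i \<cdot> p0 i)"
    by (rule cone1) (use p0 in auto)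
  then have "\<exists>!l. l \<in> hom C L0 L1 \<and> (\<forall>i \<in> Obj J. p1 i \<cdot> l = onobj F i \<cdot> p0 i)"
    using L1 p0(1) by (simp add: is_limit_def)
  then obtain l where l: "l \<in> hom C L0 L1" "\<And>i. i \<in> Obj J \<Longrightarrow> p1 i \<cdot> l = onobj F i \<cdot> p0 i"
    by blast
  have [simp]: "l \<in> Mor C" "Dom C l = L0" "Cod C l = L1" using l by (auto simp: hom_iff)
  define p where "p = (\<lambda>i. Sq l (onobj F i) (p0 i) (p1 i))"
  have "is_limit J (Arr C) F l p"
    unfolding is_limit_def
  proof (intro conjI allI impI)
    show "is_cone J (Arr C) F l p"
      unfolding is_cone_def
      by (auto simp: p_def Arr_hom p0 p1 l Fmor intro!: square_eqI)
    fix x q assume q: "is_cone J (Arr C) F x q"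
    then have x [simp]: "x \<in> Mor C" and
      q0: "\<And>i. i \<in> Obj J \<Longrightarrow> src (q i) = x" "\<And>i. i \<in> Obj J \<Longrightarrow> tgt (q i) = onobj F i"
       "\<And>i. i \<in> Obj J \<Longrightarrow> ev0 (q i) \<in> Mor C" "\<And>i. i \<in> Obj J \<Longrightarrow> Dom C (ev0 (q i)) = Dom C x"
       "\<And>i. i \<in> Obj J \<Longrightarrow> Cod C (ev0 (q i)) = Dom C (onobj F i)"
       "\<And>a. a \<in> Mor J \<Longrightarrow> ev0 (onmor F a) \<cdot> ev0 (q (Dom J a)) = ev0 (q (Cod J a))" and
      q1: "\<And>i. i \<in> Obj J \<Longrightarrow> ev1 (q i) \<in> Mor C" "\<And>i. i \<in> Obj J \<Longrightarrow> Dom C (ev1 (q i)) = Cod C x"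
       "\<And>i. i \<in> Obj J \<Longrightarrow> Cod C (ev1 (q i)) = Cod C (onobj F i)"
       "\<And>a. a \<in> Mor J \<Longrightarrow> ev1 (onmor F a) \<cdot> ev1 (q (Dom J a)) = ev1 (q (Cod J a))" and
      q01: "\<And>i. i \<in> Obj J \<Longrightarrow> onobj F i \<cdot> ev0 (q i) = ev1 (q i) \<cdot> x"
      by (auto simp: is_cone_def Arr_hom square_eq_iff)
    have "is_cone J C (Ev0 C \<circ>\<^sub>F F) (Dom C x) (\<lambda>i. ev0 (q i))"
      "is_cone J C (Ev1 C \<circ>\<^sub>F F) (Cod C x) (\<lambda>i. ev1 (q i))"
      using q0 q1 by (auto simp: is_cone_def hom_iff)
    then have ex0: "\<exists>!h. h \<in> hom C (Dom C x) L0 \<and> (\<forall>i\<in>Obj J. p0 i \<cdot> h = ev0 (q i))"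
      and ex1: "\<exists>!h. h \<in> hom C (Cod C x) L1 \<and> (\<forall>i\<in>Obj J. p1 i \<cdot> h = ev1 (q i))"
      using L0 L1 unfolding is_limit_def by auto
    obtain h0 where h0: "h0 \<in> hom C (Dom C x) L0" "\<forall>i\<in>Obj J. p0 i \<cdot> h0 = ev0 (q i)"
      using ex0 by blast
    obtain h1 where h1: "h1 \<in> hom C (Cod C x) L1" "\<forall>i\<in>Obj J. p1 i \<cdot> h1 = ev1 (q i)"
      using ex1 by blast
    have ex01: "\<exists>!h. h \<in> hom C (Dom C x) L1 \<and> (\<forall>i\<in>Obj J. p1 i \<cdot> h = onobj F i \<cdot> ev0 (q i))"
      using L1 cone1[OF x q0(3,4,5,6)] unfolding is_limit_def by auto
    have "l \<cdot> h0 \<in> hom C (Dom C x) L1 \<and> (\<forall>i\<in>Obj J. p1 i \<cdot> (l \<cdot> h0) = onobj F i \<cdot> ev0 (q i))"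
      using h0 by (auto simp: hom_iff reassoc2[OF l(2)] p0 p1)
    moreover have "h1 \<cdot> x \<in> hom C (Dom C x) L1 \<and> (\<forall>i\<in>Obj J. p1 i \<cdot> (h1 \<cdot> x) = onobj F i \<cdot> ev0 (q i))"
    proof (intro conjI ballI)
      fix i assume i: "i \<in> Obj J"
      have e: "p1 i \<cdot> h1 = ev1 (q i)" using h1 i by simp
      note [simp] = homD[OF h1(1)]
      show "p1 i \<cdot> (h1 \<cdot> x) = onobj F i \<cdot> ev0 (q i)"
        using i by (simp add: reassoc[OF e] p1 q01)
    qed (use h1 in \<open>simp add: hom_iff\<close>)
    ultimately have eq: "l \<cdot> h0 = h1 \<cdot> x" using ex01 by blast
    show "\<exists>!h. h \<in> hom (Arr C) x l \<and> (\<forall>i\<in>Obj J. p i \<cdot>\<^bsub>Arr C\<^esub> h = q i)"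
    proof (rule ex1I[of _ "Sq x l h0 h1"])
      show "Sq x l h0 h1 \<in> hom (Arr C) x l \<and> (\<forall>i\<in>Obj J. p i \<cdot>\<^bsub>Arr C\<^esub> Sq x l h0 h1 = q i)"
        using h0(2) h1(2) homD[OF h0(1)] homD[OF h1(1)]
        by (auto simp: Arr_Mor hom_iff p_def eq q0 intro!: square_eqI)
      fix h assume h: "h \<in> hom (Arr C) x l \<and> (\<forall>i\<in>Obj J. p i \<cdot>\<^bsub>Arr C\<^esub> h = q i)"
      have "ev0 h \<in> hom C (Dom C x) L0 \<and> (\<forall>i\<in>Obj J. p0 i \<cdot> ev0 h = ev0 (q i))"
        "ev1 h \<in> hom C (Cod C x) L1 \<and> (\<forall>i\<in>Obj J. p1 i \<cdot> ev1 h = ev1 (q i))"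
        using h by (auto simp: Arr_Mor p_def hom_iff square_eq_iff)
      then have "ev0 h = h0" "ev1 h = h1"
        using ex0 ex1 h0 h1 by blast+
      then show "h = Sq x l h0 h1"
        using h by (auto simp: Arr_hom intro: square_eqI)
    qed
  qed
  then show "\<exists>L p. is_limit J (Arr C) F L p" by blast
qed

section \<open>Duality for model categories\<close>

text \<open>
  An isomorphism from the opposite of \<open>D\<close> to \<open>E\<close> that is the identity on objects. Besides
  \<open>op_cat C\<close> itself it covers \<open>Arr (op_cat C)\<close>, whose morphisms are flipped squares.
\<close>

locale anti_iso = D: category D + E: category E
  for D :: "('o, 'm) cat" and E :: "('o, 'n) cat" +
  fixes t :: "'m \<Rightarrow> 'n" and t' :: "'n \<Rightarrow> 'm"
  assumes Obj_eq: "Obj E = Obj D"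
    and t_Mor [simp]: "f \<in> Mor D \<Longrightarrow> t f \<in> Mor E"
    and t'_Mor [simp]: "x \<in> Mor E \<Longrightarrow> t' x \<in> Mor D"
    and t't [simp]: "f \<in> Mor D \<Longrightarrow> t' (t f) = f"
    and tt' [simp]: "x \<in> Mor E \<Longrightarrow> t (t' x) = x"
    and Dom_t [simp]: "f \<in> Mor D \<Longrightarrow> Dom E (t f) = Cod D f"
    and Cod_t [simp]: "f \<in> Mor D \<Longrightarrow> Cod E (t f) = Dom D f"
    and t_Ident [simp]: "X \<in> Obj D \<Longrightarrow> t (Ident D X) = Ident E X"
    and t_Comp [simp]: "\<lbrakk>f \<in> Mor D; g \<in> Mor D; Cod D f = Dom D g\<rbrakk> \<Longrightarrow> t (g \<cdot>\<^bsub>D\<^esub> f) = t f \<cdot>\<^bsub>E\<^esub> t g"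
begin

lemma Dom_t' [simp]: "g \<in> Mor E \<Longrightarrow> Dom D (t' g) = Cod E g"
  and Cod_t' [simp]: "g \<in> Mor E \<Longrightarrow> Cod D (t' g) = Dom E g"
  using Dom_t[of "t' g"] Cod_t[of "t' g"] by simp_all

lemma swap: "anti_iso E D t' t"
proof (unfold_locales, goal_cases)
  case (9 f g)
  have "t (t' g \<cdot>\<^bsub>D\<^esub> t' f) = f \<cdot>\<^bsub>E\<^esub> g" if "f \<in> Mor E" "g \<in> Mor E" "Cod E g = Dom E f" for f g
    using that by simp
  from this[of g f] 9 show ?case
    by (metis t't D.Comp_Mor t'_Mor Dom_t' Cod_t')
next
  case (8 X)
  then show ?case by (metis Obj_eq D.Ident_Mor t't t_Ident)
qed (auto simp: Obj_eq)

text \<open>Reversing arrows turns the codomain component of a square into a domain component, so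
  source and target trade places and so do \<open>ev0\<close> and \<open>ev1\<close>.\<close>

definition sqt :: "'m square \<Rightarrow> 'n square" where
  "sqt s = Sq (t (tgt s)) (t (src s)) (t (ev1 s)) (t (ev0 s))"

lemma sqt_simps [simp]:
  "src (sqt s) = t (tgt s)" "tgt (sqt s) = t (src s)" "ev0 (sqt s) = t (ev1 s)" "ev1 (sqt s) = t (ev0 s)"
  by (simp_all add: sqt_def)

lemma sqt_Mor [simp]: "s \<in> Mor (Arr D) \<Longrightarrow> sqt s \<in> Mor (Arr E)"
  by (auto simp: Arr_Mor simp flip: t_Comp)

lemma sqt_Comp:
  "\<lbrakk>s \<in> Mor (Arr D); r \<in> Mor (Arr D); tgt s = src r\<rbrakk> \<Longrightarrow> sqt (r \<cdot>\<^bsub>Arr D\<^esub> s) = sqt s \<cdot>\<^bsub>Arr E\<^esub> sqt r"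
  by (auto simp: Arr_Mor intro: square_eqI)

lemma lifting_transfer:
  assumes "has_lifting D i p" "i \<in> Mor D" "p \<in> Mor D"
  shows "has_lifting E (t p) (t i)"
  unfolding has_lifting_def
proof
  interpret s: anti_iso E D t' t by (rule swap)
  fix s assume s: "s \<in> hom (Arr E) (t p) (t i)"
  have "s.sqt s \<in> hom (Arr D) i p"
    using s s.sqt_Mor[of s] assms by (simp add: hom_iff)
  then obtain h where h: "h \<in> hom D (Cod D i) (Dom D p)" "h \<cdot>\<^bsub>D\<^esub> i = t' (ev1 s)" "p \<cdot>\<^bsub>D\<^esub> h = t' (ev0 s)"
    using assms(1) unfolding has_lifting_def by fastforce
  have "t i \<cdot>\<^bsub>E\<^esub> t h = t (h \<cdot>\<^bsub>D\<^esub> i)" "t h \<cdot>\<^bsub>E\<^esub> t p = t (p \<cdot>\<^bsub>D\<^esub> h)"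
    using h(1) assms by (simp_all add: hom_iff)
  then show "\<exists>h\<in>hom E (Cod E (t p)) (Dom E (t i)). h \<cdot>\<^bsub>E\<^esub> t p = ev0 s \<and> t i \<cdot>\<^bsub>E\<^esub> h = ev1 s"
    using h s assms by (intro bexI[of _ "t h"]) (auto simp: hom_iff Arr_Mor)
qed

lemma lifting_iff:
  assumes "i \<in> Mor D" "p \<in> Mor D"
  shows "has_lifting E (t p) (t i) \<longleftrightarrow> has_lifting D i p"
proof -
  interpret s: anti_iso E D t' t by (rule swap)
  show ?thesis using lifting_transfer[of i p] s.lifting_transfer[of "t p" "t i"] assms by auto
qed

lemma retract_transfer:
  assumes "is_retract D f g" "f \<in> Mor D" "g \<in> Mor D"
  shows "is_retract E (t f) (t g)"
proof -
  obtain s r where sr: "s \<in> hom (Arr D) f g" "r \<in> hom (Arr D) g f" "r \<cdot>\<^bsub>Arr D\<^esub> s = Ident (Arr D) f"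
    using assms unfolding is_retract_def by blast
  have "sqt s \<cdot>\<^bsub>Arr E\<^esub> sqt r = sqt (r \<cdot>\<^bsub>Arr D\<^esub> s)"
    using sqt_Comp[of s r] sr by (simp add: hom_iff)
  also have "\<dots> = Ident (Arr E) (t f)"
    using sr(3) assms by (simp add: sqt_def)
  finally show ?thesis
    using sr sqt_Mor[of s] sqt_Mor[of r] assms unfolding is_retract_def
    by (intro bexI[of _ "sqt r"] bexI[of _ "sqt s"]) (auto simp: hom_iff)
qed

lemma retracts_transfer:
  assumes "closed_under_retracts D S" "S \<subseteq> Mor D"
  shows "closed_under_retracts E (t ` S)"
  unfolding closed_under_retracts_def
proof (intro ballI impI)
  interpret s: anti_iso E D t' t by (rule swap)
  fix f g assume "f \<in> Mor E" "g \<in> t ` S" "is_retract E f g"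
  then have "t' f \<in> S"
    using assms s.retract_transfer[of f g] unfolding closed_under_retracts_def by fastforce
  then show "f \<in> t ` S" using \<open>f \<in> Mor E\<close> by (metis image_eqI tt')
qed

lemma wide_transfer:
  assumes "is_wide_subcategory D S"
  shows "is_wide_subcategory E (t ` S)"
  unfolding is_wide_subcategory_def
proof (intro conjI ballI impI)
  have S: "f \<in> S \<Longrightarrow> f \<in> Mor D" for f using assms by (auto simp: is_wide_subcategory_def)
  show "t ` S \<subseteq> Mor E" using S by auto
  show "Ident E X \<in> t ` S" if "X \<in> Obj E" for X
    using that assms by (auto simp: is_wide_subcategory_def Obj_eq intro!: image_eqI[of _ _ "Ident D X"])
  fix f g assume "f \<in> t ` S" "g \<in> t ` S" and c: "Cod E f = Dom E g"
  then obtain f' g' where "f = t f'" "g = t g'" "f' \<in> S" "g' \<in> S" by auto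
  then show "g \<cdot>\<^bsub>E\<^esub> f \<in> t ` S"
    using assms S c by (auto simp: is_wide_subcategory_def intro!: image_eqI[of _ _ "f' \<cdot>\<^bsub>D\<^esub> g'"])
qed

text \<open>Conjugation of an endofunctor of the arrow category by \<open>sqt\<close>. The square
  fed to \<open>F\<close> is the inverse image under \<open>sqt\<close>, written out because that
  inverse belongs to the locale with the roles of \<open>D\<close> and \<open>E\<close>
  exchanged.\<close>

definition conj_functor :: "('m, 'm square, 'm, 'm square) cfunctor \<Rightarrow> ('n, 'n square, 'n, 'n square) cfunctor" where
  "conj_functor F = \<lparr>onobj = (\<lambda>f. t (onobj F (t' f))),
     onmor = (\<lambda>s. sqt (onmor F (Sq (t' (tgt s)) (t' (src s)) (t' (ev1 s)) (t' (ev0 s)))))\<rparr>"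

lemma conj_functor_is_functor:
  assumes F: "is_functor (Arr D) (Arr D) F"
  shows "is_functor (Arr E) (Arr E) (conj_functor F)"
proof -
  interpret s: anti_iso E D t' t by (rule swap)
  have onmor_F: "onmor (conj_functor F) s = sqt (onmor F (s.sqt s))" for s
    by (simp add: conj_functor_def s.sqt_def)
  have onobj_F: "onobj (conj_functor F) f = t (onobj F (t' f))" for f
    by (simp add: conj_functor_def)
  note FF = functorD[OF F, simplified]
  show ?thesis
  proof (rule functorI, goal_cases)
    case (1 f)
    then show ?case by (simp add: onobj_F FF)
  next
    case (2 s)
    have s: "s.sqt s \<in> Mor (Arr D)" using 2 by (rule s.sqt_Mor)
    then show ?case
      using 2 by (simp add: onmor_F onobj_F hom_iff FF(2-4)[OF s])
  next
    case (3 f)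
    then have "s.sqt (Ident (Arr E) f) = Ident (Arr D) (t' f)"
      by (simp add: s.sqt_def)
    then show ?case
      using 3 FF(5)[of "t' f"] FF(1)[of "t' f"] by (simp add: onmor_F onobj_F) (simp add: sqt_def)
  next
    case (4 s r)
    have s: "s.sqt s \<in> Mor (Arr D)" "s.sqt r \<in> Mor (Arr D)" using 4 by (auto intro: s.sqt_Mor)
    have e: "s.sqt (r \<cdot>\<^bsub>Arr E\<^esub> s) = s.sqt s \<cdot>\<^bsub>Arr D\<^esub> s.sqt r"
      using 4 by (intro s.sqt_Comp) simp_all
    have "onmor F (s.sqt (r \<cdot>\<^bsub>Arr E\<^esub> s)) = onmor F (s.sqt s) \<cdot>\<^bsub>Arr D\<^esub> onmor F (s.sqt r)"
      unfolding e by (rule functorD(6)[OF F]) (use s 4 in auto)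
    moreover have "sqt (onmor F (s.sqt s) \<cdot>\<^bsub>Arr D\<^esub> onmor F (s.sqt r)) = sqt (onmor F (s.sqt r)) \<cdot>\<^bsub>Arr E\<^esub> sqt (onmor F (s.sqt s))"
      by (rule sqt_Comp) (use FF(2-4) s 4 in auto)
    ultimately show ?case unfolding onmor_F by simp
  qed
qed

text \<open>Reversing arrows reverses a factorization, hence the right factor becomes the left one
  and the two functors and the two classes are exchanged.\<close>

lemma factors_transfer:
  assumes "factors_into D L R \<alpha> \<beta>" and LR: "L \<subseteq> Mor D" "R \<subseteq> Mor D"
  shows "factors_into E (t ` R) (t ` L) (conj_functor \<beta>) (conj_functor \<alpha>)"
proof -
  interpret s: anti_iso E D t' t by (rule swap)
  have a: "is_functor (Arr D) (Arr D) \<alpha>" and b: "is_functor (Arr D) (Arr D) \<beta>"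
    and f: "\<And>f. f \<in> Mor D \<Longrightarrow> Dom D (onobj \<alpha> f) = Dom D f \<and> Cod D (onobj \<alpha> f) = Dom D (onobj \<beta> f) \<and>
        Cod D (onobj \<beta> f) = Cod D f \<and> f = onobj \<beta> f \<cdot>\<^bsub>D\<^esub> onobj \<alpha> f"
    and s: "\<And>s. s \<in> Mor (Arr D) \<Longrightarrow> ev0 (onmor \<alpha> s) = ev0 s \<and> ev1 (onmor \<alpha> s) = ev0 (onmor \<beta> s) \<and>
        ev1 (onmor \<beta> s) = ev1 s"
    and m: "\<And>f. f \<in> Mor D \<Longrightarrow> onobj \<alpha> f \<in> L \<and> onobj \<beta> f \<in> R"
    using assms unfolding factors_into_def functorial_factorization_def by auto
  have m': "onobj \<alpha> f \<in> Mor D" "onobj \<beta> f \<in> Mor D" if "f \<in> Mor D" for f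
    using m[OF that] LR by auto
  have o: "onobj (conj_functor F) f = t (onobj F (t' f))"
    "onmor (conj_functor F) s = sqt (onmor F (s.sqt s))" for F f s
    by (simp_all add: conj_functor_def s.sqt_def)
  have ft: "f = onobj (conj_functor \<alpha>) f \<cdot>\<^bsub>E\<^esub> onobj (conj_functor \<beta>) f" if "f \<in> Mor E" for f
  proof -
    have "t (t' f) = t (onobj \<beta> (t' f) \<cdot>\<^bsub>D\<^esub> onobj \<alpha> (t' f))"
      using f[of "t' f"] that by simp
    also have "\<dots> = t (onobj \<alpha> (t' f)) \<cdot>\<^bsub>E\<^esub> t (onobj \<beta> (t' f))"
      using f[of "t' f"] m'[of "t' f"] that by (intro t_Comp) simp_all
    finally show ?thesis using that by (simp add: o)
  qed
  show ?thesis
    unfolding factors_into_def functorial_factorization_def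
  proof (intro conjI ballI)
    show "is_functor (Arr E) (Arr E) (conj_functor \<beta>)" "is_functor (Arr E) (Arr E) (conj_functor \<alpha>)"
      using a b by (auto intro: conj_functor_is_functor)
    fix f assume fE: "f \<in> Mor E"
    then have fD: "t' f \<in> Mor D" by simp
    note ff = f[OF fD] and mm = m'[OF fD] m[OF fD]
    show "Dom E (onobj (conj_functor \<beta>) f) = Dom E f" "Cod E (onobj (conj_functor \<beta>) f) = Dom E (onobj (conj_functor \<alpha>) f)"
      "Cod E (onobj (conj_functor \<alpha>) f) = Cod E f"
      "onobj (conj_functor \<beta>) f \<in> t ` R" "onobj (conj_functor \<alpha>) f \<in> t ` L"
      using ff mm fE by (auto simp: o)
    show "f = onobj (conj_functor \<alpha>) f \<cdot>\<^bsub>E\<^esub> onobj (conj_functor \<beta>) f" by (rule ft[OF fE])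
  next
    fix s assume sE: "s \<in> Mor (Arr E)"
    then have "s.sqt s \<in> Mor (Arr D)" by (rule s.sqt_Mor)
    from s[OF this] sE show "ev0 (onmor (conj_functor \<beta>) s) = ev0 s"
      "ev1 (onmor (conj_functor \<beta>) s) = ev0 (onmor (conj_functor \<alpha>) s)"
      "ev1 (onmor (conj_functor \<alpha>) s) = ev1 s"
      by (auto simp: o Arr_Mor)
  qed
qed

text \<open>A cocone under a diagram of shape \<open>J\<close> in \<open>E\<close> is a cone over
  the same diagram, of shape \<open>op_cat J\<close>, in \<open>D\<close>. The fact
  \<open>cocone\<close> says this, and \<open>t\<close> carries the limiting cone over.\<close>

lemma limits_transfer:
  assumes "has_small_limits U D"
  shows "has_small_colimits U E"
  unfolding has_small_colimits_def
proof (intro allI impI, elim conjE)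
  interpret s: anti_iso E D t' t by (rule swap)
  fix J :: "('a, 'a) cat" and F assume J: "category J" and F: "is_functor J E F"
  interpret J: category J by fact
  interpret oJ: category "op_cat J" by (rule J.category_op)
  let ?F = "\<lparr>onobj = onobj F, onmor = t' \<circ> onmor F\<rparr>"
  note FF = functorD[OF F]
  have "is_functor (op_cat J) D ?F"
    using FF by (auto simp: is_functor_def hom_iff Obj_eq)
  then obtain L p where L: "is_limit (op_cat J) D ?F L p"
    using assms oJ.category_axioms unfolding has_small_limits_def by blast
  have cocone: "is_cocone J E F X q \<longleftrightarrow> is_cone (op_cat J) D ?F X (t' \<circ> q) \<and> (\<forall>i\<in>Obj J. q i \<in> Mor E)" for X q
  proof -
    have "q (Cod J a) \<cdot>\<^bsub>E\<^esub> onmor F a = q (Dom J a) \<longleftrightarrow> t' (onmor F a) \<cdot>\<^bsub>D\<^esub> t' (q (Cod J a)) = t' (q (Dom J a))"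
      if "\<forall>i\<in>Obj J. q i \<in> hom E (onobj F i) X" "a \<in> Mor J" for a
    proof -
      have "q (Cod J a) \<in> hom E (onobj F (Cod J a)) X" "q (Dom J a) \<in> hom E (onobj F (Dom J a)) X"
        using that by auto
      then have "t' (onmor F a) \<cdot>\<^bsub>D\<^esub> t' (q (Cod J a)) = t' (q (Cod J a) \<cdot>\<^bsub>E\<^esub> onmor F a)"
        and "q (Cod J a) \<cdot>\<^bsub>E\<^esub> onmor F a \<in> Mor E" "q (Dom J a) \<in> Mor E"
        using FF that by (simp_all add: hom_iff)
      then show ?thesis by (metis tt')
    qed
    moreover have "(\<forall>i\<in>Obj J. t' (q i) \<in> hom D X (onobj F i)) \<longleftrightarrow> (\<forall>i\<in>Obj J. q i \<in> hom E (onobj F i) X)"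
      if "\<forall>i\<in>Obj J. q i \<in> Mor E"
      using that by (auto simp: hom_iff)
    ultimately show ?thesis
      unfolding is_cone_def is_cocone_def
      by (auto simp: Obj_eq hom_iff)
  qed
  have p: "p i \<in> Mor D" "Dom D (p i) = L" "Cod D (p i) = onobj F i" if "i \<in> Obj J" for i
    using L that by (auto simp: is_limit_def is_cone_def hom_iff)
  have "is_colimit J E F L (t \<circ> p)"
    unfolding is_colimit_def
  proof (intro conjI allI impI)
    have "is_cone (op_cat J) D ?F L (t' \<circ> (t \<circ> p)) = is_cone (op_cat J) D ?F L p"
      unfolding is_cone_def using p by auto
    then show "is_cocone J E F L (t \<circ> p)"
      using cocone[of L "t \<circ> p"] L p by (simp add: is_limit_def)
    fix X q assume q: "is_cocone J E F X q"
    have qi: "q i \<in> Mor E" "Dom E (q i) = onobj F i" "Cod E (q i) = X" if "i \<in> Obj J" for i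
      using q that by (auto simp: is_cocone_def hom_iff)
    have "\<exists>!h. h \<in> hom D X L \<and> (\<forall>i\<in>Obj J. p i \<cdot>\<^bsub>D\<^esub> h = t' (q i))"
    proof -
      have "is_cone (op_cat J) D ?F X (t' \<circ> q)" using cocone[of X q] q by blast
      then have "\<exists>!h. h \<in> hom D X L \<and> (\<forall>i\<in>Obj (op_cat J). p i \<cdot>\<^bsub>D\<^esub> h = (t' \<circ> q) i)"
        using L unfolding is_limit_def by blast
      then show ?thesis by simp
    qed
    then obtain h where h: "h \<in> hom D X L" "\<forall>i\<in>Obj J. p i \<cdot>\<^bsub>D\<^esub> h = t' (q i)"
      and u: "\<And>h'. \<lbrakk>h' \<in> hom D X L; \<forall>i\<in>Obj J. p i \<cdot>\<^bsub>D\<^esub> h' = t' (q i)\<rbrakk> \<Longrightarrow> h' = h" by blast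
    show "\<exists>!h. h \<in> hom E L X \<and> (\<forall>i\<in>Obj J. h \<cdot>\<^bsub>E\<^esub> (t \<circ> p) i = q i)"
    proof (rule ex1I[of _ "t h"], intro conjI ballI)
      show "t h \<in> hom E L X" using h by (simp add: hom_iff)
      fix i assume i: "i \<in> Obj J"
      have "t h \<cdot>\<^bsub>E\<^esub> t (p i) = t (p i \<cdot>\<^bsub>D\<^esub> h)" using p[OF i] h by (simp add: hom_iff)
      then show "t h \<cdot>\<^bsub>E\<^esub> (t \<circ> p) i = q i" using h i qi by simp
    next
      fix k assume k: "k \<in> hom E L X \<and> (\<forall>i\<in>Obj J. k \<cdot>\<^bsub>E\<^esub> (t \<circ> p) i = q i)"
      then have kE: "k \<in> Mor E" "Dom E k = L" "Cod E k = X" by (auto simp: hom_iff)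
      have "t' k = h"
      proof (rule u)
        show "t' k \<in> hom D X L" using kE by (simp add: hom_iff)
        show "\<forall>i\<in>Obj J. p i \<cdot>\<^bsub>D\<^esub> t' k = t' (q i)"
        proof
          fix i assume i: "i \<in> Obj J"
          have "t' (k \<cdot>\<^bsub>E\<^esub> t (p i)) = t' (t (p i)) \<cdot>\<^bsub>D\<^esub> t' k"
            using p[OF i] kE by (intro s.t_Comp) simp_all
          then show "p i \<cdot>\<^bsub>D\<^esub> t' k = t' (q i)" using k i p[OF i] by simp
        qed
      qed
      then show "k = t h" using kE by auto
    qed
  qed
  then show "\<exists>L p. is_colimit J E F L p" by blast
qed

end

context model_category
begin

lemma Weq_Mor: "f \<in> Weq M \<Longrightarrow> f \<in> Mor C"
  and Cof_Mor: "f \<in> Cof M \<Longrightarrow> f \<in> Mor C"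
  and Fib_Mor: "f \<in> Fib M \<Longrightarrow> f \<in> Mor C"
  using Weq_subcat Cof_subcat Fib_subcat by (auto simp: is_wide_subcategory_def)

end

context anti_iso
begin

definition dual_ms :: "'m model_structure \<Rightarrow> 'n model_structure" where
  "dual_ms M = \<lparr>Weq = t ` Weq M, Cof = t ` Fib M, Fib = t ` Cof M\<rparr>"

theorem model_transfer:
  assumes "model_category D U M"
  shows "model_category E U (dual_ms M)"
proof -
  interpret s: anti_iso E D t' t by (rule swap)
  interpret D: model_category D U M by fact
  note [simp] = D.Weq_Mor D.Cof_Mor D.Fib_Mor
  have mem: "f \<in> t ` S \<longleftrightarrow> t' f \<in> S" if "f \<in> Mor E" "S \<subseteq> Mor D" for f S
  proof
    assume "f \<in> t ` S"
    then obtain x where "x \<in> S" "f = t x" by blast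
    then show "t' f \<in> S" using that(2) by auto
  next
    assume "t' f \<in> S"
    then show "f \<in> t ` S" using tt'[OF that(1)] by (metis imageI)
  qed
  have sub: "Weq M \<subseteq> Mor D" "Cof M \<subseteq> Mor D" "Fib M \<subseteq> Mor D" by auto
  have int: "t ` S \<inter> t ` S' = t ` (S \<inter> S')" if "S \<subseteq> Mor D" "S' \<subseteq> Mor D" for S S'
    using inj_on_image_Int[OF inj_on_inverseI[of "Mor D" t' t] that] by simp
  obtain \<alpha> \<beta> \<gamma> \<delta> where f: "factors_into D (Cof M) (Fib M \<inter> Weq M) \<alpha> \<beta>"
    "factors_into D (Cof M \<inter> Weq M) (Fib M) \<gamma> \<delta>"
    using D.factor_cof_tfib D.factor_tcof_fib by blast
  \<comment> \<open>\<open>limits_transfer\<close> turns limits into colimits. For the limits of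
    \<open>E\<close> it is applied to the opposite categories, where \<open>t\<close> is again an
    anti-isomorphism, and the result is read back through \<open>limits_op\<close>.\<close>
  have lim: "has_small_limits U E"
  proof -
    have "category (op_cat D)" "category (op_cat E)" by (rule D.category_op, rule E.category_op)
    then interpret o: anti_iso "op_cat D" "op_cat E" t t'
      by (intro anti_iso.intro anti_iso_axioms.intro) (auto simp: Obj_eq)
    have "has_small_colimits U (op_cat E)" by (rule o.limits_transfer[OF limits_op[OF D.colimits D.category_axioms]])
    from limits_op[OF this] show ?thesis by (simp add: E.category_op)
  qed
  show ?thesis
  proof (unfold_locales, unfold dual_ms_def model_structure.simps, goal_cases)
    case 1 show ?case by (rule lim)
  next
    case 2 show ?case by (rule limits_transfer[OF D.limits])
  next
    case 3 show ?case by (rule wide_transfer[OF D.Weq_subcat])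
  next
    case 4 show ?case by (rule wide_transfer[OF D.Fib_subcat])
  next
    case 5 show ?case by (rule wide_transfer[OF D.Cof_subcat])
  next
    case (6 f X Y g Z)
    note f = homD[OF 6(1)] and g = homD[OF 6(2)]
    have fg: "t' (g \<cdot>\<^bsub>E\<^esub> f) = t' f \<cdot>\<^bsub>D\<^esub> t' g" "g \<cdot>\<^bsub>E\<^esub> f \<in> Mor E" using f g by simp_all
    have "t' g \<in> hom D Z Y" "t' f \<in> hom D Y X" using f g by (simp_all add: hom_iff)
    from D.two_of_three[OF this] show ?case
      unfolding mem[OF f(1) sub(1)] mem[OF g(1) sub(1)] mem[OF fg(2) sub(1)] fg(1) by blast
  next
    case 7 show ?case by (rule retracts_transfer[OF D.Weq_retracts sub(1)])
  next
    case 8 show ?case by (rule retracts_transfer[OF D.Fib_retracts sub(3)])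
  next
    case 9 show ?case by (rule retracts_transfer[OF D.Cof_retracts sub(2)])
  next
    case (10 i p) then show ?case by (auto intro!: lifting_transfer D.lifting_cof_tfib simp: int sub)
  next
    case (11 i p) then show ?case by (auto intro!: lifting_transfer D.lifting_tcof_fib simp: int sub)
  next
    case 12 show ?case using factors_transfer[OF f(2)] sub by (auto simp: int Int_commute)
  next
    case 13 show ?case using factors_transfer[OF f(1)] sub by (auto simp: int Int_commute)
  qed
qed

end

lemma (in category) anti_iso_op: "anti_iso C (op_cat C) (\<lambda>f. f) (\<lambda>f. f)"
proof -
  interpret op: category "op_cat C" by (rule category_op)
  show ?thesis by unfold_locales auto
qed

definition op_ms :: "'m model_structure \<Rightarrow> 'm model_structure" where
  "op_ms M = \<lparr>Weq = Weq M, Cof = Fib M, Fib = Cof M\<rparr>"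

lemma op_ms_simps [simp]: "Weq (op_ms M) = Weq M" "Cof (op_ms M) = Fib M" "Fib (op_ms M) = Cof M"
  "op_ms (op_ms M) = M"
  by (simp_all add: op_ms_def)

lemma (in model_category) model_category_op: "model_category (op_cat C) U (op_ms M)"
proof -
  interpret o: anti_iso C "op_cat C" "\<lambda>f. f" "\<lambda>f. f" by (rule anti_iso_op)
  show ?thesis using o.model_transfer[OF model_category_axioms] by (simp add: o.dual_ms_def op_ms_def)
qed

lemma fibrant_op: "is_fibrant (op_cat C) (op_ms M) = is_cofibrant C M"
  and cofibrant_op: "is_cofibrant (op_cat C) (op_ms M) = is_fibrant C M"
  by (simp_all add: is_fibrant_def is_cofibrant_def fun_eq_iff terminal_op initial_op)

section \<open>Model categories\<close>

lemma has_liftingI: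
  assumes "\<And>u v. \<lbrakk>u \<in> hom C (Dom C i) (Dom C p); v \<in> hom C (Cod C i) (Cod C p); p \<cdot>\<^bsub>C\<^esub> u = v \<cdot>\<^bsub>C\<^esub> i\<rbrakk>
    \<Longrightarrow> \<exists>h \<in> hom C (Cod C i) (Dom C p). h \<cdot>\<^bsub>C\<^esub> i = u \<and> p \<cdot>\<^bsub>C\<^esub> h = v"
  shows "has_lifting C i p"
  unfolding has_lifting_def
proof
  fix s assume "s \<in> hom (Arr C) i p"
  then show "\<exists>h\<in>hom C (Cod C i) (Dom C p). h \<cdot>\<^bsub>C\<^esub> i = ev0 s \<and> p \<cdot>\<^bsub>C\<^esub> h = ev1 s"
    by (intro assms) (auto simp: Arr_hom hom_iff[of _ C])
qed

lemma has_liftingE: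
  assumes "has_lifting C i p" "i \<in> hom C A B" "p \<in> hom C X Y"
    and "u \<in> hom C A X" "v \<in> hom C B Y" "p \<cdot>\<^bsub>C\<^esub> u = v \<cdot>\<^bsub>C\<^esub> i"
  obtains h where "h \<in> hom C B X" "h \<cdot>\<^bsub>C\<^esub> i = u" "p \<cdot>\<^bsub>C\<^esub> h = v"
proof -
  have "Sq i p u v \<in> hom (Arr C) i p"
    using assms by (auto simp: Arr_hom hom_iff[of _ C])
  then show thesis
    using assms that unfolding has_lifting_def by (auto simp: hom_iff[of _ C])
qed

lemma pullbackE:
  assumes "is_pullback C f g i j" "f \<in> hom C B A" "g \<in> hom C D A" "i \<in> hom C P B"
  shows "j \<in> hom C P D" "f \<cdot>\<^bsub>C\<^esub> i = g \<cdot>\<^bsub>C\<^esub> j"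
    and "\<lbrakk>u \<in> hom C Z B; v \<in> hom C Z D; f \<cdot>\<^bsub>C\<^esub> u = g \<cdot>\<^bsub>C\<^esub> v\<rbrakk>
          \<Longrightarrow> \<exists>!h. h \<in> hom C Z P \<and> i \<cdot>\<^bsub>C\<^esub> h = u \<and> j \<cdot>\<^bsub>C\<^esub> h = v"
  using assms unfolding is_pullback_def by (auto simp: hom_iff)

lemma pushoutE:
  assumes "is_pushout C f g i j" "f \<in> hom C A B" "g \<in> hom C A D" "i \<in> hom C B P"
  shows "j \<in> hom C D P" "i \<cdot>\<^bsub>C\<^esub> f = j \<cdot>\<^bsub>C\<^esub> g"
    and "\<lbrakk>u \<in> hom C B Z; v \<in> hom C D Z; u \<cdot>\<^bsub>C\<^esub> f = v \<cdot>\<^bsub>C\<^esub> g\<rbrakk>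
          \<Longrightarrow> \<exists>!h. h \<in> hom C P Z \<and> h \<cdot>\<^bsub>C\<^esub> i = u \<and> h \<cdot>\<^bsub>C\<^esub> j = v"
  using assms unfolding is_pushout_def by (auto simp: hom_iff)

lemma pullback_hom:
  assumes "is_pullback C f g i j" "f \<in> hom C B A" "g \<in> hom C D A"
  shows "i \<in> hom C (Dom C i) B" "j \<in> hom C (Dom C i) D"
  using assms unfolding is_pullback_def by (auto simp: hom_iff)

text \<open>A lift of the square with top \<open>i\<close> and bottom the identity of
  \<open>B\<close> is a section of \<open>p\<close> that carries \<open>f\<close> to
  \<open>i\<close>; together with \<open>p\<close> it presents \<open>f\<close> as a retract of
  \<open>i\<close>.\<close>

lemma (in category) retract_argument:
  assumes "has_lifting C f p" "f = p \<cdot> i" "i \<in> hom C A Z" "p \<in> hom C Z B"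
  shows "is_retract C f i"
proof -
  note [simp] = homD[OF assms(3)] homD[OF assms(4)]
  have f: "f \<in> hom C A B" using assms by (simp add: hom_iff)
  have [simp]: "A \<in> Obj C" "B \<in> Obj C" using hom_Obj assms(3,4) by blast+
  obtain h where h: "h \<in> hom C B Z" "h \<cdot> f = i" "p \<cdot> h = Ident C B"
    by (rule has_liftingE[OF assms(1) f assms(4), of i "Ident C B"]) (use assms f in \<open>auto simp: hom_iff\<close>)
  show ?thesis
    unfolding is_retract_def
  proof (intro bexI)
    show "Sq f i (Ident C A) h \<in> hom (Arr C) f i" "Sq i f (Ident C A) p \<in> hom (Arr C) i f"
      using homD[OF f] homD[OF h(1)] h(2,3) assms(2) by (simp_all add: Arr_hom)
  qed (use homD[OF f] h(3) in simp)
qed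

context model_category
begin

lemma W_comp: "\<lbrakk>f \<in> Weq M; g \<in> Weq M; Cod C f = Dom C g\<rbrakk> \<Longrightarrow> g \<cdot> f \<in> Weq M"
  and W_left: "\<lbrakk>f \<in> Weq M; g \<cdot> f \<in> Weq M; g \<in> Mor C; Cod C f = Dom C g\<rbrakk> \<Longrightarrow> g \<in> Weq M"
  and W_right: "\<lbrakk>g \<in> Weq M; g \<cdot> f \<in> Weq M; f \<in> Mor C; Cod C f = Dom C g\<rbrakk> \<Longrightarrow> f \<in> Weq M"
  using two_of_three[of f "Dom C f" "Dom C g" g "Cod C g"] Weq_Mor by (auto simp: hom_iff)

lemma W_Ident: "X \<in> Obj C \<Longrightarrow> Ident C X \<in> Weq M"
  using Weq_subcat by (simp add: is_wide_subcategory_def)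

lemma Fib_comp: "\<lbrakk>f \<in> Fib M; g \<in> Fib M; Cod C f = Dom C g\<rbrakk> \<Longrightarrow> g \<cdot> f \<in> Fib M"
  using Fib_subcat by (simp add: is_wide_subcategory_def)

lemma Cof_comp: "\<lbrakk>f \<in> Cof M; g \<in> Cof M; Cod C f = Dom C g\<rbrakk> \<Longrightarrow> g \<cdot> f \<in> Cof M"
  using Cof_subcat by (simp add: is_wide_subcategory_def)

lemma Ident_Fib: "X \<in> Obj C \<Longrightarrow> Ident C X \<in> Fib M"
  and Ident_Cof: "X \<in> Obj C \<Longrightarrow> Ident C X \<in> Cof M"
  using Fib_subcat Cof_subcat by (simp_all add: is_wide_subcategory_def)

lemma iso_retract_Ident:
  assumes "is_iso C f"
  shows "is_retract C f (Ident C (Dom C f))"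
proof -
  have f: "f \<in> Mor C" using assms by (simp add: is_iso_def)
  obtain g where g: "g \<in> hom C (Cod C f) (Dom C f)" "g \<cdot> f = Ident C (Dom C f)"
    "f \<cdot> g = Ident C (Cod C f)" using iso_inverse[OF assms] by metis
  show ?thesis
    unfolding is_retract_def
  proof (intro bexI)
    show "Sq f (Ident C (Dom C f)) (Ident C (Dom C f)) g \<in> hom (Arr C) f (Ident C (Dom C f))"
      and "Sq (Ident C (Dom C f)) f (Ident C (Dom C f)) f \<in> hom (Arr C) (Ident C (Dom C f)) f"
      using f g(2,3) homD[OF g(1)] by (simp_all add: Arr_hom)
  qed (use f g(2,3) homD[OF g(1)] in simp)
qed

lemma iso_in_class:
  assumes "is_iso C f" "closed_under_retracts C S" "is_wide_subcategory C S"
  shows "f \<in> S"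
proof -
  have f: "f \<in> Mor C" using assms(1) by (simp add: is_iso_def)
  then have "Ident C (Dom C f) \<in> S" using assms(3) by (simp add: is_wide_subcategory_def)
  then show ?thesis
    by (rule assms(2)[unfolded closed_under_retracts_def, rule_format, OF f _ iso_retract_Ident[OF assms(1)]])
qed

lemma iso_Weq: "is_iso C f \<Longrightarrow> f \<in> Weq M"
  and iso_Fib: "is_iso C f \<Longrightarrow> f \<in> Fib M"
  using iso_in_class Weq_retracts Weq_subcat Fib_retracts Fib_subcat by blast+

lemma factor_cof:
  assumes "f \<in> hom C X Y"
  obtains Z i p where "i \<in> hom C X Z" "p \<in> hom C Z Y" "i \<in> Cof M" "p \<in> Fib M" "p \<in> Weq M" "f = p \<cdot> i"
proof -
  obtain \<alpha> \<beta> where "factors_into C (Cof M) (Fib M \<inter> Weq M) \<alpha> \<beta>" using factor_cof_tfib by blast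
  then show thesis
    using assms that[of "onobj \<alpha> f" "Cod C (onobj \<alpha> f)" "onobj \<beta> f"] Cof_Mor Fib_Mor
    unfolding factors_into_def functorial_factorization_def by (auto simp: hom_iff)
qed

lemma factor_tcof:
  assumes "f \<in> hom C X Y"
  obtains Z i p where "i \<in> hom C X Z" "p \<in> hom C Z Y" "i \<in> Cof M" "i \<in> Weq M" "p \<in> Fib M" "f = p \<cdot> i"
proof -
  obtain \<alpha> \<beta> where "factors_into C (Cof M \<inter> Weq M) (Fib M) \<alpha> \<beta>" using factor_tcof_fib by blast
  then show thesis
    using assms that[of "onobj \<alpha> f" "Cod C (onobj \<alpha> f)" "onobj \<beta> f"] Cof_Mor Fib_Mor
    unfolding factors_into_def functorial_factorization_def by (auto simp: hom_iff)
qed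

lemma lift_cof:
  assumes "i \<in> Cof M" "p \<in> Fib M" "i \<in> Weq M \<or> p \<in> Weq M" "i \<in> hom C A B" "p \<in> hom C X Y"
    and "u \<in> hom C A X" "v \<in> hom C B Y" "p \<cdot> u = v \<cdot> i"
  obtains h where "h \<in> hom C B X" "h \<cdot> i = u" "p \<cdot> h = v"
proof -
  have "has_lifting C i p" using assms(1-3) lifting_cof_tfib lifting_tcof_fib by auto
  from has_liftingE[OF this assms(4-8)] show thesis using that by blast
qed

text \<open>Factor the map and lift it against its own right factor: this makes it a retract of a
  cofibration. \<open>TCofI\<close> uses the other factorization in the same way, and
  \<open>FibI\<close> and \<open>TFibI\<close> are the duals.\<close>

lemma CofI:
  assumes "f \<in> Mor C" "\<And>p. \<lbrakk>p \<in> Fib M; p \<in> Weq M\<rbrakk> \<Longrightarrow> has_lifting C f p"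
  shows "f \<in> Cof M"
proof -
  obtain Z i p where "i \<in> hom C (Dom C f) Z" "p \<in> hom C Z (Cod C f)" "i \<in> Cof M" "p \<in> Fib M" "p \<in> Weq M" "f = p \<cdot> i"
    using factor_cof[OF Mor_hom[OF assms(1)]] by metis
  then show ?thesis
    using retract_argument[of f p i] assms Cof_retracts unfolding closed_under_retracts_def by meson
qed

lemma TCofI:
  assumes "f \<in> Mor C" "\<And>p. p \<in> Fib M \<Longrightarrow> has_lifting C f p"
  shows "f \<in> Cof M" "f \<in> Weq M"
proof -
  obtain Z i p where "i \<in> hom C (Dom C f) Z" "p \<in> hom C Z (Cod C f)" "i \<in> Cof M" "i \<in> Weq M" "p \<in> Fib M" "f = p \<cdot> i"
    using factor_tcof[OF Mor_hom[OF assms(1)]] by metis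
  then show "f \<in> Cof M" "f \<in> Weq M"
    using retract_argument[of f p i] assms Cof_retracts Weq_retracts unfolding closed_under_retracts_def by meson+
qed

lemma lifting_op: "\<lbrakk>i \<in> Mor C; p \<in> Mor C\<rbrakk> \<Longrightarrow> has_lifting (op_cat C) p i \<longleftrightarrow> has_lifting C i p"
proof -
  interpret o: anti_iso C "op_cat C" "\<lambda>f. f" "\<lambda>f. f" by (rule anti_iso_op)
  show "\<lbrakk>i \<in> Mor C; p \<in> Mor C\<rbrakk> \<Longrightarrow> has_lifting (op_cat C) p i \<longleftrightarrow> has_lifting C i p"
    by (rule o.lifting_iff)
qed

lemma FibI:
  assumes "f \<in> Mor C" "\<And>i. \<lbrakk>i \<in> Cof M; i \<in> Weq M\<rbrakk> \<Longrightarrow> has_lifting C i f"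
  shows "f \<in> Fib M"
proof -
  interpret op: model_category "op_cat C" U "op_ms M" by (rule model_category_op)
  show ?thesis using op.CofI[of f] assms Cof_Mor by (auto simp: lifting_op)
qed

lemma TFibI:
  assumes "f \<in> Mor C" "\<And>i. i \<in> Cof M \<Longrightarrow> has_lifting C i f"
  shows "f \<in> Fib M" "f \<in> Weq M"
proof -
  interpret op: model_category "op_cat C" U "op_ms M" by (rule model_category_op)
  show "f \<in> Fib M" "f \<in> Weq M" using op.TCofI[of f] assms Cof_Mor by (auto simp: lifting_op)
qed

lemma pullback_lifting:
  assumes pb: "is_pullback C f g i j" and c: "has_lifting C c g" "c \<in> Mor C"
  shows "has_lifting C c i"
proof (rule has_liftingI)
  obtain A B D P where f: "f \<in> hom C B A" and g: "g \<in> hom C D A" and i: "i \<in> hom C P B" and j: "j \<in> hom C P D"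
    and e: "f \<cdot> i = g \<cdot> j"
    and univ: "\<And>Z u v. \<lbrakk>u \<in> hom C Z B; v \<in> hom C Z D; f \<cdot> u = g \<cdot> v\<rbrakk> \<Longrightarrow> \<exists>!h. h \<in> hom C Z P \<and> i \<cdot> h = u \<and> j \<cdot> h = v"
    using pb unfolding is_pullback_def by blast
  note [simp] = homD[OF f] homD[OF g] homD[OF i] homD[OF j] c(2)
  fix u v assume uv: "u \<in> hom C (Dom C c) (Dom C i)" "v \<in> hom C (Cod C c) (Cod C i)" "i \<cdot> u = v \<cdot> c"
  then have [simp]: "u \<in> Mor C" "Dom C u = Dom C c" "Cod C u = P" "v \<in> Mor C" "Dom C v = Cod C c" "Cod C v = B"
    by (simp_all add: hom_iff)
  obtain k where k: "k \<in> hom C (Cod C c) D" "k \<cdot> c = j \<cdot> u" "g \<cdot> k = f \<cdot> v"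
    by (rule has_liftingE[OF c(1) Mor_hom[OF c(2)] g, of "j \<cdot> u" "f \<cdot> v"])
      (simp_all add: hom_iff reassoc[OF e[symmetric]] uv(3))
  note [simp] = homD[OF k(1)]
  obtain h where h: "h \<in> hom C (Cod C c) P" "i \<cdot> h = v" "j \<cdot> h = k"
    using univ[of v "Cod C c" k] k by (auto simp: hom_iff)
  note [simp] = homD[OF h(1)]
  have "\<exists>!h. h \<in> hom C (Dom C c) P \<and> i \<cdot> h = v \<cdot> c \<and> j \<cdot> h = k \<cdot> c"
    by (rule univ) (simp_all add: hom_iff reassoc[OF k(3)])
  moreover have "i \<cdot> (h \<cdot> c) = v \<cdot> c" "j \<cdot> (h \<cdot> c) = k \<cdot> c"
    by (simp_all add: reassoc[OF h(2)] reassoc[OF h(3)])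
  moreover have "h \<cdot> c \<in> hom C (Dom C c) P" "u \<in> hom C (Dom C c) P" by (simp_all add: hom_iff)
  ultimately have "h \<cdot> c = u" using uv(3) k(2) by metis
  then show "\<exists>h\<in>hom C (Cod C c) (Dom C i). h \<cdot> c = u \<and> i \<cdot> h = v"
    using h by (intro bexI[of _ h]) auto
qed

lemma pullback_Mor:
  assumes "is_pullback C f g i j"
  shows "i \<in> Mor C"
  using assms unfolding is_pullback_def by (auto simp: hom_iff)

lemma pullback_Fib: "\<lbrakk>is_pullback C f g i j; g \<in> Fib M\<rbrakk> \<Longrightarrow> i \<in> Fib M"
  by (rule FibI) (auto intro: pullback_Mor pullback_lifting lifting_tcof_fib Cof_Mor)

lemma pullback_TFib:
  assumes "is_pullback C f g i j" "g \<in> Fib M" "g \<in> Weq M"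
  shows "i \<in> Fib M" "i \<in> Weq M"
proof -
  have "\<And>c. c \<in> Cof M \<Longrightarrow> has_lifting C c i"
    using assms by (auto intro: pullback_lifting lifting_cof_tfib Cof_Mor)
  then show "i \<in> Fib M" "i \<in> Weq M"
    using TFibI[of i] pullback_Mor[OF assms(1)] by auto
qed

lemma pullback_sym: "is_pullback C f g i j \<Longrightarrow> is_pullback C g f j i"
  unfolding is_pullback_def
  apply (elim exE conjE)
  subgoal for A B D P
    by (rule exI[of _ A], rule exI[of _ D], rule exI[of _ B], rule exI[of _ P]) (auto simp: conj_commute)
  done

lemma pushout_Cof: "\<lbrakk>is_pushout C f g i j; g \<in> Cof M\<rbrakk> \<Longrightarrow> i \<in> Cof M"
proof -
  interpret op: model_category "op_cat C" U "op_ms M" by (rule model_category_op)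
  show "\<lbrakk>is_pushout C f g i j; g \<in> Cof M\<rbrakk> \<Longrightarrow> i \<in> Cof M"
    using op.pullback_Fib[of f g i j] by (simp add: pullback_op)
qed

lemma pushout_TCof:
  assumes "is_pushout C f g i j" "g \<in> Cof M" "g \<in> Weq M"
  shows "i \<in> Cof M" "i \<in> Weq M"
proof -
  interpret op: model_category "op_cat C" U "op_ms M" by (rule model_category_op)
  show "i \<in> Cof M" "i \<in> Weq M"
    using op.pullback_TFib[of f g i j] assms by (simp_all add: pullback_op)
qed

lemma pushout_sym: "is_pushout C f g i j \<Longrightarrow> is_pushout C g f j i"
proof -
  interpret op: model_category "op_cat C" U "op_ms M" by (rule model_category_op)
  show "is_pushout C f g i j \<Longrightarrow> is_pushout C g f j i"
    using op.pullback_sym[of f g i j] by (simp add: pullback_op)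
qed

lemma terminal_ex: "\<exists>T. is_terminal C T"
  using ex_terminal limits by blast

lemma terminal_hom_eq:
  assumes "is_terminal C T" "f \<in> hom C X T" "g \<in> hom C X T"
  shows "f = g"
  using assms hom_Obj[OF assms(2)] unfolding is_terminal_def by blast

lemma terminal_mor:
  assumes "is_terminal C T" "X \<in> Obj C"
  obtains f where "f \<in> hom C X T"
  using assms unfolding is_terminal_def by blast

lemma fibrant_Obj: "is_fibrant C M X \<Longrightarrow> X \<in> Obj C"
  and cofibrant_Obj: "is_cofibrant C M X \<Longrightarrow> X \<in> Obj C"
  by (auto simp: is_fibrant_def is_cofibrant_def dest: hom_Obj)

lemma fibrant_map:
  assumes X: "is_fibrant C M X" and T: "is_terminal C T" and f: "f \<in> hom C X T"
  shows "f \<in> Fib M"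
proof -
  obtain T' f' where T': "is_terminal C T'" "f' \<in> hom C X T'" "f' \<in> Fib M"
    using X by (auto simp: is_fibrant_def)
  have TO: "T \<in> Obj C" "T' \<in> Obj C" using T T' by (auto simp: is_terminal_def)
  obtain g where g: "g \<in> hom C T' T" using terminal_mor[OF T TO(2)] by metis
  obtain g' where g': "g' \<in> hom C T T'" using terminal_mor[OF T'(1) TO(1)] by metis
  note [simp] = homD[OF g] homD[OF g'] homD[OF f] homD[OF T'(2)] TO
  have "g \<cdot> g' = Ident C T" "g' \<cdot> g = Ident C T'"
    by (rule terminal_hom_eq[OF T], simp_all add: hom_iff)
      (rule terminal_hom_eq[OF T'(1)], simp_all add: hom_iff)
  then have "is_iso C g" using g' by (auto simp: is_iso_def)
  then have "g \<cdot> f' \<in> Fib M" using Fib_comp[OF T'(3) iso_Fib] by simp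
  moreover have "g \<cdot> f' = f" by (rule terminal_hom_eq[OF T]) (simp_all add: hom_iff)
  ultimately show ?thesis by simp
qed

lemma fibrant_ext:
  assumes Y: "is_fibrant C M Y" and i: "i \<in> Cof M" "i \<in> Weq M" "i \<in> hom C A B" and h: "h \<in> hom C A Y"
  obtains k where "k \<in> hom C B Y" "k \<cdot> i = h"
proof -
  obtain T f where T: "is_terminal C T" "f \<in> hom C Y T" "f \<in> Fib M"
    using Y by (auto simp: is_fibrant_def)
  obtain v where v: "v \<in> hom C B T" using terminal_mor[OF T(1) hom_Obj(2)[OF i(3)]] by metis
  have "f \<cdot> h = v \<cdot> i"
    by (rule terminal_hom_eq[OF T(1), of _ A])
      (use homD[OF T(2)] homD[OF h] homD[OF i(3)] homD[OF v] in \<open>simp_all add: hom_iff\<close>)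
  from lift_cof[OF i(1) T(3) _ i(3) T(2) h v this] i(2) that show thesis by blast
qed

text \<open>Over a terminal object every square and every lower triangle commutes, so lifting
  reduces to extending maps along trivial cofibrations.\<close>

lemma fibrantI:
  assumes Y: "Y \<in> Obj C"
    and ext: "\<And>i A B h. \<lbrakk>i \<in> Cof M; i \<in> Weq M; i \<in> hom C A B; h \<in> hom C A Y\<rbrakk> \<Longrightarrow> \<exists>k \<in> hom C B Y. k \<cdot> i = h"
  shows "is_fibrant C M Y"
proof -
  obtain T where T: "is_terminal C T" using terminal_ex by blast
  obtain f where f: "f \<in> hom C Y T" using terminal_mor[OF T Y] by metis
  note [simp] = homD[OF f]
  have "f \<in> Fib M"
  proof (rule FibI, goal_cases)
    case (2 i)
    show ?case
    proof (rule has_liftingI)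
      fix u v assume u: "u \<in> hom C (Dom C i) (Dom C f)" and v: "v \<in> hom C (Cod C i) (Cod C f)"
      have i: "i \<in> Mor C" using 2 Cof_Mor by blast
      obtain k where k: "k \<in> hom C (Cod C i) Y" "k \<cdot> i = u"
        using ext[OF 2 Mor_hom[OF i], of u] u by auto
      have "f \<cdot> k = v"
        by (rule terminal_hom_eq[OF T, of _ "Cod C i"]) (use homD[OF k(1)] homD[OF v] in \<open>simp_all add: hom_iff\<close>)
      then show "\<exists>h\<in>hom C (Cod C i) (Dom C f). h \<cdot> i = u \<and> f \<cdot> h = v"
        using k by (intro bexI[of _ k]) auto
    qed
  qed simp
  then show ?thesis using T f by (auto simp: is_fibrant_def)
qed

lemma Fib_fibrant:
  assumes "p \<in> Fib M" "p \<in> hom C X Y" "is_fibrant C M Y"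
  shows "is_fibrant C M X"
proof -
  obtain T f where T: "is_terminal C T" "f \<in> hom C Y T" "f \<in> Fib M"
    using assms by (auto simp: is_fibrant_def)
  then show ?thesis
    using Fib_comp[OF assms(1) T(3)] homD[OF assms(2)] homD[OF T(2)]
    by (auto simp: is_fibrant_def hom_iff intro!: exI[of _ T] exI[of _ "f \<cdot> p"])
qed

lemma fibrant_repl:
  assumes "X \<in> Obj C"
  obtains Y j where "j \<in> hom C X Y" "j \<in> Cof M" "j \<in> Weq M" "is_fibrant C M Y"
proof -
  obtain T where T: "is_terminal C T" using terminal_ex by blast
  obtain f where f: "f \<in> hom C X T" using terminal_mor[OF T assms] by metis
  obtain Z i p where "i \<in> hom C X Z" "p \<in> hom C Z T" "i \<in> Cof M" "i \<in> Weq M" "p \<in> Fib M"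
    using factor_tcof[OF f] by metis
  then show thesis using that T by (auto simp: is_fibrant_def)
qed

lemma cofibrant_repl:
  assumes "X \<in> Obj C"
  obtains Y q where "q \<in> hom C Y X" "q \<in> Fib M" "q \<in> Weq M" "is_cofibrant C M Y"
proof -
  interpret op: model_category "op_cat C" U "op_ms M" by (rule model_category_op)
  show thesis using op.fibrant_repl[of X] that assms by (auto simp: fibrant_op)
qed

lemma cofibrant_lift:
  assumes "is_cofibrant C M X" "p \<in> Fib M" "p \<in> Weq M" "p \<in> hom C E B" "h \<in> hom C X B"
  obtains k where "k \<in> hom C X E" "p \<cdot> k = h"
proof -
  interpret op: model_category "op_cat C" U "op_ms M" by (rule model_category_op)
  show thesis using op.fibrant_ext[of X p B E h] that assms by (auto simp: fibrant_op)
qed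

lemma cofibrantI:
  assumes "Y \<in> Obj C"
    and "\<And>p A B h. \<lbrakk>p \<in> Fib M; p \<in> Weq M; p \<in> hom C B A; h \<in> hom C Y A\<rbrakk> \<Longrightarrow> \<exists>k \<in> hom C Y B. p \<cdot> k = h"
  shows "is_cofibrant C M Y"
proof -
  interpret op: model_category "op_cat C" U "op_ms M" by (rule model_category_op)
  show ?thesis using op.fibrantI[of Y] assms by (simp add: fibrant_op)
qed

lemma Cof_cofibrant:
  assumes "i \<in> Cof M" "i \<in> hom C X Y" "is_cofibrant C M X"
  shows "is_cofibrant C M Y"
proof -
  interpret op: model_category "op_cat C" U "op_ms M" by (rule model_category_op)
  show ?thesis using op.Fib_fibrant[of i Y X] assms by (simp add: fibrant_op)
qed

lemma cofibrant_map:
  assumes "is_cofibrant C M X" "is_initial C T" "f \<in> hom C T X"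
  shows "f \<in> Cof M"
proof -
  interpret op: model_category "op_cat C" U "op_ms M" by (rule model_category_op)
  show ?thesis using op.fibrant_map[of X T f] assms by (simp add: fibrant_op terminal_op)
qed

text \<open>The product is the pullback over a terminal object, so each projection is a pullback of
  the map from the other factor to that object; this is where fibrancy of a factor enters.\<close>

lemma ex_product:
  assumes X: "X \<in> Obj C" and Y: "Y \<in> Obj C"
  shows "\<exists>P p1 p2. p1 \<in> hom C P X \<and> p2 \<in> hom C P Y \<and>
    (\<forall>Z. \<forall>u \<in> hom C Z X. \<forall>v \<in> hom C Z Y. \<exists>!h. h \<in> hom C Z P \<and> p1 \<cdot> h = u \<and> p2 \<cdot> h = v) \<and>
    (is_fibrant C M Y \<longrightarrow> p1 \<in> Fib M) \<and> (is_fibrant C M X \<longrightarrow> p2 \<in> Fib M)"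
proof -
  obtain T where T: "is_terminal C T" using terminal_ex by blast
  obtain f where f: "f \<in> hom C X T" using terminal_mor[OF T X] by metis
  obtain g where g: "g \<in> hom C Y T" using terminal_mor[OF T Y] by metis
  obtain p1 p2 where pb: "is_pullback C f g p1 p2" using ex_pullback[OF limits f g] by blast
  note h = pullback_hom[OF pb f g]
  show ?thesis
  proof (intro exI conjI allI ballI impI)
    show "p1 \<in> hom C (Dom C p1) X" "p2 \<in> hom C (Dom C p1) Y" using h by auto
    show "is_fibrant C M Y \<Longrightarrow> p1 \<in> Fib M" using pullback_Fib[OF pb] fibrant_map[OF _ T g] by blast
    show "is_fibrant C M X \<Longrightarrow> p2 \<in> Fib M" using pullback_Fib[OF pullback_sym[OF pb]] fibrant_map[OF _ T f] by blast
    fix Z u v assume uv: "u \<in> hom C Z X" "v \<in> hom C Z Y"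
    have "f \<cdot> u = g \<cdot> v"
      by (rule terminal_hom_eq[OF T, of _ Z]) (use homD[OF f] homD[OF g] homD[OF uv(1)] homD[OF uv(2)] in \<open>simp_all add: hom_iff\<close>)
    then show "\<exists>!k. k \<in> hom C Z (Dom C p1) \<and> p1 \<cdot> k = u \<and> p2 \<cdot> k = v"
      using pullbackE(3)[OF pb f g h(1) uv] by blast
  qed
qed

text \<open>Ken Brown's argument. Factor the graph \<open>X -> X x Y\<close> of \<open>u\<close>
  into a trivial cofibration \<open>j\<close> and a fibration \<open>q\<close>. Both projections of
  the middle object are trivial fibrations between fibrant objects; \<open>j\<close> is a section of
  the first, and \<open>u\<close> is the second after \<open>j\<close>.\<close>

lemma ken_brown_right:
  assumes E: "model_category E V N" and G: "is_functor C E G"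
    and tfib: "\<And>p. \<lbrakk>p \<in> Fib M; p \<in> Weq M; is_fibrant C M (Dom C p); is_fibrant C M (Cod C p)\<rbrakk>
       \<Longrightarrow> onmor G p \<in> Weq N"
    and u: "u \<in> Weq M" "u \<in> hom C X Y" and fib: "is_fibrant C M X" "is_fibrant C M Y"
  shows "onmor G u \<in> Weq N"
proof -
  interpret E: model_category E V N by fact
  have XY [simp]: "X \<in> Obj C" "Y \<in> Obj C" using hom_Obj[OF u(2)] by auto
  obtain P p1 p2 where p1: "p1 \<in> hom C P X" and p2: "p2 \<in> hom C P Y"
    and univ: "\<And>Z u v. \<lbrakk>u \<in> hom C Z X; v \<in> hom C Z Y\<rbrakk> \<Longrightarrow> \<exists>!h. h \<in> hom C Z P \<and> p1 \<cdot> h = u \<and> p2 \<cdot> h = v"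
    and pf: "p1 \<in> Fib M" "p2 \<in> Fib M"
    using ex_product[OF XY] fib by blast
  have "Ident C X \<in> hom C X X" by (simp add: hom_iff)
  from univ[OF this u(2)] obtain d where d: "d \<in> hom C X P" "p1 \<cdot> d = Ident C X" "p2 \<cdot> d = u"
    by blast
  obtain Z j q where j: "j \<in> hom C X Z" "j \<in> Weq M" and q: "q \<in> hom C Z P" "q \<in> Fib M" and dq: "d = q \<cdot> j"
    using factor_tcof[OF d(1)] by metis
  note [simp] = homD[OF p1] homD[OF p2] homD[OF u(2)] homD[OF j(1)] homD[OF q(1)]
  have e: "(p1 \<cdot> q) \<cdot> j = Ident C X" "(p2 \<cdot> q) \<cdot> j = u" using d dq by simp_all
  have w1: "p1 \<cdot> q \<in> Weq M" "p2 \<cdot> q \<in> Weq M"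
    using W_left[OF j(2), of "p1 \<cdot> q"] W_left[OF j(2), of "p2 \<cdot> q"] u(1) W_Ident[of X] e by simp_all
  have f1: "p1 \<cdot> q \<in> Fib M" "p2 \<cdot> q \<in> Fib M" using Fib_comp[OF q(2)] pf by simp_all
  have "is_fibrant C M Z" using Fib_fibrant[OF f1(1), of Z X] fib by (simp add: hom_iff)
  then have G12: "onmor G (p1 \<cdot> q) \<in> Weq N" "onmor G (p2 \<cdot> q) \<in> Weq N"
    using tfib w1 f1 fib by simp_all
  have "onmor G (p1 \<cdot> q) \<cdot>\<^bsub>E\<^esub> onmor G j = Ident E (onobj G X)" "onmor G u = onmor G (p2 \<cdot> q) \<cdot>\<^bsub>E\<^esub> onmor G j"
    using functorD(6)[OF G, of j "p1 \<cdot> q"] functorD(6)[OF G, of j "p2 \<cdot> q"] functorD(5)[OF G, of X] e by simp_all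
  then show ?thesis
    using E.W_right[OF G12(1), of "onmor G j"] E.W_comp[OF _ G12(2), of "onmor G j"] E.W_Ident[of "onobj G X"]
      functorD[OF G] by simp
qed

lemma ken_brown_left:
  assumes "model_category E V N" and "is_functor C E G"
    and "\<And>p. \<lbrakk>p \<in> Cof M; p \<in> Weq M; is_cofibrant C M (Dom C p); is_cofibrant C M (Cod C p)\<rbrakk>
       \<Longrightarrow> onmor G p \<in> Weq N"
    and "u \<in> Weq M" "u \<in> hom C X Y" and "is_cofibrant C M X" "is_cofibrant C M Y"
  shows "onmor G u \<in> Weq N"
proof -
  interpret op: model_category "op_cat C" U "op_ms M" by (rule model_category_op)
  show ?thesis
    using op.ken_brown_right[OF model_category.model_category_op[OF assms(1)], of G u Y X] assms
    by (simp add: fibrant_op functor_op)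
qed

end

section \<open>Homotopies\<close>

text \<open>
  The joint lifting property says that \<open>W \<squnion> W \<rightarrow> Z\<close> is a cofibration, without referring
  to a coproduct.
\<close>

definition cylinder_on ::
    "('o, 'm) cat \<Rightarrow> 'm model_structure \<Rightarrow> 'o \<Rightarrow> 'o \<Rightarrow> 'm \<Rightarrow> 'm \<Rightarrow> 'm \<Rightarrow> bool" where
  "cylinder_on C M W Z i0 i1 s \<longleftrightarrow> i0 \<in> hom C W Z \<and> i1 \<in> hom C W Z \<and> s \<in> hom C Z W \<and> s \<in> Weq M \<and>
     s \<cdot>\<^bsub>C\<^esub> i0 = Ident C W \<and> s \<cdot>\<^bsub>C\<^esub> i1 = Ident C W \<and>
     (\<forall>p Y X v u0 u1. p \<in> Fib M \<and> p \<in> Weq M \<and> p \<in> hom C X Y \<and> u0 \<in> hom C W X \<and> u1 \<in> hom C W X \<and>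
        v \<in> hom C Z Y \<and> p \<cdot>\<^bsub>C\<^esub> u0 = v \<cdot>\<^bsub>C\<^esub> i0 \<and> p \<cdot>\<^bsub>C\<^esub> u1 = v \<cdot>\<^bsub>C\<^esub> i1 \<longrightarrow>
        (\<exists>h \<in> hom C Z X. p \<cdot>\<^bsub>C\<^esub> h = v \<and> h \<cdot>\<^bsub>C\<^esub> i0 = u0 \<and> h \<cdot>\<^bsub>C\<^esub> i1 = u1))"

text \<open>Dual to \<open>cylinder_on\<close>: the joint lifting property says that
  \<open>(d0, d1)\<close> is a fibration from \<open>Z\<close> to the product of \<open>Y\<close>
  with itself.\<close>

definition path_on ::
    "('o, 'm) cat \<Rightarrow> 'm model_structure \<Rightarrow> 'o \<Rightarrow> 'o \<Rightarrow> 'm \<Rightarrow> 'm \<Rightarrow> 'm \<Rightarrow> bool" where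
  "path_on C M Y Z d0 d1 s \<longleftrightarrow> d0 \<in> hom C Z Y \<and> d1 \<in> hom C Z Y \<and> s \<in> hom C Y Z \<and> s \<in> Weq M \<and>
     d0 \<cdot>\<^bsub>C\<^esub> s = Ident C Y \<and> d1 \<cdot>\<^bsub>C\<^esub> s = Ident C Y \<and>
     (\<forall>i A B u v0 v1. i \<in> Cof M \<and> i \<in> Weq M \<and> i \<in> hom C A B \<and> v0 \<in> hom C B Y \<and> v1 \<in> hom C B Y \<and>
        u \<in> hom C A Z \<and> v0 \<cdot>\<^bsub>C\<^esub> i = d0 \<cdot>\<^bsub>C\<^esub> u \<and> v1 \<cdot>\<^bsub>C\<^esub> i = d1 \<cdot>\<^bsub>C\<^esub> u \<longrightarrow>
        (\<exists>h \<in> hom C B Z. h \<cdot>\<^bsub>C\<^esub> i = u \<and> d0 \<cdot>\<^bsub>C\<^esub> h = v0 \<and> d1 \<cdot>\<^bsub>C\<^esub> h = v1))"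

text \<open>Left homotopy through an arbitrary cylinder. It becomes an equivalence relation, and the
  same as right homotopy, once the source is cofibrant and the target fibrant.\<close>

definition homotopic :: "('o, 'm) cat \<Rightarrow> 'm model_structure \<Rightarrow> 'm \<Rightarrow> 'm \<Rightarrow> bool" where
  "homotopic C M f g \<longleftrightarrow> (\<exists>Z i0 i1 s H. cylinder_on C M (Dom C f) Z i0 i1 s \<and>
     H \<in> hom C Z (Cod C f) \<and> H \<cdot>\<^bsub>C\<^esub> i0 = f \<and> H \<cdot>\<^bsub>C\<^esub> i1 = g)"

lemma path_lift:
  assumes "path_on C M Y Z d0 d1 s" "i \<in> Cof M" "i \<in> Weq M" "i \<in> hom C A B" "v0 \<in> hom C B Y" "v1 \<in> hom C B Y"
    "u \<in> hom C A Z" "v0 \<cdot>\<^bsub>C\<^esub> i = d0 \<cdot>\<^bsub>C\<^esub> u" "v1 \<cdot>\<^bsub>C\<^esub> i = d1 \<cdot>\<^bsub>C\<^esub> u"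
  obtains h where "h \<in> hom C B Z" "h \<cdot>\<^bsub>C\<^esub> i = u" "d0 \<cdot>\<^bsub>C\<^esub> h = v0" "d1 \<cdot>\<^bsub>C\<^esub> h = v1"
  using assms unfolding path_on_def by metis

lemma cylinder_lift:
  assumes "cylinder_on C M W Z i0 i1 s" "p \<in> Fib M" "p \<in> Weq M" "p \<in> hom C X Y" "u0 \<in> hom C W X" "u1 \<in> hom C W X"
    "v \<in> hom C Z Y" "p \<cdot>\<^bsub>C\<^esub> u0 = v \<cdot>\<^bsub>C\<^esub> i0" "p \<cdot>\<^bsub>C\<^esub> u1 = v \<cdot>\<^bsub>C\<^esub> i1"
  obtains h where "h \<in> hom C Z X" "h \<cdot>\<^bsub>C\<^esub> i0 = u0" "h \<cdot>\<^bsub>C\<^esub> i1 = u1" "p \<cdot>\<^bsub>C\<^esub> h = v"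
  using assms unfolding cylinder_on_def by metis

lemma path_onD:
  assumes "path_on C M Y Z d0 d1 s"
  shows "d0 \<in> hom C Z Y" "d1 \<in> hom C Z Y" "s \<in> hom C Y Z" "s \<in> Weq M"
    "d0 \<cdot>\<^bsub>C\<^esub> s = Ident C Y" "d1 \<cdot>\<^bsub>C\<^esub> s = Ident C Y"
  using assms by (simp_all add: path_on_def)

lemma cylinder_onD:
  assumes "cylinder_on C M W Z i0 i1 s"
  shows "i0 \<in> hom C W Z" "i1 \<in> hom C W Z" "s \<in> hom C Z W" "s \<in> Weq M"
    "s \<cdot>\<^bsub>C\<^esub> i0 = Ident C W" "s \<cdot>\<^bsub>C\<^esub> i1 = Ident C W"
  using assms by (simp_all add: cylinder_on_def)

lemma path_op: "path_on (op_cat C) (op_ms M) = cylinder_on C M"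
  and cylinder_op: "cylinder_on (op_cat C) (op_ms M) = path_on C M"
  by (simp_all add: path_on_def cylinder_on_def fun_eq_iff)

lemma path_swap:
  assumes p: "path_on C M Y Z d0 d1 s"
  shows "path_on C M Y Z d1 d0 s"
  unfolding path_on_def
proof (intro conjI allI impI)
  fix i A B u v0 v1
  assume "i \<in> Cof M \<and> i \<in> Weq M \<and> i \<in> hom C A B \<and> v0 \<in> hom C B Y \<and> v1 \<in> hom C B Y \<and>
        u \<in> hom C A Z \<and> v0 \<cdot>\<^bsub>C\<^esub> i = d1 \<cdot>\<^bsub>C\<^esub> u \<and> v1 \<cdot>\<^bsub>C\<^esub> i = d0 \<cdot>\<^bsub>C\<^esub> u"
  then obtain h where "h \<in> hom C B Z" "h \<cdot>\<^bsub>C\<^esub> i = u" "d0 \<cdot>\<^bsub>C\<^esub> h = v1" "d1 \<cdot>\<^bsub>C\<^esub> h = v0"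
    using path_lift[OF p, of i A B v1 v0 u] by blast
  then show "\<exists>h \<in> hom C B Z. h \<cdot>\<^bsub>C\<^esub> i = u \<and> d1 \<cdot>\<^bsub>C\<^esub> h = v0 \<and> d0 \<cdot>\<^bsub>C\<^esub> h = v1" by blast
qed (use path_onD[OF p] in auto)

lemma cylinder_swap: "cylinder_on C M Y Z d0 d1 s \<Longrightarrow> cylinder_on C M Y Z d1 d0 s"
  by (rule path_swap[of "op_cat C" "op_ms M", unfolded path_op])

context model_category
begin

text \<open>Factor the diagonal of \<open>Y\<close> into a trivial cofibration \<open>s\<close> and
  a fibration \<open>q\<close>; the two ends are the coordinates of \<open>q\<close>.\<close>

lemma ex_path:
  assumes "Y \<in> Obj C"
  shows "\<exists>Z d0 d1 s. path_on C M Y Z d0 d1 s"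
proof -
  obtain P p1 p2 where p1: "p1 \<in> hom C P Y" and p2: "p2 \<in> hom C P Y"
    and un: "\<forall>Z. \<forall>u \<in> hom C Z Y. \<forall>v \<in> hom C Z Y. \<exists>!h. h \<in> hom C Z P \<and> p1 \<cdot> h = u \<and> p2 \<cdot> h = v"
    using ex_product[OF assms assms] by (elim exE conjE) (rule that)
  have univ: "\<exists>!h. h \<in> hom C Z P \<and> p1 \<cdot> h = u \<and> p2 \<cdot> h = v" if "u \<in> hom C Z Y" "v \<in> hom C Z Y" for Z u v
    by (rule un[rule_format, OF that])
  have "Ident C Y \<in> hom C Y Y" using assms by (simp add: hom_iff)
  from univ[OF this this] obtain d where d: "d \<in> hom C Y P" "p1 \<cdot> d = Ident C Y" "p2 \<cdot> d = Ident C Y"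
    by blast
  obtain Z s q where s: "s \<in> hom C Y Z" "s \<in> Weq M" and q: "q \<in> hom C Z P" "q \<in> Fib M" and dq: "d = q \<cdot> s"
    using factor_tcof[OF d(1)] by metis
  note [simp] = homD[OF p1] homD[OF p2] homD[OF s(1)] homD[OF q(1)]
  have "path_on C M Y Z (p1 \<cdot> q) (p2 \<cdot> q) s"
    unfolding path_on_def
  proof (intro conjI allI impI)
    show "(p1 \<cdot> q) \<cdot> s = Ident C Y" "(p2 \<cdot> q) \<cdot> s = Ident C Y" using d dq by simp_all
    fix i A B u v0 v1
    assume "i \<in> Cof M \<and> i \<in> Weq M \<and> i \<in> hom C A B \<and> v0 \<in> hom C B Y \<and> v1 \<in> hom C B Y \<and>
        u \<in> hom C A Z \<and> v0 \<cdot> i = (p1 \<cdot> q) \<cdot> u \<and> v1 \<cdot> i = (p2 \<cdot> q) \<cdot> u"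
    then have i: "i \<in> Cof M" "i \<in> Weq M" "i \<in> hom C A B" and v: "v0 \<in> hom C B Y" "v1 \<in> hom C B Y"
      and u: "u \<in> hom C A Z" and e: "v0 \<cdot> i = (p1 \<cdot> q) \<cdot> u" "v1 \<cdot> i = (p2 \<cdot> q) \<cdot> u" by auto
    note [simp] = homD[OF i(3)] homD[OF v(1)] homD[OF v(2)] homD[OF u]
    obtain w where w: "w \<in> hom C B P" "p1 \<cdot> w = v0" "p2 \<cdot> w = v1" using univ[OF v] by blast
    note [simp] = homD[OF w(1)]
    have "\<exists>!h. h \<in> hom C A P \<and> p1 \<cdot> h = v0 \<cdot> i \<and> p2 \<cdot> h = v1 \<cdot> i"
      by (rule univ) (simp_all add: hom_iff)
    moreover have "p1 \<cdot> (w \<cdot> i) = v0 \<cdot> i" "p2 \<cdot> (w \<cdot> i) = v1 \<cdot> i"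
      by (simp_all add: reassoc[OF w(2)] reassoc[OF w(3)])
    moreover have "p1 \<cdot> (q \<cdot> u) = v0 \<cdot> i" "p2 \<cdot> (q \<cdot> u) = v1 \<cdot> i" using e by simp_all
    moreover have "w \<cdot> i \<in> hom C A P" "q \<cdot> u \<in> hom C A P" by (simp_all add: hom_iff)
    ultimately have "q \<cdot> u = w \<cdot> i" by metis
    from lift_cof[OF i(1) q(2) _ i(3) q(1) u w(1) this] i(2)
    obtain h where h: "h \<in> hom C B Z" "h \<cdot> i = u" "q \<cdot> h = w" by blast
    note [simp] = homD[OF h(1)]
    show "\<exists>h\<in>hom C B Z. h \<cdot> i = u \<and> (p1 \<cdot> q) \<cdot> h = v0 \<and> (p2 \<cdot> q) \<cdot> h = v1"
      using h w by (intro bexI[of _ h]) auto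
  qed (use s in \<open>auto simp: hom_iff\<close>)
  then show ?thesis by blast
qed

lemma ex_cylinder:
  assumes "W \<in> Obj C"
  shows "\<exists>Z i0 i1 s. cylinder_on C M W Z i0 i1 s"
proof -
  interpret op: model_category "op_cat C" U "op_ms M" by (rule model_category_op)
  show ?thesis using op.ex_path[of W] assms by (simp add: path_op)
qed

text \<open>To lift against \<open>d0\<close>, prescribe the other end as well: fibrancy of
  \<open>Y\<close> extends \<open>d1 \<cdot> u\<close> along the trivial cofibration, and then the
  joint lifting property applies.\<close>

lemma path_TFib:
  assumes p: "path_on C M Y Z d0 d1 s" and Y: "is_fibrant C M Y"
  shows "d0 \<in> Fib M" "d0 \<in> Weq M"
proof -
  note [simp] = homD[OF path_onD(1)[OF p]] homD[OF path_onD(2)[OF p]] homD[OF path_onD(3)[OF p]]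
  have "Y \<in> Obj C" using fibrant_Obj[OF Y] .
  then show "d0 \<in> Weq M" using W_left[OF path_onD(4)[OF p], of d0] path_onD(5)[OF p] W_Ident by simp
  show "d0 \<in> Fib M"
  proof (rule FibI)
    fix i assume i: "i \<in> Cof M" "i \<in> Weq M"
    have ih: "i \<in> hom C (Dom C i) (Cod C i)" using Cof_Mor[OF i(1)] by (rule Mor_hom)
    show "has_lifting C i d0"
    proof (rule has_liftingI)
      fix u v assume u: "u \<in> hom C (Dom C i) (Dom C d0)" and v: "v \<in> hom C (Cod C i) (Cod C d0)" and e: "d0 \<cdot> u = v \<cdot> i"
      have u': "u \<in> hom C (Dom C i) Z" and v': "v \<in> hom C (Cod C i) Y" using u v by simp_all
      have "d1 \<cdot> u \<in> hom C (Dom C i) Y" using homD[OF u'] by (simp add: hom_iff)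
      from fibrant_ext[OF Y i ih this] obtain k where k: "k \<in> hom C (Cod C i) Y" "k \<cdot> i = d1 \<cdot> u" by blast
      from path_lift[OF p i ih v' k(1) u' e[symmetric] k(2)]
      show "\<exists>h\<in>hom C (Cod C i) (Dom C d0). h \<cdot> i = u \<and> d0 \<cdot> h = v" by (metis homD(2)[OF path_onD(1)[OF p]])
    qed
  qed simp
qed

lemma cylinder_TCof:
  assumes "cylinder_on C M W Z i0 i1 s" "is_cofibrant C M W"
  shows "i0 \<in> Cof M" "i0 \<in> Weq M"
proof -
  interpret op: model_category "op_cat C" U "op_ms M" by (rule model_category_op)
  show "i0 \<in> Cof M" "i0 \<in> Weq M" using op.path_TFib[of W Z i0 i1 s] assms by (simp_all add: path_op fibrant_op)
qed

text \<open>On the end \<open>i0\<close> of the cylinder put the constant path at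
  \<open>H \<cdot> i0\<close> and extend it along the trivial cofibration \<open>i0\<close> to a
  family of paths from \<open>H \<cdot> i0 \<cdot> s\<close> to \<open>H\<close>. The other end of
  the cylinder yields \<open>G\<close>.\<close>

lemma left_to_right:
  assumes c: "cylinder_on C M W Z i0 i1 s" and W: "is_cofibrant C M W"
    and p: "path_on C M Y P d0 d1 t" and H: "H \<in> hom C Z Y"
  obtains G where "G \<in> hom C W P" "d0 \<cdot> G = H \<cdot> i0" "d1 \<cdot> G = H \<cdot> i1"
proof -
  note cD = cylinder_onD[OF c] and pD = path_onD[OF p]
  note [simp] = homD[OF cD(1)] homD[OF cD(2)] homD[OF cD(3)] homD[OF pD(1)] homD[OF pD(2)] homD[OF pD(3)] homD[OF H]
  have 0: "H \<cdot> i0 \<cdot> s \<in> hom C Z Y" "t \<cdot> H \<cdot> i0 \<in> hom C W P" by (simp_all add: hom_iff)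
  obtain K where K: "K \<in> hom C Z P" "K \<cdot> i0 = t \<cdot> H \<cdot> i0" "d0 \<cdot> K = H \<cdot> i0 \<cdot> s" "d1 \<cdot> K = H"
    by (rule path_lift[OF p cylinder_TCof[OF c W] cD(1) 0(1) H 0(2)])
      (simp_all add: cD(5) reassoc[OF pD(5)] reassoc[OF pD(6)])
  note [simp] = homD[OF K(1)]
  show thesis
    by (rule that[of "K \<cdot> i1"]) (simp_all add: hom_iff reassoc[OF K(3)] reassoc[OF K(4)] cD(6))
qed

lemma right_to_left:
  assumes "cylinder_on C M W Z i0 i1 s" and "is_fibrant C M Y"
    and "path_on C M Y P d0 d1 t" and "G \<in> hom C W P"
  obtains H where "H \<in> hom C Z Y" "H \<cdot> i0 = d0 \<cdot> G" "H \<cdot> i1 = d1 \<cdot> G"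
proof -
  interpret op: model_category "op_cat C" U "op_ms M" by (rule model_category_op)
  show thesis using op.left_to_right[of Y P d0 d1 t W Z i0 i1 s G] assms that
    by (simp add: path_op cylinder_op fibrant_op cofibrant_op) blast
qed

lemma homotopicI_left:
  "\<lbrakk>cylinder_on C M W Z i0 i1 s; H \<in> hom C Z Y; H \<cdot> i0 = f; H \<cdot> i1 = g\<rbrakk> \<Longrightarrow> homotopic C M f g"
  unfolding homotopic_def using cylinder_onD(1)[of C M W Z i0 i1 s]
  by (intro exI[of _ Z] exI[of _ i0] exI[of _ i1] exI[of _ s] exI[of _ H]) (auto simp: hom_iff)

context
  fixes W Y
  assumes W: "is_cofibrant C M W" and Y: "is_fibrant C M Y"
begin

lemma homotopicI_right:
  assumes "path_on C M Y P d0 d1 t" "G \<in> hom C W P"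
  shows "homotopic C M (d0 \<cdot> G) (d1 \<cdot> G)"
proof -
  obtain Z i0 i1 s where c: "cylinder_on C M W Z i0 i1 s" using ex_cylinder[OF cofibrant_Obj[OF W]] by blast
  from right_to_left[OF c Y assms] obtain H where "H \<in> hom C Z Y" "H \<cdot> i0 = d0 \<cdot> G" "H \<cdot> i1 = d1 \<cdot> G" by blast
  from homotopicI_left[OF c this] show ?thesis .
qed

lemma homotopicE_right:
  assumes h: "homotopic C M f g" and f: "f \<in> hom C W Y" and p: "path_on C M Y P d0 d1 t"
  obtains G where "G \<in> hom C W P" "d0 \<cdot> G = f" "d1 \<cdot> G = g"
proof -
  obtain Z i0 i1 s H where c: "cylinder_on C M W Z i0 i1 s" and H: "H \<in> hom C Z Y" "H \<cdot> i0 = f" "H \<cdot> i1 = g"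
    using h f unfolding homotopic_def by (auto simp: hom_iff[of f])
  from left_to_right[OF c W p H(1)] show thesis using that H by blast
qed

lemma homotopicE_left:
  assumes h: "homotopic C M f g" and f: "f \<in> hom C W Y" and c: "cylinder_on C M W Z i0 i1 s"
  obtains H where "H \<in> hom C Z Y" "H \<cdot> i0 = f" "H \<cdot> i1 = g"
proof -
  obtain P d0 d1 t where p: "path_on C M Y P d0 d1 t" using ex_path[OF fibrant_Obj[OF Y]] by blast
  from homotopicE_right[OF h f p] obtain G where "G \<in> hom C W P" "d0 \<cdot> G = f" "d1 \<cdot> G = g" by blast
  with right_to_left[OF c Y p this(1)] show thesis using that by metis
qed

lemma homotopic_hom:
  assumes "homotopic C M f g" "f \<in> hom C W Y"
  shows "g \<in> hom C W Y"
proof -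
  obtain Z i0 i1 s where c: "cylinder_on C M W Z i0 i1 s" using ex_cylinder[OF cofibrant_Obj[OF W]] by blast
  from homotopicE_left[OF assms c] obtain H where H: "H \<in> hom C Z Y" "H \<cdot> i1 = g" by blast
  then show ?thesis using cylinder_onD(2)[OF c] by (auto simp: hom_iff)
qed

lemma homotopic_refl:
  assumes f: "f \<in> hom C W Y"
  shows "homotopic C M f f"
proof -
  obtain Z i0 i1 s where c: "cylinder_on C M W Z i0 i1 s" using ex_cylinder[OF cofibrant_Obj[OF W]] by blast
  note [simp] = homD[OF f] homD[OF cylinder_onD(1)[OF c]] homD[OF cylinder_onD(2)[OF c]] homD[OF cylinder_onD(3)[OF c]]
  show ?thesis
    by (rule homotopicI_left[OF c, of "f \<cdot> s"]) (simp_all add: hom_iff cylinder_onD(5,6)[OF c])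
qed

lemma homotopic_sym:
  assumes "homotopic C M f g" "f \<in> hom C W Y"
  shows "homotopic C M g f"
proof -
  obtain Z i0 i1 s H where "cylinder_on C M W Z i0 i1 s" "H \<in> hom C Z Y" "H \<cdot> i0 = f" "H \<cdot> i1 = g"
    using assms unfolding homotopic_def by (auto simp: hom_iff[of f])
  then show ?thesis using homotopicI_left[OF cylinder_swap] by blast
qed

text \<open>The left homotopy \<open>H\<close>, the right homotopy \<open>G\<close> and the constant
  homotopy at \<open>h\<close> are three sides of a square, which is filled by lifting along
  \<open>i1\<close>. The fourth side, the filler restricted to \<open>i0\<close>, is a right
  homotopy from \<open>f\<close> to \<open>h\<close>.\<close>

lemma homotopic_trans:
  assumes fg: "homotopic C M f g" and gh: "homotopic C M g h" and f: "f \<in> hom C W Y"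
  shows "homotopic C M f h"
proof -
  obtain Z i0 i1 s where c: "cylinder_on C M W Z i0 i1 s" using ex_cylinder[OF cofibrant_Obj[OF W]] by blast
  obtain P d0 d1 t where p: "path_on C M Y P d0 d1 t" using ex_path[OF fibrant_Obj[OF Y]] by blast
  have g: "g \<in> hom C W Y" using homotopic_hom[OF fg f] .
  have h: "h \<in> hom C W Y" using homotopic_hom[OF gh g] .
  from homotopicE_left[OF fg f c] obtain H where H: "H \<in> hom C Z Y" "H \<cdot> i0 = f" "H \<cdot> i1 = g" by blast
  from homotopicE_right[OF gh g p] obtain G where G: "G \<in> hom C W P" "d0 \<cdot> G = g" "d1 \<cdot> G = h" by blast
  note cD = cylinder_onD[OF c] and pD = path_onD[OF p]
  note [simp] = homD[OF cD(1)] homD[OF cD(2)] homD[OF cD(3)] homD[OF pD(1)] homD[OF pD(2)] homD[OF pD(3)] homD[OF H(1)]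
    homD[OF G(1)] homD[OF h]
  have hs: "h \<cdot> s \<in> hom C Z Y" by (simp add: hom_iff)
  obtain L where L: "L \<in> hom C Z P" "L \<cdot> i1 = G" "d0 \<cdot> L = H" "d1 \<cdot> L = h \<cdot> s"
    by (rule path_lift[OF p cylinder_TCof[OF cylinder_swap[OF c] W] cD(2) H(1) hs G(1)])
      (simp_all add: G H cD(6))
  note [simp] = homD[OF L(1)]
  have "L \<cdot> i0 \<in> hom C W P" by (simp add: hom_iff)
  moreover have "d0 \<cdot> (L \<cdot> i0) = f" "d1 \<cdot> (L \<cdot> i0) = h"
    by (simp_all add: reassoc[OF L(3)] reassoc[OF L(4)] H cD(5))
  ultimately show ?thesis using homotopicI_right[OF p, of "L \<cdot> i0"] by simp
qed

end

lemma homotopic_post: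
  assumes "homotopic C M f g" "f \<in> hom C W Y" "k \<in> hom C Y Y'"
  shows "homotopic C M (k \<cdot> f) (k \<cdot> g)"
proof -
  obtain Z i0 i1 s H where c: "cylinder_on C M W Z i0 i1 s" and H: "H \<in> hom C Z Y" "H \<cdot> i0 = f" "H \<cdot> i1 = g"
    using assms unfolding homotopic_def by (auto simp: hom_iff[of f])
  note [simp] = homD[OF H(1)] homD[OF assms(3)] homD[OF cylinder_onD(1)[OF c]] homD[OF cylinder_onD(2)[OF c]]
  show ?thesis by (rule homotopicI_left[OF c, of "k \<cdot> H"]) (auto simp: hom_iff H)
qed

text \<open>Precomposition is immediate for right homotopies but not for left ones, hence the
  conversion.\<close>

lemma homotopic_pre:
  assumes h: "homotopic C M f g" and f: "f \<in> hom C W Y" and u: "u \<in> hom C W' W"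
    and W: "is_cofibrant C M W" "is_cofibrant C M W'" and Y: "is_fibrant C M Y"
  shows "homotopic C M (f \<cdot> u) (g \<cdot> u)"
proof -
  obtain P d0 d1 t where p: "path_on C M Y P d0 d1 t" using ex_path[OF fibrant_Obj[OF Y]] by blast
  from homotopicE_right[OF W(1) Y h f p] obtain G where G: "G \<in> hom C W P" "d0 \<cdot> G = f" "d1 \<cdot> G = g" by blast
  note [simp] = homD[OF G(1)] homD[OF u] homD[OF path_onD(1)[OF p]] homD[OF path_onD(2)[OF p]]
  have "G \<cdot> u \<in> hom C W' P" by (simp add: hom_iff)
  from homotopicI_right[OF W(2) Y p this] show ?thesis
    by (simp add: reassoc[OF G(2)] reassoc[OF G(3)])
qed

text \<open>Fibrancy of \<open>Y\<close> gives the retraction \<open>r\<close>. The map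
  \<open>j \<cdot> r\<close> and the identity agree on \<open>Y\<close>, and the path object of
  \<open>Z\<close> extends the constant path there to a homotopy \<open>K\<close> between
  them.\<close>

lemma tcof_deformation:
  assumes j: "j \<in> Cof M" "j \<in> Weq M" "j \<in> hom C Y Z" and Y: "is_fibrant C M Y" and Z: "is_fibrant C M Z"
  obtains r where "r \<in> hom C Z Y" "r \<cdot> j = Ident C Y"
    "\<And>W h. \<lbrakk>is_cofibrant C M W; h \<in> hom C W Z\<rbrakk> \<Longrightarrow> homotopic C M (j \<cdot> (r \<cdot> h)) h"
proof -
  have [simp]: "Y \<in> Obj C" "Z \<in> Obj C" using fibrant_Obj Y Z by auto
  have "Ident C Y \<in> hom C Y Y" by (simp add: hom_iff)
  from fibrant_ext[OF Y j this] obtain r where r: "r \<in> hom C Z Y" "r \<cdot> j = Ident C Y" by blast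
  obtain P d0 d1 t where p: "path_on C M Z P d0 d1 t" using ex_path[OF fibrant_Obj[OF Z]] by blast
  note pD = path_onD[OF p]
  note [simp] = homD[OF pD(1)] homD[OF pD(2)] homD[OF pD(3)] homD[OF j(3)] homD[OF r(1)]
  obtain K where K: "K \<in> hom C Z P" "K \<cdot> j = t \<cdot> j" "d0 \<cdot> K = j \<cdot> r" "d1 \<cdot> K = Ident C Z"
    by (rule path_lift[OF p j, of "j \<cdot> r" "Ident C Z" "t \<cdot> j"])
      (simp_all add: hom_iff r reassoc[OF pD(5)] reassoc[OF pD(6)])
  note [simp] = homD[OF K(1)]
  show thesis
  proof (rule that[OF r])
    fix W h assume W: "is_cofibrant C M W" and h: "h \<in> hom C W Z"
    note [simp] = homD[OF h]
    have "K \<cdot> h \<in> hom C W P" by (simp add: hom_iff)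
    from homotopicI_right[OF W Z p this] show "homotopic C M (j \<cdot> (r \<cdot> h)) h"
      by (simp add: reassoc[OF K(3)] reassoc[OF K(4)])
  qed
qed

text \<open>In the factorization \<open>k = q \<cdot> j\<close> the trivial fibration
  \<open>q\<close> lifts maps and homotopies out of a cofibrant object, and the trivial cofibration
  \<open>j\<close> has a deformation retraction \<open>r\<close>; together they give bijectivity on
  homotopy classes.\<close>

lemma
  assumes k: "k \<in> Weq M" "k \<in> hom C Y Y'" and Y: "is_fibrant C M Y" "is_fibrant C M Y'" and W: "is_cofibrant C M W"
  shows homotopic_weq_surj: "h \<in> hom C W Y' \<Longrightarrow> \<exists>f \<in> hom C W Y. homotopic C M (k \<cdot> f) h"
    and homotopic_weq_inj: "\<lbrakk>homotopic C M (k \<cdot> f) (k \<cdot> g); f \<in> hom C W Y; g \<in> hom C W Y\<rbrakk> \<Longrightarrow> homotopic C M f g"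
proof -
  obtain Z j q where j: "j \<in> Cof M" "j \<in> Weq M" "j \<in> hom C Y Z" and q: "q \<in> hom C Z Y'" "q \<in> Fib M" and kq: "k = q \<cdot> j"
    using factor_tcof[OF k(2)] by metis
  note [simp] = homD[OF q(1)] homD[OF j(3)]
  have qW: "q \<in> Weq M" using W_left[OF j(2), of q] k kq by simp
  have Z: "is_fibrant C M Z" using Fib_fibrant[OF q(2,1) Y(2)] .
  obtain r where r: "r \<in> hom C Z Y" "r \<cdot> j = Ident C Y"
    and def: "\<And>h. h \<in> hom C W Z \<Longrightarrow> homotopic C M (j \<cdot> (r \<cdot> h)) h"
    using tcof_deformation[OF j Y(1) Z] W by metis
  note [simp] = homD[OF r(1)]
  show "\<exists>f \<in> hom C W Y. homotopic C M (k \<cdot> f) h" if h: "h \<in> hom C W Y'"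
  proof -
    from cofibrant_lift[OF W q(2) qW q(1) h] obtain h' where h': "h' \<in> hom C W Z" "q \<cdot> h' = h" by blast
    note [simp] = homD[OF h'(1)]
    have "homotopic C M (q \<cdot> (j \<cdot> (r \<cdot> h'))) (q \<cdot> h')"
      by (rule homotopic_post[OF def[OF h'(1)] _ q(1), of W]) (simp add: hom_iff)
    then show ?thesis using h' kq by (intro bexI[of _ "r \<cdot> h'"]) (simp_all add: hom_iff)
  qed
  show "homotopic C M f g" if hg: "homotopic C M (k \<cdot> f) (k \<cdot> g)" and f: "f \<in> hom C W Y" and g: "g \<in> hom C W Y"
  proof -
    note [simp] = homD[OF f] homD[OF g] homD[OF k(2)]
    obtain V i0 i1 s where c: "cylinder_on C M W V i0 i1 s" using ex_cylinder[OF cofibrant_Obj[OF W]] by blast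
    have kf: "k \<cdot> f \<in> hom C W Y'" by (simp add: hom_iff)
    obtain H where H: "H \<in> hom C V Y'" "H \<cdot> i0 = k \<cdot> f" "H \<cdot> i1 = k \<cdot> g"
      using homotopicE_left[OF W Y(2) hg kf c] by blast
    obtain H' where H': "H' \<in> hom C V Z" "H' \<cdot> i0 = j \<cdot> f" "H' \<cdot> i1 = j \<cdot> g" "q \<cdot> H' = H"
      by (rule cylinder_lift[OF c q(2) qW q(1) _ _ H(1), of "j \<cdot> f" "j \<cdot> g"]) (auto simp: hom_iff H kq)
    from homotopicI_left[OF c H'(1,2,3)] have "homotopic C M (j \<cdot> f) (j \<cdot> g)" .
    from homotopic_post[OF this _ r(1), of W] show ?thesis
      by (simp add: hom_iff reassoc[OF r(2)])
  qed
qed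

lemma homotopic_Weq:
  assumes h: "homotopic C M f g" and f: "f \<in> Weq M" and fh: "f \<in> hom C W Y"
    and W: "is_cofibrant C M W"
  shows "g \<in> Weq M"
proof -
  obtain Z i0 i1 s H where c: "cylinder_on C M W Z i0 i1 s" and H: "H \<in> hom C Z Y" "H \<cdot> i0 = f" "H \<cdot> i1 = g"
    using h fh unfolding homotopic_def by (auto simp: hom_iff[of f])
  note [simp] = homD[OF H(1)] homD[OF cylinder_onD(1)[OF c]] homD[OF cylinder_onD(2)[OF c]]
  have "H \<in> Weq M" using W_left[OF cylinder_TCof(2)[OF c W], of H] f H by simp
  then show ?thesis
    using W_comp[OF cylinder_TCof(2)[OF cylinder_swap[OF c] W], of H] H by simp
qed

text \<open>With \<open>f = p \<cdot> i\<close> and \<open>i\<close> a trivial cofibration, it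
  suffices to treat the fibration \<open>p\<close>. Lifting the homotopy from
  \<open>f \<cdot> g\<close> to the identity turns \<open>i \<cdot> g\<close> into a strict section
  \<open>g'\<close> of \<open>p\<close>. Then \<open>g' \<cdot> p\<close> is homotopic to the
  identity, hence a weak equivalence, and \<open>p\<close> is a retract of it.\<close>

lemma whitehead:
  assumes f: "f \<in> hom C X Y" and g: "g \<in> hom C Y X"
    and gf: "homotopic C M (g \<cdot> f) (Ident C X)" and fg: "homotopic C M (f \<cdot> g) (Ident C Y)"
    and X: "is_cofibrant C M X" "is_fibrant C M X" and Y: "is_cofibrant C M Y" "is_fibrant C M Y"
  shows "f \<in> Weq M"
proof -
  obtain Z i p where i: "i \<in> hom C X Z" "i \<in> Cof M" "i \<in> Weq M" and p: "p \<in> hom C Z Y" "p \<in> Fib M" and fpi: "f = p \<cdot> i"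
    using factor_tcof[OF f] by metis
  have Z: "is_cofibrant C M Z" "is_fibrant C M Z"
    using Cof_cofibrant[OF i(2,1) X(1)] Fib_fibrant[OF p(2,1) Y(2)] by auto
  have [simp]: "X \<in> Obj C" "Y \<in> Obj C" "Z \<in> Obj C" using fibrant_Obj X Y Z by auto
  note [simp] = homD[OF f] homD[OF g] homD[OF i(1)] homD[OF p(1)]
  obtain r where r: "r \<in> hom C Z X" "r \<cdot> i = Ident C X"
    and def: "\<And>W h. \<lbrakk>is_cofibrant C M W; h \<in> hom C W Z\<rbrakk> \<Longrightarrow> homotopic C M (i \<cdot> (r \<cdot> h)) h"
    using tcof_deformation[OF i(2,3,1) X(2) Z(2)] by metis
  note [simp] = homD[OF r(1)]
  let ?g = "i \<cdot> g"
  obtain V i0 i1 s where c: "cylinder_on C M Y V i0 i1 s" using ex_cylinder by force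
  note cD = cylinder_onD[OF c]
  note [simp] = homD[OF cD(1)] homD[OF cD(2)] homD[OF cD(3)]
  have fgh: "f \<cdot> g \<in> hom C Y Y" by (simp add: hom_iff)
  from homotopicE_left[OF Y fg fgh c] obtain H where H: "H \<in> hom C V Y" "H \<cdot> i0 = f \<cdot> g" "H \<cdot> i1 = Ident C Y" by blast
  obtain H' where H': "H' \<in> hom C V Z" "H' \<cdot> i0 = ?g" "p \<cdot> H' = H"
    by (rule lift_cof[OF cylinder_TCof(1)[OF c Y(1)] p(2) _ cD(1) p(1) _ H(1), of ?g])
      (simp_all add: cylinder_TCof(2)[OF c Y(1)] hom_iff H fpi)
  note [simp] = homD[OF H'(1)]
  define g' where "g' = H' \<cdot> i1"
  have g' [simp]: "g' \<in> Mor C" "Dom C g' = Y" "Cod C g' = Z" by (simp_all add: g'_def)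
  have pg': "p \<cdot> g' = Ident C Y" using H H' by (simp add: g'_def reassoc[OF H'(3)])
  have gg': "homotopic C M ?g g'" using homotopicI_left[OF c H'(1,2)] by (simp add: g'_def)
  have h1: "homotopic C M (?g \<cdot> p) (g' \<cdot> p)"
    by (rule homotopic_pre[OF gg' _ p(1) Y(1) Z]) (simp add: hom_iff)
  have "homotopic C M ((g \<cdot> f) \<cdot> r) (Ident C X \<cdot> r)"
    by (rule homotopic_pre[OF gf _ r(1) X(1) Z(1) X(2)]) (simp add: hom_iff)
  then have a: "homotopic C M (i \<cdot> (g \<cdot> (f \<cdot> r))) (i \<cdot> r)"
    using homotopic_post[of "g \<cdot> (f \<cdot> r)" r Z X i Z] i(1) by (simp add: hom_iff)
  \<comment> \<open>Here \<open>f \<cdot> r\<close> is \<open>p \<cdot> i \<cdot> r\<close>, and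
    \<open>i \<cdot> r\<close> is homotopic to the identity of \<open>Z\<close>.\<close>
  have b: "homotopic C M (i \<cdot> (g \<cdot> (f \<cdot> r))) (i \<cdot> (g \<cdot> p))"
  proof -
    have "homotopic C M (i \<cdot> (r \<cdot> Ident C Z)) (Ident C Z)" by (rule def[OF Z(1)]) (simp add: hom_iff)
    then show ?thesis
      using homotopic_post[of "i \<cdot> r" "Ident C Z" Z Z "i \<cdot> (g \<cdot> p)" Z] by (simp add: hom_iff fpi)
  qed
  have d: "homotopic C M (i \<cdot> r) (Ident C Z)"
    using def[OF Z(1), of "Ident C Z"] by (simp add: hom_iff)
  have m: "i \<cdot> (g \<cdot> (f \<cdot> r)) \<in> hom C Z Z" "i \<cdot> (g \<cdot> p) \<in> hom C Z Z" by (simp_all add: hom_iff)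
  have "homotopic C M (i \<cdot> (g \<cdot> p)) (Ident C Z)"
    by (rule homotopic_trans[OF Z homotopic_trans[OF Z homotopic_sym[OF Z b m(1)] a m(2)] d m(2)])
  from homotopic_sym[OF Z this m(2)] have "homotopic C M (Ident C Z) (g' \<cdot> p)"
    by (rule homotopic_trans[OF Z]) (use h1 in \<open>simp_all add: hom_iff\<close>)
  then have w: "g' \<cdot> p \<in> Weq M"
    using homotopic_Weq[OF _ W_Ident[of Z] _ Z(1)] by (simp add: hom_iff)
  have "is_retract C p (g' \<cdot> p)"
    unfolding is_retract_def
  proof (intro bexI)
    show "Sq p (g' \<cdot> p) (Ident C Z) g' \<in> hom (Arr C) p (g' \<cdot> p)"
      "Sq (g' \<cdot> p) p (Ident C Z) p \<in> hom (Arr C) (g' \<cdot> p) p"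
      by (simp_all add: Arr_hom reassoc[OF pg'])
  qed (simp add: pg')
  then have "p \<in> Weq M"
    using Weq_retracts w homD(1)[OF p(1)] unfolding closed_under_retracts_def by meson
  then show ?thesis using W_comp[OF i(3), of p] fpi by simp
qed

end

section \<open>The projective model structure\<close>

lemma (in category) pushout_unique:
  assumes "is_pushout C f g i j" "i \<in> hom C B P" "h \<in> hom C P Z" "k \<in> hom C P Z"
    "h \<cdot> i = k \<cdot> i" "h \<cdot> j = k \<cdot> j"
  shows "h = k"
proof -
  obtain A D where f: "f \<in> hom C A B" and g: "g \<in> hom C A D" and j: "j \<in> hom C D P" and e: "i \<cdot> f = j \<cdot> g"
    using assms(1,2) unfolding is_pushout_def by (auto simp: hom_iff)
  note [simp] = homD[OF f] homD[OF g] homD[OF j] homD[OF assms(2)] homD[OF assms(3)] homD[OF assms(4)]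
  have "\<exists>!x. x \<in> hom C P Z \<and> x \<cdot> i = k \<cdot> i \<and> x \<cdot> j = k \<cdot> j"
    by (rule pushoutE(3)[OF assms(1) f g assms(2)]) (simp_all add: hom_iff e)
  with assms(3-6) show ?thesis by blast
qed

text \<open>The common setting of both factorizations of a model category: left factors lift against
  right factors. The factorization functors of \<open>Arr C\<close> are built once here and then
  used for each of the two.\<close>

locale factorization = category C for C :: "('o, 'm) cat" (structure) +
  fixes L R :: "'m set" and \<alpha> \<beta> :: "('m, 'm square, 'm, 'm square) cfunctor"
  assumes fac: "factors_into C L R \<alpha> \<beta>"
    and L_Mor: "L \<subseteq> Mor C" and R_Mor: "R \<subseteq> Mor C"
    and LR: "\<lbrakk>l \<in> L; r \<in> R\<rbrakk> \<Longrightarrow> has_lifting C l r"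
    and pushouts: "\<lbrakk>f \<in> hom C A B; g \<in> hom C A D\<rbrakk> \<Longrightarrow> \<exists>i j. is_pushout C f g i j"
begin

lemma a_obj [simp]: "f \<in> Mor C \<Longrightarrow> onobj \<alpha> f \<in> Mor C" "f \<in> Mor C \<Longrightarrow> Dom C (onobj \<alpha> f) = Dom C f"
    "f \<in> Mor C \<Longrightarrow> Dom C (onobj \<beta> f) = Cod C (onobj \<alpha> f)"
  and b_obj [simp]: "f \<in> Mor C \<Longrightarrow> onobj \<beta> f \<in> Mor C" "f \<in> Mor C \<Longrightarrow> Cod C (onobj \<beta> f) = Cod C f"
  and ba: "f \<in> Mor C \<Longrightarrow> onobj \<beta> f \<cdot> onobj \<alpha> f = f"
  and a_L: "f \<in> Mor C \<Longrightarrow> onobj \<alpha> f \<in> L" and b_R: "f \<in> Mor C \<Longrightarrow> onobj \<beta> f \<in> R"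
  using fac L_Mor R_Mor unfolding factors_into_def functorial_factorization_def by auto

lemma a_functor: "is_functor (Arr C) (Arr C) \<alpha>" and b_functor: "is_functor (Arr C) (Arr C) \<beta>"
  using fac unfolding factors_into_def functorial_factorization_def by auto

text \<open>The map that functoriality induces between the middle objects of two factored
  arrows.\<close>

definition fm :: "'m square \<Rightarrow> 'm" where "fm t = ev1 (onmor \<alpha> t)"

lemma fm:
  assumes "t \<in> Mor (Arr C)"
  shows "fm t \<in> Mor C" "Dom C (fm t) = Cod C (onobj \<alpha> (src t))" "Cod C (fm t) = Cod C (onobj \<alpha> (tgt t))"
    "onobj \<alpha> (tgt t) \<cdot> ev0 t = fm t \<cdot> onobj \<alpha> (src t)"
    "onobj \<beta> (tgt t) \<cdot> fm t = ev1 t \<cdot> onobj \<beta> (src t)"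
proof -
  have e: "ev0 (onmor \<alpha> t) = ev0 t" "ev1 (onmor \<alpha> t) = ev0 (onmor \<beta> t)" "ev1 (onmor \<beta> t) = ev1 t"
    using fac assms unfolding factors_into_def functorial_factorization_def by auto
  have "onmor \<alpha> t \<in> Mor (Arr C)" "src (onmor \<alpha> t) = onobj \<alpha> (src t)" "tgt (onmor \<alpha> t) = onobj \<alpha> (tgt t)"
    "onmor \<beta> t \<in> Mor (Arr C)" "src (onmor \<beta> t) = onobj \<beta> (src t)" "tgt (onmor \<beta> t) = onobj \<beta> (tgt t)"
    using functorD(2-4)[OF a_functor assms] functorD(2-4)[OF b_functor assms] by auto
  then show "fm t \<in> Mor C" "Dom C (fm t) = Cod C (onobj \<alpha> (src t))" "Cod C (fm t) = Cod C (onobj \<alpha> (tgt t))"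
    "onobj \<alpha> (tgt t) \<cdot> ev0 t = fm t \<cdot> onobj \<alpha> (src t)"
    "onobj \<beta> (tgt t) \<cdot> fm t = ev1 t \<cdot> onobj \<beta> (src t)"
    using e by (auto simp: Arr_Mor fm_def)
qed

lemma fm_Ident: "f \<in> Mor C \<Longrightarrow> fm (Ident (Arr C) f) = Ident C (Cod C (onobj \<alpha> f))"
  using functorD(5)[OF a_functor, of f] by (simp add: fm_def)

lemma fm_Comp:
  "\<lbrakk>s \<in> Mor (Arr C); t \<in> Mor (Arr C); tgt s = src t\<rbrakk> \<Longrightarrow> fm (t \<cdot>\<^bsub>Arr C\<^esub> s) = fm t \<cdot> fm s"
  using functorD(6)[OF a_functor, of s t] by (simp add: fm_def)

text \<open>
  A square \<open>s\<close> is factored on \<open>Ev\<^sub>0\<close> first; \<open>co s\<close> is the corner map out of the pushout of \<open>src s\<close>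
  along the left factor, and factoring it yields the factorization on \<open>Ev\<^sub>1\<close>.
\<close>

definition mo :: "'m square \<Rightarrow> 'o" where "mo s = Cod C (onobj \<alpha> (ev0 s))"

definition po :: "'m square \<Rightarrow> 'm \<times> 'm" where
  "po s = (SOME (i, j). is_pushout C (src s) (onobj \<alpha> (ev0 s)) i j)"

definition pv :: "'m square \<Rightarrow> 'o" where "pv s = Cod C (fst (po s))"

lemma po:
  assumes s: "s \<in> Mor (Arr C)"
  shows "is_pushout C (src s) (onobj \<alpha> (ev0 s)) (fst (po s)) (snd (po s))"
    and "fst (po s) \<in> hom C (Cod C (src s)) (pv s)" "snd (po s) \<in> hom C (mo s) (pv s)"
    and "fst (po s) \<cdot> src s = snd (po s) \<cdot> onobj \<alpha> (ev0 s)"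
proof -
  have f: "src s \<in> hom C (Dom C (src s)) (Cod C (src s))" "onobj \<alpha> (ev0 s) \<in> hom C (Dom C (src s)) (mo s)"
    using s by (auto simp: Arr_Mor hom_iff mo_def)
  from pushouts[OF f] obtain i j where "is_pushout C (src s) (onobj \<alpha> (ev0 s)) i j" by blast
  then have "case (i, j) of (i, j) \<Rightarrow> is_pushout C (src s) (onobj \<alpha> (ev0 s)) i j" by simp
  then have "case po s of (i, j) \<Rightarrow> is_pushout C (src s) (onobj \<alpha> (ev0 s)) i j"
    unfolding po_def by (rule someI)
  then show p: "is_pushout C (src s) (onobj \<alpha> (ev0 s)) (fst (po s)) (snd (po s))" by (simp add: case_prod_beta)
  then show i: "fst (po s) \<in> hom C (Cod C (src s)) (pv s)"
    by (auto simp: is_pushout_def hom_iff pv_def)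
  show "snd (po s) \<in> hom C (mo s) (pv s)" "fst (po s) \<cdot> src s = snd (po s) \<cdot> onobj \<alpha> (ev0 s)"
    using pushoutE(1,2)[OF p f i] by auto
qed

lemma po_ind:
  assumes s: "s \<in> Mor (Arr C)" and u: "u \<in> hom C (Cod C (src s)) Z" and v: "v \<in> hom C (mo s) Z"
    and e: "u \<cdot> src s = v \<cdot> onobj \<alpha> (ev0 s)"
  shows "\<exists>!h. h \<in> hom C (pv s) Z \<and> h \<cdot> fst (po s) = u \<and> h \<cdot> snd (po s) = v"
  by (rule pushoutE(3)[OF po(1)[OF s] _ _ po(2)[OF s] u v e, of "Dom C (src s)"])
    (use s in \<open>auto simp: Arr_Mor hom_iff mo_def\<close>)

lemma po_unique:
  assumes s: "s \<in> Mor (Arr C)" and "h \<in> hom C (pv s) Z" "k \<in> hom C (pv s) Z"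
    "h \<cdot> fst (po s) = k \<cdot> fst (po s)" "h \<cdot> snd (po s) = k \<cdot> snd (po s)"
  shows "h = k"
  by (rule pushout_unique[OF po(1)[OF s] po(2)[OF s] assms(2-)])

definition co :: "'m square \<Rightarrow> 'm" where
  "co s = (THE h. h \<in> hom C (pv s) (Cod C (tgt s)) \<and> h \<cdot> fst (po s) = ev1 s \<and> h \<cdot> snd (po s) = tgt s \<cdot> onobj \<beta> (ev0 s))"

lemma co:
  assumes s: "s \<in> Mor (Arr C)"
  shows "co s \<in> hom C (pv s) (Cod C (tgt s))" "co s \<cdot> fst (po s) = ev1 s" "co s \<cdot> snd (po s) = tgt s \<cdot> onobj \<beta> (ev0 s)"
proof -
  have "\<exists>!h. h \<in> hom C (pv s) (Cod C (tgt s)) \<and> h \<cdot> fst (po s) = ev1 s \<and> h \<cdot> snd (po s) = tgt s \<cdot> onobj \<beta> (ev0 s)"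
    by (rule po_ind[OF s]) (use s ba[of "ev0 s"] in \<open>auto simp: Arr_Mor hom_iff mo_def\<close>)
  from theI'[OF this]
  show "co s \<in> hom C (pv s) (Cod C (tgt s))" "co s \<cdot> fst (po s) = ev1 s" "co s \<cdot> snd (po s) = tgt s \<cdot> onobj \<beta> (ev0 s)"
    by (simp_all add: co_def)
qed

text \<open>The middle arrow of the factored square: from the middle object on
  \<open>Ev\<^sub>0\<close> into the pushout, and on to the middle object of the factored corner
  map.\<close>

definition mid :: "'m square \<Rightarrow> 'm" where "mid s = onobj \<alpha> (co s) \<cdot> snd (po s)"

definition lsq :: "'m square \<Rightarrow> 'm square" where
  "lsq s = Sq (src s) (mid s) (onobj \<alpha> (ev0 s)) (onobj \<alpha> (co s) \<cdot> fst (po s))"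

definition rsq :: "'m square \<Rightarrow> 'm square" where
  "rsq s = Sq (mid s) (tgt s) (onobj \<beta> (ev0 s)) (onobj \<beta> (co s))"

lemma obj_facts:
  assumes s: "s \<in> Mor (Arr C)"
  shows "src s \<in> Mor C" "tgt s \<in> Mor C" "ev0 s \<in> Mor C" "ev1 s \<in> Mor C"
    "Dom C (ev0 s) = Dom C (src s)" "Cod C (ev0 s) = Dom C (tgt s)"
    "Dom C (ev1 s) = Cod C (src s)" "Cod C (ev1 s) = Cod C (tgt s)"
    "Cod C (onobj \<alpha> (ev0 s)) = mo s"
    "fst (po s) \<in> Mor C" "Dom C (fst (po s)) = Cod C (src s)" "Cod C (fst (po s)) = pv s"
    "snd (po s) \<in> Mor C" "Dom C (snd (po s)) = mo s" "Cod C (snd (po s)) = pv s"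
    "co s \<in> Mor C" "Dom C (co s) = pv s" "Cod C (co s) = Cod C (tgt s)"
    "mid s \<in> Mor C" "Dom C (mid s) = mo s" "Cod C (mid s) = Cod C (onobj \<alpha> (co s))"
  using s homD[OF po(2)[OF s]] homD[OF po(3)[OF s]] homD[OF co(1)[OF s]]
  by (auto simp: Arr_Mor mo_def mid_def)

lemma lsq_Mor:
  assumes s: "s \<in> Mor (Arr C)"
  shows "lsq s \<in> Mor (Arr C)"
proof -
  note [simp] = obj_facts[OF s]
  have "mid s \<cdot> onobj \<alpha> (ev0 s) = (onobj \<alpha> (co s) \<cdot> fst (po s)) \<cdot> src s"
    by (simp add: mid_def po(4)[OF s])
  then show ?thesis unfolding lsq_def Arr_Mor by simp
qed

lemma rsq_Mor:
  assumes s: "s \<in> Mor (Arr C)"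
  shows "rsq s \<in> Mor (Arr C)"
proof -
  note [simp] = obj_facts[OF s]
  have "tgt s \<cdot> onobj \<beta> (ev0 s) = onobj \<beta> (co s) \<cdot> mid s"
    by (simp add: mid_def reassoc[OF ba[of "co s"]] co(3)[OF s])
  then show ?thesis unfolding rsq_def Arr_Mor by simp
qed

lemma rl_eq:
  assumes s: "s \<in> Mor (Arr C)"
  shows "s = rsq s \<cdot>\<^bsub>Arr C\<^esub> lsq s"
proof -
  note [simp] = obj_facts[OF s]
  show ?thesis
    by (intro square_eqI) (simp_all add: rsq_def lsq_def co(2)[OF s] ba reassoc[OF ba[of "co s"]])
qed

text \<open>The square \<open>lsq s\<close> is lifted first on \<open>Ev\<^sub>0\<close> and then, along the corner map, on \<open>Ev\<^sub>1\<close>.\<close>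

lemma lsq_lifting:
  assumes s: "s \<in> Mor (Arr C)" and p: "p \<in> levelwise C R"
  shows "has_lifting (Arr C) (lsq s) p"
proof (rule has_liftingI)
  note [simp] = obj_facts[OF s]
  have pA: "p \<in> Mor (Arr C)" and pR: "ev0 p \<in> R" "ev1 p \<in> R" using p by (auto simp: levelwise_def)
  note [simp] = obj_facts(1-8)[OF pA]
  have psq: "tgt p \<cdot> ev0 p = ev1 p \<cdot> src p" using pA by (simp add: Arr_Mor)
  fix u v assume u: "u \<in> hom (Arr C) (Dom (Arr C) (lsq s)) (Dom (Arr C) p)"
    and v: "v \<in> hom (Arr C) (Cod (Arr C) (lsq s)) (Cod (Arr C) p)"
    and e: "p \<cdot>\<^bsub>Arr C\<^esub> u = v \<cdot>\<^bsub>Arr C\<^esub> lsq s"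
  have u': "u \<in> Mor (Arr C)" "src u = src s" "tgt u = src p" "src p \<cdot> ev0 u = ev1 u \<cdot> src s"
    and v': "v \<in> Mor (Arr C)" "src v = mid s" "tgt v = tgt p" "tgt p \<cdot> ev0 v = ev1 v \<cdot> mid s"
    using u v by (auto simp: hom_iff[of _ "Arr C"] Arr_Mor lsq_def)
  note [simp] = obj_facts(3-8)[OF u'(1), unfolded u'(2,3)] obj_facts(3-8)[OF v'(1), unfolded v'(2,3), simplified]
  have e0: "ev0 p \<cdot> ev0 u = ev0 v \<cdot> onobj \<alpha> (ev0 s)" and e1: "ev1 p \<cdot> ev1 u = ev1 v \<cdot> (onobj \<alpha> (co s) \<cdot> fst (po s))"
    using e by (simp_all add: lsq_def)
  obtain h0 where h0: "h0 \<in> hom C (mo s) (Dom C (src p))" "h0 \<cdot> onobj \<alpha> (ev0 s) = ev0 u" "ev0 p \<cdot> h0 = ev0 v"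
    by (rule has_liftingE[OF LR[OF a_L pR(1)], of "ev0 s" "Dom C (src s)" "mo s" "Dom C (src p)" "Dom C (tgt p)" "ev0 u" "ev0 v"])
      (simp_all add: hom_iff e0)
  note [simp] = homD[OF h0(1)]
  have "\<exists>!h. h \<in> hom C (pv s) (Cod C (src p)) \<and> h \<cdot> fst (po s) = ev1 u \<and> h \<cdot> snd (po s) = src p \<cdot> h0"
    by (rule po_ind[OF s]) (simp_all add: hom_iff h0 u')
  then obtain k where k: "k \<in> hom C (pv s) (Cod C (src p))" "k \<cdot> fst (po s) = ev1 u" "k \<cdot> snd (po s) = src p \<cdot> h0"
    by blast
  note [simp] = homD[OF k(1)]
  \<comment> \<open>Both sides are maps out of the pushout. On \<open>fst (po s)\<close> they agree
    by \<open>e1\<close>, on \<open>snd (po s)\<close> by the choice of \<open>h0\<close>.\<close>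
  have ek: "ev1 p \<cdot> k = ev1 v \<cdot> onobj \<alpha> (co s)"
  proof (rule po_unique[OF s, of _ "Cod C (tgt p)"])
    show "(ev1 p \<cdot> k) \<cdot> fst (po s) = (ev1 v \<cdot> onobj \<alpha> (co s)) \<cdot> fst (po s)" by (simp add: k e1)
    have "(ev1 p \<cdot> k) \<cdot> snd (po s) = ev1 p \<cdot> (src p \<cdot> h0)" by (simp add: k)
    also have "\<dots> = tgt p \<cdot> (ev0 p \<cdot> h0)" by (simp add: reassoc2[OF psq])
    also have "\<dots> = ev1 v \<cdot> mid s" by (simp add: h0 v')
    finally show "(ev1 p \<cdot> k) \<cdot> snd (po s) = (ev1 v \<cdot> onobj \<alpha> (co s)) \<cdot> snd (po s)" by (simp add: mid_def)
  qed (simp_all add: hom_iff)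
  obtain h1 where h1: "h1 \<in> hom C (Cod C (onobj \<alpha> (co s))) (Cod C (src p))" "h1 \<cdot> onobj \<alpha> (co s) = k" "ev1 p \<cdot> h1 = ev1 v"
    by (rule has_liftingE[OF LR[OF a_L pR(2)], of "co s" "pv s" "Cod C (onobj \<alpha> (co s))" "Cod C (src p)" "Cod C (tgt p)" k "ev1 v"])
      (simp_all add: hom_iff ek)
  note [simp] = homD[OF h1(1)]
  have c: "src p \<cdot> h0 = h1 \<cdot> mid s" by (simp add: mid_def reassoc[OF h1(2)] k)
  show "\<exists>h\<in>hom (Arr C) (Cod (Arr C) (lsq s)) (Dom (Arr C) p). h \<cdot>\<^bsub>Arr C\<^esub> lsq s = u \<and> p \<cdot>\<^bsub>Arr C\<^esub> h = v"
  proof (rule bexI[of _ "Sq (mid s) (src p) h0 h1"])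
    show "Sq (mid s) (src p) h0 h1 \<in> hom (Arr C) (Cod (Arr C) (lsq s)) (Dom (Arr C) p)"
      by (simp add: Arr_hom lsq_def c)
    show "Sq (mid s) (src p) h0 h1 \<cdot>\<^bsub>Arr C\<^esub> lsq s = u \<and> p \<cdot>\<^bsub>Arr C\<^esub> Sq (mid s) (src p) h0 h1 = v"
      by (auto intro!: square_eqI simp: lsq_def h0 h1 u' v' reassoc[OF h1(2)] k)
  qed
qed

text \<open>A morphism \<open>S\<close> between squares is a cube. Its face on
  \<open>Ev\<^sub>0\<close> is \<open>sq0 S\<close>; the pushouts of the two ends are joined by
  \<open>wm S\<close>, and \<open>sq1 S\<close> is the resulting square between the corner maps.
  Factoring both squares gives the map \<open>msq S\<close> of middle arrows.\<close>

definition sq0 :: "'m square square \<Rightarrow> 'm square" where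
  "sq0 S = Sq (ev0 (src S)) (ev0 (tgt S)) (ev0 (ev0 S)) (ev0 (ev1 S))"

definition wm :: "'m square square \<Rightarrow> 'm" where
  "wm S = (THE w. w \<in> hom C (pv (src S)) (pv (tgt S)) \<and> w \<cdot> fst (po (src S)) = fst (po (tgt S)) \<cdot> ev1 (ev0 S) \<and>
     w \<cdot> snd (po (src S)) = snd (po (tgt S)) \<cdot> fm (sq0 S))"

definition sq1 :: "'m square square \<Rightarrow> 'm square" where
  "sq1 S = Sq (co (src S)) (co (tgt S)) (wm S) (ev1 (ev1 S))"

definition msq :: "'m square square \<Rightarrow> 'm square" where
  "msq S = Sq (mid (src S)) (mid (tgt S)) (fm (sq0 S)) (fm (sq1 S))"

definition lfun :: "('m square, 'm square square, 'm square, 'm square square) cfunctor" where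
  "lfun = \<lparr>onobj = lsq, onmor = (\<lambda>S. Sq (lsq (src S)) (lsq (tgt S)) (ev0 S) (msq S))\<rparr>"

definition rfun :: "('m square, 'm square square, 'm square, 'm square square) cfunctor" where
  "rfun = \<lparr>onobj = rsq, onmor = (\<lambda>S. Sq (rsq (src S)) (rsq (tgt S)) (msq S) (ev1 S))\<rparr>"

lemma mor_facts:
  assumes S: "S \<in> Mor (Arr (Arr C))"
  shows "src S \<in> Mor (Arr C)" "tgt S \<in> Mor (Arr C)" "ev0 S \<in> Mor (Arr C)" "ev1 S \<in> Mor (Arr C)"
    "src (ev0 S) = src (src S)" "tgt (ev0 S) = src (tgt S)" "src (ev1 S) = tgt (src S)" "tgt (ev1 S) = tgt (tgt S)"
    "ev0 (tgt S) \<cdot> ev0 (ev0 S) = ev0 (ev1 S) \<cdot> ev0 (src S)"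
    "ev1 (tgt S) \<cdot> ev1 (ev0 S) = ev1 (ev1 S) \<cdot> ev1 (src S)"
    "src (tgt S) \<cdot> ev0 (ev0 S) = ev1 (ev0 S) \<cdot> src (src S)"
    "tgt (tgt S) \<cdot> ev0 (ev1 S) = ev1 (ev1 S) \<cdot> tgt (src S)"
proof -
  have S': "src S \<in> Mor (Arr C) \<and> tgt S \<in> Mor (Arr C) \<and> ev0 S \<in> Mor (Arr C) \<and> src (ev0 S) = src (src S) \<and>
      tgt (ev0 S) = src (tgt S) \<and> ev1 S \<in> Mor (Arr C) \<and> src (ev1 S) = tgt (src S) \<and> tgt (ev1 S) = tgt (tgt S) \<and>
      tgt S \<cdot>\<^bsub>Arr C\<^esub> ev0 S = ev1 S \<cdot>\<^bsub>Arr C\<^esub> src S"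
    by (rule S[unfolded Arr_Mor[of S "Arr C"] Arr_simps(1-3)])
  then show m: "src S \<in> Mor (Arr C)" "tgt S \<in> Mor (Arr C)" "ev0 S \<in> Mor (Arr C)" "ev1 S \<in> Mor (Arr C)"
    "src (ev0 S) = src (src S)" "tgt (ev0 S) = src (tgt S)" "src (ev1 S) = tgt (src S)" "tgt (ev1 S) = tgt (tgt S)"
    by blast+
  have "tgt S \<cdot>\<^bsub>Arr C\<^esub> ev0 S = ev1 S \<cdot>\<^bsub>Arr C\<^esub> src S" using S' by blast
  then show "ev0 (tgt S) \<cdot> ev0 (ev0 S) = ev0 (ev1 S) \<cdot> ev0 (src S)"
    "ev1 (tgt S) \<cdot> ev1 (ev0 S) = ev1 (ev1 S) \<cdot> ev1 (src S)"
    unfolding Arr_simps square.inject by blast+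
  show "src (tgt S) \<cdot> ev0 (ev0 S) = ev1 (ev0 S) \<cdot> src (src S)"
    "tgt (tgt S) \<cdot> ev0 (ev1 S) = ev1 (ev1 S) \<cdot> tgt (src S)"
    using m(3,4) unfolding Arr_Mor m(5-8) by simp_all
qed

lemma sq0:
  assumes S: "S \<in> Mor (Arr (Arr C))"
  shows "sq0 S \<in> Mor (Arr C)"
proof -
  note m = mor_facts[OF S]
  note [simp] = m(1-8) obj_facts[OF m(1)] obj_facts[OF m(2)] obj_facts(3-8)[OF m(3), unfolded m(5,6)] obj_facts(3-8)[OF m(4), unfolded m(7,8)]
  show ?thesis unfolding sq0_def Arr_Mor by (simp add: m(9))
qed

lemma wm:
  assumes S: "S \<in> Mor (Arr (Arr C))"
  shows "wm S \<in> hom C (pv (src S)) (pv (tgt S))"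
    "wm S \<cdot> fst (po (src S)) = fst (po (tgt S)) \<cdot> ev1 (ev0 S)"
    "wm S \<cdot> snd (po (src S)) = snd (po (tgt S)) \<cdot> fm (sq0 S)"
proof -
  note m = mor_facts[OF S]
  note [simp] = m(1-8) obj_facts[OF m(1)] obj_facts[OF m(2)] obj_facts(3-8)[OF m(3), unfolded m(5,6)] obj_facts(3-8)[OF m(4), unfolded m(7,8)]
  have f: "fm (sq0 S) \<in> Mor C" "Dom C (fm (sq0 S)) = mo (src S)" "Cod C (fm (sq0 S)) = mo (tgt S)"
    "onobj \<alpha> (ev0 (tgt S)) \<cdot> ev0 (ev0 S) = fm (sq0 S) \<cdot> onobj \<alpha> (ev0 (src S))"
    using fm[OF sq0[OF S]] by (simp_all add: sq0_def)
  note [simp] = f(1-3)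
  have "\<exists>!w. w \<in> hom C (pv (src S)) (pv (tgt S)) \<and> w \<cdot> fst (po (src S)) = fst (po (tgt S)) \<cdot> ev1 (ev0 S) \<and>
     w \<cdot> snd (po (src S)) = snd (po (tgt S)) \<cdot> fm (sq0 S)"
    by (rule po_ind[OF m(1)])
      (simp_all add: hom_iff m(11)[symmetric] f(4)[symmetric] reassoc2[OF po(4)[OF m(2)]])
  from theI'[OF this] show "wm S \<in> hom C (pv (src S)) (pv (tgt S))"
    "wm S \<cdot> fst (po (src S)) = fst (po (tgt S)) \<cdot> ev1 (ev0 S)"
    "wm S \<cdot> snd (po (src S)) = snd (po (tgt S)) \<cdot> fm (sq0 S)"
    by (simp_all add: wm_def)
qed

lemma sq1:
  assumes S: "S \<in> Mor (Arr (Arr C))"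
  shows "sq1 S \<in> Mor (Arr C)"
proof -
  note m = mor_facts[OF S]
  note [simp] = m(1-8) obj_facts[OF m(1)] obj_facts[OF m(2)] obj_facts(3-8)[OF m(3), unfolded m(5,6)]
    obj_facts(3-8)[OF m(4), unfolded m(7,8)] homD[OF wm(1)[OF S]]
  have f: "fm (sq0 S) \<in> Mor C" "Dom C (fm (sq0 S)) = mo (src S)" "Cod C (fm (sq0 S)) = mo (tgt S)"
    "onobj \<beta> (ev0 (tgt S)) \<cdot> fm (sq0 S) = ev0 (ev1 S) \<cdot> onobj \<beta> (ev0 (src S))"
    using fm[OF sq0[OF S]] by (simp_all add: sq0_def)
  note [simp] = f(1-3)
  have "co (tgt S) \<cdot> wm S = ev1 (ev1 S) \<cdot> co (src S)"
    by (rule po_unique[OF m(1), of _ "Cod C (tgt (tgt S))"])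
      (simp_all add: hom_iff wm(2,3)[OF S] reassoc[OF co(2)[OF m(2)]] reassoc2[OF co(3)[OF m(2)]] co(2,3)[OF m(1)] m(10) f(4) reassoc2[OF m(12)])
  then show ?thesis unfolding sq1_def Arr_Mor by simp
qed

lemma msq:
  assumes S: "S \<in> Mor (Arr (Arr C))"
  shows "msq S \<in> Mor (Arr C)" "lsq (tgt S) \<cdot>\<^bsub>Arr C\<^esub> ev0 S = msq S \<cdot>\<^bsub>Arr C\<^esub> lsq (src S)"
    "rsq (tgt S) \<cdot>\<^bsub>Arr C\<^esub> msq S = ev1 S \<cdot>\<^bsub>Arr C\<^esub> rsq (src S)"
proof -
  note m = mor_facts[OF S]
  note [simp] = m(1-8) obj_facts[OF m(1)] obj_facts[OF m(2)] obj_facts(3-8)[OF m(3), unfolded m(5,6)]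
    obj_facts(3-8)[OF m(4), unfolded m(7,8)] homD[OF wm(1)[OF S]]
  have f: "fm (sq0 S) \<in> Mor C" "Dom C (fm (sq0 S)) = mo (src S)" "Cod C (fm (sq0 S)) = mo (tgt S)"
    "onobj \<alpha> (ev0 (tgt S)) \<cdot> ev0 (ev0 S) = fm (sq0 S) \<cdot> onobj \<alpha> (ev0 (src S))"
    "onobj \<beta> (ev0 (tgt S)) \<cdot> fm (sq0 S) = ev0 (ev1 S) \<cdot> onobj \<beta> (ev0 (src S))"
    using fm[OF sq0[OF S]] by (simp_all add: sq0_def)
  have g: "fm (sq1 S) \<in> Mor C" "Dom C (fm (sq1 S)) = Cod C (onobj \<alpha> (co (src S)))" "Cod C (fm (sq1 S)) = Cod C (onobj \<alpha> (co (tgt S)))"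
    "onobj \<alpha> (co (tgt S)) \<cdot> wm S = fm (sq1 S) \<cdot> onobj \<alpha> (co (src S))"
    "onobj \<beta> (co (tgt S)) \<cdot> fm (sq1 S) = ev1 (ev1 S) \<cdot> onobj \<beta> (co (src S))"
    using fm[OF sq1[OF S]] by (simp_all add: sq1_def)
  note [simp] = f(1-3) g(1-3)
  have "mid (tgt S) \<cdot> fm (sq0 S) = onobj \<alpha> (co (tgt S)) \<cdot> (wm S \<cdot> snd (po (src S)))"
    by (simp add: mid_def wm(3)[OF S])
  also have "\<dots> = fm (sq1 S) \<cdot> mid (src S)"
    by (simp add: reassoc2[OF g(4)] mid_def)
  finally show "msq S \<in> Mor (Arr C)" unfolding msq_def Arr_Mor by simp
  have "onobj \<alpha> (co (tgt S)) \<cdot> (fst (po (tgt S)) \<cdot> ev1 (ev0 S)) = fm (sq1 S) \<cdot> (onobj \<alpha> (co (src S)) \<cdot> fst (po (src S)))"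
    by (simp add: wm(2)[OF S, symmetric] reassoc2[OF g(4)])
  then show "lsq (tgt S) \<cdot>\<^bsub>Arr C\<^esub> ev0 S = msq S \<cdot>\<^bsub>Arr C\<^esub> lsq (src S)"
    by (auto intro!: square_eqI simp: lsq_def msq_def f(4))
  show "rsq (tgt S) \<cdot>\<^bsub>Arr C\<^esub> msq S = ev1 S \<cdot>\<^bsub>Arr C\<^esub> rsq (src S)"
    by (auto intro!: square_eqI simp: rsq_def msq_def f(5) g(5))
qed

lemma sq_ends [simp]:
  "src (lsq s) = src s" "tgt (lsq s) = mid s" "src (rsq s) = mid s" "tgt (rsq s) = tgt s"
  "src (msq S) = mid (src S)" "tgt (msq S) = mid (tgt S)"
  by (simp_all add: lsq_def rsq_def msq_def)

lemma sq0_Ident: "s \<in> Mor (Arr C) \<Longrightarrow> sq0 (Ident (Arr (Arr C)) s) = Ident (Arr C) (ev0 s)"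
  by (simp add: sq0_def obj_facts)

lemma sq1_Ident:
  assumes s: "s \<in> Mor (Arr C)"
  shows "sq1 (Ident (Arr (Arr C)) s) = Ident (Arr C) (co s)"
proof -
  interpret A: category "Arr C" by (rule category_Arr)
  interpret AA: category "Arr (Arr C)" by (rule A.category_Arr)
  let ?S = "Ident (Arr (Arr C)) s"
  have S: "?S \<in> Mor (Arr (Arr C))" using s AA.Ident_Mor[of s] by simp
  note [simp] = obj_facts[OF s]
  have f: "fm (sq0 ?S) = Ident C (mo s)" using sq0_Ident[OF s] fm_Ident[of "ev0 s"] by (simp only: obj_facts[OF s])
  have w: "wm ?S \<in> hom C (pv s) (pv s)" "wm ?S \<cdot> fst (po s) = fst (po s)" "wm ?S \<cdot> snd (po s) = snd (po s)"
    using wm[OF S] f by simp_all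
  have po: "pv s \<in> Obj C" using hom_Obj[OF po(2)[OF s]] by simp
  have "wm ?S = Ident C (pv s)"
    by (rule po_unique[OF s w(1)]) (use w po in \<open>simp_all add: hom_iff\<close>)
  then show ?thesis by (simp add: sq1_def)
qed

lemma sq0_Comp: "\<lbrakk>S \<in> Mor (Arr (Arr C)); T \<in> Mor (Arr (Arr C)); tgt S = src T\<rbrakk>
    \<Longrightarrow> sq0 (T \<cdot>\<^bsub>Arr (Arr C)\<^esub> S) = sq0 T \<cdot>\<^bsub>Arr C\<^esub> sq0 S"
  by (simp add: sq0_def)

lemma fm0_Comp: "\<lbrakk>S \<in> Mor (Arr (Arr C)); T \<in> Mor (Arr (Arr C)); tgt S = src T\<rbrakk>
    \<Longrightarrow> fm (sq0 (T \<cdot>\<^bsub>Arr (Arr C)\<^esub> S)) = fm (sq0 T) \<cdot> fm (sq0 S)"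
  unfolding sq0_Comp by (rule fm_Comp[OF sq0 sq0]) (simp_all add: sq0_def)

lemma sq1_Comp:
  assumes S: "S \<in> Mor (Arr (Arr C))" and T: "T \<in> Mor (Arr (Arr C))" and c: "tgt S = src T"
  shows "sq1 (T \<cdot>\<^bsub>Arr (Arr C)\<^esub> S) = sq1 T \<cdot>\<^bsub>Arr C\<^esub> sq1 S"
proof -
  interpret A: category "Arr C" by (rule category_Arr)
  interpret AA: category "Arr (Arr C)" by (rule A.category_Arr)
  define W where "W = T \<cdot>\<^bsub>Arr (Arr C)\<^esub> S"
  have TS: "W \<in> Mor (Arr (Arr C))" unfolding W_def by (rule AA.Comp_Mor[OF S T]) (simp add: c)
  have W: "src W = src S" "tgt W = tgt T" "ev1 (ev0 W) = ev1 (ev0 T) \<cdot> ev1 (ev0 S)" "ev1 (ev1 W) = ev1 (ev1 T) \<cdot> ev1 (ev1 S)"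
    "fm (sq0 W) = fm (sq0 T) \<cdot> fm (sq0 S)"
    unfolding fm0_Comp[OF S T c, folded W_def] by (simp_all add: W_def)
  note m = mor_facts[OF S] and n = mor_facts[OF T] 
  note [simp] = m(1-8) n(1-8) obj_facts[OF m(1)] obj_facts[OF n(1)] obj_facts[OF n(2)]
    obj_facts(3-8)[OF m(3), unfolded m(5,6)] obj_facts(3-8)[OF m(4), unfolded m(7,8)] c
    obj_facts(3-8)[OF n(3), unfolded n(5,6)] obj_facts(3-8)[OF n(4), unfolded n(7,8)]
    homD[OF wm(1)[OF S], unfolded c] homD[OF wm(1)[OF T]]
  note [simp] = fm(1-3)[OF sq0[OF S], unfolded sq0_def[of S] square.sel, folded sq0_def[of S]]
     fm(1-3)[OF sq0[OF T], unfolded sq0_def[of T] square.sel, folded sq0_def[of T]]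
  note w = wm[OF TS, unfolded W]
  have "wm W = wm T \<cdot> wm S"
    by (rule po_unique[OF m(1) w(1)])
      (simp_all add: hom_iff w(2,3) wm(2,3)[OF S, unfolded c] reassoc2[OF wm(2)[OF T]] reassoc2[OF wm(3)[OF T]])
  then show ?thesis unfolding W_def[symmetric] by (simp add: sq1_def W)
qed

lemma fm1_Comp: "\<lbrakk>S \<in> Mor (Arr (Arr C)); T \<in> Mor (Arr (Arr C)); tgt S = src T\<rbrakk>
    \<Longrightarrow> fm (sq1 (T \<cdot>\<^bsub>Arr (Arr C)\<^esub> S)) = fm (sq1 T) \<cdot> fm (sq1 S)"
  unfolding sq1_Comp by (rule fm_Comp[OF sq1 sq1]) (simp_all add: sq1_def)

lemma msq_Ident: 
  assumes s: "s \<in> Mor (Arr C)"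
  shows "msq (Ident (Arr (Arr C)) s) = Ident (Arr C) (mid s)"
  using fm_Ident[of "co s"] fm_Ident[of "ev0 s"] sq0_Ident[OF s] sq1_Ident[OF s] obj_facts[OF s]
  by (simp add: msq_def)

lemma msq_Comp: "\<lbrakk>S \<in> Mor (Arr (Arr C)); T \<in> Mor (Arr (Arr C)); tgt S = src T\<rbrakk>
    \<Longrightarrow> msq (T \<cdot>\<^bsub>Arr (Arr C)\<^esub> S) = msq T \<cdot>\<^bsub>Arr C\<^esub> msq S"
  using fm0_Comp[of S T] fm1_Comp[of S T] by (simp add: msq_def)

lemma lr_functor: "is_functor (Arr (Arr C)) (Arr (Arr C)) lfun" "is_functor (Arr (Arr C)) (Arr (Arr C)) rfun"
proof -
  show "is_functor (Arr (Arr C)) (Arr (Arr C)) lfun"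
  proof (rule functorI, goal_cases)
    case (1 s) then show ?case by (simp add: lfun_def lsq_Mor)
  next
    case (2 S) then show ?case
      using mor_facts[OF 2] msq[OF 2] by (simp add: lfun_def Arr_hom lsq_Mor)
  next
    case (3 s) 
    then have s: "s \<in> Mor (Arr C)" by simp
    show ?case
      using msq_Ident[OF s] by (simp add: lfun_def)
  next
    case (4 S T)
    then show ?case using msq_Comp[of S T] by (simp add: lfun_def)
  qed
  show "is_functor (Arr (Arr C)) (Arr (Arr C)) rfun"
  proof (rule functorI, goal_cases)
    case (1 s) then show ?case by (simp add: rfun_def rsq_Mor)
  next
    case (2 S) then show ?case
      using mor_facts[OF 2] msq[OF 2] by (simp add: rfun_def Arr_hom rsq_Mor)
  next
    case (3 s) 
    then have s: "s \<in> Mor (Arr C)" by simp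
    show ?case
      using msq_Ident[OF s] by (simp add: rfun_def)
  next
    case (4 S T)
    then show ?case using msq_Comp[of S T] by (simp add: rfun_def)
  qed
qed

lemma factors_Arr:
  assumes "\<And>s. s \<in> Mor (Arr C) \<Longrightarrow> lsq s \<in> L'" "\<And>s. s \<in> Mor (Arr C) \<Longrightarrow> rsq s \<in> R'"
  shows "factors_into (Arr C) L' R' lfun rfun"
  unfolding factors_into_def functorial_factorization_def
proof (intro conjI ballI)
  fix s assume s: "s \<in> Mor (Arr C)"
  show "Dom (Arr C) (onobj lfun s) = Dom (Arr C) s" "Cod (Arr C) (onobj lfun s) = Dom (Arr C) (onobj rfun s)"
    "Cod (Arr C) (onobj rfun s) = Cod (Arr C) s" "onobj lfun s \<in> L'" "onobj rfun s \<in> R'"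
    using assms s by (simp_all add: lfun_def rfun_def)
  show "s = onobj rfun s \<cdot>\<^bsub>Arr C\<^esub> onobj lfun s"
    using rl_eq[OF s] by (simp only: lfun_def rfun_def cfunctor.simps)
qed (rule lr_functor, rule lr_functor, auto simp: lfun_def rfun_def)

lemma rsq_levelwise: "s \<in> Mor (Arr C) \<Longrightarrow> rsq s \<in> levelwise C R"
  using rsq_Mor b_R[of "ev0 s"] b_R[of "co s"] obj_facts by (simp add: levelwise_def rsq_def)

end

lemma retract_functor:
  assumes C: "category C" and F: "is_functor C D F" and r: "is_retract C f g"
  shows "is_retract D (onmor F f) (onmor F g)"
proof -
  interpret category C by fact
  obtain s r where s: "s \<in> hom (Arr C) f g" and r: "r \<in> hom (Arr C) g f" and rs: "r \<cdot>\<^bsub>Arr C\<^esub> s = Ident (Arr C) f"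
    using r unfolding is_retract_def by blast
  note s' = s[unfolded Arr_hom] and r' = r[unfolded Arr_hom]
  have fg: "f \<in> Mor C" "g \<in> Mor C" using s' by blast+
  have s1: "src s = f" "tgt s = g" "ev0 s \<in> Mor C" "Dom C (ev0 s) = Dom C f" "Cod C (ev0 s) = Dom C g"
    "ev1 s \<in> Mor C" "Dom C (ev1 s) = Cod C f" "Cod C (ev1 s) = Cod C g" "g \<cdot>\<^bsub>C\<^esub> ev0 s = ev1 s \<cdot>\<^bsub>C\<^esub> f" using s' by blast+
  have r1: "src r = g" "tgt r = f" "ev0 r \<in> Mor C" "Dom C (ev0 r) = Dom C g" "Cod C (ev0 r) = Dom C f"
    "ev1 r \<in> Mor C" "Dom C (ev1 r) = Cod C g" "Cod C (ev1 r) = Cod C f" "f \<cdot>\<^bsub>C\<^esub> ev0 r = ev1 r \<cdot>\<^bsub>C\<^esub> g" using r' by blast+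
  have e: "ev0 r \<cdot>\<^bsub>C\<^esub> ev0 s = Ident C (Dom C f)" "ev1 r \<cdot>\<^bsub>C\<^esub> ev1 s = Ident C (Cod C f)"
    using rs by (simp_all add: s1 r1)
  note FF = functorD[OF F]
  have F1: "onmor F g \<cdot>\<^bsub>D\<^esub> onmor F (ev0 s) = onmor F (ev1 s) \<cdot>\<^bsub>D\<^esub> onmor F f"
    "onmor F f \<cdot>\<^bsub>D\<^esub> onmor F (ev0 r) = onmor F (ev1 r) \<cdot>\<^bsub>D\<^esub> onmor F g"
    "onmor F (ev0 r) \<cdot>\<^bsub>D\<^esub> onmor F (ev0 s) = Ident D (onobj F (Dom C f))"
    "onmor F (ev1 r) \<cdot>\<^bsub>D\<^esub> onmor F (ev1 s) = Ident D (onobj F (Cod C f))"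
    using FF(6)[of "ev0 s" g] FF(6)[of f "ev1 s"] FF(6)[of "ev0 r" f] FF(6)[of g "ev1 r"]
      FF(6)[of "ev0 s" "ev0 r"] FF(6)[of "ev1 s" "ev1 r"] FF(5)[of "Dom C f"] FF(5)[of "Cod C f"]
    by (simp_all add: s1 r1 e fg)
  show ?thesis
    unfolding is_retract_def
  proof (intro bexI)
    show "Sq (onmor F f) (onmor F g) (onmor F (ev0 s)) (onmor F (ev1 s)) \<in> hom (Arr D) (onmor F f) (onmor F g)"
      "Sq (onmor F g) (onmor F f) (onmor F (ev0 r)) (onmor F (ev1 r)) \<in> hom (Arr D) (onmor F g) (onmor F f)"
      by (simp_all add: Arr_hom FF F1 s1 r1 fg)
  qed (simp add: F1 FF fg)
qed

section \<open>Classes given by lifting, levelwise classes and flipped squares\<close>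

context category
begin

lemma llp_wide:
  assumes P: "P \<subseteq> Mor C"
  shows "is_wide_subcategory C {i \<in> Mor C. \<forall>p \<in> P. has_lifting C i p}"
  unfolding is_wide_subcategory_def
proof (intro conjI ballI impI)
  show "Ident C X \<in> {i \<in> Mor C. \<forall>p\<in>P. has_lifting C i p}" if X: "X \<in> Obj C" for X
  proof (intro CollectI conjI ballI has_liftingI)
    fix p u v assume p: "p \<in> P" and uv: "u \<in> hom C (Dom C (Ident C X)) (Dom C p)"
      "v \<in> hom C (Cod C (Ident C X)) (Cod C p)" "p \<cdot> u = v \<cdot> Ident C X"
    then show "\<exists>h\<in>hom C (Cod C (Ident C X)) (Dom C p). h \<cdot> Ident C X = u \<and> p \<cdot> h = v"
      using X by (intro bexI[of _ u]) (auto simp: hom_iff)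
  qed (use X in simp)
  fix f g assume "f \<in> {i \<in> Mor C. \<forall>p\<in>P. has_lifting C i p}" "g \<in> {i \<in> Mor C. \<forall>p\<in>P. has_lifting C i p}"
    and c: "Cod C f = Dom C g"
  then have fg: "f \<in> Mor C" "g \<in> Mor C" "\<And>p. p \<in> P \<Longrightarrow> has_lifting C f p" "\<And>p. p \<in> P \<Longrightarrow> has_lifting C g p" by auto
  note [simp] = fg(1,2) c
  show "g \<cdot> f \<in> {i \<in> Mor C. \<forall>p\<in>P. has_lifting C i p}"
  proof (intro CollectI conjI ballI has_liftingI)
    fix p u v assume p: "p \<in> P" and u: "u \<in> hom C (Dom C (g \<cdot> f)) (Dom C p)"
      and v: "v \<in> hom C (Cod C (g \<cdot> f)) (Cod C p)" and e: "p \<cdot> u = v \<cdot> (g \<cdot> f)"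
    have u': "u \<in> hom C (Dom C f) (Dom C p)" and v': "v \<in> hom C (Cod C g) (Cod C p)" using u v by simp_all
    have pM: "p \<in> hom C (Dom C p) (Cod C p)" using P p by (auto simp: hom_iff)
    note [simp] = homD[OF u'] homD[OF v'] homD(1)[OF pM]
    obtain h where h: "h \<in> hom C (Cod C f) (Dom C p)" "h \<cdot> f = u" "p \<cdot> h = v \<cdot> g"
      by (rule has_liftingE[OF fg(3)[OF p] Mor_hom[OF fg(1)] pM u', of "v \<cdot> g"]) (simp_all add: hom_iff e)
    have h': "h \<in> hom C (Dom C g) (Dom C p)" using h(1) by simp
    from has_liftingE[OF fg(4)[OF p] Mor_hom[OF fg(2)] pM h' v' h(3)]
    obtain k where k: "k \<in> hom C (Cod C g) (Dom C p)" "k \<cdot> g = h" "p \<cdot> k = v" by blast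
    note [simp] = homD[OF k(1)]
    show "\<exists>h\<in>hom C (Cod C (g \<cdot> f)) (Dom C p). h \<cdot> (g \<cdot> f) = u \<and> p \<cdot> h = v"
      using k h by (intro bexI[of _ k]) (auto simp: reassoc[OF k(2)])
  qed simp
qed auto

lemma llp_retracts:
  assumes P: "P \<subseteq> Mor C"
  shows "closed_under_retracts C {i \<in> Mor C. \<forall>p \<in> P. has_lifting C i p}"
  unfolding closed_under_retracts_def
proof (intro ballI impI CollectI conjI has_liftingI)
  fix f g p u v assume f [simp]: "f \<in> Mor C" and g: "g \<in> {i \<in> Mor C. \<forall>p\<in>P. has_lifting C i p}" and r: "is_retract C f g"
    and p: "p \<in> P" and u: "u \<in> hom C (Dom C f) (Dom C p)" and v: "v \<in> hom C (Cod C f) (Cod C p)" and e: "p \<cdot> u = v \<cdot> f"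
  have gM [simp]: "g \<in> Mor C" and l: "has_lifting C g p" using g p by auto
  have pM: "p \<in> hom C (Dom C p) (Cod C p)" using P p by (auto simp: hom_iff)
  obtain s r where s: "s \<in> hom (Arr C) f g" and r: "r \<in> hom (Arr C) g f" and rs: "r \<cdot>\<^bsub>Arr C\<^esub> s = Ident (Arr C) f"
    using r unfolding is_retract_def by blast
  note s' = s[unfolded Arr_hom] and r' = r[unfolded Arr_hom]
  have s1: "src s = f" "tgt s = g" "ev0 s \<in> Mor C" "Dom C (ev0 s) = Dom C f" "Cod C (ev0 s) = Dom C g"
    "ev1 s \<in> Mor C" "Dom C (ev1 s) = Cod C f" "Cod C (ev1 s) = Cod C g" "g \<cdot> ev0 s = ev1 s \<cdot> f" using s' by blast+
  have r1: "src r = g" "tgt r = f" "ev0 r \<in> Mor C" "Dom C (ev0 r) = Dom C g" "Cod C (ev0 r) = Dom C f"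
    "ev1 r \<in> Mor C" "Dom C (ev1 r) = Cod C g" "Cod C (ev1 r) = Cod C f" "f \<cdot> ev0 r = ev1 r \<cdot> g" using r' by blast+
  have rse: "ev0 r \<cdot> ev0 s = Ident C (Dom C f)" "ev1 r \<cdot> ev1 s = Ident C (Cod C f)"
    using rs by (simp_all add: s1 r1)
  note [simp] = homD[OF u] homD[OF v] homD(1)[OF pM] s1(1-8) r1(1-8)
  obtain h where h: "h \<in> hom C (Cod C g) (Dom C p)" "h \<cdot> g = u \<cdot> ev0 r" "p \<cdot> h = v \<cdot> ev1 r"
    by (rule has_liftingE[OF l Mor_hom[OF gM] pM, of "u \<cdot> ev0 r" "v \<cdot> ev1 r"])
      (simp_all add: hom_iff reassoc2[OF e] r1(9))
  note [simp] = homD[OF h(1)]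
  have "(h \<cdot> ev1 s) \<cdot> f = u" "p \<cdot> (h \<cdot> ev1 s) = v"
    by (simp_all add: s1(9)[symmetric] reassoc2[OF h(2)] reassoc2[OF h(3)] rse)
  then show "\<exists>h\<in>hom C (Cod C f) (Dom C p). h \<cdot> f = u \<and> p \<cdot> h = v"
    by (intro bexI[of _ "h \<cdot> ev1 s"]) (simp_all add: hom_iff)
qed auto

definition flip :: "'m square \<Rightarrow> 'm square" where
  "flip s = Sq (tgt s) (src s) (ev1 s) (ev0 s)"

lemma flip_simps [simp]: "src (flip s) = tgt s" "tgt (flip s) = src s" "ev0 (flip s) = ev1 s" "ev1 (flip s) = ev0 s"
  "flip (flip s) = s"
  by (simp_all add: flip_def)

lemma flip_Mor: "flip s \<in> Mor (Arr C) \<longleftrightarrow> s \<in> Mor (Arr (op_cat C))"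
  by (auto simp: Arr_Mor)

lemma anti_iso_Arr: "anti_iso (Arr (op_cat C)) (Arr C) flip flip"
proof -
  interpret op: category "op_cat C" by (rule category_op)
  interpret A: category "Arr C" by (rule category_Arr)
  interpret B: category "Arr (op_cat C)" by (rule op.category_Arr)
  have "s \<in> Mor (Arr (op_cat C)) \<Longrightarrow> flip s \<in> Mor (Arr C)" "s \<in> Mor (Arr C) \<Longrightarrow> flip s \<in> Mor (Arr (op_cat C))" for s
    using flip_Mor[of s] flip_Mor[of "flip s"] by simp_all
  then show ?thesis
    by unfold_locales (simp_all, simp_all add: flip_def)
qed

lemma levelwise_iff: "s \<in> levelwise C S \<longleftrightarrow> s \<in> Mor (Arr C) \<and> ev0 s \<in> S \<and> ev1 s \<in> S"
  by (simp add: levelwise_def)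

lemma levelwise_op: "flip ` levelwise (op_cat C) S = levelwise C S"
proof -
  have "s \<in> flip ` levelwise (op_cat C) S \<longleftrightarrow> flip s \<in> levelwise (op_cat C) S" for s
    by (metis flip_simps(5) image_iff)
  then show ?thesis
    using flip_Mor by (auto simp: levelwise_def) (metis flip_simps(5))+
qed

lemma levelwise_wide:
  assumes S: "is_wide_subcategory C S"
  shows "is_wide_subcategory (Arr C) (levelwise C S)"
proof -
  interpret A: category "Arr C" by (rule category_Arr)
  show ?thesis
    unfolding is_wide_subcategory_def
  proof (intro conjI ballI impI)
    show "Ident (Arr C) f \<in> levelwise C S" if "f \<in> Obj (Arr C)" for f
      using that A.Ident_Mor[of f] S by (simp add: levelwise_iff is_wide_subcategory_def)
    show "t \<cdot>\<^bsub>Arr C\<^esub> s \<in> levelwise C S" if "s \<in> levelwise C S" "t \<in> levelwise C S" "Cod (Arr C) s = Dom (Arr C) t" for s t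
    proof -
      have st: "s \<in> Mor (Arr C)" "t \<in> Mor (Arr C)" "ev0 s \<in> S" "ev1 s \<in> S" "ev0 t \<in> S" "ev1 t \<in> S" "tgt s = src t"
        using that by (auto simp: levelwise_iff)
      have "Cod C (ev0 s) = Dom C (ev0 t)" "Cod C (ev1 s) = Dom C (ev1 t)"
        using st(1,2) st(7) by (simp_all add: Arr_Mor)
      then have "ev0 t \<cdot> ev0 s \<in> S" "ev1 t \<cdot> ev1 s \<in> S"
        using S st(3-6) by (simp_all add: is_wide_subcategory_def)
      then show ?thesis using A.Comp_Mor[of s t] st by (simp add: levelwise_iff)
    qed
  qed (auto simp: levelwise_iff)
qed

lemma levelwise_retracts:
  assumes S: "closed_under_retracts C S"
  shows "closed_under_retracts (Arr C) (levelwise C S)"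
  unfolding closed_under_retracts_def
proof (intro ballI impI)
  interpret A: category "Arr C" by (rule category_Arr)
  fix f g assume f: "f \<in> Mor (Arr C)" and g: "g \<in> levelwise C S" and r: "is_retract (Arr C) f g"
  have "is_retract C (ev0 f) (ev0 g)" "is_retract C (ev1 f) (ev1 g)"
    using retract_functor[OF category_Arr Ev0_functor r] retract_functor[OF category_Arr Ev1_functor r] by simp_all
  then have "ev0 f \<in> S" "ev1 f \<in> S"
    using S f g unfolding closed_under_retracts_def levelwise_iff by (meson Arr_Mor)+
  then show "f \<in> levelwise C S" using f by (simp add: levelwise_iff)
qed

end

context model_category
begin

text \<open>\<open>flip\<close> identifies squares of \<open>C\<close> with reversed squares of
  \<open>op_cat C\<close>, so colimits of arrows are limits of arrows of the opposite
  category.\<close>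

lemma colimits_Arr: "has_small_colimits U (Arr C)"
proof -
  interpret op: category "op_cat C" by (rule category_op)
  interpret a: anti_iso "Arr (op_cat C)" "Arr C" flip flip by (rule anti_iso_Arr)
  show ?thesis
    by (rule a.limits_transfer[OF op.limits_Arr[OF limits_op[OF colimits category_axioms]]])
qed

lemma projective_simps [simp]:
  "Weq (projective C M) = levelwise C (Weq M)" "Fib (projective C M) = levelwise C (Fib M)"
  "Cof (projective C M) = {i \<in> Mor (Arr C). \<forall>p \<in> levelwise C (Fib M) \<inter> levelwise C (Weq M). has_lifting (Arr C) i p}"
  by (simp_all add: projective_def)

lemma injective_simps [simp]:
  "Weq (injective C M) = levelwise C (Weq M)" "Cof (injective C M) = levelwise C (Cof M)"
  "Fib (injective C M) = {p \<in> Mor (Arr C). \<forall>i \<in> levelwise C (Cof M) \<inter> levelwise C (Weq M). has_lifting (Arr C) i p}"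
  by (simp_all add: injective_def)

lemma levelwise_Int: "levelwise C (S \<inter> T) = levelwise C S \<inter> levelwise C T"
  by (auto simp: levelwise_iff)

lemma levelwise_two_of_three:
  assumes "f \<in> hom (Arr C) x y" "g \<in> hom (Arr C) y z"
  shows "f \<in> levelwise C (Weq M) \<and> g \<in> levelwise C (Weq M) \<longrightarrow> g \<cdot>\<^bsub>Arr C\<^esub> f \<in> levelwise C (Weq M)"
    "f \<in> levelwise C (Weq M) \<and> g \<cdot>\<^bsub>Arr C\<^esub> f \<in> levelwise C (Weq M) \<longrightarrow> g \<in> levelwise C (Weq M)"
    "g \<in> levelwise C (Weq M) \<and> g \<cdot>\<^bsub>Arr C\<^esub> f \<in> levelwise C (Weq M) \<longrightarrow> f \<in> levelwise C (Weq M)"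
proof -
  interpret A: category "Arr C" by (rule category_Arr)
  have M: "f \<in> Mor (Arr C)" "g \<in> Mor (Arr C)" "g \<cdot>\<^bsub>Arr C\<^esub> f \<in> Mor (Arr C)"
    using homD[OF assms(1)] homD[OF assms(2)] A.Comp_Mor[of f g] by simp_all
  have "ev0 f \<in> hom C (Dom C x) (Dom C y)" "ev0 g \<in> hom C (Dom C y) (Dom C z)"
    "ev1 f \<in> hom C (Cod C x) (Cod C y)" "ev1 g \<in> hom C (Cod C y) (Cod C z)"
    using assms by (auto simp: Arr_hom hom_iff[of _ C])
  from two_of_three[OF this(1,2)] two_of_three[OF this(3,4)] M
  show "f \<in> levelwise C (Weq M) \<and> g \<in> levelwise C (Weq M) \<longrightarrow> g \<cdot>\<^bsub>Arr C\<^esub> f \<in> levelwise C (Weq M)"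
    "f \<in> levelwise C (Weq M) \<and> g \<cdot>\<^bsub>Arr C\<^esub> f \<in> levelwise C (Weq M) \<longrightarrow> g \<in> levelwise C (Weq M)"
    "g \<in> levelwise C (Weq M) \<and> g \<cdot>\<^bsub>Arr C\<^esub> f \<in> levelwise C (Weq M) \<longrightarrow> f \<in> levelwise C (Weq M)"
    unfolding levelwise_iff Arr_simps square.sel by blast+
qed

theorem projective_model: "model_category (Arr C) U (projective C M)"
proof -
  interpret A: category "Arr C" by (rule category_Arr)
  obtain \<alpha> \<beta> \<gamma> \<delta> where f: "factors_into C (Cof M) (Fib M \<inter> Weq M) \<alpha> \<beta>"
    "factors_into C (Cof M \<inter> Weq M) (Fib M) \<gamma> \<delta>"
    using factor_cof_tfib factor_tcof_fib by blast
  interpret F1: factorization C "Cof M" "Fib M \<inter> Weq M" \<alpha> \<beta>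
    by unfold_locales (auto intro: f lifting_cof_tfib ex_pushout[OF colimits] Cof_Mor Fib_Mor)
  interpret F2: factorization C "Cof M \<inter> Weq M" "Fib M" \<gamma> \<delta>
    by unfold_locales (auto intro: f lifting_tcof_fib ex_pushout[OF colimits] Cof_Mor Fib_Mor)
  have lev: "levelwise C S \<subseteq> Mor (Arr C)" for S by (auto simp: levelwise_iff)
  \<comment> \<open>On \<open>Ev\<^sub>1\<close> the left square is a pushout leg, a trivial
    cofibration like the left factor on \<open>Ev\<^sub>0\<close>, followed by the left factor of
    the corner map.\<close>
  have F2W: "F2.lsq s \<in> levelwise C (Weq M)" if s: "s \<in> Mor (Arr C)" for s
  proof -
    have "onobj \<gamma> (ev0 s) \<in> Weq M" "onobj \<gamma> (ev0 s) \<in> Cof M" using F2.a_L[of "ev0 s"] F2.obj_facts[OF s] by auto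
    moreover have "onobj \<gamma> (F2.co s) \<in> Weq M" using F2.a_L[of "F2.co s"] F2.obj_facts[OF s] by auto
    moreover have "fst (F2.po s) \<in> Weq M" using pushout_TCof(2)[OF F2.po(1)[OF s]] calculation by blast
    ultimately have "onobj \<gamma> (F2.co s) \<cdot> fst (F2.po s) \<in> Weq M"
      using F2.obj_facts[OF s] by (intro W_comp) auto
    then show ?thesis
      using F2.lsq_Mor[OF s] \<open>onobj \<gamma> (ev0 s) \<in> Weq M\<close> by (simp add: levelwise_iff F2.lsq_def)
  qed
  \<comment> \<open>Projective cofibrations are defined by lifting against trivial fibrations only.
    If \<open>i\<close> is also a weak equivalence, so is its right factor \<open>F2.rsq i\<close>,
    and the retract argument makes \<open>i\<close> a retract of \<open>F2.lsq i\<close>, which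
    lifts against all fibrations.\<close>
  have liftF2: "has_lifting (Arr C) i p" if "i \<in> Cof (projective C M)" "i \<in> Weq (projective C M)" "p \<in> Fib (projective C M)" for i p
  proof -
    have i: "i \<in> Mor (Arr C)" "i \<in> levelwise C (Weq M)" and p: "p \<in> levelwise C (Fib M)" using that by auto
    note e = F2.rl_eq[OF i(1)]
    have l: "F2.lsq i \<in> hom (Arr C) (src i) (F2.mid i)" and r: "F2.rsq i \<in> hom (Arr C) (F2.mid i) (tgt i)"
      using F2.lsq_Mor[OF i(1)] F2.rsq_Mor[OF i(1)] by (simp_all add: hom_iff)
    have "F2.rsq i \<in> levelwise C (Weq M)"
      using levelwise_two_of_three(2)[OF l r] F2W[OF i(1)] i(2) e by metis
    then have "has_lifting (Arr C) i (F2.rsq i)"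
      using that(1) F2.rsq_levelwise[OF i(1)] by auto
    from A.retract_argument[OF this e l r] have "is_retract (Arr C) i (F2.lsq i)" .
    \<comment> \<open>Lifting against the single map \<open>p\<close> is a class of the form to
      which \<open>llp_retracts\<close> applies.\<close>
    moreover have "F2.lsq i \<in> {i \<in> Mor (Arr C). \<forall>q \<in> {p}. has_lifting (Arr C) i q}"
      using F2.lsq_Mor[OF i(1)] F2.lsq_lifting[OF i(1) p] by simp
    moreover have "{p} \<subseteq> Mor (Arr C)" using p lev by blast
    ultimately have "i \<in> {i \<in> Mor (Arr C). \<forall>q \<in> {p}. has_lifting (Arr C) i q}"
      using A.llp_retracts[of "{p}"] i(1) unfolding closed_under_retracts_def by blast
    then show ?thesis by simp
  qed
  show ?thesis
  proof (unfold_locales, goal_cases)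
    case 1 show ?case by (rule limits_Arr[OF limits])
  next
    case 2 show ?case by (rule colimits_Arr)
  next
    case 3 show ?case using levelwise_wide[OF Weq_subcat] by simp
  next
    case 4 show ?case unfolding projective_simps by (rule A.llp_wide) (use lev in auto)
  next
    case 5 show ?case using levelwise_wide[OF Fib_subcat] by simp
  next
    case (6 f X Y g Z)
    show ?case unfolding projective_simps using levelwise_two_of_three[OF 6] by blast
  next
    case 7 show ?case using levelwise_retracts[OF Weq_retracts] by simp
  next
    case 8 show ?case unfolding projective_simps by (rule A.llp_retracts) (use lev in auto)
  next
    case 9 show ?case using levelwise_retracts[OF Fib_retracts] by simp
  next
    case (10 i p) then show ?case using liftF2 by blast
  next
    case (11 i p) then show ?case by auto
  next
    case 12
    have "factors_into (Arr C) (Cof (projective C M)) (Fib (projective C M) \<inter> Weq (projective C M)) F1.lfun F1.rfun"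
    proof (rule F1.factors_Arr)
      fix s assume s: "s \<in> Mor (Arr C)"
      show "F1.lsq s \<in> Cof (projective C M)"
        using F1.lsq_Mor[OF s] F1.lsq_lifting[OF s] by (auto simp: levelwise_Int)
      show "F1.rsq s \<in> Fib (projective C M) \<inter> Weq (projective C M)"
        using F1.rsq_levelwise[OF s] by (simp add: levelwise_Int)
    qed
    then show ?case by blast
  next
    case 13
    have "factors_into (Arr C) (Cof (projective C M) \<inter> Weq (projective C M)) (Fib (projective C M)) F2.lfun F2.rfun"
    proof (rule F2.factors_Arr)
      fix s assume s: "s \<in> Mor (Arr C)"
      show "F2.lsq s \<in> Cof (projective C M) \<inter> Weq (projective C M)"
        using F2.lsq_Mor[OF s] F2.lsq_lifting[OF s] F2W[OF s] by auto
      show "F2.rsq s \<in> Fib (projective C M)"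
        using F2.rsq_levelwise[OF s] by simp
    qed
    then show ?case by blast
  qed
qed

text \<open>The projective structure on the arrows of \<open>op_cat C\<close>, transported along
  \<open>flip\<close>. Levelwise classes match at once; what takes an argument is that projective
  cofibrations become injective fibrations, both being defined by lifting.\<close>

theorem injective_model: "model_category (Arr C) U (injective C M)"
proof -
  interpret op: model_category "op_cat C" U "op_ms M" by (rule model_category_op)
  interpret a: anti_iso "Arr (op_cat C)" "Arr C" flip flip by (rule anti_iso_Arr)
  have m: "levelwise (op_cat C) S \<subseteq> Mor (Arr (op_cat C))" for S by (auto simp: op.levelwise_iff)
  have lw: "s \<in> levelwise (op_cat C) S \<longleftrightarrow> flip s \<in> levelwise C S" for s S
    by (auto simp: op.levelwise_iff levelwise_iff flip_Mor)
  have "flip ` Cof (projective (op_cat C) (op_ms M)) = Fib (injective C M)"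
  proof -
    have "p \<in> flip ` Cof (projective (op_cat C) (op_ms M)) \<longleftrightarrow> flip p \<in> Cof (projective (op_cat C) (op_ms M))" for p
      by (metis flip_simps(5) image_iff)
    moreover have "flip p \<in> Cof (projective (op_cat C) (op_ms M)) \<longleftrightarrow> p \<in> Fib (injective C M)" for p
    proof -
      have "(\<forall>i \<in> levelwise (op_cat C) (Cof M) \<inter> levelwise (op_cat C) (Weq M). has_lifting (Arr (op_cat C)) (flip p) i) \<longleftrightarrow>
        (\<forall>i \<in> levelwise C (Cof M) \<inter> levelwise C (Weq M). has_lifting (Arr C) i p)" if p: "p \<in> Mor (Arr C)"
      proof -
        have p': "flip p \<in> Mor (Arr (op_cat C))" using p flip_Mor[of "flip p"] by simp
        have l: "has_lifting (Arr C) (flip i) p \<longleftrightarrow> has_lifting (Arr (op_cat C)) (flip p) i" if "i \<in> Mor (Arr (op_cat C))" for i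
          using a.lifting_iff[OF p' that] by simp
        show ?thesis
        proof (intro iffI ballI)
          fix i assume A: "\<forall>i \<in> levelwise (op_cat C) (Cof M) \<inter> levelwise (op_cat C) (Weq M). has_lifting (Arr (op_cat C)) (flip p) i"
            and i: "i \<in> levelwise C (Cof M) \<inter> levelwise C (Weq M)"
          have "flip i \<in> levelwise (op_cat C) (Cof M) \<inter> levelwise (op_cat C) (Weq M)"
            using i by (simp add: lw)
          then show "has_lifting (Arr C) i p" using A l[of "flip i"] m by auto
        next
          fix i assume B: "\<forall>i \<in> levelwise C (Cof M) \<inter> levelwise C (Weq M). has_lifting (Arr C) i p"
            and i: "i \<in> levelwise (op_cat C) (Cof M) \<inter> levelwise (op_cat C) (Weq M)"
          have "flip i \<in> levelwise C (Cof M) \<inter> levelwise C (Weq M)"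
            using i by (simp add: lw)
          then show "has_lifting (Arr (op_cat C)) (flip p) i" using B l[of i] i m by blast
        qed
      qed
      then show ?thesis
        unfolding op.projective_simps injective_simps op_ms_simps mem_Collect_eq
        using flip_Mor[of "flip p"] by (simp only: flip_simps) blast
    qed
    ultimately show ?thesis by blast
  qed
  then have "a.dual_ms (projective (op_cat C) (op_ms M)) = injective C M"
    unfolding a.dual_ms_def by (simp add: levelwise_op injective_def)
  then show ?thesis using a.model_transfer[OF op.projective_model] by simp
qed

end

section \<open>Cokernels and kernels\<close>

text \<open>The zero morphism \<open>X -> 0 -> Y\<close> through the chosen zero object.\<close>

definition zmap :: "('o, 'm) cat \<Rightarrow> 'o \<Rightarrow> 'o \<Rightarrow> 'm" where
  "zmap C X Y = (THE t. t \<in> hom C (zero_obj C) Y) \<cdot>\<^bsub>C\<^esub> (THE t. t \<in> hom C X (zero_obj C))"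

lemma zmap_op: "zmap (op_cat C) X Y = zmap C Y X"
  by (simp add: zmap_def)

text \<open>The universal property of the quotient, phrased with zero morphisms in place of a
  pushout square. In this form no leg out of the zero object has to be carried along, and the dual
  is literally \<open>is_kernel\<close>.\<close>

definition is_cokernel :: "('o, 'm) cat \<Rightarrow> 'm \<Rightarrow> 'm \<Rightarrow> bool" where
  "is_cokernel C f q \<longleftrightarrow> f \<in> Mor C \<and> q \<in> Mor C \<and> Dom C q = Cod C f \<and> q \<cdot>\<^bsub>C\<^esub> f = zmap C (Dom C f) (Cod C q) \<and>
     (\<forall>Y. \<forall>g \<in> hom C (Cod C f) Y. g \<cdot>\<^bsub>C\<^esub> f = zmap C (Dom C f) Y \<longrightarrow> (\<exists>!h. h \<in> hom C (Cod C q) Y \<and> h \<cdot>\<^bsub>C\<^esub> q = g))"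

definition is_kernel :: "('o, 'm) cat \<Rightarrow> 'm \<Rightarrow> 'm \<Rightarrow> bool" where
  "is_kernel C p k \<longleftrightarrow> p \<in> Mor C \<and> k \<in> Mor C \<and> Cod C k = Dom C p \<and> p \<cdot>\<^bsub>C\<^esub> k = zmap C (Dom C k) (Cod C p) \<and>
     (\<forall>Y. \<forall>g \<in> hom C Y (Dom C p). p \<cdot>\<^bsub>C\<^esub> g = zmap C Y (Cod C p) \<longrightarrow> (\<exists>!h. h \<in> hom C Y (Dom C k) \<and> k \<cdot>\<^bsub>C\<^esub> h = g))"

lemma is_cokernel_op: "is_cokernel (op_cat C) = is_kernel C"
  by (simp add: is_cokernel_def is_kernel_def zmap_op fun_eq_iff)

lemma cok_map_op: "cok_map (op_cat C) = ker_map C"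
  by (simp add: cok_map_def ker_map_def pushout_op fun_eq_iff)

locale pointed_model_category = model_category +
  assumes pointed_C: "pointed C"
begin

abbreviation "Z \<equiv> zero_obj C"

lemma Z_zero: "is_zero C Z"
  unfolding zero_obj_def using pointed_C unfolding pointed_def by (rule someI_ex)

lemma Z_Obj [simp]: "Z \<in> Obj C"
  using Z_zero by (simp add: is_zero_def is_initial_def)

lemma Z_initial: "is_initial C Z" and Z_terminal: "is_terminal C Z"
  using Z_zero by (simp_all add: is_zero_def)

lemma to_Z_eq: "\<lbrakk>f \<in> Mor C; g \<in> Mor C; Dom C f = Dom C g; Cod C f = Z; Cod C g = Z\<rbrakk> \<Longrightarrow> f = g"
  by (rule terminal_hom_eq[OF Z_terminal, of f "Dom C g"]) (auto simp: hom_iff)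

lemma from_Z_eq: "\<lbrakk>f \<in> Mor C; g \<in> Mor C; Cod C f = Cod C g; Dom C f = Z; Dom C g = Z\<rbrakk> \<Longrightarrow> f = g"
proof -
  assume a: "f \<in> Mor C" "g \<in> Mor C" "Cod C f = Cod C g" "Dom C f = Z" "Dom C g = Z"
  then have "\<exists>!h. h \<in> hom C Z (Cod C g)" using Z_initial by (simp add: is_initial_def)
  then show "f = g" using a by (auto simp: hom_iff)
qed

lemma zmap_parts:
  assumes "X \<in> Obj C" "Y \<in> Obj C"
  shows "(THE t. t \<in> hom C X Z) \<in> hom C X Z" "(THE t. t \<in> hom C Z Y) \<in> hom C Z Y"
  using theI'[of "\<lambda>t. t \<in> hom C X Z"] theI'[of "\<lambda>t. t \<in> hom C Z Y"] Z_initial Z_terminal assms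
  unfolding is_initial_def is_terminal_def by blast+

lemma zmap_hom [simp]:
  assumes "X \<in> Obj C" "Y \<in> Obj C"
  shows "zmap C X Y \<in> Mor C" "Dom C (zmap C X Y) = X" "Cod C (zmap C X Y) = Y"
  using homD[OF zmap_parts(1)[OF assms]] homD[OF zmap_parts(2)[OF assms]] by (simp_all add: zmap_def)

lemma zmap_factor:
  assumes "f \<in> Mor C" "g \<in> Mor C" "Cod C f = Z" "Dom C g = Z"
  shows "g \<cdot> f = zmap C (Dom C f) (Cod C g)"
proof -
  have o: "Dom C f \<in> Obj C" "Cod C g \<in> Obj C" using assms by simp_all
  note h = homD[OF zmap_parts(1)[OF o]] homD[OF zmap_parts(2)[OF o]]
  have "(THE t. t \<in> hom C (Dom C f) Z) = f" "(THE t. t \<in> hom C Z (Cod C g)) = g"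
    by (rule to_Z_eq, use h assms in simp_all, rule from_Z_eq, use h assms in simp_all)
  then show ?thesis by (simp add: zmap_def)
qed

lemma comp_zmap [simp]:
  assumes "f \<in> Mor C" "X \<in> Obj C" "Dom C f = Y"
  shows "f \<cdot> zmap C X Y = zmap C X (Cod C f)"
proof -
  have o: "Y \<in> Obj C" using assms by auto
  note h = homD[OF zmap_parts(1)[OF assms(2) o]] homD[OF zmap_parts(2)[OF assms(2) o]]
  show ?thesis
    using zmap_factor[of "THE t. t \<in> hom C X Z" "f \<cdot> (THE t. t \<in> hom C Z Y)"] h assms by (simp add: zmap_def)
qed

lemma zmap_comp [simp]:
  assumes "f \<in> Mor C" "X \<in> Obj C" "Cod C f = Y"
  shows "zmap C Y X \<cdot> f = zmap C (Dom C f) X"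
proof -
  have o: "Y \<in> Obj C" using assms by auto
  note h = homD[OF zmap_parts(1)[OF o assms(2)]] homD[OF zmap_parts(2)[OF o assms(2)]]
  show ?thesis
    using zmap_factor[of "(THE t. t \<in> hom C Y Z) \<cdot> f" "THE t. t \<in> hom C Z X"] h assms by (simp add: zmap_def)
qed

lemma from_Z_zmap: "\<lbrakk>f \<in> Mor C; Dom C f = Z\<rbrakk> \<Longrightarrow> f = zmap C Z (Cod C f)"
  by (rule from_Z_eq; simp)

lemma pointed_op: "pointed_model_category (op_cat C) U (op_ms M)"
proof -
  interpret op: model_category "op_cat C" U "op_ms M" by (rule model_category_op)
  show ?thesis by unfold_locales (use pointed_C in \<open>simp add: pointed_def zero_op\<close>)
qed

text \<open>The second leg starts at the zero object, where maps are unique, so a cocone amounts to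
  a map that kills \<open>f\<close>.\<close>

lemma pushout_is_cokernel:
  assumes p: "is_pushout C f t q z" and f: "f \<in> hom C A B" and t: "t \<in> hom C A Z"
  shows "is_cokernel C f q"
proof -
  have q: "q \<in> hom C B (Cod C q)" using p f unfolding is_pushout_def by (auto simp: hom_iff)
  note pE = pushoutE[OF p f t q]
  note [simp] = homD[OF f] homD[OF t] homD(1,2)[OF q] homD[OF pE(1)]
  have "q \<cdot> f = zmap C A (Cod C q)" using pE(2) zmap_factor[of t z] by simp
  moreover have "\<exists>!h. h \<in> hom C (Cod C q) Y \<and> h \<cdot> q = g" if g: "g \<in> hom C B Y" "g \<cdot> f = zmap C A Y" for Y g
  proof -
    note [simp] = homD[OF g(1)]
    have Y: "Y \<in> Obj C" using hom_Obj[OF g(1)] by simp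
    have "\<exists>!h. h \<in> hom C (Cod C q) Y \<and> h \<cdot> q = g \<and> h \<cdot> z = zmap C Z Y"
      by (rule pE(3)[OF g(1)]) (use Y zmap_factor[of t "zmap C Z Y"] in \<open>simp_all add: hom_iff g(2)\<close>)
    moreover have "h \<cdot> z = zmap C Z Y" if "h \<in> hom C (Cod C q) Y" for h
      using from_Z_zmap[of "h \<cdot> z"] homD[OF that] by simp
    ultimately show ?thesis by blast
  qed
  ultimately show ?thesis by (simp add: is_cokernel_def)
qed

lemma cok:
  assumes f: "f \<in> Mor C"
  shows "is_cokernel C f (cok_map C f)"
proof -
  have t: "zmap C (Dom C f) Z \<in> hom C (Dom C f) Z" using f by (simp add: hom_iff)
  obtain q z where "is_pushout C f (zmap C (Dom C f) Z) q z" using ex_pushout[OF colimits Mor_hom[OF f] t] by blast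
  with t have "\<exists>q t z. t \<in> hom C (Dom C f) Z \<and> is_pushout C f t q z" by blast
  from someI_ex[OF this] obtain t z where "t \<in> hom C (Dom C f) Z" "is_pushout C f t (cok_map C f) z"
    unfolding cok_map_def by blast
  then show ?thesis using pushout_is_cokernel Mor_hom[OF f] by blast
qed

lemma cokernel_Mor:
  assumes "is_cokernel C f q"
  shows "f \<in> Mor C" "q \<in> Mor C" 
  using assms unfolding is_cokernel_def by blast+

lemma cokernel_zero:
  assumes "is_cokernel C f q"
  shows "Dom C q = Cod C f" "q \<cdot> f = zmap C (Dom C f) (Cod C q)"
  using assms unfolding is_cokernel_def by blast+

lemma cokernel_univ:
  assumes c: "is_cokernel C f q" and g: "g \<in> hom C (Cod C f) Y" "g \<cdot> f = zmap C (Dom C f) Y"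
  shows "\<exists>!h. h \<in> hom C (Cod C q) Y \<and> h \<cdot> q = g"
proof -
  have "\<forall>Y. \<forall>g \<in> hom C (Cod C f) Y. g \<cdot> f = zmap C (Dom C f) Y \<longrightarrow> (\<exists>!h. h \<in> hom C (Cod C q) Y \<and> h \<cdot> q = g)"
    using c unfolding is_cokernel_def by (elim conjE)
  then show ?thesis using g by blast
qed

lemma cokernel_ex:
  assumes "is_cokernel C f q" "g \<in> Mor C" "Dom C g = Cod C f" "g \<cdot> f = zmap C (Dom C f) (Cod C g)"
  obtains h where "h \<in> Mor C" "Dom C h = Cod C q" "Cod C h = Cod C g" "h \<cdot> q = g"
proof -
  have "g \<in> hom C (Cod C f) (Cod C g)" using assms by (simp add: hom_iff)
  from cokernel_univ[OF assms(1) this assms(4)] obtain h where "h \<in> hom C (Cod C q) (Cod C g)" "h \<cdot> q = g"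
    by blast
  then show thesis using that by (auto simp: hom_iff)
qed

lemma cokernel_epi:
  assumes c: "is_cokernel C f q" and gh: "g \<cdot> q = h \<cdot> q" "g \<in> Mor C" "h \<in> Mor C" "Dom C g = Cod C q" "Dom C h = Cod C q"
  shows "g = h"
proof -
  note [simp] = cokernel_Mor[OF c] cokernel_zero(1)[OF c] gh(2-5)
  have cod: "Cod C h = Cod C g" using arg_cong[OF gh(1), of "Cod C"] by simp
  have "h \<cdot> q \<in> hom C (Cod C f) (Cod C g)" "(h \<cdot> q) \<cdot> f = zmap C (Dom C f) (Cod C g)"
    by (simp_all add: hom_iff cod cokernel_zero(2)[OF c])
  from cokernel_univ[OF c this] have u: "\<exists>!k. k \<in> hom C (Cod C q) (Cod C g) \<and> k \<cdot> q = h \<cdot> q" .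
  have "g \<in> hom C (Cod C q) (Cod C g)" "h \<in> hom C (Cod C q) (Cod C g)" by (simp_all add: hom_iff cod)
  with u gh(1) show ?thesis by blast
qed

lemma kernel_Mor:
  assumes "is_kernel C p k"
  shows "p \<in> Mor C" "k \<in> Mor C" 
  using assms unfolding is_kernel_def by blast+

lemma kernel_zero:
  assumes "is_kernel C p k"
  shows "Cod C k = Dom C p" "p \<cdot> k = zmap C (Dom C k) (Cod C p)"
  using assms unfolding is_kernel_def by blast+

lemma kernel_univ:
  assumes c: "is_kernel C p k" and g: "g \<in> hom C Y (Dom C p)" "p \<cdot> g = zmap C Y (Cod C p)"
  shows "\<exists>!h. h \<in> hom C Y (Dom C k) \<and> k \<cdot> h = g"
proof -
  interpret op: pointed_model_category "op_cat C" U "op_ms M" by (rule pointed_op)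
  show ?thesis using op.cokernel_univ[of p k g Y] assms by (simp add: is_cokernel_op zmap_op)
qed

lemma kernel_ex:
  assumes "is_kernel C p k" "g \<in> Mor C" "Cod C g = Dom C p" "p \<cdot> g = zmap C (Dom C g) (Cod C p)"
  obtains h where "h \<in> Mor C" "Cod C h = Dom C k" "Dom C h = Dom C g" "k \<cdot> h = g"
proof -
  interpret op: pointed_model_category "op_cat C" U "op_ms M" by (rule pointed_op)
  show thesis using op.cokernel_ex[of p k g] that assms by (auto simp: is_cokernel_op zmap_op)
qed

lemma kernel_mono:
  assumes "is_kernel C p k" "k \<cdot> g = k \<cdot> h" "g \<in> Mor C" "h \<in> Mor C" "Cod C g = Dom C k" "Cod C h = Dom C k"
  shows "g = h"
proof -
  interpret op: pointed_model_category "op_cat C" U "op_ms M" by (rule pointed_op)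
  show ?thesis using op.cokernel_epi[of p k g h] assms by (simp add: is_cokernel_op)
qed

lemma ker: "p \<in> Mor C \<Longrightarrow> is_kernel C p (ker_map C p)"
proof -
  interpret op: pointed_model_category "op_cat C" U "op_ms M" by (rule pointed_op)
  show "p \<in> Mor C \<Longrightarrow> is_kernel C p (ker_map C p)" using op.cok[of p] by (simp add: is_cokernel_op cok_map_op)
qed

section \<open>The cokernel functor, the kernel functor and their adjunction\<close>

abbreviation "K \<equiv> cokernel_functor C"
abbreviation "R \<equiv> kernel_functor C"

lemma onobj_K [simp]: "onobj K f = cok_map C f" and onobj_R [simp]: "onobj R p = ker_map C p"
  by (simp_all add: cokernel_functor_def kernel_functor_def)

lemma cok_simps [simp]:
  assumes "f \<in> Mor C"
  shows "cok_map C f \<in> Mor C" "Dom C (cok_map C f) = Cod C f" "cok_map C f \<cdot> f = zmap C (Dom C f) (Cod C (cok_map C f))"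
  using cokernel_zero[OF cok[OF assms]] cokernel_Mor[OF cok[OF assms]] by auto

lemma ker_simps [simp]:
  assumes "f \<in> Mor C"
  shows "ker_map C f \<in> Mor C" "Cod C (ker_map C f) = Dom C f" "f \<cdot> ker_map C f = zmap C (Dom C (ker_map C f)) (Cod C f)"
  using kernel_zero[OF ker[OF assms]] kernel_Mor[OF ker[OF assms]] by auto

lemma Arr_MorD:
  assumes "s \<in> Mor (Arr C)"
  shows "src s \<in> Mor C" "tgt s \<in> Mor C" "ev0 s \<in> Mor C" "ev1 s \<in> Mor C"
    "Dom C (ev0 s) = Dom C (src s)" "Cod C (ev0 s) = Dom C (tgt s)"
    "Dom C (ev1 s) = Cod C (src s)" "Cod C (ev1 s) = Cod C (tgt s)" "tgt s \<cdot> ev0 s = ev1 s \<cdot> src s"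
  using assms by (simp_all add: Arr_Mor)

lemma K_mor:
  assumes s: "s \<in> Mor (Arr C)"
  shows "src (onmor K s) = cok_map C (src s)" "tgt (onmor K s) = cok_map C (tgt s)" "ev0 (onmor K s) = ev1 s"
    "ev1 (onmor K s) \<in> Mor C" "Dom C (ev1 (onmor K s)) = Cod C (cok_map C (src s))"
    "Cod C (ev1 (onmor K s)) = Cod C (cok_map C (tgt s))"
    "ev1 (onmor K s) \<cdot> cok_map C (src s) = cok_map C (tgt s) \<cdot> ev1 s"
proof -
  note [simp] = Arr_MorD(1-8)[OF s]
  have z: "(cok_map C (tgt s) \<cdot> ev1 s) \<cdot> src s = zmap C (Dom C (src s)) (Cod C (cok_map C (tgt s)))"
    by (simp add: Arr_MorD(9)[OF s, symmetric] reassoc[OF cok_simps(3)])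
  have "\<exists>!w. w \<in> hom C (Cod C (cok_map C (src s))) (Cod C (cok_map C (tgt s))) \<and> w \<cdot> cok_map C (src s) = cok_map C (tgt s) \<cdot> ev1 s"
    by (rule cokernel_univ[OF cok]) (use z in \<open>simp_all add: hom_iff\<close>)
  from theI'[OF this] show "src (onmor K s) = cok_map C (src s)" "tgt (onmor K s) = cok_map C (tgt s)" "ev0 (onmor K s) = ev1 s"
    "ev1 (onmor K s) \<in> Mor C" "Dom C (ev1 (onmor K s)) = Cod C (cok_map C (src s))"
    "Cod C (ev1 (onmor K s)) = Cod C (cok_map C (tgt s))"
    "ev1 (onmor K s) \<cdot> cok_map C (src s) = cok_map C (tgt s) \<cdot> ev1 s"
    by (simp_all add: cokernel_functor_def hom_iff)
qed

lemma K_mor_unique: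
  assumes s: "s \<in> Mor (Arr C)" and w: "w \<in> Mor C" "Dom C w = Cod C (cok_map C (src s))"
    and e: "w \<cdot> cok_map C (src s) = cok_map C (tgt s) \<cdot> ev1 s"
  shows "ev1 (onmor K s) = w"
  by (rule cokernel_epi[OF cok[of "src s"]]) (use K_mor[OF s] Arr_MorD[OF s] w e in simp_all)

lemma K_functor: "is_functor (Arr C) (Arr C) K"
proof (rule functorI, goal_cases)
  case (1 f) then show ?case by simp
next
  case (2 s) then show ?case using K_mor[OF 2] Arr_MorD[OF 2] by (simp add: Arr_hom)
next
  case (3 f)
  interpret A: category "Arr C" by (rule category_Arr)
  have f: "f \<in> Mor C" using 3 by simp
  have s: "Ident (Arr C) f \<in> Mor (Arr C)" using A.Ident_Mor[OF 3] .
  have "ev1 (onmor K (Ident (Arr C) f)) = Ident C (Cod C (cok_map C f))"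
    by (rule K_mor_unique[OF s]) (use f in simp_all)
  then show ?case using K_mor(1-3)[OF s] f by (intro square_eqI) simp_all
next
  case (4 s t)
  interpret A: category "Arr C" by (rule category_Arr)
  have ts: "t \<cdot>\<^bsub>Arr C\<^esub> s \<in> Mor (Arr C)" using A.Comp_Mor[OF 4] .
  have c: "tgt s = src t" using 4 by simp
  note [simp] = K_mor(1-6)[OF 4(1)] K_mor(1-6)[OF 4(2)] Arr_MorD(1-8)[OF 4(1)] Arr_MorD(1-8)[OF 4(2)] c
  have "ev1 (onmor K (t \<cdot>\<^bsub>Arr C\<^esub> s)) = ev1 (onmor K t) \<cdot> ev1 (onmor K s)"
    by (rule K_mor_unique[OF ts])
      (simp_all add: K_mor(7)[OF 4(1)] reassoc2[OF K_mor(7)[OF 4(2)]])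
  then show ?case using K_mor(1-3)[OF ts] by (intro square_eqI) simp_all
qed

lemma flip_Mor': "s \<in> Mor (Arr C) \<Longrightarrow> flip s \<in> Mor (Arr (op_cat C))"
  using flip_Mor[of "flip s"] by simp

text \<open>The kernel functor is the cokernel functor of the opposite category seen through
  \<open>flip\<close>; the facts on \<open>onmor R\<close> are thereby read off from those on
  \<open>onmor K\<close>.\<close>

lemma R_flip: "onmor R s = flip (onmor (cokernel_functor (op_cat C)) (flip s))"
  by (simp add: kernel_functor_def cokernel_functor_def cok_map_op flip_def)

lemma R_mor:
  assumes s: "s \<in> Mor (Arr C)"
  shows "src (onmor R s) = ker_map C (src s)" "tgt (onmor R s) = ker_map C (tgt s)" "ev1 (onmor R s) = ev0 s"
    "ev0 (onmor R s) \<in> Mor C" "Dom C (ev0 (onmor R s)) = Dom C (ker_map C (src s))"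
    "Cod C (ev0 (onmor R s)) = Dom C (ker_map C (tgt s))"
    "ker_map C (tgt s) \<cdot> ev0 (onmor R s) = ev0 s \<cdot> ker_map C (src s)"
proof -
  interpret op: pointed_model_category "op_cat C" U "op_ms M" by (rule pointed_op)
  show "src (onmor R s) = ker_map C (src s)" "tgt (onmor R s) = ker_map C (tgt s)" "ev1 (onmor R s) = ev0 s"
    "ev0 (onmor R s) \<in> Mor C" "Dom C (ev0 (onmor R s)) = Dom C (ker_map C (src s))"
    "Cod C (ev0 (onmor R s)) = Dom C (ker_map C (tgt s))"
    "ker_map C (tgt s) \<cdot> ev0 (onmor R s) = ev0 s \<cdot> ker_map C (src s)"
    unfolding R_flip using op.K_mor[OF flip_Mor'[OF s]] by (simp_all add: cok_map_op)
qed

lemma R_mor_unique: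
  assumes s: "s \<in> Mor (Arr C)" and w: "w \<in> Mor C" "Cod C w = Dom C (ker_map C (tgt s))"
    and e: "ker_map C (tgt s) \<cdot> w = ev0 s \<cdot> ker_map C (src s)"
  shows "ev0 (onmor R s) = w"
  by (rule kernel_mono[OF ker[of "tgt s"]]) (use R_mor[OF s] Arr_MorD[OF s] w e in simp_all)

lemma R_functor: "is_functor (Arr C) (Arr C) R"
proof (rule functorI, goal_cases)
  case (1 f) then show ?case by simp
next
  case (2 s) then show ?case using R_mor[OF 2] Arr_MorD[OF 2] by (simp add: Arr_hom)
next
  case (3 f)
  interpret A: category "Arr C" by (rule category_Arr)
  have f: "f \<in> Mor C" using 3 by simp
  have s: "Ident (Arr C) f \<in> Mor (Arr C)" using A.Ident_Mor[OF 3] .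
  have "ev0 (onmor R (Ident (Arr C) f)) = Ident C (Dom C (ker_map C f))"
    by (rule R_mor_unique[OF s]) (use f in simp_all)
  then show ?case using R_mor(1-3)[OF s] f by (intro square_eqI) simp_all
next
  case (4 s t)
  interpret A: category "Arr C" by (rule category_Arr)
  have ts: "t \<cdot>\<^bsub>Arr C\<^esub> s \<in> Mor (Arr C)" using A.Comp_Mor[OF 4] .
  have c: "tgt s = src t" using 4 by simp
  note [simp] = R_mor(1-6)[OF 4(1)] R_mor(1-6)[OF 4(2)] Arr_MorD(1-8)[OF 4(1)] Arr_MorD(1-8)[OF 4(2)] c
  have "ev0 (onmor R (t \<cdot>\<^bsub>Arr C\<^esub> s)) = ev0 (onmor R t) \<cdot> ev0 (onmor R s)"
    by (rule R_mor_unique[OF ts])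
      (simp_all add: R_mor(7)[OF 4(1), unfolded c] reassoc2[OF R_mor(7)[OF 4(2)]])
  then show ?case using R_mor(1-3)[OF ts] by (intro square_eqI) simp_all
qed

abbreviation "\<Phi> \<equiv> cok_ker_adj C"

lemma adj:
  assumes f: "f \<in> Mor C" and p: "p \<in> Mor C" and s: "s \<in> hom (Arr C) (cok_map C f) p"
  shows "src (\<Phi> f p s) = f" "tgt (\<Phi> f p s) = ker_map C p" "ev1 (\<Phi> f p s) = ev0 s"
    "ev0 (\<Phi> f p s) \<in> Mor C" "Dom C (ev0 (\<Phi> f p s)) = Dom C f" "Cod C (ev0 (\<Phi> f p s)) = Dom C (ker_map C p)"
    "ker_map C p \<cdot> ev0 (\<Phi> f p s) = ev0 s \<cdot> f"
    "\<Phi> f p s \<in> hom (Arr C) f (ker_map C p)"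
proof -
  have sM: "s \<in> Mor (Arr C)" "src s = cok_map C f" "tgt s = p" using s by (auto simp: hom_iff)
  note sD = Arr_MorD[OF sM(1), unfolded sM(2,3)]
  note [simp] = f p sD(3-8)
  have z: "p \<cdot> (ev0 s \<cdot> f) = zmap C (Dom C f) (Cod C p)"
    by (simp add: reassoc2[OF sD(9)])
  have "\<exists>!a. a \<in> hom C (Dom C f) (Dom C (ker_map C p)) \<and> ker_map C p \<cdot> a = ev0 s \<cdot> f"
    by (rule kernel_univ[OF ker[OF p]]) (use z in \<open>simp_all add: hom_iff\<close>)
  from theI'[OF this] show *: "src (\<Phi> f p s) = f" "tgt (\<Phi> f p s) = ker_map C p" "ev1 (\<Phi> f p s) = ev0 s"
    "ev0 (\<Phi> f p s) \<in> Mor C" "Dom C (ev0 (\<Phi> f p s)) = Dom C f" "Cod C (ev0 (\<Phi> f p s)) = Dom C (ker_map C p)"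
    "ker_map C p \<cdot> ev0 (\<Phi> f p s) = ev0 s \<cdot> f"
    by (simp_all add: cok_ker_adj_def hom_iff)
  then show "\<Phi> f p s \<in> hom (Arr C) f (ker_map C p)" by (simp add: Arr_hom)
qed

lemma adj_unique:
  assumes "f \<in> Mor C" "p \<in> Mor C" "s \<in> hom (Arr C) (cok_map C f) p"
    and a: "a \<in> Mor C" "Cod C a = Dom C (ker_map C p)" "ker_map C p \<cdot> a = ev0 s \<cdot> f"
  shows "ev0 (\<Phi> f p s) = a"
  by (rule kernel_mono[OF ker[OF assms(2)]]) (use adj[OF assms(1-3)] a in simp_all)

text \<open>Given a square \<open>f -> ker p\<close>, its component on codomains followed by
  \<open>p\<close> kills \<open>f\<close> and hence descends to the cokernel; that is the missing
  component of the square \<open>cok f -> p\<close>.\<close>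

lemma adj_surj:
  assumes f: "f \<in> Mor C" and p: "p \<in> Mor C" and r: "r \<in> hom (Arr C) f (ker_map C p)"
  obtains s where "s \<in> hom (Arr C) (cok_map C f) p" "\<Phi> f p s = r"
proof -
  have rM: "r \<in> Mor (Arr C)" "src r = f" "tgt r = ker_map C p" using r by (auto simp: hom_iff)
  note rD = Arr_MorD[OF rM(1), unfolded rM(2,3)]
  note [simp] = f p rD(3-8)
  have z: "(p \<cdot> ev1 r) \<cdot> f = zmap C (Dom C f) (Cod C p)"
    by (simp add: rD(9)[symmetric] reassoc[OF ker_simps(3)])
  obtain d where d: "d \<in> Mor C" "Dom C d = Cod C (cok_map C f)" "Cod C d = Cod C (p \<cdot> ev1 r)" "d \<cdot> cok_map C f = p \<cdot> ev1 r"
    by (rule cokernel_ex[OF cok[OF f], of "p \<cdot> ev1 r"]) (use z in simp_all)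
  let ?s = "Sq (cok_map C f) p (ev1 r) d"
  have s: "?s \<in> hom (Arr C) (cok_map C f) p" using d by (simp add: Arr_hom)
  show thesis
  proof (rule that[OF s])
    have "ev0 (\<Phi> f p ?s) = ev0 r" by (rule adj_unique[OF f p s]) (simp_all add: rD(9))
    then show "\<Phi> f p ?s = r" using adj(1-3)[OF f p s] rM by (intro square_eqI) simp_all
  qed
qed

lemma adj_inj:
  assumes f: "f \<in> Mor C" and p: "p \<in> Mor C" and s: "s \<in> hom (Arr C) (cok_map C f) p" and t: "t \<in> hom (Arr C) (cok_map C f) p"
    and e: "\<Phi> f p s = \<Phi> f p t"
  shows "s = t"
proof -
  have sM: "s \<in> Mor (Arr C)" "src s = cok_map C f" "tgt s = p" "t \<in> Mor (Arr C)" "src t = cok_map C f" "tgt t = p"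
    using s t by (auto simp: hom_iff)
  note sD = Arr_MorD[OF sM(1), unfolded sM] and tD = Arr_MorD[OF sM(4), unfolded sM]
  have e0: "ev0 s = ev0 t" using adj(3)[OF f p s] adj(3)[OF f p t] e by simp
  have "ev1 s = ev1 t"
    by (rule cokernel_epi[OF cok[OF f]]) (use sD tD e0 in simp_all)
  then show ?thesis using e0 sM by (intro square_eqI) simp_all
qed

lemma adj_nat_left:
  assumes a: "a \<in> Mor (Arr C)" and p: "p \<in> Mor C" and h: "h \<in> hom (Arr C) (cok_map C (tgt a)) p"
  shows "\<Phi> (src a) p (h \<cdot>\<^bsub>Arr C\<^esub> onmor K a) = \<Phi> (tgt a) p h \<cdot>\<^bsub>Arr C\<^esub> a"
proof -
  interpret A: category "Arr C" by (rule category_Arr)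
  note aD = Arr_MorD[OF a]
  note [simp] = aD(1-8) p
  have hK: "h \<cdot>\<^bsub>Arr C\<^esub> onmor K a \<in> hom (Arr C) (cok_map C (src a)) p"
    using A.Comp_in[OF _ h, of "onmor K a"] functor_hom[OF K_functor A.Mor_hom[OF a]] by simp
  note A1 = adj[OF aD(2) p h]
  have hM: "h \<in> Mor (Arr C)" "src h = cok_map C (tgt a)" "tgt h = p" using h by (auto simp: hom_iff)
  note hD = Arr_MorD[OF hM(1), unfolded hM(2,3)]
  note [simp] = A1(1-6) hD(3-8) K_mor(1-3)[OF a]
  have "ev0 (\<Phi> (src a) p (h \<cdot>\<^bsub>Arr C\<^esub> onmor K a)) = ev0 (\<Phi> (tgt a) p h) \<cdot> ev0 a"
    by (rule adj_unique[OF aD(1) p hK]) (simp_all add: reassoc[OF A1(7)] aD(9))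
  then show ?thesis using adj(1-3)[OF aD(1) p hK] by (intro square_eqI) simp_all
qed

lemma adj_nat_right:
  assumes f: "f \<in> Mor C" and b: "b \<in> Mor (Arr C)" and h: "h \<in> hom (Arr C) (cok_map C f) (src b)"
  shows "\<Phi> f (tgt b) (b \<cdot>\<^bsub>Arr C\<^esub> h) = onmor R b \<cdot>\<^bsub>Arr C\<^esub> \<Phi> f (src b) h"
proof -
  interpret A: category "Arr C" by (rule category_Arr)
  note bD = Arr_MorD[OF b]
  note [simp] = bD(1-8) f
  have bh: "b \<cdot>\<^bsub>Arr C\<^esub> h \<in> hom (Arr C) (cok_map C f) (tgt b)"
    using A.Comp_in[OF h, of b] A.Mor_hom[OF b] by simp
  note A1 = adj[OF f bD(1) h]
  have hM: "h \<in> Mor (Arr C)" "src h = cok_map C f" "tgt h = src b" using h by (auto simp: hom_iff)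
  note hD = Arr_MorD[OF hM(1), unfolded hM(2,3)]
  note [simp] = A1(1-6) hD(3-8) R_mor(1-6)[OF b]
  have "ev0 (\<Phi> f (tgt b) (b \<cdot>\<^bsub>Arr C\<^esub> h)) = ev0 (onmor R b) \<cdot> ev0 (\<Phi> f (src b) h)"
    by (rule adj_unique[OF f bD(2) bh]) (simp_all add: reassoc2[OF R_mor(7)[OF b]] A1(7))
  then show ?thesis using adj(1-3)[OF f bD(2) bh] by (intro square_eqI) simp_all
qed

theorem cok_ker_adjunction: "is_adjunction (Arr C) (Arr C) K R \<Phi>"
  unfolding is_adjunction_def
proof (intro conjI ballI)
  show "is_functor (Arr C) (Arr C) K" "is_functor (Arr C) (Arr C) R" by (rule K_functor, rule R_functor)
  show "bij_betw (\<Phi> f p) (hom (Arr C) (onobj K f) p) (hom (Arr C) f (onobj R p))"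
    if "f \<in> Obj (Arr C)" "p \<in> Obj (Arr C)" for f p
  proof -
    have fp: "f \<in> Mor C" "p \<in> Mor C" using that by simp_all
    show ?thesis
      unfolding bij_betw_def onobj_K onobj_R
    proof (intro conjI inj_onI equalityI subsetI)
      show "s = t" if "s \<in> hom (Arr C) (cok_map C f) p" "t \<in> hom (Arr C) (cok_map C f) p" "\<Phi> f p s = \<Phi> f p t" for s t
        using adj_inj[OF fp that] .
      show "r \<in> hom (Arr C) f (ker_map C p)" if "r \<in> \<Phi> f p ` hom (Arr C) (cok_map C f) p" for r
        using that adj(8)[OF fp] by auto
      show "r \<in> \<Phi> f p ` hom (Arr C) (cok_map C f) p" if "r \<in> hom (Arr C) f (ker_map C p)" for r
        using adj_surj[OF fp that] by blast
    qed
  qed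
qed (use adj_nat_left adj_nat_right in auto)

text \<open>Right adjoint to \<open>Ev1\<close> is the functor that sends an object to its identity
  arrow; the test square is the image of \<open>p\<close> under it, and lifting transposes.\<close>

lemma lifting_ev1:
  assumes i: "i \<in> Mor (Arr C)" and p: "p \<in> hom C X Y"
    and l: "has_lifting (Arr C) i (Sq (Ident C X) (Ident C Y) p p)"
  shows "has_lifting C (ev1 i) p"
proof (rule has_liftingI)
  note iD = Arr_MorD[OF i]
  note [simp] = iD(1-8) homD[OF p]
  have [simp]: "X \<in> Obj C" "Y \<in> Obj C" using hom_Obj[OF p] by auto
  fix u v assume u: "u \<in> hom C (Dom C (ev1 i)) (Dom C p)" and v: "v \<in> hom C (Cod C (ev1 i)) (Cod C p)" and e: "p \<cdot> u = v \<cdot> ev1 i"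
  note [simp] = homD[OF u, simplified] homD[OF v, simplified]
  have iA: "i \<in> hom (Arr C) (src i) (tgt i)" using i by (simp add: hom_iff)
  have pA: "Sq (Ident C X) (Ident C Y) p p \<in> hom (Arr C) (Ident C X) (Ident C Y)" by (simp add: Arr_hom)
  obtain h where h: "h \<in> hom (Arr C) (tgt i) (Ident C X)" "h \<cdot>\<^bsub>Arr C\<^esub> i = Sq (src i) (Ident C X) (u \<cdot> src i) u"
    "Sq (Ident C X) (Ident C Y) p p \<cdot>\<^bsub>Arr C\<^esub> h = Sq (tgt i) (Ident C Y) (v \<cdot> tgt i) v"
    by (rule has_liftingE[OF l iA pA, of "Sq (src i) (Ident C X) (u \<cdot> src i) u" "Sq (tgt i) (Ident C Y) (v \<cdot> tgt i) v"])
      (simp_all add: Arr_hom iD(9) e reassoc[OF e])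
  show "\<exists>h\<in>hom C (Cod C (ev1 i)) (Dom C p). h \<cdot> ev1 i = u \<and> p \<cdot> h = v"
    by (rule bexI[of _ "ev1 h"]) (use h in \<open>simp_all add: Arr_hom hom_iff[of _ C]\<close>)
qed

text \<open>The codomain of the cokernel has the right adjoint
  \<open>X \<mapsto> (0 \<rightarrow> X)\<close>: a square from \<open>f\<close> to
  \<open>0 \<rightarrow> X\<close> is a map on the codomain that kills \<open>f\<close>. The lift
  \<open>ev1 h\<close> therefore descends to the cokernel.\<close>

lemma lifting_K_ev1:
  assumes i: "i \<in> Mor (Arr C)" and p: "p \<in> hom C X Y"
    and l: "has_lifting (Arr C) i (Sq (zmap C Z X) (zmap C Z Y) (Ident C Z) p)"
  shows "has_lifting C (ev1 (onmor K i)) p"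
proof (rule has_liftingI)
  note iD = Arr_MorD[OF i] and kD = K_mor[OF i]
  note [simp] = iD(1-8) homD[OF p] kD(1-6)
  have [simp]: "X \<in> Obj C" "Y \<in> Obj C" using hom_Obj[OF p] by auto
  fix u v assume u: "u \<in> hom C (Dom C (ev1 (onmor K i))) (Dom C p)" and v: "v \<in> hom C (Cod C (ev1 (onmor K i))) (Cod C p)"
    and e: "p \<cdot> u = v \<cdot> ev1 (onmor K i)"
  note [simp] = homD[OF u, simplified] homD[OF v, simplified]
  have iA: "i \<in> hom (Arr C) (src i) (tgt i)" using i by (simp add: hom_iff)
  have pA: "Sq (zmap C Z X) (zmap C Z Y) (Ident C Z) p \<in> hom (Arr C) (zmap C Z X) (zmap C Z Y)" by (simp add: Arr_hom)
  let ?u = "Sq (src i) (zmap C Z X) (zmap C (Dom C (src i)) Z) (u \<cdot> cok_map C (src i))"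
  let ?v = "Sq (tgt i) (zmap C Z Y) (zmap C (Dom C (tgt i)) Z) (v \<cdot> cok_map C (tgt i))"
  have uv: "?u \<in> hom (Arr C) (src i) (zmap C Z X)" "?v \<in> hom (Arr C) (tgt i) (zmap C Z Y)"
    "Sq (zmap C Z X) (zmap C Z Y) (Ident C Z) p \<cdot>\<^bsub>Arr C\<^esub> ?u = ?v \<cdot>\<^bsub>Arr C\<^esub> i"
    by (simp_all add: Arr_hom reassoc2[OF e] kD(7))
  from has_liftingE[OF l iA pA uv] obtain h where h: "h \<in> hom (Arr C) (tgt i) (zmap C Z X)" "h \<cdot>\<^bsub>Arr C\<^esub> i = ?u"
    "Sq (zmap C Z X) (zmap C Z Y) (Ident C Z) p \<cdot>\<^bsub>Arr C\<^esub> h = ?v" by blast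
  have hD: "ev1 h \<in> Mor C" "Dom C (ev1 h) = Cod C (tgt i)" "Cod C (ev1 h) = X" "zmap C Z X \<cdot> ev0 h = ev1 h \<cdot> tgt i"
    "ev0 h \<in> Mor C" "Dom C (ev0 h) = Dom C (tgt i)" "Cod C (ev0 h) = Z"
    "ev1 h \<cdot> ev1 i = u \<cdot> cok_map C (src i)" "p \<cdot> ev1 h = v \<cdot> cok_map C (tgt i)"
    using h by (auto simp: Arr_hom)
  note [simp] = hD(1-3,5-7)
  obtain k where k: "k \<in> Mor C" "Dom C k = Cod C (cok_map C (tgt i))" "Cod C k = Cod C (ev1 h)" "k \<cdot> cok_map C (tgt i) = ev1 h"
    by (rule cokernel_ex[OF cok[OF iD(2)], of "ev1 h"]) (use hD(4) in simp_all)
  note [simp] = k(1-3)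
  have "k \<cdot> ev1 (onmor K i) = u"
    by (rule cokernel_epi[OF cok[OF iD(1)]]) (simp_all add: kD(7) reassoc[OF k(4)] hD(8))
  moreover have "p \<cdot> k = v"
    by (rule cokernel_epi[OF cok[OF iD(2)]]) (simp_all add: k(4) hD(9))
  ultimately show "\<exists>h\<in>hom C (Cod C (ev1 (onmor K i))) (Dom C p). h \<cdot> ev1 (onmor K i) = u \<and> p \<cdot> h = v"
    by (intro bexI[of _ k]) (simp_all add: hom_iff)
qed

text \<open>Images of \<open>p\<close> under the right adjoints of \<open>Ev1\<close>, of the
  codomain of the cokernel and of \<open>Ev0\<close>, in this order. The second functor is at the
  same time left adjoint to \<open>Ev1\<close>.\<close>

lemma const_levelwise:
  assumes p: "p \<in> hom C X Y" and S: "p \<in> S" "is_wide_subcategory C S"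
  shows "Sq (Ident C X) (Ident C Y) p p \<in> levelwise C S"
    "Sq (zmap C Z X) (zmap C Z Y) (Ident C Z) p \<in> levelwise C S"
    "Sq (zmap C X Z) (zmap C Y Z) p (Ident C Z) \<in> levelwise C S"
proof -
  have [simp]: "X \<in> Obj C" "Y \<in> Obj C" using hom_Obj[OF p] by auto
  note [simp] = homD[OF p]
  have "Ident C Z \<in> S" using S by (simp add: is_wide_subcategory_def)
  then show "Sq (Ident C X) (Ident C Y) p p \<in> levelwise C S"
    "Sq (zmap C Z X) (zmap C Z Y) (Ident C Z) p \<in> levelwise C S"
    "Sq (zmap C X Z) (zmap C Y Z) p (Ident C Z) \<in> levelwise C S"
    using S by (simp_all add: levelwise_iff Arr_Mor)
qed

text \<open>An injective cofibration is tested on each level. The first component of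
  \<open>onmor K i\<close> is \<open>ev1 i\<close>, the second is the map of quotients, and each
  lifts against \<open>p\<close> because \<open>i\<close> lifts against the matching test
  square.\<close>

theorem K_preserves:
  shows "i \<in> Cof (projective C M) \<Longrightarrow> onmor K i \<in> Cof (injective C M)"
    "i \<in> Cof (projective C M) \<inter> Weq (projective C M) \<Longrightarrow> onmor K i \<in> Cof (injective C M) \<inter> Weq (injective C M)"
proof -
  interpret P: model_category "Arr C" U "projective C M" by (rule projective_model)
  have KM: "onmor K i \<in> Mor (Arr C)" if "i \<in> Mor (Arr C)" for i using functorD(2)[OF K_functor that] .
  show "onmor K i \<in> Cof (injective C M)" if i: "i \<in> Cof (projective C M)"
  proof -
    have iM: "i \<in> Mor (Arr C)" using i by simp
    have l: "has_lifting (Arr C) i q" if "q \<in> levelwise C (Fib M)" "q \<in> levelwise C (Weq M)" for q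
      using i that by auto
    have "has_lifting C (ev1 i) p" "has_lifting C (ev1 (onmor K i)) p" if "p \<in> Fib M" "p \<in> Weq M" for p
      using lifting_ev1[OF iM Mor_hom l] lifting_K_ev1[OF iM Mor_hom l] const_levelwise[OF Mor_hom] that
        Fib_Mor Fib_subcat Weq_subcat by blast+
    then have "ev1 i \<in> Cof M" "ev1 (onmor K i) \<in> Cof M"
      using CofI Arr_MorD(4)[OF iM] Arr_MorD(4)[OF KM[OF iM]] by blast+
    then show ?thesis using KM[OF iM] K_mor(3)[OF iM] by (simp add: levelwise_iff)
  qed
  show "onmor K i \<in> Cof (injective C M) \<inter> Weq (injective C M)" if i: "i \<in> Cof (projective C M) \<inter> Weq (projective C M)"
  proof -
    have iM: "i \<in> Mor (Arr C)" using i by simp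
    have l: "has_lifting (Arr C) i q" if "q \<in> levelwise C (Fib M)" for q
      using P.lifting_tcof_fib[OF i] that by simp
    have "has_lifting C (ev1 i) p" "has_lifting C (ev1 (onmor K i)) p" if "p \<in> Fib M" for p
      using lifting_ev1[OF iM Mor_hom l] lifting_K_ev1[OF iM Mor_hom l] const_levelwise[OF Mor_hom] that
        Fib_Mor Fib_subcat by blast+
    then have "ev1 i \<in> Cof M" "ev1 (onmor K i) \<in> Cof M" "ev1 i \<in> Weq M" "ev1 (onmor K i) \<in> Weq M"
      using TCofI Arr_MorD(4)[OF iM] Arr_MorD(4)[OF KM[OF iM]] by blast+
    then show ?thesis using KM[OF iM] K_mor(3)[OF iM] by (simp add: levelwise_iff)
  qed
qed

end

section \<open>The homotopy category\<close>

locale localization = category C for C :: "('o, 'm) cat" (structure) +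
  fixes W :: "'m set"
  assumes W_sub: "w \<in> W \<Longrightarrow> w \<in> Mor C"
begin

abbreviation "H \<equiv> Ho C W"
abbreviation "cls \<equiv> ho_class C W"

text \<open>The canonical functor from \<open>C\<close> to the localization, on morphisms.\<close>

definition L :: "'m \<Rightarrow> ('o, 'm) ho_mor" where "L f = cls (Dom C f) (Cod C f) [Fwd f]"

lemma zigzag_Obj: "zigzag C W X xs Y \<Longrightarrow> X \<in> Obj C \<and> Y \<in> Obj C"
proof (induction xs arbitrary: X)
  case (Cons s xs)
  then show ?case by (cases s) (auto simp: W_sub)
qed simp

lemma zigzag_append: "zigzag C W X (xs @ ys) V \<longleftrightarrow> (\<exists>Y. zigzag C W X xs Y \<and> zigzag C W Y ys V)"
proof (induction xs arbitrary: X)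
  case (Cons s xs)
  then show ?case by (cases s) auto
qed (auto dest: zigzag_Obj)

lemma zigzag_eqD: "zigzag_eq C W X Y xs ys \<Longrightarrow> zigzag C W X xs Y \<and> zigzag C W X ys Y"
proof (induction rule: zigzag_eq.induct)
  case (append X Y xs xs' V ys ys')
  then show ?case by (auto simp: zigzag_append)
qed (auto simp: hom_iff W_sub)

lemma cls_eq_iff:
  assumes "zigzag C W X xs Y"
  shows "cls X Y xs = cls X Y ys \<longleftrightarrow> zigzag_eq C W X Y xs ys"
proof
  assume "cls X Y xs = cls X Y ys"
  then have "{zs. zigzag_eq C W X Y xs zs} = {zs. zigzag_eq C W X Y ys zs}" by (simp add: ho_class_def)
  with zigzag_eq.refl[OF assms] have "zigzag_eq C W X Y ys xs" by blast
  then show "zigzag_eq C W X Y xs ys" by (rule zigzag_eq.sym)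
next
  assume e: "zigzag_eq C W X Y xs ys"
  have "zigzag_eq C W X Y xs zs \<longleftrightarrow> zigzag_eq C W X Y ys zs" for zs
    using zigzag_eq.trans[OF e] zigzag_eq.trans[OF zigzag_eq.sym[OF e]] by blast
  then show "cls X Y xs = cls X Y ys" by (simp add: ho_class_def)
qed

lemma cls_eqI: "zigzag_eq C W X Y xs ys \<Longrightarrow> cls X Y xs = cls X Y ys"
  using cls_eq_iff zigzag_eqD by blast

lemma H_simps [simp]: "Obj H = Obj C" "Dom H (cls X Y xs) = X" "Cod H (cls X Y xs) = Y" "Ident H X = cls X X []"
  by (simp_all add: Ho_def ho_class_def)

lemma cls_Mor: "zigzag C W X xs Y \<Longrightarrow> cls X Y xs \<in> Mor H"
  by (auto simp: Ho_def)

lemma H_MorE: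
  assumes "a \<in> Mor H"
  obtains X Y xs where "zigzag C W X xs Y" "a = cls X Y xs"
  using assms by (auto simp: Ho_def)

lemma H_homE:
  assumes "a \<in> hom H X Y"
  obtains xs where "zigzag C W X xs Y" "a = cls X Y xs"
proof -
  have "a \<in> Mor H" "Dom H a = X" "Cod H a = Y" using homD[OF assms] by auto
  then show thesis using that by (elim H_MorE) auto
qed

lemma cls_hom: "zigzag C W X xs Y \<Longrightarrow> cls X Y xs \<in> hom H X Y"
  using cls_Mor by (simp add: hom_iff)

lemma cls_Comp:
  assumes "zigzag C W X xs Y" "zigzag C W Y ys V"
  shows "cls Y V ys \<cdot>\<^bsub>H\<^esub> cls X Y xs = cls X V (xs @ ys)"
proof -
  have "(\<exists>xs'. zigzag_eq C W X Y xs xs' \<and> (\<exists>ys'. zigzag_eq C W Y V ys ys' \<and> zigzag_eq C W X V (xs' @ ys') zs)) \<longleftrightarrow>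
      zigzag_eq C W X V (xs @ ys) zs" for zs
    using assms zigzag_eq.append[of C W X Y xs] zigzag_eq.trans[of C W X V "xs @ ys"] zigzag_eq.refl by meson
  then show ?thesis by (simp add: Ho_def ho_class_def)
qed

lemma category_H: "category H"
proof (unfold_locales, goal_cases)
  case (1 f)
  then show ?case by (elim H_MorE) (auto dest: zigzag_Obj)
next
  case (2 f)
  then show ?case by (elim H_MorE) (auto dest: zigzag_Obj)
next
  case (3 X)
  then show ?case using cls_hom[of X "[]" X] by simp
next
  case (4 f X Y g V)
  then show ?case by (elim H_homE) (auto simp: cls_Comp zigzag_append intro!: cls_hom)
next
  case (5 f X Y)
  then show ?case using zigzag_Obj by (elim H_homE) (auto simp: cls_Comp)
next
  case (6 f X Y)
  then show ?case using zigzag_Obj by (elim H_homE) (auto simp: cls_Comp)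
next
  case (7 f X Y g V h V')
  from 7(1) obtain xs where x: "zigzag C W X xs Y" "f = cls X Y xs" by (rule H_homE)
  from 7(2) obtain ys where y: "zigzag C W Y ys V" "g = cls Y V ys" by (rule H_homE)
  from 7(3) obtain zs where z: "zigzag C W V zs V'" "h = cls V V' zs" by (rule H_homE)
  have "zigzag C W X (xs @ ys) V" "zigzag C W Y (ys @ zs) V'" using x y z by (auto simp: zigzag_append)
  then show ?case using x y z by (simp add: cls_Comp)
qed

lemma L_hom: "f \<in> Mor C \<Longrightarrow> L f \<in> hom H (Dom C f) (Cod C f)"
  unfolding L_def by (rule cls_hom) simp

lemma L_simps [simp]: "f \<in> Mor C \<Longrightarrow> L f \<in> Mor H" "Dom H (L f) = Dom C f" "Cod H (L f) = Cod C f"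
  using L_hom[of f] by (simp_all add: hom_iff) (simp_all add: L_def)

lemma L_Comp [simp]:
  assumes "f \<in> Mor C" "g \<in> Mor C" "Cod C f = Dom C g"
  shows "L (g \<cdot> f) = L g \<cdot>\<^bsub>H\<^esub> L f"
proof -
  have "zigzag_eq C W (Dom C f) (Cod C g) [Fwd f, Fwd g] [Fwd (g \<cdot> f)]"
    by (rule zigzag_eq.comp[of _ _ _ "Dom C g"]) (use assms in \<open>simp_all add: hom_iff\<close>)
  from cls_eqI[OF this] show ?thesis
    using cls_Comp[of "Dom C f" "[Fwd f]" "Cod C f" "[Fwd g]" "Cod C g"] assms by (simp add: L_def)
qed

lemma L_Ident: "X \<in> Obj C \<Longrightarrow> L (Ident C X) = Ident H X"
  using cls_eqI[OF zigzag_eq.ident[of X C W]] by (simp add: L_def)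

lemma L_inv:
  assumes "w \<in> W"
  shows "cls (Cod C w) (Dom C w) [Bwd w] \<in> hom H (Cod C w) (Dom C w)"
    "L w \<cdot>\<^bsub>H\<^esub> cls (Cod C w) (Dom C w) [Bwd w] = Ident H (Cod C w)"
    "cls (Cod C w) (Dom C w) [Bwd w] \<cdot>\<^bsub>H\<^esub> L w = Ident H (Dom C w)"
proof -
  have w: "w \<in> hom C (Dom C w) (Cod C w)" using W_sub[OF assms] by (simp add: hom_iff)
  note [simp] = homD(1)[OF w]
  show "cls (Cod C w) (Dom C w) [Bwd w] \<in> hom H (Cod C w) (Dom C w)"
    by (rule cls_hom) (use assms in simp)
  show "L w \<cdot>\<^bsub>H\<^esub> cls (Cod C w) (Dom C w) [Bwd w] = Ident H (Cod C w)"
    using cls_eqI[OF zigzag_eq.inv_left[OF assms w]] assms by (simp add: L_def cls_Comp)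
  show "cls (Cod C w) (Dom C w) [Bwd w] \<cdot>\<^bsub>H\<^esub> L w = Ident H (Dom C w)"
    using cls_eqI[OF zigzag_eq.inv_right[OF assms w]] assms by (simp add: L_def cls_Comp)
qed

lemma L_iso: "w \<in> W \<Longrightarrow> is_iso H (L w)"
  unfolding is_iso_def using L_inv[of w] W_sub[of w] by auto

lemma zigzag_map:
  assumes F: "is_functor C D F" and V: "\<And>w. w \<in> W \<Longrightarrow> onmor F w \<in> V"
  shows "zigzag C W X xs Y \<Longrightarrow> zigzag D V (onobj F X) (map (map_step (onmor F)) xs) (onobj F Y)"
proof (induction xs arbitrary: X)
  case Nil
  then show ?case using functorD(1)[OF F] by auto
next
  case (Cons s xs)
  then show ?case using functorD(2-4)[OF F] V by (cases s) (auto simp: W_sub)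
qed

lemma zigzag_eq_map:
  assumes F: "is_functor C D F" and V: "\<And>w. w \<in> W \<Longrightarrow> onmor F w \<in> V"
  shows "zigzag_eq C W X Y xs ys \<Longrightarrow>
    zigzag_eq D V (onobj F X) (onobj F Y) (map (map_step (onmor F)) xs) (map (map_step (onmor F)) ys)"
proof (induction rule: zigzag_eq.induct)
  case (refl X xs Y)
  show ?case by (rule zigzag_eq.refl[OF zigzag_map[OF F V refl]])
next
  case (sym X Y xs ys) show ?case by (rule zigzag_eq.sym[OF sym.IH])
next
  case (trans X Y xs ys zs) show ?case by (rule zigzag_eq.trans[OF trans.IH])
next
  case (append X Y xs xs' Z ys ys') show ?case using zigzag_eq.append[OF append.IH] by simp
next
  case (ident X)
  then show ?case using zigzag_eq.ident[of "onobj F X" D V] functorD(1,5)[OF F] by simp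
next
  case (comp f X Y g Z)
  have fg: "f \<in> Mor C" "g \<in> Mor C" "Cod C f = Dom C g" using comp by (auto simp: hom_iff)
  show ?case
    using zigzag_eq.comp[OF functor_hom[OF F comp(1)] functor_hom[OF F comp(2)], of V] functorD(6)[OF F fg] by simp
next
  case (inv_right w X Y)
  then show ?case using zigzag_eq.inv_right[of "onmor F w" V D "onobj F X" "onobj F Y"] V functor_hom[OF F] by simp
next
  case (inv_left w X Y)
  then show ?case using zigzag_eq.inv_left[of "onmor F w" V D "onobj F X" "onobj F Y"] V functor_hom[OF F] by simp
qed

lemma ho_functor_cls:
  assumes F: "is_functor C D F" and V: "\<And>w. w \<in> W \<Longrightarrow> onmor F w \<in> V" and x: "zigzag C W X xs Y"
  shows "onmor (ho_functor D V F) (cls X Y xs) = ho_class D V (onobj F X) (onobj F Y) (map (map_step (onmor F)) xs)"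
proof -
  have "(\<exists>ys. zigzag_eq C W X Y xs ys \<and> zigzag_eq D V (onobj F X) (onobj F Y) (map (map_step (onmor F)) ys) zs) \<longleftrightarrow>
     zigzag_eq D V (onobj F X) (onobj F Y) (map (map_step (onmor F)) xs) zs" for zs
    using zigzag_eq_map[OF F V] zigzag_eq.refl[OF x] zigzag_eq.trans[of D V "onobj F X" "onobj F Y"] by blast
  then show ?thesis by (simp add: ho_functor_def ho_class_def)
qed

end

lemma ho_functor_L:
  assumes "localization C W" "localization D V" "is_functor C D F" "\<And>w. w \<in> W \<Longrightarrow> onmor F w \<in> V" "f \<in> Mor C"
  shows "onmor (ho_functor D V F) (localization.L C W f) = localization.L D V (onmor F f)"
proof -
  interpret C: localization C W by fact
  interpret D: localization D V by fact
  show ?thesis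
    using C.ho_functor_cls[OF assms(3,4), of "Dom C f" "[Fwd f]" "Cod C f"] assms(5) functorD(3,4)[OF assms(3,5)]
    by (simp add: C.L_def D.L_def)
qed

section \<open>Equivalences of categories\<close>

lemma equivalence_ess_surj:
  assumes "is_equivalence C D F" "Y \<in> Obj D"
  obtains X e where "X \<in> Obj C" "e \<in> hom D (onobj F X) Y" "is_iso D e"
proof -
  obtain G \<epsilon> where "is_functor D C G" "is_natural_iso D D (F \<circ>\<^sub>F G) id_functor \<epsilon>"
    using assms unfolding is_equivalence_def by blast
  then show thesis using that[of "onobj G Y" "\<epsilon> Y"] assms(2)
    by (simp add: is_natural_iso_def id_functor_def functorD(1))
qed

lemma natural_iso_faithful:
  assumes C: "category C" and G: "is_natural_iso C C id_functor (G \<circ>\<^sub>F F) \<eta>"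
    and ab: "a \<in> hom C X Y" "b \<in> hom C X Y" "onmor F a = onmor F b"
  shows "a = b"
proof -
  interpret category C by fact
  have Y: "X \<in> Obj C" "Y \<in> Obj C" using hom_Obj[OF ab(1)] by auto
  have "is_iso C (\<eta> Y)" "\<eta> Y \<in> hom C Y (onobj G (onobj F Y))" "\<eta> Y \<cdot>\<^bsub>C\<^esub> a = \<eta> Y \<cdot>\<^bsub>C\<^esub> b"
    using G Y homD[OF ab(1)] homD[OF ab(2)] ab(3) by (auto simp: is_natural_iso_def id_functor_def) metis
  then show ?thesis using iso_cancel_left[of "\<eta> Y" a b X] ab by (simp add: hom_iff)
qed

lemma natural_iso_faithful':
  assumes C: "category C" and G: "is_natural_iso C C (G \<circ>\<^sub>F F) id_functor \<epsilon>"
    and F: "is_functor C C (G \<circ>\<^sub>F F)"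
    and ab: "a \<in> hom C X Y" "b \<in> hom C X Y" "onmor F a = onmor F b"
  shows "a = b"
proof -
  interpret category C by fact
  have Y: "X \<in> Obj C" "Y \<in> Obj C" using hom_Obj[OF ab(1)] by auto
  have "is_iso C (\<epsilon> X)" "\<epsilon> X \<in> hom C (onobj G (onobj F X)) X" "a \<cdot>\<^bsub>C\<^esub> \<epsilon> X = b \<cdot>\<^bsub>C\<^esub> \<epsilon> X"
    using G Y homD[OF ab(1)] homD[OF ab(2)] ab(3) by (auto simp: is_natural_iso_def id_functor_def) metis
  then show ?thesis using iso_cancel_right[of "\<epsilon> X" a b Y] ab by (simp add: hom_iff)
qed

lemma equivalence_faithful:
  assumes "category C" "is_equivalence C D F" "a \<in> hom C X Y" "b \<in> hom C X Y" "onmor F a = onmor F b"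
  shows "a = b"
proof -
  obtain G \<eta> where "is_natural_iso C C id_functor (G \<circ>\<^sub>F F) \<eta>"
    using assms(2) unfolding is_equivalence_def by blast
  from natural_iso_faithful[OF assms(1) this assms(3-5)] show ?thesis .
qed

text \<open>The preimage is forced by naturality of the unit: \<open>a\<close> is the inverse of
  \<open>\<eta> Y\<close> after \<open>onmor G c\<close> after \<open>\<eta> X\<close>. Then
  \<open>onmor F a\<close> and \<open>c\<close> have the same image under \<open>G\<close>, which is
  faithful because \<open>F \<circ>\<^sub>F G\<close> is isomorphic to the identity.\<close>

lemma equivalence_full:
  assumes C: "category C" and D: "category D" and E: "is_equivalence C D F"
    and X: "X \<in> Obj C" "Y \<in> Obj C" and c: "c \<in> hom D (onobj F X) (onobj F Y)"
  obtains a where "a \<in> hom C X Y" "onmor F a = c"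
proof -
  interpret C: category C by fact
  interpret D: category D by fact
  obtain G \<eta> \<epsilon> where F: "is_functor C D F" and G: "is_functor D C G"
    and \<eta>: "is_natural_iso C C id_functor (G \<circ>\<^sub>F F) \<eta>" and \<epsilon>: "is_natural_iso D D (F \<circ>\<^sub>F G) id_functor \<epsilon>"
    using E unfolding is_equivalence_def by blast
  have e: "\<eta> V \<in> hom C V (onobj G (onobj F V))" "is_iso C (\<eta> V)" if "V \<in> Obj C" for V
    using \<eta> that by (auto simp: is_natural_iso_def id_functor_def)
  note [simp] = homD[OF e(1)[OF X(1)]] homD[OF e(1)[OF X(2)]]
  note Gc = functor_hom[OF G c]
  note [simp] = homD[OF Gc]
  obtain i where i: "i \<in> hom C (onobj G (onobj F Y)) Y" "\<eta> Y \<cdot>\<^bsub>C\<^esub> i = Ident C (onobj G (onobj F Y))"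
    using C.iso_inverse[OF e(2)[OF X(2)]] by auto
  note [simp] = homD[OF i(1)]
  define a where "a = i \<cdot>\<^bsub>C\<^esub> (onmor G c \<cdot>\<^bsub>C\<^esub> \<eta> X)"
  have a: "a \<in> hom C X Y" by (simp add: a_def hom_iff)
  note [simp] = homD[OF a]
  have GFa: "onmor G (onmor F a) \<in> hom C (onobj G (onobj F X)) (onobj G (onobj F Y))"
    by (rule functor_hom[OF G functor_hom[OF F a]])
  have nat: "\<forall>f \<in> Mor C. onmor G (onmor F f) \<cdot>\<^bsub>C\<^esub> \<eta> (Dom C f) = \<eta> (Cod C f) \<cdot>\<^bsub>C\<^esub> f"
    using \<eta> by (simp add: is_natural_iso_def id_functor_def)
  have "onmor G (onmor F a) \<cdot>\<^bsub>C\<^esub> \<eta> X = \<eta> Y \<cdot>\<^bsub>C\<^esub> a"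
    using bspec[OF nat homD(1)[OF a]] by simp
  also have "\<dots> = onmor G c \<cdot>\<^bsub>C\<^esub> \<eta> X"
    unfolding a_def by (simp add: C.reassoc[OF i(2)])
  finally have "onmor G (onmor F a) = onmor G c"
    using C.iso_cancel_right[OF e(2)[OF X(1)], of "onmor G (onmor F a)" "onmor G c" "onobj G (onobj F Y)"] GFa Gc by simp
  then have "onmor F a = c"
    using natural_iso_faithful'[OF D \<epsilon> comp_is_functor[OF D G F] functor_hom[OF F a] c] by simp
  with a that show thesis by blast
qed

section \<open>Maps in the homotopy category\<close>

context model_category
begin

definition some_terminal :: 'o where "some_terminal = (SOME T. is_terminal C T)"

definition bang :: "'o \<Rightarrow> 'm" where "bang X = (THE f. f \<in> hom C X some_terminal)"

definition fib_fac :: "('m, 'm square, 'm, 'm square) cfunctor" where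
  "fib_fac = (SOME \<gamma>. \<exists>\<delta>. factors_into C (Cof M \<inter> Weq M) (Fib M) \<gamma> \<delta>)"

text \<open>Functorial fibrant replacement: the left factor of the map to a terminal object, for a
  factorization fixed once.\<close>

definition frep :: "'o \<Rightarrow> 'm" where "frep X = onobj fib_fac (bang X)"

definition fobj :: "'o \<Rightarrow> 'o" where "fobj X = Cod C (frep X)"

definition fmor :: "'m \<Rightarrow> 'm" where
  "fmor f = ev1 (onmor fib_fac (Sq (bang (Dom C f)) (bang (Cod C f)) f (Ident C some_terminal)))"

lemma some_terminal: "is_terminal C some_terminal"
  unfolding some_terminal_def using terminal_ex by (rule someI_ex)

lemma bang: "X \<in> Obj C \<Longrightarrow> bang X \<in> hom C X some_terminal"
  unfolding bang_def by (rule theI') (use some_terminal in \<open>simp add: is_terminal_def\<close>)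

lemma fib_fac: "\<exists>\<delta>. factors_into C (Cof M \<inter> Weq M) (Fib M) fib_fac \<delta>"
  unfolding fib_fac_def using factor_tcof_fib by (rule someI_ex)

lemma frep:
  assumes X: "X \<in> Obj C"
  shows "frep X \<in> Mor C" "Dom C (frep X) = X" "Cod C (frep X) = fobj X"
    "frep X \<in> Cof M" "frep X \<in> Weq M" "is_fibrant C M (fobj X)"
proof -
  obtain \<delta> where d: "factors_into C (Cof M \<inter> Weq M) (Fib M) fib_fac \<delta>" using fib_fac by blast
  have b: "bang X \<in> Mor C" "Dom C (bang X) = X" "Cod C (bang X) = some_terminal" using homD[OF bang[OF X]] by auto
  then show c: "frep X \<in> Cof M" "frep X \<in> Weq M" "Dom C (frep X) = X" "Cod C (frep X) = fobj X"
    using d by (auto simp: factors_into_def functorial_factorization_def frep_def fobj_def)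
  then show "frep X \<in> Mor C" using Cof_Mor by blast
  have "onobj \<delta> (bang X) \<in> Fib M" "Dom C (onobj \<delta> (bang X)) = fobj X" "Cod C (onobj \<delta> (bang X)) = some_terminal"
    using d b by (auto simp: factors_into_def functorial_factorization_def frep_def fobj_def)
  then show "is_fibrant C M (fobj X)"
    using some_terminal Fib_Mor by (auto simp: is_fibrant_def hom_iff)
qed

lemma fmor_sq:
  assumes "f \<in> Mor C"
  shows "Sq (bang (Dom C f)) (bang (Cod C f)) f (Ident C some_terminal) \<in> hom (Arr C) (bang (Dom C f)) (bang (Cod C f))"
proof -
  note b = homD[OF bang[of "Dom C f"]] homD[OF bang[of "Cod C f"]]
  have t: "some_terminal \<in> Obj C" using some_terminal by (simp add: is_terminal_def)
  have "bang (Cod C f) \<cdot> f = bang (Dom C f)"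
    by (rule terminal_hom_eq[OF some_terminal, of _ "Dom C f"]) (use assms b in \<open>simp_all add: hom_iff\<close>)
  then show ?thesis using assms b t by (simp add: Arr_hom)
qed

lemma fmor [simp]:
  assumes f: "f \<in> Mor C"
  shows "fmor f \<in> Mor C" "Dom C (fmor f) = fobj (Dom C f)" "Cod C (fmor f) = fobj (Cod C f)"
    and fmor_frep: "fmor f \<cdot> frep (Dom C f) = frep (Cod C f) \<cdot> f"
proof -
  obtain \<delta> where d: "factors_into C (Cof M \<inter> Weq M) (Fib M) fib_fac \<delta>" using fib_fac by blast
  then have F: "is_functor (Arr C) (Arr C) fib_fac" and e: "\<And>s. s \<in> Mor (Arr C) \<Longrightarrow> ev0 (onmor fib_fac s) = ev0 s"
    by (auto simp: factors_into_def functorial_factorization_def)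
  have "onmor fib_fac (Sq (bang (Dom C f)) (bang (Cod C f)) f (Ident C some_terminal)) \<in> hom (Arr C) (frep (Dom C f)) (frep (Cod C f))"
    using functor_hom[OF F fmor_sq[OF f]] by (simp add: frep_def)
  then show "fmor f \<in> Mor C" "Dom C (fmor f) = fobj (Dom C f)" "Cod C (fmor f) = fobj (Cod C f)"
     "fmor f \<cdot> frep (Dom C f) = frep (Cod C f) \<cdot> f"
    using e[OF homD(1)[OF fmor_sq[OF f]]] by (simp_all add: Arr_hom fmor_def fobj_def)
qed

lemma fmor_Ident: "X \<in> Obj C \<Longrightarrow> fmor (Ident C X) = Ident C (fobj X)"
proof -
  assume X: "X \<in> Obj C"
  obtain \<delta> where d: "factors_into C (Cof M \<inter> Weq M) (Fib M) fib_fac \<delta>" using fib_fac by blast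
  then have F: "is_functor (Arr C) (Arr C) fib_fac" by (auto simp: factors_into_def functorial_factorization_def)
  show ?thesis
    using functorD(5)[OF F, of "bang X"] homD[OF bang[OF X]] X by (simp add: fmor_def frep_def fobj_def)
qed

lemma fmor_Comp:
  assumes f: "f \<in> Mor C" and g: "g \<in> Mor C" and c: "Cod C f = Dom C g"
  shows "fmor (g \<cdot> f) = fmor g \<cdot> fmor f"
proof -
  obtain \<delta> where d: "factors_into C (Cof M \<inter> Weq M) (Fib M) fib_fac \<delta>" using fib_fac by blast
  then have F: "is_functor (Arr C) (Arr C) fib_fac" by (auto simp: factors_into_def functorial_factorization_def)
  have t: "some_terminal \<in> Obj C" using some_terminal by (simp add: is_terminal_def)
  show ?thesis
    using functorD(6)[OF F homD(1)[OF fmor_sq[OF f]] homD(1)[OF fmor_sq[OF g]]] f g c t by (simp add: fmor_def)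
qed

lemma fmor_Weq: 
  assumes "f \<in> Weq M"
  shows "fmor f \<in> Weq M"
proof -
  have f: "f \<in> Mor C" using Weq_Mor assms by blast
  note r1 = frep[OF Dom_Obj[OF f]] and r2 = frep[OF Cod_Obj[OF f]]
  have "fmor f \<cdot> frep (Dom C f) \<in> Weq M"
    unfolding fmor_frep[OF f] using W_comp[OF assms r2(5)] r2(2) by simp
  then show ?thesis using W_left[OF r1(5), of "fmor f"] r1 f by simp
qed

sublocale ho: localization C "Weq M"
  by unfold_locales (rule Weq_Mor)

text \<open>Both ends of a cylinder are sections of \<open>s\<close>, which becomes invertible in
  the localization, so they have the same class.\<close>

lemma homotopic_L:
  assumes "homotopic C M f g" "f \<in> hom C X Y"
  shows "ho.L f = ho.L g"
proof -
  interpret H: category ho.H by (rule ho.category_H)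
  obtain V i0 i1 s h where c: "cylinder_on C M X V i0 i1 s" and h: "h \<in> hom C V Y" "h \<cdot> i0 = f" "h \<cdot> i1 = g"
    using assms unfolding homotopic_def by (auto simp: hom_iff[of f])
  note cD = cylinder_onD[OF c]
  note [simp] = homD[OF cD(1)] homD[OF cD(2)] homD[OF cD(3)] homD[OF h(1)]
  have "ho.L (s \<cdot> i0) = ho.L (s \<cdot> i1)" using cD(5,6) by simp
  then have "ho.L s \<cdot>\<^bsub>ho.H\<^esub> ho.L i0 = ho.L s \<cdot>\<^bsub>ho.H\<^esub> ho.L i1" by simp
  from H.iso_cancel_left[OF ho.L_iso[OF cD(4)] this, of X] have "ho.L i0 = ho.L i1"
    by (simp add: hom_iff)
  then have "ho.L (h \<cdot> i0) = ho.L (h \<cdot> i1)" by simp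
  then show ?thesis using h by simp
qed

text \<open>A string of arrows acts on homotopy classes of maps from \<open>W\<close> into fibrant
  replacements: a forward step composes, a backward step picks a preimage up to homotopy. Hence
  \<open>act\<close> is a relation rather than a function. It serves to read homotopies off from
  equalities in the localization, which are only known through generating relations.\<close>

primrec act :: "'o \<Rightarrow> 'm step list \<Rightarrow> 'm \<Rightarrow> 'm \<Rightarrow> bool" where
  "act W [] = homotopic C M"
| "act W (s # xs) = (case s of Fwd f \<Rightarrow> (\<lambda>h. act W xs (fmor f \<cdot> h))
     | Bwd w \<Rightarrow> (\<lambda>h k. \<exists>h' \<in> hom C W (fobj (Dom C w)). homotopic C M (fmor w \<cdot> h') h \<and> act W xs h' k))"

context
  fixes W assumes W: "is_cofibrant C M W"
begin

lemma fobj_fibrant [simp]: "X \<in> Obj C \<Longrightarrow> is_fibrant C M (fobj X)"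
  using frep(6) .

lemma act_cong:
  "\<lbrakk>zigzag C (Weq M) X xs Y; h \<in> hom C W (fobj X); h' \<in> hom C W (fobj X); homotopic C M h h'\<rbrakk> \<Longrightarrow> act W xs h k = act W xs h' k"
proof (induction xs arbitrary: X h h')
  case Nil
  then have XO: "X \<in> Obj C" by auto
  note X = frep(6)[OF XO]
  show ?case
    using homotopic_trans[OF W X homotopic_sym[OF W X Nil(4,2)] _ Nil(3)] homotopic_trans[OF W X Nil(4) _ Nil(2)]
    by auto
next
  case (Cons s xs)
  show ?case
  proof (cases s)
    case (Fwd f)
    then have f: "f \<in> Mor C" "Dom C f = X" "zigzag C (Weq M) (Cod C f) xs Y" using Cons.prems by auto
    have fm: "fmor f \<in> hom C (fobj X) (fobj (Cod C f))" using f by (simp add: hom_iff)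
    have "act W xs (fmor f \<cdot> h) k = act W xs (fmor f \<cdot> h') k"
      by (rule Cons.IH[OF f(3)])
        (use homotopic_post[OF Cons.prems(4,2) fm] homD[OF Cons.prems(2)] homD[OF Cons.prems(3)] f in \<open>simp_all add: hom_iff\<close>)
    then show ?thesis using Fwd by simp
  next
    case (Bwd w)
    then have w: "w \<in> Weq M" "Cod C w = X" "w \<in> Mor C" using Cons.prems Weq_Mor by auto
    then have X: "is_fibrant C M (fobj X)" by auto
    have "homotopic C M (fmor w \<cdot> h'') h \<longleftrightarrow> homotopic C M (fmor w \<cdot> h'') h'" if "h'' \<in> hom C W (fobj (Dom C w))" for h''
    proof -
      have "fmor w \<cdot> h'' \<in> hom C W (fobj X)" using homD[OF that] w by (simp add: hom_iff)
      then show ?thesis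
        using homotopic_trans[OF W X] homotopic_sym[OF W X] Cons.prems by blast
    qed
    then show ?thesis using Bwd by auto
  qed
qed

lemma act_hom:
  "\<lbrakk>zigzag C (Weq M) X xs Y; h \<in> hom C W (fobj X); act W xs h k\<rbrakk> \<Longrightarrow> k \<in> hom C W (fobj Y)"
proof (induction xs arbitrary: X h)
  case Nil
  then show ?case using homotopic_hom[OF W fobj_fibrant, of X h k] by auto
next
  case (Cons s xs)
  show ?case
  proof (cases s)
    case (Fwd f)
    then have f: "f \<in> Mor C" "Dom C f = X" "zigzag C (Weq M) (Cod C f) xs Y" using Cons.prems by auto
    show ?thesis
      by (rule Cons.IH[OF f(3), of "fmor f \<cdot> h"]) (use Cons.prems(3) homD[OF Cons.prems(2)] f Fwd in \<open>simp_all add: hom_iff\<close>)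
  next
    case (Bwd w)
    then show ?thesis using Cons by auto
  qed
qed

lemma act_append:
  "\<lbrakk>zigzag C (Weq M) X xs Y; zigzag C (Weq M) Y ys V; h \<in> hom C W (fobj X)\<rbrakk>
    \<Longrightarrow> act W (xs @ ys) h k \<longleftrightarrow> (\<exists>m \<in> hom C W (fobj Y). act W xs h m \<and> act W ys m k)"
proof (induction xs arbitrary: X h)
  case Nil
  then have X: "is_fibrant C M (fobj X)" "X = Y" by auto
  have hY: "h \<in> hom C W (fobj Y)" using Nil(3) X(2) by simp
  have eq: "act W ys h k = act W ys m k" if "homotopic C M h m" for m
    by (rule act_cong[OF Nil(2) hY _ that]) (use homotopic_hom[OF W X(1) that Nil(3)] X(2) in simp)
  show ?case unfolding act.simps append_Nil using eq homotopic_refl[OF W X(1) Nil(3)] hY by blast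
next
  case (Cons s xs)
  show ?case
  proof (cases s)
    case (Fwd f)
    then have f: "f \<in> Mor C" "Dom C f = X" "zigzag C (Weq M) (Cod C f) xs Y" using Cons.prems by auto
    have "fmor f \<cdot> h \<in> hom C W (fobj (Cod C f))" using f homD[OF Cons.prems(3)] by (simp add: hom_iff)
    from Cons.IH[OF f(3) Cons.prems(2) this] show ?thesis using Fwd by simp
  next
    case (Bwd w)
    then have w: "zigzag C (Weq M) (Dom C w) xs Y" using Cons.prems by auto
    show ?thesis using Cons.IH[OF w Cons.prems(2)] Bwd by auto
  qed
qed

text \<open>Checked on the generating relations. A formal inverse cancels because a weak equivalence
  between fibrant objects is bijective on homotopy classes out of the cofibrant
  \<open>W\<close>.\<close>

lemma act_eq:
  "zigzag_eq C (Weq M) X Y xs ys \<Longrightarrow> (\<forall>h \<in> hom C W (fobj X). \<forall>k. act W xs h k = act W ys h k)"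
proof (induction rule: zigzag_eq.induct)
  case (append X Y xs xs' V ys ys')
  show ?case
  proof (intro ballI allI)
    fix h k assume h: "h \<in> hom C W (fobj X)"
    note z = ho.zigzag_eqD[OF append(1)] ho.zigzag_eqD[OF append(2)]
    show "act W (xs @ ys) h k = act W (xs' @ ys') h k"
      unfolding act_append[OF z(1)[THEN conjunct1] z(2)[THEN conjunct1] h] act_append[OF z(1)[THEN conjunct2] z(2)[THEN conjunct2] h]
      using append.IH h by auto
  qed
next
  case (ident X)
  show ?case
    using ident by (auto simp: fmor_Ident hom_iff)
next
  case (comp f X Y g V)
  have fg: "f \<in> Mor C" "g \<in> Mor C" "Cod C f = Y" "Dom C g = Y" "Dom C f = X" "Cod C g = V" using comp by (auto simp: hom_iff)
  show ?case using fg by (auto simp: fmor_Comp hom_iff)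
next
  case (inv_right w X Y)
  note w = homD[OF inv_right(2)]
  have o: "X \<in> Obj C" "Y \<in> Obj C" using hom_Obj[OF inv_right(2)] by auto
  note fx = frep(6)[OF o(1)] frep(6)[OF o(2)]
  have fw: "fmor w \<in> Weq M" "fmor w \<in> hom C (fobj X) (fobj Y)" using fmor_Weq[OF inv_right(1)] w by (simp_all add: hom_iff)
  show ?case
  proof (intro ballI allI)
    fix h k assume h: "h \<in> hom C W (fobj X)"
    have "(\<exists>h' \<in> hom C W (fobj X). homotopic C M (fmor w \<cdot> h') (fmor w \<cdot> h) \<and> homotopic C M h' k) \<longleftrightarrow> homotopic C M h k"
    proof
      assume "\<exists>h' \<in> hom C W (fobj X). homotopic C M (fmor w \<cdot> h') (fmor w \<cdot> h) \<and> homotopic C M h' k"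
      then obtain h' where h': "h' \<in> hom C W (fobj X)" "homotopic C M (fmor w \<cdot> h') (fmor w \<cdot> h)" "homotopic C M h' k" by blast
      from homotopic_weq_inj[OF fw fx W h'(2,1) h] have "homotopic C M h' h" .
      from homotopic_trans[OF W fx(1) homotopic_sym[OF W fx(1) this h'(1)] h'(3) h] show "homotopic C M h k" .
    next
      assume k: "homotopic C M h k"
      have "fmor w \<cdot> h \<in> hom C W (fobj Y)" using homD[OF h] homD[OF fw(2)] by (simp add: hom_iff)
      then show "\<exists>h' \<in> hom C W (fobj X). homotopic C M (fmor w \<cdot> h') (fmor w \<cdot> h) \<and> homotopic C M h' k"
        using homotopic_refl[OF W fx(2)] h k by blast
    qed
    then show "act W [Fwd w, Bwd w] h k = act W [] h k" using w by simp
  qed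
next
  case (inv_left w X Y)
  note w = homD[OF inv_left(2)]
  have o: "X \<in> Obj C" "Y \<in> Obj C" using hom_Obj[OF inv_left(2)] by auto
  note fx = frep(6)[OF o(1)] frep(6)[OF o(2)]
  have fw: "fmor w \<in> Weq M" "fmor w \<in> hom C (fobj X) (fobj Y)" using fmor_Weq[OF inv_left(1)] w by (simp_all add: hom_iff)
  show ?case
  proof (intro ballI allI)
    fix h k assume h: "h \<in> hom C W (fobj Y)"
    have "(\<exists>h' \<in> hom C W (fobj X). homotopic C M (fmor w \<cdot> h') h \<and> homotopic C M (fmor w \<cdot> h') k) \<longleftrightarrow> homotopic C M h k"
    proof
      assume "\<exists>h' \<in> hom C W (fobj X). homotopic C M (fmor w \<cdot> h') h \<and> homotopic C M (fmor w \<cdot> h') k"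
      then obtain h' where h': "h' \<in> hom C W (fobj X)" "homotopic C M (fmor w \<cdot> h') h" "homotopic C M (fmor w \<cdot> h') k" by blast
      have "fmor w \<cdot> h' \<in> hom C W (fobj Y)" using homD[OF h'(1)] homD[OF fw(2)] by (simp add: hom_iff)
      from homotopic_trans[OF W fx(2) homotopic_sym[OF W fx(2) h'(2) this] h'(3) h] show "homotopic C M h k" .
    next
      assume k: "homotopic C M h k"
      from homotopic_weq_surj[OF fw fx W h] obtain h' where h': "h' \<in> hom C W (fobj X)" "homotopic C M (fmor w \<cdot> h') h" by blast
      have "fmor w \<cdot> h' \<in> hom C W (fobj Y)" using homD[OF h'(1)] homD[OF fw(2)] by (simp add: hom_iff)
      from homotopic_trans[OF W fx(2) h'(2) k this] h' 
      show "\<exists>h' \<in> hom C W (fobj X). homotopic C M (fmor w \<cdot> h') h \<and> homotopic C M (fmor w \<cdot> h') k" by blast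
    qed
    then show "act W [Bwd w, Fwd w] h k = act W [] h k" using w by simp
  qed
qed auto

lemma act_ex:
  "\<lbrakk>zigzag C (Weq M) X xs Y; h \<in> hom C W (fobj X)\<rbrakk> \<Longrightarrow> \<exists>k. act W xs h k"
proof (induction xs arbitrary: X h)
  case Nil
  then show ?case using homotopic_refl[OF W fobj_fibrant, of X h] by auto
next
  case (Cons s xs)
  show ?case
  proof (cases s)
    case (Fwd f)
    then have f: "f \<in> Mor C" "Dom C f = X" "zigzag C (Weq M) (Cod C f) xs Y" using Cons.prems by auto
    have "fmor f \<cdot> h \<in> hom C W (fobj (Cod C f))" using f homD[OF Cons.prems(2)] by (simp add: hom_iff)
    from Cons.IH[OF f(3) this] show ?thesis using Fwd by simp
  next
    case (Bwd w)
    then have w: "w \<in> Weq M" "Cod C w = X" "zigzag C (Weq M) (Dom C w) xs Y" using Cons.prems by auto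
    have wM: "w \<in> Mor C" using Weq_Mor w by blast
    have fw: "fmor w \<in> hom C (fobj (Dom C w)) (fobj X)" using wM w by (simp add: hom_iff)
    have "is_fibrant C M (fobj (Dom C w))" "is_fibrant C M (fobj X)" using wM w(2) by auto
    from homotopic_weq_surj[OF fmor_Weq[OF w(1)] fw this W Cons.prems(2)]
    obtain h' where h': "h' \<in> hom C W (fobj (Dom C w))" "homotopic C M (fmor w \<cdot> h') h" by blast
    from Cons.IH[OF w(3) h'(1)] h' show ?thesis using Bwd by auto
  qed
qed

text \<open>Links the action to composition. The invariant is that a map into the fibrant
  replacement represents a morphism of the localization, and each step of the string preserves it by
  naturality of \<open>frep\<close>.\<close>

lemma act_represents:
  "\<lbrakk>zigzag C (Weq M) X xs Y; h \<in> hom C W (fobj X); act W xs h k; a \<in> hom ho.H W X;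
    ho.L (frep X) \<cdot>\<^bsub>ho.H\<^esub> a = ho.L h\<rbrakk> \<Longrightarrow> ho.L (frep Y) \<cdot>\<^bsub>ho.H\<^esub> (ho.cls X Y xs \<cdot>\<^bsub>ho.H\<^esub> a) = ho.L k"
proof (induction xs arbitrary: X h a)
  interpret H: category ho.H by (rule ho.category_H)
  case Nil
  then have X: "X = Y" "X \<in> Obj C" by auto
  have "ho.cls X Y [] \<cdot>\<^bsub>ho.H\<^esub> a = a" using H.Comp_Ident_left[OF Nil(4)] X by simp
  then show ?case using Nil homotopic_L[of h k W "fobj X"] X by simp
next
  interpret H: category ho.H by (rule ho.category_H)
  case (Cons s xs)
  have XY: "X \<in> Obj C" "Y \<in> Obj C" using ho.zigzag_Obj[OF Cons.prems(1)] by auto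
  note aH [simp] = homD[OF Cons.prems(4)]
  note h [simp] = homD[OF Cons.prems(2)]
  note [simp] = frep(1-3)[OF XY(1)]
  show ?case
  proof (cases s)
    case (Fwd f)
    then have f: "f \<in> Mor C" "Dom C f = X" "zigzag C (Weq M) (Cod C f) xs Y" using Cons.prems by auto
    note [simp] = f(1,2) frep(1-3)[OF Cod_Obj[OF f(1)]]
    have fh: "fmor f \<cdot> h \<in> hom C W (fobj (Cod C f))" by (simp add: hom_iff)
    have fa: "ho.L f \<cdot>\<^bsub>ho.H\<^esub> a \<in> hom ho.H W (Cod C f)" by (simp add: hom_iff)
    have "ho.L (frep (Cod C f)) \<cdot>\<^bsub>ho.H\<^esub> ho.L f = ho.L (fmor f) \<cdot>\<^bsub>ho.H\<^esub> ho.L (frep X)"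
      using fmor_frep[OF f(1)] ho.L_Comp[of f "frep (Cod C f)"] ho.L_Comp[of "frep X" "fmor f"] by simp
    from H.reassoc2[OF this, of a] Cons.prems(5)
    have e: "ho.L (frep (Cod C f)) \<cdot>\<^bsub>ho.H\<^esub> (ho.L f \<cdot>\<^bsub>ho.H\<^esub> a) = ho.L (fmor f \<cdot> h)" by simp
    have c: "ho.cls X Y (s # xs) = ho.cls (Cod C f) Y xs \<cdot>\<^bsub>ho.H\<^esub> ho.L f"
      using ho.cls_Comp[of X "[Fwd f]" "Cod C f" xs Y] f(3) Fwd XY by (simp add: ho.L_def)
    have xs: "ho.cls (Cod C f) Y xs \<in> hom ho.H (Cod C f) Y" using ho.cls_hom[OF f(3)] .
    have "act W xs (fmor f \<cdot> h) k" using Cons.prems(3) Fwd by simp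
    from Cons.IH[OF f(3) fh this fa e] show ?thesis unfolding c using homD[OF xs] by simp
  next
    case (Bwd w)
    then have w: "w \<in> Weq M" "Cod C w = X" "zigzag C (Weq M) (Dom C w) xs Y" using Cons.prems by auto
    have wM [simp]: "w \<in> Mor C" using Weq_Mor w by blast
    note [simp] = w(2) frep(1-3)[OF Dom_Obj[OF wM]]
    obtain h' where h': "h' \<in> hom C W (fobj (Dom C w))" "homotopic C M (fmor w \<cdot> h') h" "act W xs h' k"
      using Cons.prems(3) Bwd by auto
    note [simp] = homD[OF h'(1)]
    let ?v = "ho.cls X (Dom C w) [Bwd w]"
    note v = ho.L_inv[OF w(1), unfolded w(2)]
    note [simp] = homD[OF v(1)]
    have va: "?v \<cdot>\<^bsub>ho.H\<^esub> a \<in> hom ho.H W (Dom C w)" by (simp add: hom_iff)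
    have 1: "ho.L (fmor w) \<cdot>\<^bsub>ho.H\<^esub> ho.L (frep (Dom C w)) = ho.L (frep X) \<cdot>\<^bsub>ho.H\<^esub> ho.L w"
      using fmor_frep[OF wM] ho.L_Comp[of w "frep X"] ho.L_Comp[of "frep (Dom C w)" "fmor w"] by simp
    have IX: "Ident ho.H X \<cdot>\<^bsub>ho.H\<^esub> a = a" using H.Comp_Ident_left[OF Cons.prems(4)] .
    have "ho.L (fmor w) \<cdot>\<^bsub>ho.H\<^esub> (ho.L (frep (Dom C w)) \<cdot>\<^bsub>ho.H\<^esub> (?v \<cdot>\<^bsub>ho.H\<^esub> a)) = ho.L (frep X) \<cdot>\<^bsub>ho.H\<^esub> a"
      using H.reassoc2[OF 1, of "?v \<cdot>\<^bsub>ho.H\<^esub> a"] H.reassoc[OF v(2), of a] IX by simp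
    also have "\<dots> = ho.L (fmor w) \<cdot>\<^bsub>ho.H\<^esub> ho.L h'"
      using Cons.prems(5) homotopic_L[OF h'(2), of W "fobj X"] by (simp add: hom_iff)
    finally have "ho.L (frep (Dom C w)) \<cdot>\<^bsub>ho.H\<^esub> (?v \<cdot>\<^bsub>ho.H\<^esub> a) = ho.L h'"
      using H.iso_cancel_left[OF ho.L_iso[OF fmor_Weq[OF w(1)]], of _ _ W] by (simp add: hom_iff)
    from Cons.IH[OF w(3) h'(1,3) va this]
    have r: "ho.L (frep Y) \<cdot>\<^bsub>ho.H\<^esub> (ho.cls (Dom C w) Y xs \<cdot>\<^bsub>ho.H\<^esub> (?v \<cdot>\<^bsub>ho.H\<^esub> a)) = ho.L k" .
    have c: "ho.cls X Y (s # xs) = ho.cls (Dom C w) Y xs \<cdot>\<^bsub>ho.H\<^esub> ?v"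
      using ho.cls_Comp[of X "[Bwd w]" "Dom C w" xs Y] w Bwd XY by simp
    have xs: "ho.cls (Dom C w) Y xs \<in> hom ho.H (Dom C w) Y" using ho.cls_hom[OF w(3)] .
    show ?thesis unfolding c using homD[OF xs] r by simp
  qed
qed

text \<open>Let the string act on \<open>frep W\<close>. The result is a map into the replacement of
  \<open>Y\<close>, and since \<open>Y\<close> is itself fibrant it comes, up to homotopy, from a
  map into \<open>Y\<close>.\<close>

lemma ho_strict:
  assumes Y: "is_fibrant C M Y" and x: "x \<in> hom ho.H W Y"
  obtains f where "f \<in> hom C W Y" "ho.L f = x"
proof -
  interpret H: category ho.H by (rule ho.category_H)
  have o: "W \<in> Obj C" "Y \<in> Obj C" using cofibrant_Obj[OF W] fibrant_Obj[OF Y] by auto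
  note [simp] = frep(1-3)[OF o(1)] frep(1-3)[OF o(2)] homD[OF x] o
  obtain xs where xs: "zigzag C (Weq M) W xs Y" "x = ho.cls W Y xs" using x by (rule ho.H_homE)
  have j: "frep W \<in> hom C W (fobj W)" by (simp add: hom_iff)
  from act_ex[OF xs(1) j] obtain k where k: "act W xs (frep W) k" by blast
  have kh: "k \<in> hom C W (fobj Y)" using act_hom[OF xs(1) j k] .
  have I: "Ident ho.H W \<in> hom ho.H W W" using H.Ident_in[of W] by simp
  have "ho.L (frep W) \<cdot>\<^bsub>ho.H\<^esub> Ident ho.H W = ho.L (frep W)" using H.Comp_Ident_right[OF ho.L_hom[of "frep W"]] by simp
  from act_represents[OF xs(1) j k I this]
  have e: "ho.L (frep Y) \<cdot>\<^bsub>ho.H\<^esub> x = ho.L k" using H.Comp_Ident_right[OF x] xs(2) by simp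
  have jY: "frep Y \<in> hom C Y (fobj Y)" by (simp add: hom_iff)
  from homotopic_weq_surj[OF frep(5)[OF o(2)] jY Y frep(6)[OF o(2)] W kh]
  obtain f where f: "f \<in> hom C W Y" "homotopic C M (frep Y \<cdot> f) k" by blast
  note [simp] = homD[OF f(1)]
  have "ho.L (frep Y) \<cdot>\<^bsub>ho.H\<^esub> ho.L f = ho.L (frep Y) \<cdot>\<^bsub>ho.H\<^esub> x"
    using homotopic_L[OF f(2), of W "fobj Y"] e by (simp add: hom_iff)
  then have "ho.L f = x"
    using H.iso_cancel_left[OF ho.L_iso[OF frep(5)[OF o(2)]], of "ho.L f" x W] by (simp add: hom_iff)
  with f that show thesis by blast
qed

text \<open>The two one-step strings are equivalent, so they act alike on \<open>frep W\<close>.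
  This gives a homotopy after composing with \<open>frep Y\<close>, which is injective on homotopy
  classes.\<close>

lemma L_homotopic:
  assumes Y: "is_fibrant C M Y" and f: "f \<in> hom C W Y" and g: "g \<in> hom C W Y" and e: "ho.L f = ho.L g"
  shows "homotopic C M f g"
proof -
  have o: "W \<in> Obj C" "Y \<in> Obj C" using cofibrant_Obj[OF W] fibrant_Obj[OF Y] by auto
  note [simp] = frep(1-3)[OF o(1)] frep(1-3)[OF o(2)] homD[OF f] homD[OF g]
  have z: "zigzag C (Weq M) W [Fwd f] Y" using o by simp
  have zz: "zigzag_eq C (Weq M) W Y [Fwd f] [Fwd g]"
    using e ho.cls_eq_iff[OF z] by (simp add: ho.L_def)
  have j: "frep W \<in> hom C W (fobj W)" by (simp add: hom_iff)
  have gj: "fmor g \<cdot> frep W \<in> hom C W (fobj Y)" by (simp add: hom_iff)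
  have "act W [Fwd g] (frep W) (fmor g \<cdot> frep W)"
    using homotopic_refl[OF W frep(6)[OF o(2)] gj] by simp
  then have "homotopic C M (fmor f \<cdot> frep W) (fmor g \<cdot> frep W)"
    using act_eq[OF zz] j by simp
  then have h: "homotopic C M (frep Y \<cdot> f) (frep Y \<cdot> g)" using fmor_frep[of f] fmor_frep[of g] by simp
  have jY: "frep Y \<in> hom C Y (fobj Y)" by (simp add: hom_iff)
  from homotopic_weq_inj[OF frep(5)[OF o(2)] jY Y frep(6)[OF o(2)] W h f g] show ?thesis .
qed

end

section \<open>Saturation: maps that become invertible are weak equivalences\<close>

lemma L_iso_Weq_bifibrant:
  assumes f: "f \<in> hom C X Y" and i: "is_iso ho.H (ho.L f)"
    and X: "is_cofibrant C M X" "is_fibrant C M X" and Y: "is_cofibrant C M Y" "is_fibrant C M Y"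
  shows "f \<in> Weq M"
proof -
  interpret H: category ho.H by (rule ho.category_H)
  have o: "X \<in> Obj C" "Y \<in> Obj C" using hom_Obj[OF f] by auto
  note [simp] = homD[OF f] o
  obtain x where x: "x \<in> hom ho.H Y X" "x \<cdot>\<^bsub>ho.H\<^esub> ho.L f = Ident ho.H X" "ho.L f \<cdot>\<^bsub>ho.H\<^esub> x = Ident ho.H Y"
    by (rule H.iso_inverse[OF i]) (rule that, simp_all)
  obtain g where g: "g \<in> hom C Y X" "ho.L g = x" using ho_strict[OF Y(1) X(2) x(1)] by blast
  note [simp] = homD[OF g(1)]
  have e: "ho.L (g \<cdot> f) = ho.L (Ident C X)" "ho.L (f \<cdot> g) = ho.L (Ident C Y)"
    using x g ho.L_Ident[of X] ho.L_Ident[of Y] by simp_all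
  have "homotopic C M (g \<cdot> f) (Ident C X)"
    by (rule L_homotopic[OF X(1) X(2) _ _ e(1)]) (simp_all add: hom_iff)
  moreover have "homotopic C M (f \<cdot> g) (Ident C Y)"
    by (rule L_homotopic[OF Y(1) Y(2) _ _ e(2)]) (simp_all add: hom_iff)
  ultimately show ?thesis using whitehead[OF f g(1) _ _ X Y] by blast
qed

lemma frep_iso_iff:
  assumes f: "f \<in> Mor C"
  shows "is_iso ho.H (ho.L (fmor f)) \<longleftrightarrow> is_iso ho.H (ho.L f)"
proof -
  interpret H: category ho.H by (rule ho.category_H)
  note [simp] = f frep(1-3)[OF Dom_Obj[OF f]] frep(1-3)[OF Cod_Obj[OF f]]
  have e: "ho.L (fmor f) \<cdot>\<^bsub>ho.H\<^esub> ho.L (frep (Dom C f)) = ho.L (frep (Cod C f)) \<cdot>\<^bsub>ho.H\<^esub> ho.L f"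
    using ho.L_Comp[of "frep (Dom C f)" "fmor f"] ho.L_Comp[of f "frep (Cod C f)"] fmor_frep[OF f] by simp
  have i: "is_iso ho.H (ho.L (frep (Dom C f)))" "is_iso ho.H (ho.L (frep (Cod C f)))"
    using ho.L_iso frep(5) f by auto
  show ?thesis
  proof
    assume "is_iso ho.H (ho.L (fmor f))"
    from H.iso_comp[OF i(1) this] have "is_iso ho.H (ho.L (frep (Cod C f)) \<cdot>\<^bsub>ho.H\<^esub> ho.L f)" unfolding e by simp
    from H.iso_two_of_three_left[OF this i(2)] show "is_iso ho.H (ho.L f)" by simp
  next
    assume "is_iso ho.H (ho.L f)"
    from H.iso_comp[OF this i(2)] have "is_iso ho.H (ho.L (fmor f) \<cdot>\<^bsub>ho.H\<^esub> ho.L (frep (Dom C f)))" unfolding e by simp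
    from H.iso_two_of_three_right[OF this i(1)] show "is_iso ho.H (ho.L (fmor f))" by simp
  qed
qed

text \<open>Replace source and target by cofibrant and then by fibrant objects. The induced map
  between bifibrant objects has a homotopy inverse, and two-out-of-three leads back to
  \<open>f\<close>.\<close>

theorem L_iso_Weq:
  assumes f: "f \<in> hom C X Y" and i: "is_iso ho.H (ho.L f)"
  shows "f \<in> Weq M"
proof -
  interpret H: category ho.H by (rule ho.category_H)
  have o: "X \<in> Obj C" "Y \<in> Obj C" using hom_Obj[OF f] by auto
  obtain X' q where q: "q \<in> hom C X' X" "q \<in> Fib M" "q \<in> Weq M" "is_cofibrant C M X'" using cofibrant_repl[OF o(1)] by blast
  obtain Y' r where r: "r \<in> hom C Y' Y" "r \<in> Fib M" "r \<in> Weq M" "is_cofibrant C M Y'" using cofibrant_repl[OF o(2)] by blast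
  note [simp] = homD[OF f] homD[OF q(1)] homD[OF r(1)]
  have "f \<cdot> q \<in> hom C X' Y" by (simp add: hom_iff)
  from cofibrant_lift[OF q(4) r(2,3,1) this] obtain f' where f': "f' \<in> hom C X' Y'" "r \<cdot> f' = f \<cdot> q" by blast
  note [simp] = homD[OF f'(1)]
  have o': "X' \<in> Obj C" "Y' \<in> Obj C" using hom_Obj[OF f'(1)] by auto
  have "is_iso ho.H (ho.L f \<cdot>\<^bsub>ho.H\<^esub> ho.L q)" using H.iso_comp[OF ho.L_iso[OF q(3)] i] by simp
  then have "is_iso ho.H (ho.L r \<cdot>\<^bsub>ho.H\<^esub> ho.L f')"
    using f'(2) ho.L_Comp[of f' r] ho.L_Comp[of q f] by simp
  then have i': "is_iso ho.H (ho.L f')" using H.iso_two_of_three_left[OF _ ho.L_iso[OF r(3)], of "ho.L f'"] by simp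
  then have i2: "is_iso ho.H (ho.L (fmor f'))" using frep_iso_iff[of f'] by simp
  have c: "is_cofibrant C M (fobj X')" "is_cofibrant C M (fobj Y')"
    using Cof_cofibrant[OF frep(4) _ q(4)] Cof_cofibrant[OF frep(4) _ r(4)] frep(1-3) o' by (auto simp: hom_iff)
  have "fmor f' \<in> Weq M"
    by (rule L_iso_Weq_bifibrant[OF _ i2 c(1) frep(6)[OF o'(1)] c(2) frep(6)[OF o'(2)]]) (simp add: hom_iff)
  then have "fmor f' \<cdot> frep X' \<in> Weq M" using W_comp[OF frep(5)[OF o'(1)]] frep(3)[OF o'(1)] by simp
  then have "frep Y' \<cdot> f' \<in> Weq M" using fmor_frep[of f'] by simp
  then have "f' \<in> Weq M" using W_right[OF frep(5)[OF o'(2)]] frep(2)[OF o'(2)] by simp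
  then have "f \<cdot> q \<in> Weq M" using W_comp[OF _ r(3), of f'] f'(2) by simp
  then show ?thesis using W_left[OF q(3), of f] by simp
qed

end

section \<open>Cylinders, cones and the suspension\<close>

context pointed_model_category
begin

text \<open>A lift is found first on the domain, which is cofibrant, and then on the codomain along
  the cofibration \<open>f\<close>.\<close>

lemma projective_cofibrant:
  assumes f: "f \<in> Cof M" and A: "is_cofibrant C M (Dom C f)"
  shows "is_cofibrant (Arr C) (projective C M) f"
proof -
  interpret P: model_category "Arr C" U "projective C M" by (rule projective_model)
  have fM: "f \<in> Mor C" using Cof_Mor[OF f] .
  show ?thesis
  proof (rule P.cofibrantI)
    show "f \<in> Obj (Arr C)" using fM by simp
    fix p x y h assume p: "p \<in> Fib (projective C M)" "p \<in> Weq (projective C M)" "p \<in> hom (Arr C) y x" and h: "h \<in> hom (Arr C) f x"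
    have pM: "p \<in> Mor (Arr C)" "src p = y" "tgt p = x" using p(3) by (auto simp: hom_iff)
    have hM: "h \<in> Mor (Arr C)" "src h = f" "tgt h = x" using h by (auto simp: hom_iff)
    note pD = Arr_MorD[OF pM(1), unfolded pM(2,3)] and hD = Arr_MorD[OF hM(1), unfolded hM(2,3)]
    note [simp] = pD(1-8) hD(1-8)
    have t: "ev0 p \<in> Fib M" "ev0 p \<in> Weq M" "ev1 p \<in> Fib M" "ev1 p \<in> Weq M" using p by (auto simp: levelwise_iff)
    obtain a where a: "a \<in> hom C (Dom C f) (Dom C y)" "ev0 p \<cdot> a = ev0 h"
      by (rule cofibrant_lift[OF A t(1,2), of "Dom C y" "Dom C x" "ev0 h"]) (simp_all add: hom_iff)
    note [simp] = homD[OF a(1)]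
    have "ev1 p \<cdot> (y \<cdot> a) = ev1 h \<cdot> f"
      by (simp add: reassoc2[OF pD(9)[symmetric]] a hD(9))
    then obtain b where b: "b \<in> hom C (Cod C f) (Cod C y)" "b \<cdot> f = y \<cdot> a" "ev1 p \<cdot> b = ev1 h"
      using lift_cof[OF f t(3) disjI2[OF t(4)], of "Dom C f" "Cod C f" "Cod C y" "Cod C x" "y \<cdot> a" "ev1 h"] by (auto simp: hom_iff)
    show "\<exists>k\<in>hom (Arr C) f y. p \<cdot>\<^bsub>Arr C\<^esub> k = h"
      by (rule bexI[of _ "Sq f y a b"]) (use a b homD[OF b(1)] pM hM in \<open>auto simp: Arr_hom intro!: square_eqI\<close>)
  qed
qed

text \<open>Ken Brown's lemma for the left Quillen functor \<open>K\<close>;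
  \<open>projective_cofibrant\<close> recognizes the two ends as cofibrant arrows.\<close>

lemma K_Weq:
  assumes u: "u \<in> levelwise C (Weq M)" and c: "src u \<in> Cof M" "is_cofibrant C M (Dom C (src u))"
    "tgt u \<in> Cof M" "is_cofibrant C M (Dom C (tgt u))"
  shows "onmor K u \<in> levelwise C (Weq M)"
proof -
  interpret P: model_category "Arr C" U "projective C M" by (rule projective_model)
  have "onmor K u \<in> Weq (injective C M)"
  proof (rule P.ken_brown_left[OF injective_model K_functor])
    show "onmor K p \<in> Weq (injective C M)" if "p \<in> Cof (projective C M)" "p \<in> Weq (projective C M)" for p
      using K_preserves(2)[of p] that by blast
    show "u \<in> Weq (projective C M)" "u \<in> hom (Arr C) (src u) (tgt u)" using u by (auto simp: levelwise_iff hom_iff)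
  qed (use projective_cofibrant c in auto)
  then show ?thesis by simp
qed

lemma cokernel_cofibrant:
  assumes f: "f \<in> Cof M" and c: "is_cofibrant C M (Dom C f)"
  shows "is_cofibrant C M (Cod C (cok_map C f))"
proof -
  have fM [simp]: "f \<in> Mor C" using Cof_Mor[OF f] .
  show ?thesis
  proof (rule cofibrantI)
    fix p A B h assume p: "p \<in> Fib M" "p \<in> Weq M" "p \<in> hom C B A" and h: "h \<in> hom C (Cod C (cok_map C f)) A"
    note [simp] = homD[OF p(3)] homD[OF h]
    have [simp]: "A \<in> Obj C" "B \<in> Obj C" using hom_Obj[OF p(3)] by auto
    obtain k where k: "k \<in> hom C (Cod C f) B" "k \<cdot> f = zmap C (Dom C f) B" "p \<cdot> k = h \<cdot> cok_map C f"
      by (rule lift_cof[OF f p(1) disjI2[OF p(2)] Mor_hom[OF fM] p(3), of "zmap C (Dom C f) B" "h \<cdot> cok_map C f"])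
        (simp_all add: hom_iff)
    note [simp] = homD[OF k(1)]
    obtain l where l: "l \<in> Mor C" "Dom C l = Cod C (cok_map C f)" "Cod C l = Cod C k" "l \<cdot> cok_map C f = k"
      by (rule cokernel_ex[OF cok[OF fM], of k]) (simp_all add: k)
    note [simp] = l(1-3)
    have "p \<cdot> l = h" by (rule cokernel_epi[OF cok[OF fM]]) (simp_all add: l k)
    then show "\<exists>k\<in>hom C (Cod C (cok_map C f)) B. p \<cdot> k = h" by (intro bexI[of _ l]) (simp_all add: hom_iff)
  qed simp
qed

section \<open>The cofibrant replacement and the cylinder inside the suspension\<close>

lemma coproduct_ex: "X \<in> Obj C \<Longrightarrow> \<exists>i j. is_coproduct C X X i j"
proof -
  assume X: "X \<in> Obj C"
  interpret op: model_category "op_cat C" U "op_ms M" by (rule model_category_op)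
  show ?thesis using op.ex_product[of X X] X unfolding is_coproduct_def by (simp add: ) blast
qed

abbreviation "in0 X \<equiv> fst (copair C X)"
abbreviation "in1 X \<equiv> snd (copair C X)"
definition cp :: "'a \<Rightarrow> 'a" where "cp X = Cod C (in0 X)"

lemma copair:
  assumes "X \<in> Obj C"
  shows "in0 X \<in> hom C X (cp X)" "in1 X \<in> hom C X (cp X)"
    "\<lbrakk>u \<in> hom C X Y; v \<in> hom C X Y\<rbrakk> \<Longrightarrow> \<exists>!h. h \<in> hom C (cp X) Y \<and> h \<cdot> in0 X = u \<and> h \<cdot> in1 X = v"
proof -
  from coproduct_ex[OF assms] obtain i j where "is_coproduct C X X i j" by blast
  then have "case (i, j) of (i, j) \<Rightarrow> is_coproduct C X X i j" by simp
  then have "case copair C X of (i, j) \<Rightarrow> is_coproduct C X X i j" unfolding copair_def by (rule someI)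
  then obtain P where P: "in0 X \<in> hom C X P" "in1 X \<in> hom C X P"
    "\<forall>Z. \<forall>u\<in>hom C X Z. \<forall>v\<in>hom C X Z. \<exists>!h. h \<in> hom C P Z \<and> h \<cdot> in0 X = u \<and> h \<cdot> in1 X = v"
    unfolding is_coproduct_def by (auto simp: case_prod_beta)
  have "P = cp X" using P(1) by (simp add: cp_def hom_iff)
  with P show "in0 X \<in> hom C X (cp X)" "in1 X \<in> hom C X (cp X)"
    "\<lbrakk>u \<in> hom C X Y; v \<in> hom C X Y\<rbrakk> \<Longrightarrow> \<exists>!h. h \<in> hom C (cp X) Y \<and> h \<cdot> in0 X = u \<and> h \<cdot> in1 X = v" by auto
qed

lemma in_simps [simp]:
  assumes "X \<in> Obj C"
  shows "in0 X \<in> Mor C" "Dom C (in0 X) = X" "Cod C (in0 X) = cp X"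
    "in1 X \<in> Mor C" "Dom C (in1 X) = X" "Cod C (in1 X) = cp X"
  using homD[OF copair(1)[OF assms]] homD[OF copair(2)[OF assms]] by auto

lemma copair_map:
  assumes X: "X \<in> Obj C" and u: "u \<in> hom C X Y" and v: "v \<in> hom C X Y"
  shows "copair_map C X u v \<in> Mor C" "Dom C (copair_map C X u v) = cp X" "Cod C (copair_map C X u v) = Y"
    "copair_map C X u v \<cdot> in0 X = u" "copair_map C X u v \<cdot> in1 X = v"
  using theI'[OF copair(3)[OF X u v]] homD(3)[OF u] by (simp_all add: copair_map_def cp_def hom_iff)

lemma copair_eq:
  assumes X: "X \<in> Obj C" and h: "h \<in> Mor C" "Dom C h = cp X" and k: "k \<in> Mor C" "Dom C k = cp X" "Cod C h = Cod C k"
    and e: "h \<cdot> in0 X = k \<cdot> in0 X" "h \<cdot> in1 X = k \<cdot> in1 X"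
  shows "h = k"
proof -
  have "\<exists>!l. l \<in> hom C (cp X) (Cod C k) \<and> l \<cdot> in0 X = k \<cdot> in0 X \<and> l \<cdot> in1 X = k \<cdot> in1 X"
    by (rule copair(3)[OF X]) (use X k in \<open>simp_all add: hom_iff\<close>)
  moreover have "h \<in> hom C (cp X) (Cod C k)" "k \<in> hom C (cp X) (Cod C k)" using h k by (simp_all add: hom_iff)
  ultimately show ?thesis using e by blast
qed

definition nab :: "'a \<Rightarrow> 'b" where "nab X = copair_map C X (Ident C X) (Ident C X)"

lemma nab:
  assumes "X \<in> Obj C"
  shows "nab X \<in> Mor C" "Dom C (nab X) = cp X" "Cod C (nab X) = X" "nab X \<cdot> in0 X = Ident C X" "nab X \<cdot> in1 X = Ident C X"
  using copair_map[OF assms, of "Ident C X" X "Ident C X"] assms by (simp_all add: nab_def hom_iff)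

lemma fold_simps:
  "onobj (fold_functor C) X = nab X"
  "onmor (fold_functor C) f = Sq (nab (Dom C f)) (nab (Cod C f))
     (copair_map C (Dom C f) (in0 (Cod C f) \<cdot> f) (in1 (Cod C f) \<cdot> f)) f"
  by (simp_all add: fold_functor_def nab_def)

lemma fold_functor: "is_functor C (Arr C) (fold_functor C)"
proof -
  have cm: "copair_map C (Dom C f) (in0 (Cod C f) \<cdot> f) (in1 (Cod C f) \<cdot> f) \<in> Mor C"
    "Dom C (copair_map C (Dom C f) (in0 (Cod C f) \<cdot> f) (in1 (Cod C f) \<cdot> f)) = cp (Dom C f)"
    "Cod C (copair_map C (Dom C f) (in0 (Cod C f) \<cdot> f) (in1 (Cod C f) \<cdot> f)) = cp (Cod C f)"
    "copair_map C (Dom C f) (in0 (Cod C f) \<cdot> f) (in1 (Cod C f) \<cdot> f) \<cdot> in0 (Dom C f) = in0 (Cod C f) \<cdot> f"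
    "copair_map C (Dom C f) (in0 (Cod C f) \<cdot> f) (in1 (Cod C f) \<cdot> f) \<cdot> in1 (Dom C f) = in1 (Cod C f) \<cdot> f"
    if "f \<in> Mor C" for f
    using copair_map[of "Dom C f" "in0 (Cod C f) \<cdot> f" "cp (Cod C f)" "in1 (Cod C f) \<cdot> f"] that by (simp_all add: hom_iff)
  show ?thesis
  proof (rule functorI, goal_cases)
    case (1 X) then show ?case by (simp add: fold_simps nab)
  next
    case (2 f)
    note [simp] = 2 cm[OF 2] nab(1-3)[OF Dom_Obj[OF 2]] nab(1-3)[OF Cod_Obj[OF 2]]
    have "nab (Cod C f) \<cdot> copair_map C (Dom C f) (in0 (Cod C f) \<cdot> f) (in1 (Cod C f) \<cdot> f) = f \<cdot> nab (Dom C f)"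
      by (rule copair_eq[of "Dom C f"])
        (simp_all add: reassoc[OF nab(4)] reassoc[OF nab(5)] nab(4,5))
    then show ?case by (simp add: fold_simps Arr_hom)
  next
    case (3 X)
    have "copair_map C X (in0 X) (in1 X) = Ident C (cp X)"
      by (rule copair_eq[OF 3]) (use 3 copair_map[OF 3 copair(1,2)[OF 3]] Cod_Obj[of "in0 X"] in simp_all)
    then show ?case using 3 by (simp add: fold_simps nab)
  next
    case (4 f g)
    note [simp] = 4 cm(1-3)[OF 4(1)] cm(1-3)[OF 4(2)]
    have gf [simp]: "g \<cdot> f \<in> Mor C" by simp
    note k = cm[OF gf]
    have d: "Dom C (g \<cdot> f) = Dom C f" "Cod C (g \<cdot> f) = Cod C g" by simp_all
    note k = cm[OF gf, unfolded d] and c = cm(4,5)[OF 4(1), unfolded 4(3)] cm(4,5)[OF 4(2)]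
    note [simp] = k(1-3) cm(1-3)[OF 4(1), unfolded 4(3)]
    have "copair_map C (Dom C f) (in0 (Cod C g) \<cdot> (g \<cdot> f)) (in1 (Cod C g) \<cdot> (g \<cdot> f)) =
      copair_map C (Dom C g) (in0 (Cod C g) \<cdot> g) (in1 (Cod C g) \<cdot> g) \<cdot> copair_map C (Dom C f) (in0 (Dom C g) \<cdot> f) (in1 (Dom C g) \<cdot> f)"
      by (rule copair_eq[of "Dom C f"]) (simp_all add: k(4,5) c(1,2) reassoc2[OF c(3)] reassoc2[OF c(4)])
    then show ?case by (simp add: fold_simps)
  qed
qed

definition fz :: "'a \<Rightarrow> 'b" where "fz X = (THE t. t \<in> hom C Z X)"

lemma fz: 
  assumes "X \<in> Obj C"
  shows "fz X \<in> Mor C" "Dom C (fz X) = Z" "Cod C (fz X) = X"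
  using homD[OF zmap_parts(2)[OF assms assms]] by (simp_all add: fz_def)

lemma from_zero_simps: "onobj (from_zero C) X = fz X"
  "onmor (from_zero C) f = Sq (fz (Dom C f)) (fz (Cod C f)) (Ident C Z) f"
  by (simp_all add: from_zero_def fz_def Let_def)

lemma from_zero_functor: "is_functor C (Arr C) (from_zero C)"
proof (rule functorI, goal_cases)
  case (1 X) then show ?case by (simp add: from_zero_simps fz)
next
  case (2 f)
  have "fz (Cod C f) = f \<cdot> fz (Dom C f)" by (rule from_Z_eq) (use 2 fz in simp_all)
  then show ?case using 2 by (simp add: from_zero_simps Arr_hom fz)
next
  case (3 X) then show ?case by (simp add: from_zero_simps fz)
next
  case (4 f g) then show ?case by (simp add: from_zero_simps)
qed

text \<open>This has to be the very factorization that \<open>cof_repl\<close> and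
  \<open>cylinder\<close> choose, since the suspension is built from it.\<close>

definition fa where "fa = fst (cof_tfib_factorization C M)"
definition fb where "fb = snd (cof_tfib_factorization C M)"

lemma fab: "factors_into C (Cof M) (Fib M \<inter> Weq M) fa fb"
proof -
  obtain \<alpha> \<beta> where "factors_into C (Cof M) (Fib M \<inter> Weq M) \<alpha> \<beta>" using factor_cof_tfib by blast
  then have "case (\<alpha>, \<beta>) of (\<alpha>, \<beta>) \<Rightarrow> factors_into C (Cof M) (Fib M \<inter> Weq M) \<alpha> \<beta>" by simp
  then have "case cof_tfib_factorization C M of (\<alpha>, \<beta>) \<Rightarrow> factors_into C (Cof M) (Fib M \<inter> Weq M) \<alpha> \<beta>"
    unfolding cof_tfib_factorization_def by (rule someI)
  then show ?thesis by (simp add: fa_def fb_def case_prod_beta)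
qed

sublocale fab: factorization C "Cof M" "Fib M \<inter> Weq M" fa fb
  by unfold_locales (auto intro: fab lifting_cof_tfib ex_pushout[OF colimits] Cof_Mor Fib_Mor)

abbreviation "Q \<equiv> cof_repl C M"
definition qm :: "'a \<Rightarrow> 'b" where "qm X = onobj fb (fz X)"

lemma Q_functor: "is_functor C C Q"
  unfolding cof_repl_def fb_def[symmetric]
  by (rule comp_is_functor[OF category_axioms comp_is_functor[OF category_axioms from_zero_functor fab.b_functor] Ev0_functor])

lemma qm:
  assumes X: "X \<in> Obj C"
  shows "qm X \<in> Mor C" "Dom C (qm X) = onobj Q X" "Cod C (qm X) = X" "qm X \<in> Weq M" "qm X \<in> Fib M"
    "is_cofibrant C M (onobj Q X)"
proof -
  note z = fz[OF X]
  show "qm X \<in> Mor C" "Dom C (qm X) = onobj Q X" "Cod C (qm X) = X" "qm X \<in> Weq M" "qm X \<in> Fib M"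
    using fab.b_obj[OF z(1)] fab.b_R[OF z(1)] z
    by (simp_all add: qm_def cof_repl_def fb_def[symmetric] from_zero_simps)
  have "onobj fa (fz X) \<in> hom C Z (onobj Q X)"
    using fab.a_obj[OF z(1)] z
    by (simp add: hom_iff cof_repl_def fb_def[symmetric] from_zero_simps)
  then show "is_cofibrant C M (onobj Q X)"
    using fab.a_L[OF z(1)] Z_initial by (auto simp: is_cofibrant_def)
qed

lemma qm_nat: 
  assumes f: "f \<in> Mor C"
  shows "qm (Cod C f) \<cdot> onmor Q f = f \<cdot> qm (Dom C f)"
proof -
  have s: "onmor (from_zero C) f \<in> Mor (Arr C)" using functorD(2)[OF from_zero_functor f] .
  have e: "ev0 (onmor fb (onmor (from_zero C) f)) = fab.fm (onmor (from_zero C) f)"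
    using fab s unfolding factors_into_def functorial_factorization_def fab.fm_def by auto
  show ?thesis
    using fab.fm(5)[OF s] e by (simp add: qm_def cof_repl_def fb_def[symmetric] from_zero_simps)
qed

abbreviation "Cy \<equiv> cylinder C M"
definition cyl :: "'a \<Rightarrow> 'a" where "cyl X = Cod C (onobj Cy X)"
definition cs :: "'a \<Rightarrow> 'b" where "cs X = onobj fb (nab X)"
definition i0 :: "'a \<Rightarrow> 'b" where "i0 X = onobj Cy X \<cdot> in0 X"
definition i1 :: "'a \<Rightarrow> 'b" where "i1 X = onobj Cy X \<cdot> in1 X"
definition cm :: "'b \<Rightarrow> 'b" where "cm f = ev1 (onmor Cy f)"

lemma Cy_simps: "onobj Cy X = onobj fa (nab X)" "onmor Cy f = onmor fa (onmor (fold_functor C) f)"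
  by (simp_all add: cylinder_def fa_def[symmetric] fold_simps)

lemma Cy_functor: "is_functor C (Arr C) Cy"
  unfolding cylinder_def fa_def[symmetric]
  by (rule comp_is_functor[OF category_axioms fold_functor fab.a_functor])

lemma Cy:
  assumes X: "X \<in> Obj C"
  shows "onobj Cy X \<in> Cof M" "onobj Cy X \<in> Mor C" "Dom C (onobj Cy X) = cp X" "Cod C (onobj Cy X) = cyl X"
    "cs X \<in> Mor C" "Dom C (cs X) = cyl X" "Cod C (cs X) = X" "cs X \<in> Weq M" "cs X \<cdot> onobj Cy X = nab X"
    "i0 X \<in> Mor C" "Dom C (i0 X) = X" "Cod C (i0 X) = cyl X" "i1 X \<in> Mor C" "Dom C (i1 X) = X" "Cod C (i1 X) = cyl X"
    "cs X \<cdot> i0 X = Ident C X" "cs X \<cdot> i1 X = Ident C X"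
proof -
  note n = nab[OF X]
  show c: "onobj Cy X \<in> Cof M" "onobj Cy X \<in> Mor C" "Dom C (onobj Cy X) = cp X" "Cod C (onobj Cy X) = cyl X"
    "cs X \<in> Mor C" "Dom C (cs X) = cyl X" "Cod C (cs X) = X" "cs X \<in> Weq M" "cs X \<cdot> onobj Cy X = nab X"
    using fab.a_L[OF n(1)] fab.a_obj[OF n(1)] fab.b_obj[OF n(1)] fab.b_R[OF n(1)] fab.ba[OF n(1)] n
    by (simp_all add: cyl_def cs_def Cy_simps)
  show "i0 X \<in> Mor C" "Dom C (i0 X) = X" "Cod C (i0 X) = cyl X" "i1 X \<in> Mor C" "Dom C (i1 X) = X" "Cod C (i1 X) = cyl X"
    "cs X \<cdot> i0 X = Ident C X" "cs X \<cdot> i1 X = Ident C X"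
    using c X n by (simp_all add: i0_def i1_def reassoc[OF c(9)])
qed

text \<open>Ties the chosen cylinder to the homotopies above: a pair of maps on the ends is one map
  out of the coproduct, and \<open>onobj Cy X\<close> is a cofibration.\<close>

lemma cylinder_on_Cy:
  assumes X: "X \<in> Obj C"
  shows "cylinder_on C M X (cyl X) (i0 X) (i1 X) (cs X)"
  unfolding cylinder_on_def
proof (intro conjI allI impI)
  note [simp] = X Cy[OF X]
  show "i0 X \<in> hom C X (cyl X)" "i1 X \<in> hom C X (cyl X)" "cs X \<in> hom C (cyl X) X" "cs X \<in> Weq M"
    "cs X \<cdot> i0 X = Ident C X" "cs X \<cdot> i1 X = Ident C X" by (simp_all add: hom_iff)
  fix p B E v u0 u1
  assume "p \<in> Fib M \<and> p \<in> Weq M \<and> p \<in> hom C E B \<and> u0 \<in> hom C X E \<and> u1 \<in> hom C X E \<and>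
      v \<in> hom C (cyl X) B \<and> p \<cdot> u0 = v \<cdot> i0 X \<and> p \<cdot> u1 = v \<cdot> i1 X"
  then have p: "p \<in> Fib M" "p \<in> Weq M" "p \<in> hom C E B" and u: "u0 \<in> hom C X E" "u1 \<in> hom C X E" and v: "v \<in> hom C (cyl X) B"
    and e: "p \<cdot> u0 = v \<cdot> i0 X" "p \<cdot> u1 = v \<cdot> i1 X" by auto
  note w = copair_map[OF X u]
  note [simp] = w homD[OF p(3)] homD[OF u(1)] homD[OF u(2)] homD[OF v]
  have "p \<cdot> copair_map C X u0 u1 = v \<cdot> onobj Cy X"
    by (rule copair_eq[OF X]) (use e in \<open>simp_all add: i0_def i1_def\<close>)
  then obtain h where h: "h \<in> hom C (cyl X) E" "h \<cdot> onobj Cy X = copair_map C X u0 u1" "p \<cdot> h = v"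
    using lift_cof[OF Cy(1)[OF X] p(1) disjI2[OF p(2)], of "cp X" "cyl X" E B "copair_map C X u0 u1" v] by (auto simp: hom_iff)
  note [simp] = homD[OF h(1)]
  show "\<exists>h\<in>hom C (cyl X) E. p \<cdot> h = v \<and> h \<cdot> i0 X = u0 \<and> h \<cdot> i1 X = u1"
    by (rule bexI[of _ h]) (simp_all add: h i0_def i1_def reassoc[OF h(2)])
qed

lemma cm:
  assumes f: "f \<in> Mor C"
  shows "cm f \<in> Mor C" "Dom C (cm f) = cyl (Dom C f)" "Cod C (cm f) = cyl (Cod C f)"
    "cm f \<cdot> i0 (Dom C f) = i0 (Cod C f) \<cdot> f" "cm f \<cdot> i1 (Dom C f) = i1 (Cod C f) \<cdot> f"
proof -
  have s: "onmor (fold_functor C) f \<in> Mor (Arr C)" using functorD(2)[OF fold_functor f] .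
  have c: "ev0 (onmor Cy f) = copair_map C (Dom C f) (in0 (Cod C f) \<cdot> f) (in1 (Cod C f) \<cdot> f)"
    using fab s unfolding factors_into_def functorial_factorization_def Cy_simps by (simp add: fold_simps)
  have o: "Dom C f \<in> Obj C" "Cod C f \<in> Obj C" using f by auto
  note cpm = copair_map[OF o(1), of "in0 (Cod C f) \<cdot> f" "cp (Cod C f)" "in1 (Cod C f) \<cdot> f"]
  note D = Arr_MorD[OF functorD(2)[OF Cy_functor f]]
  note [simp] = f Cy(2-4)[OF o(1)] Cy(2-4)[OF o(2)]
  have e: "src (onmor Cy f) = onobj Cy (Dom C f)" "tgt (onmor Cy f) = onobj Cy (Cod C f)"
    using functorD(3,4)[OF Cy_functor f] by simp_all
  show [simp]: "cm f \<in> Mor C" "Dom C (cm f) = cyl (Dom C f)" "Cod C (cm f) = cyl (Cod C f)"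
    using D e by (simp_all add: cm_def)
  have sq: "cm f \<cdot> onobj Cy (Dom C f) = onobj Cy (Cod C f) \<cdot> copair_map C (Dom C f) (in0 (Cod C f) \<cdot> f) (in1 (Cod C f) \<cdot> f)"
    using D(9) e c by (simp add: cm_def)
  show "cm f \<cdot> i0 (Dom C f) = i0 (Cod C f) \<cdot> f" "cm f \<cdot> i1 (Dom C f) = i1 (Cod C f) \<cdot> f"
    using cpm by (simp_all add: i0_def i1_def reassoc2[OF sq] hom_iff)
qed

text \<open>The cone \<open>ce X : X \<rightarrow> E X\<close>, where \<open>E X\<close> is the cylinder with one end collapsed.\<close>

definition cE :: "'a \<Rightarrow> 'a" where "cE X = Cod C (cok_map C (i0 X))"
definition ce :: "'a \<Rightarrow> 'b" where "ce X = cok_map C (i0 X) \<cdot> i1 X"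
definition cEm :: "'b \<Rightarrow> 'b" where "cEm f = ev1 (onmor K (Sq (i0 (Dom C f)) (i0 (Cod C f)) f (cm f)))"
definition cx :: "'b \<Rightarrow> 'b square" where "cx f = Sq (ce (Dom C f)) (ce (Cod C f)) f (cEm f)"

lemma ce:
  assumes X: "X \<in> Obj C"
  shows "ce X \<in> Mor C" "Dom C (ce X) = X" "Cod C (ce X) = cE X" "cE X \<in> Obj C"
  using Cy[OF X] by (simp_all add: ce_def cE_def)

text \<open>Maps out of \<open>cE X\<close> are maps out of the cylinder that vanish on
  \<open>i0 X\<close>. Lifting with both ends prescribed shows that \<open>ce X\<close> is a
  cofibration. Since \<open>i0 X\<close> is a trivial cofibration, the map from the zero object to
  \<open>cE X\<close> lifts against all fibrations.\<close>

lemma cone_props: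
  assumes X: "is_cofibrant C M X"
  shows "ce X \<in> Cof M" "zmap C Z (cE X) \<in> Weq M" "zmap C Z (cE X) \<in> Cof M"
proof -
  have XO: "X \<in> Obj C" using cofibrant_Obj[OF X] .
  note [simp] = XO Cy(1-8,10-15)[OF XO] ce[OF XO]
  have cE: "Cod C (cok_map C (i0 X)) = cE X" by (simp add: cE_def)
  note tc = cylinder_TCof[OF cylinder_on_Cy[OF XO] X]
  show "ce X \<in> Cof M"
  proof (rule CofI)
    fix p assume p: "p \<in> Fib M" "p \<in> Weq M"
    have pM [simp]: "p \<in> Mor C" using Fib_Mor[OF p(1)] .
    show "has_lifting C (ce X) p"
    proof (rule has_liftingI)
      fix u v assume u: "u \<in> hom C (Dom C (ce X)) (Dom C p)" and v: "v \<in> hom C (Cod C (ce X)) (Cod C p)" and e: "p \<cdot> u = v \<cdot> ce X"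
      note [simp] = homD[OF u, simplified] homD[OF v, simplified]
      have a: "zmap C X (Dom C p) \<in> hom C X (Dom C p)" "u \<in> hom C X (Dom C p)" "v \<cdot> cok_map C (i0 X) \<in> hom C (cyl X) (Cod C p)"
        by (simp_all add: hom_iff cE)
      obtain l where l: "l \<in> hom C (cyl X) (Dom C p)" "l \<cdot> i0 X = zmap C X (Dom C p)" "l \<cdot> i1 X = u" "p \<cdot> l = v \<cdot> cok_map C (i0 X)"
        by (rule cylinder_lift[OF cylinder_on_Cy[OF XO] p Mor_hom[OF pM] a])
          (use e in \<open>simp_all add: ce_def cE\<close>)
      note [simp] = homD[OF l(1)]
      obtain k where k: "k \<in> Mor C" "Dom C k = cE X" "Cod C k = Dom C p" "k \<cdot> cok_map C (i0 X) = l"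
        by (rule cokernel_ex[OF cok[of "i0 X"], of l]) (simp_all add: l cE)
      note [simp] = k(1-3)
      have "p \<cdot> k = v" by (rule cokernel_epi[OF cok[of "i0 X"]]) (simp_all add: k(4) l(4) cE)
      moreover have "k \<cdot> ce X = u" unfolding ce_def using l(3) by (simp add: reassoc[OF k(4)] cE)
      ultimately show "\<exists>h\<in>hom C (Cod C (ce X)) (Dom C p). h \<cdot> ce X = u \<and> p \<cdot> h = v"
        by (intro bexI[of _ k]) (simp_all add: hom_iff)
    qed
  qed simp
  have l: "has_lifting C (zmap C Z (cE X)) p" if p: "p \<in> Fib M" for p
  proof (rule has_liftingI)
    have pM [simp]: "p \<in> Mor C" using Fib_Mor[OF p] .
    fix u v assume u: "u \<in> hom C (Dom C (zmap C Z (cE X))) (Dom C p)" and v: "v \<in> hom C (Cod C (zmap C Z (cE X))) (Cod C p)"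
    note [simp] = homD[OF u, simplified] homD[OF v, simplified]
    obtain l where l: "l \<in> hom C (cyl X) (Dom C p)" "l \<cdot> i0 X = zmap C X (Dom C p)" "p \<cdot> l = v \<cdot> cok_map C (i0 X)"
      by (rule lift_cof[OF tc(1) p disjI1[OF tc(2)], of X "cyl X" "Dom C p" "Cod C p" "zmap C X (Dom C p)" "v \<cdot> cok_map C (i0 X)"])
        (simp_all add: hom_iff cE)
    note [simp] = homD[OF l(1)]
    obtain k where k: "k \<in> Mor C" "Dom C k = cE X" "Cod C k = Dom C p" "k \<cdot> cok_map C (i0 X) = l"
      by (rule cokernel_ex[OF cok[of "i0 X"], of l]) (simp_all add: l cE)
    note [simp] = k(1-3)
    have "p \<cdot> k = v" by (rule cokernel_epi[OF cok[of "i0 X"]]) (simp_all add: k(4) l(3) cE)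
    moreover have "k \<cdot> zmap C Z (cE X) = u" by (rule from_Z_eq) simp_all
    ultimately show "\<exists>h\<in>hom C (Cod C (zmap C Z (cE X))) (Dom C p). h \<cdot> zmap C Z (cE X) = u \<and> p \<cdot> h = v"
      by (intro bexI[of _ k]) (simp_all add: hom_iff)
  qed
  show "zmap C Z (cE X) \<in> Weq M" "zmap C Z (cE X) \<in> Cof M" using TCofI[OF _ l] by simp_all
qed

lemma cEm:
  assumes f: "f \<in> Mor C"
  shows "cEm f \<in> Mor C" "Dom C (cEm f) = cE (Dom C f)" "Cod C (cEm f) = cE (Cod C f)"
    "cEm f \<cdot> cok_map C (i0 (Dom C f)) = cok_map C (i0 (Cod C f)) \<cdot> cm f"
    "cEm f \<cdot> ce (Dom C f) = ce (Cod C f) \<cdot> f"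
    "cx f \<in> Mor (Arr C)"
proof -
  have o: "Dom C f \<in> Obj C" "Cod C f \<in> Obj C" using f by auto
  note [simp] = f Cy(10-15)[OF o(1)] Cy(10-15)[OF o(2)] cm(1-3)[OF f] ce[OF o(1)] ce[OF o(2)]
  have s: "Sq (i0 (Dom C f)) (i0 (Cod C f)) f (cm f) \<in> Mor (Arr C)"
    using cm(4)[OF f] by (simp add: Arr_Mor)
  from K_mor(4-7)[OF s] show *: "cEm f \<in> Mor C" "Dom C (cEm f) = cE (Dom C f)" "Cod C (cEm f) = cE (Cod C f)"
    "cEm f \<cdot> cok_map C (i0 (Dom C f)) = cok_map C (i0 (Cod C f)) \<cdot> cm f"
    by (simp_all add: cEm_def cE_def)
  note [simp] = *(1-3)
  show e: "cEm f \<cdot> ce (Dom C f) = ce (Cod C f) \<cdot> f"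
    by (simp add: ce_def reassoc2[OF *(4)] cE_def[symmetric] cm(5)[OF f])
  show "cx f \<in> Mor (Arr C)" using e by (simp add: Arr_Mor cx_def)
qed

text \<open>
  \<open>kk X\<close> is the suspension of \<open>X\<close> as the cokernel of its cone, \<open>S X\<close> the cokernel of the cylinder
  inclusion as in the definition of \<open>suspension\<close>; both collapse the two ends, and \<open>th\<close> identifies them.
\<close>

definition kk :: "'a \<Rightarrow> 'a" where "kk X = Cod C (cok_map C (ce X))"
definition ku :: "'b \<Rightarrow> 'b" where "ku f = ev1 (onmor K (cx f))"
definition S where "S = Ev1 C \<circ>\<^sub>F K \<circ>\<^sub>F Cy"
definition th :: "'a \<Rightarrow> 'b" where
  "th X = (SOME t. t \<in> hom C (onobj S X) (kk X) \<and> t \<cdot> cok_map C (onobj Cy X) = cok_map C (ce X) \<cdot> cok_map C (i0 X) \<and> is_iso C t)"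

lemma S_functor: "is_functor C C S"
  unfolding S_def
  by (rule comp_is_functor[OF category_axioms comp_is_functor[OF category_axioms Cy_functor K_functor] Ev1_functor])

lemma ku:
  assumes "f \<in> Mor C"
  shows "ku f \<in> Mor C" "Dom C (ku f) = kk (Dom C f)" "Cod C (ku f) = kk (Cod C f)"
    "ku f \<cdot> cok_map C (ce (Dom C f)) = cok_map C (ce (Cod C f)) \<cdot> cEm f"
  using K_mor(4-7)[OF cEm(6)[OF assms]] by (simp_all add: ku_def kk_def cx_def)

text \<open>Collapsing first one end of the cylinder and then the other kills both, which gives
  \<open>t\<close>. Conversely the full quotient factors through the two collapses in turn, which
  gives its inverse \<open>w\<close>.\<close>

lemma th:
  assumes X: "X \<in> Obj C"
  shows "th X \<in> hom C (onobj S X) (kk X)" "th X \<cdot> cok_map C (onobj Cy X) = cok_map C (ce X) \<cdot> cok_map C (i0 X)" "is_iso C (th X)"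
proof -
  note [simp] = X Cy(2-8,10-15)[OF X] ce[OF X]
  have d: "Cod C (cok_map C (i0 X)) = cE X" "Cod C (cok_map C (ce X)) = kk X" "Cod C (cok_map C (onobj Cy X)) = onobj S X"
    by (simp_all add: cE_def kk_def S_def)
  note [simp] = d
  let ?c = "cok_map C (onobj Cy X)" and ?e = "cok_map C (ce X)" and ?i = "cok_map C (i0 X)"
  have c0: "?c \<cdot> i0 X = zmap C X (onobj S X)" "?c \<cdot> i1 X = zmap C X (onobj S X)"
    using reassoc[OF cok_simps(3)[of "onobj Cy X"], of "in0 X"] reassoc[OF cok_simps(3)[of "onobj Cy X"], of "in1 X"] 
      Cod_Obj[of ?c] by (simp_all add: i0_def i1_def)
  have e1: "?e \<cdot> (?i \<cdot> i1 X) = zmap C X (kk X)" using cok_simps(3)[of "ce X"] by (simp add: ce_def[symmetric])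
  have "(?e \<cdot> ?i) \<cdot> onobj Cy X = zmap C (cp X) (kk X)"
  proof (rule copair_eq[OF X])
    show "((?e \<cdot> ?i) \<cdot> onobj Cy X) \<cdot> in0 X = zmap C (cp X) (kk X) \<cdot> in0 X"
      using Cod_Obj[of ?e] Cod_Obj[of ?i] by (simp add: i0_def[symmetric])
    show "((?e \<cdot> ?i) \<cdot> onobj Cy X) \<cdot> in1 X = zmap C (cp X) (kk X) \<cdot> in1 X"
      using Cod_Obj[of ?e] e1 by (simp add: i1_def[symmetric])
  qed (use Cod_Obj[of ?e] Cod_Obj[of "in0 X"] in simp_all)
  then obtain t where t: "t \<in> Mor C" "Dom C t = onobj S X" "Cod C t = kk X" "t \<cdot> ?c = ?e \<cdot> ?i"
    using cokernel_ex[OF cok[of "onobj Cy X"], of "?e \<cdot> ?i"] by auto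
  note [simp] = t(1-3)
  obtain s where s: "s \<in> Mor C" "Dom C s = cE X" "Cod C s = onobj S X" "s \<cdot> ?i = ?c"
    using cokernel_ex[OF cok[of "i0 X"], of ?c] c0 by auto
  note [simp] = s(1-3)
  have "s \<cdot> ce X = zmap C X (onobj S X)" using c0 by (simp add: ce_def reassoc[OF s(4)])
  then obtain w where w: "w \<in> Mor C" "Dom C w = kk X" "Cod C w = onobj S X" "w \<cdot> ?e = s"
    using cokernel_ex[OF cok[of "ce X"], of s] by auto
  note [simp] = w(1-3)
  have o: "onobj S X \<in> Obj C" "kk X \<in> Obj C" using Dom_Obj[of t] Dom_Obj[of w] by simp_all
  have "w \<cdot> t = Ident C (onobj S X)"
    by (rule cokernel_epi[OF cok[of "onobj Cy X"]]) (use o in \<open>simp_all add: t(4) reassoc[OF w(4)] s(4)\<close>)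
  moreover have "t \<cdot> w = Ident C (kk X)"
  proof (rule cokernel_epi[OF cok[of "ce X"]])
    show "(t \<cdot> w) \<cdot> ?e = Ident C (kk X) \<cdot> ?e"
      by (rule cokernel_epi[OF cok[of "i0 X"]]) (use o in \<open>simp_all add: w(4) s(4) t(4)\<close>)
  qed (use o in simp_all)
  ultimately have "is_iso C t" unfolding is_iso_def by (intro conjI bexI[of _ w]) (simp_all add: hom_iff)
  then have "\<exists>t. t \<in> hom C (onobj S X) (kk X) \<and> t \<cdot> ?c = ?e \<cdot> ?i \<and> is_iso C t"
    using t by (intro exI[of _ t]) (simp add: hom_iff)
  from someI_ex[OF this] show "th X \<in> hom C (onobj S X) (kk X)" "th X \<cdot> ?c = ?e \<cdot> ?i" "is_iso C (th X)"
    unfolding th_def by blast+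
qed

lemma th_nat:
  assumes f: "f \<in> Mor C"
  shows "ku f \<cdot> th (Dom C f) = th (Cod C f) \<cdot> onmor S f"
proof -
  have o [simp]: "Dom C f \<in> Obj C" "Cod C f \<in> Obj C" using f by auto
  note Sm = functorD(2-4)[OF S_functor f]
  note [simp] = f Cy(2-8,10-15)[OF o(1)] Cy(2-8,10-15)[OF o(2)] ce[OF o(1)] ce[OF o(2)] homD[OF th(1)[OF o(1)]]
    homD[OF th(1)[OF o(2)]] ku(1-3)[OF f] Sm cEm(1-3)[OF f] cm(1-3)[OF f]
  have d: "Cod C (cok_map C (i0 X)) = cE X" "Cod C (cok_map C (ce X)) = kk X" "Cod C (cok_map C (onobj Cy X)) = onobj S X" for X
    by (simp_all add: cE_def kk_def S_def)
  note [simp] = d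
  note CM = functorD(2)[OF Cy_functor f]
  have Sc: "onmor S f \<cdot> cok_map C (onobj Cy (Dom C f)) = cok_map C (onobj Cy (Cod C f)) \<cdot> cm f"
    using K_mor(7)[OF CM] functorD(3,4)[OF Cy_functor f] by (simp add: S_def cm_def)
  show ?thesis
    by (rule cokernel_epi[OF cok[of "onobj Cy (Dom C f)"]])
      (simp_all add: th(2) Sc reassoc2[OF ku(4)[OF f]] cEm(4)[OF f] reassoc2[OF th(2)[OF o(2)]])
qed

lemma contractible_Weq:
  assumes f: "f \<in> hom C X Y" and "zmap C Z X \<in> Weq M" "zmap C Z Y \<in> Weq M"
  shows "f \<in> Weq M"
  using W_left[OF assms(2), of f] assms homD[OF f] hom_Obj[OF f] by simp

lemma cx_Weq:
  assumes u: "u \<in> Weq M" "u \<in> hom C X Y" and X: "is_cofibrant C M X" and Y: "is_cofibrant C M Y"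
  shows "cx u \<in> levelwise C (Weq M)"
proof -
  note [simp] = homD[OF u(2)]
  have "cEm u \<in> Weq M"
    by (rule contractible_Weq[OF _ cone_props(2)[OF X] cone_props(2)[OF Y]]) (use cEm[of u] in \<open>simp add: hom_iff\<close>)
  then show ?thesis using cEm(6)[of u] u by (simp add: levelwise_iff cx_def)
qed

lemma ku_Weq:
  assumes u: "u \<in> Weq M" "u \<in> hom C X Y" and X: "is_cofibrant C M X" and Y: "is_cofibrant C M Y"
  shows "ku u \<in> Weq M"
proof -
  note [simp] = homD[OF u(2)]
  have "onmor K (cx u) \<in> levelwise C (Weq M)"
    by (rule K_Weq[OF cx_Weq[OF assms]])
      (use X Y cone_props ce cofibrant_Obj in \<open>simp_all add: cx_def\<close>)
  then show ?thesis by (simp add: levelwise_iff ku_def)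
qed

lemma S_Weq:
  assumes u: "u \<in> Weq M" "u \<in> hom C X Y" and X: "is_cofibrant C M X" and Y: "is_cofibrant C M Y"
  shows "onmor S u \<in> Weq M"
proof -
  note [simp] = homD[OF u(2)]
  have o: "X \<in> Obj C" "Y \<in> Obj C" using hom_Obj[OF u(2)] by auto
  note t = iso_Weq[OF th(3)[OF o(1)]] iso_Weq[OF th(3)[OF o(2)]]
  note Sm = functorD(2-4)[OF S_functor homD(1)[OF u(2)], simplified]
  note [simp] = homD[OF th(1)[OF o(1)]] homD[OF th(1)[OF o(2)]] ku(1-3)[of u] Sm
  have "th Y \<cdot> onmor S u \<in> Weq M"
    using W_comp[OF t(1) ku_Weq[OF assms]] th_nat[of u] by simp
  then show ?thesis using W_right[OF t(2), of "onmor S u"] by simp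
qed

text \<open>Compares the suspension of the definition, which first replaces \<open>X\<close>
  cofibrantly, with the cokernel of the cone on \<open>X\<close> itself; for cofibrant
  \<open>X\<close> this is a weak equivalence.\<close>

definition tt :: "'a \<Rightarrow> 'b" where "tt X = th X \<cdot> onmor S (qm X)"

lemma tt:
  assumes X: "is_cofibrant C M X"
  shows "tt X \<in> hom C (onobj S (onobj Q X)) (kk X)" "tt X \<in> Weq M"
proof -
  have o: "X \<in> Obj C" using cofibrant_Obj[OF X] .
  note q = qm[OF o]
  have qh: "qm X \<in> hom C (onobj Q X) X" using q by (simp add: hom_iff)
  note Sm = functor_hom[OF S_functor qh]
  note [simp] = homD[OF Sm] homD[OF th(1)[OF o]]
  show "tt X \<in> hom C (onobj S (onobj Q X)) (kk X)" by (simp add: tt_def hom_iff)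
  show "tt X \<in> Weq M" unfolding tt_def
    using W_comp[OF S_Weq[OF q(4) qh q(6) X] iso_Weq[OF th(3)[OF o]]] by simp
qed

lemma tt_nat:
  assumes f: "f \<in> hom C X Y"
  shows "ku f \<cdot> tt X = tt Y \<cdot> onmor S (onmor Q f)"
proof -
  note [simp] = homD[OF f]
  have o: "X \<in> Obj C" "Y \<in> Obj C" using hom_Obj[OF f] by auto
  have qh: "qm X \<in> hom C (onobj Q X) X" "qm Y \<in> hom C (onobj Q Y) Y" using qm o by (auto simp: hom_iff)
  note Qf = functor_hom[OF Q_functor f]
  note [simp] = homD[OF qh(1)] homD[OF qh(2)] homD[OF Qf]
  note [simp] = homD[OF functor_hom[OF S_functor qh(1)]] homD[OF functor_hom[OF S_functor qh(2)]] homD[OF functor_hom[OF S_functor f]]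
    homD[OF functor_hom[OF S_functor Qf]] homD[OF th(1)[OF o(1)]] homD[OF th(1)[OF o(2)]] ku(1-3)[of f]
  have "onmor S f \<cdot> onmor S (qm X) = onmor S (qm Y) \<cdot> onmor S (onmor Q f)"
    using functorD(6)[OF S_functor, of "qm X" f] functorD(6)[OF S_functor, of "onmor Q f" "qm Y"] qm_nat[of f] by simp
  then show ?thesis
    using reassoc2[OF th_nat[of f], of "onmor S (qm X)"] by (simp add: tt_def)
qed

end

section \<open>The suspension on the homotopy category through cokernels of cones\<close>

context stable_model_category
begin

sublocale pointed_model_category
  by unfold_locales (rule has_zero)

abbreviation "sus \<equiv> suspension C M"

lemma sus_eq: "sus = ho_functor C (Weq M) (S \<circ>\<^sub>F Q)"
  by (simp add: suspension_def S_def comp_functor_def comp_assoc)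

lemma SQ_functor: "is_functor C C (S \<circ>\<^sub>F Q)"
  by (rule comp_is_functor[OF category_axioms Q_functor S_functor])

text \<open>Strings can be mapped step by step only if weak equivalences go to weak equivalences.
  \<open>S\<close> preserves those between cofibrant objects, and \<open>Q\<close> makes the objects
  cofibrant.\<close>

lemma SQ_Weq:
  assumes w: "w \<in> Weq M"
  shows "onmor (S \<circ>\<^sub>F Q) w \<in> Weq M"
proof -
  have wM: "w \<in> Mor C" using Weq_Mor w by blast
  note q1 = qm[OF Dom_Obj[OF wM]] and q2 = qm[OF Cod_Obj[OF wM]]
  have Qw: "onmor Q w \<in> hom C (onobj Q (Dom C w)) (onobj Q (Cod C w))" using functor_hom[OF Q_functor Mor_hom[OF wM]] .
  have "w \<cdot> qm (Dom C w) \<in> Weq M" using W_comp[OF q1(4) w] q1(3) by simp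
  then have "qm (Cod C w) \<cdot> onmor Q w \<in> Weq M" unfolding qm_nat[OF wM] .
  then have "onmor Q w \<in> Weq M" using W_right[OF q2(4)] q2(2) homD[OF Qw] by simp
  from S_Weq[OF this Qw q1(6) q2(6)] show ?thesis by simp
qed

lemma sus_L: "f \<in> Mor C \<Longrightarrow> onmor sus (ho.L f) = ho.L (onmor (S \<circ>\<^sub>F Q) f)"
  unfolding sus_eq by (rule ho_functor_L[OF ho.localization_axioms ho.localization_axioms SQ_functor SQ_Weq])

lemma sus_obj: "onobj sus X = onobj S (onobj Q X)"
  unfolding sus_eq by (simp add: ho_functor_def)

text \<open>Conjugate \<open>x\<close> with the isomorphisms \<open>tt A\<close> and
  \<open>tt B\<close>, use fullness of the suspension, and represent the resulting morphism by a
  map, which is possible because \<open>A\<close> is cofibrant and \<open>B\<close> fibrant.\<close>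

lemma ku_full:
  assumes A: "is_cofibrant C M A" and B: "is_cofibrant C M B" "is_fibrant C M B" and x: "x \<in> hom ho.H (kk A) (kk B)"
  obtains r where "r \<in> hom C A B" "ho.L (ku r) = x"
proof -
  interpret H: category ho.H by (rule ho.category_H)
  have o: "A \<in> Obj ho.H" "B \<in> Obj ho.H" using cofibrant_Obj A B by auto
  note tA = tt[OF A] and tB = tt[OF B(1)]
  note [simp] = homD[OF tA(1)] homD[OF tB(1)] homD[OF x]
  obtain v where v: "v \<in> hom ho.H (kk B) (onobj S (onobj Q B))" "ho.L (tt B) \<cdot>\<^bsub>ho.H\<^esub> v = Ident ho.H (kk B)"
    by (rule H.iso_inverse[OF ho.L_iso[OF tB(2)]]) (rule that, simp_all)
  note [simp] = homD[OF v(1)]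
  have "v \<cdot>\<^bsub>ho.H\<^esub> (x \<cdot>\<^bsub>ho.H\<^esub> ho.L (tt A)) \<in> hom ho.H (onobj sus A) (onobj sus B)"
    unfolding sus_obj by (simp add: hom_iff)
  from equivalence_full[OF ho.category_H ho.category_H suspension_equivalence o this]
  obtain a where a: "a \<in> hom ho.H A B" "onmor sus a = v \<cdot>\<^bsub>ho.H\<^esub> (x \<cdot>\<^bsub>ho.H\<^esub> ho.L (tt A))" by blast
  obtain r where r: "r \<in> hom C A B" "ho.L r = a" using ho_strict[OF A B(2) a(1)] by blast
  note [simp] = homD[OF r(1)] ku(1-3)[of r]
  have sr: "onmor S (onmor Q r) \<in> hom C (onobj S (onobj Q A)) (onobj S (onobj Q B))"
    by (rule functor_hom[OF S_functor functor_hom[OF Q_functor r(1)]])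
  note [simp] = homD[OF sr]
  have e: "ho.L (onmor S (onmor Q r)) = v \<cdot>\<^bsub>ho.H\<^esub> (x \<cdot>\<^bsub>ho.H\<^esub> ho.L (tt A))"
    using sus_L[of r] r a by simp
  have "ho.L (ku r) \<cdot>\<^bsub>ho.H\<^esub> ho.L (tt A) = ho.L (tt B) \<cdot>\<^bsub>ho.H\<^esub> ho.L (onmor S (onmor Q r))"
    using tt_nat[OF r(1)] ho.L_Comp[of "tt A" "ku r"] ho.L_Comp[of "onmor S (onmor Q r)" "tt B"] by simp
  also have "\<dots> = Ident ho.H (kk B) \<cdot>\<^bsub>ho.H\<^esub> (x \<cdot>\<^bsub>ho.H\<^esub> ho.L (tt A))"
    unfolding e by (rule H.reassoc[OF v(2)]) simp_all
  also have "\<dots> = x \<cdot>\<^bsub>ho.H\<^esub> ho.L (tt A)"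
    by (rule H.Comp_Ident_left[of _ "onobj S (onobj Q A)"]) (simp add: hom_iff)
  finally have "ho.L (ku r) = x"
    using H.iso_cancel_right[OF ho.L_iso[OF tA(2)], of "ho.L (ku r)" x "kk B"] by (simp add: hom_iff)
  with r(1) that show thesis by blast
qed

lemma ku_faithful:
  assumes A: "is_cofibrant C M A" and B: "is_cofibrant C M B" and r: "r \<in> hom C A B" "r' \<in> hom C A B"
    and e: "ho.L (ku r) = ho.L (ku r')"
  shows "ho.L r = ho.L r'"
proof -
  interpret H: category ho.H by (rule ho.category_H)
  note tA = tt[OF A] and tB = tt[OF B]
  note [simp] = homD[OF tA(1)] homD[OF tB(1)] homD[OF r(1)] homD[OF r(2)] ku(1-3)[of r] ku(1-3)[of r']
  have sr: "onmor S (onmor Q f) \<in> hom C (onobj S (onobj Q A)) (onobj S (onobj Q B))" if "f \<in> hom C A B" for f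
    by (rule functor_hom[OF S_functor functor_hom[OF Q_functor that]])
  note [simp] = homD[OF sr[OF r(1)]] homD[OF sr[OF r(2)]]
  have "ho.L (tt B) \<cdot>\<^bsub>ho.H\<^esub> ho.L (onmor S (onmor Q r)) = ho.L (ku r) \<cdot>\<^bsub>ho.H\<^esub> ho.L (tt A)"
    "ho.L (tt B) \<cdot>\<^bsub>ho.H\<^esub> ho.L (onmor S (onmor Q r')) = ho.L (ku r') \<cdot>\<^bsub>ho.H\<^esub> ho.L (tt A)"
    using tt_nat[OF r(1)] tt_nat[OF r(2)] ho.L_Comp[of "tt A" "ku r"] ho.L_Comp[of "onmor S (onmor Q r)" "tt B"]
      ho.L_Comp[of "tt A" "ku r'"] ho.L_Comp[of "onmor S (onmor Q r')" "tt B"] by simp_all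
  then have "ho.L (tt B) \<cdot>\<^bsub>ho.H\<^esub> ho.L (onmor S (onmor Q r)) = ho.L (tt B) \<cdot>\<^bsub>ho.H\<^esub> ho.L (onmor S (onmor Q r'))"
    using e by simp
  from H.iso_cancel_left[OF ho.L_iso[OF tB(2)] this, of "onobj S (onobj Q A)"]
  have "onmor sus (ho.L r) = onmor sus (ho.L r')"
    using sus_L[of r] sus_L[of r'] by (simp add: hom_iff)
  moreover have "ho.L r \<in> hom ho.H A B" "ho.L r' \<in> hom ho.H A B" by (simp_all add: hom_iff)
  ultimately show ?thesis
    using equivalence_faithful[OF ho.category_H suspension_equivalence] by blast
qed

text \<open>Essential surjectivity yields an isomorphism in the homotopy category from the
  suspension of some \<open>X\<close> to \<open>Y\<close>. Pass from \<open>X\<close> to the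
  bifibrant \<open>B\<close>; as \<open>kk B\<close> is cofibrant, the isomorphism is represented by
  a map, and saturation makes this map a weak equivalence.\<close>

lemma ku_ess_surj:
  assumes Y: "is_fibrant C M Y"
  obtains B h where "is_cofibrant C M B" "is_fibrant C M B" "h \<in> hom C (kk B) Y" "h \<in> Weq M"
proof -
  interpret H: category ho.H by (rule ho.category_H)
  have "Y \<in> Obj ho.H" using fibrant_Obj[OF Y] by simp
  from equivalence_ess_surj[OF suspension_equivalence this]
  obtain X e where X: "X \<in> Obj C" and e: "e \<in> hom ho.H (onobj S (onobj Q X)) Y" "is_iso ho.H e"
    unfolding sus_obj ho.H_simps(1) by blast
  note q = qm[OF X]
  let ?Q = "onobj Q X" and ?F = "S \<circ>\<^sub>F Q"
  have QO: "?Q \<in> Obj C" using functorD(1)[OF Q_functor X] .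
  note fr = frep[OF QO]
  define B where "B = fobj ?Q"
  have j: "frep ?Q \<in> hom C ?Q B" using fr by (simp add: hom_iff B_def)
  have B: "is_cofibrant C M B" "is_fibrant C M B"
    using Cof_cofibrant[OF fr(4) j q(6)] fr(6) by (auto simp: B_def)
  have qh: "qm X \<in> hom C ?Q X" using q by (simp add: hom_iff)
  note t = tt[OF B(1)]
  note f1 = functor_hom[OF SQ_functor j] and f2 = functor_hom[OF SQ_functor qh]
  note w1 = SQ_Weq[OF fr(5)] and w2 = SQ_Weq[OF q(4)]
  note [simp] = homD[OF f1, simplified] homD[OF f2, simplified] homD[OF t(1)] homD[OF e(1)]
  obtain v where v: "v \<in> hom ho.H (onobj S (onobj Q B)) (onobj S (onobj Q ?Q))" "is_iso ho.H v"
    by (rule H.iso_inverse[OF ho.L_iso[OF w1]]) (rule that, simp_all)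
  obtain v' where v': "v' \<in> hom ho.H (kk B) (onobj S (onobj Q B))" "is_iso ho.H v'"
    by (rule H.iso_inverse[OF ho.L_iso[OF t(2)]]) (rule that, simp_all)
  note [simp] = homD[OF v(1)] homD[OF v'(1)]
  \<comment> \<open>From \<open>kk B\<close> back through \<open>tt B\<close> to the suspension of
    \<open>B\<close>, back along \<open>frep ?Q\<close>, forward along \<open>qm X\<close> to the
    suspension of \<open>X\<close>, and on to \<open>Y\<close> by \<open>e\<close>.\<close>
  let ?x = "e \<cdot>\<^bsub>ho.H\<^esub> (ho.L (onmor ?F (qm X)) \<cdot>\<^bsub>ho.H\<^esub> (v \<cdot>\<^bsub>ho.H\<^esub> v'))"
  have 1: "is_iso ho.H (v \<cdot>\<^bsub>ho.H\<^esub> v')" using H.iso_comp[OF v'(2) v(2)] by simp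
  have 2: "is_iso ho.H (ho.L (onmor ?F (qm X)) \<cdot>\<^bsub>ho.H\<^esub> (v \<cdot>\<^bsub>ho.H\<^esub> v'))"
    using H.iso_comp[OF 1 ho.L_iso[OF w2]] by simp
  have 3: "is_iso ho.H ?x" using H.iso_comp[OF 2 e(2)] by simp
  have x: "?x \<in> hom ho.H (kk B) Y" by (simp add: hom_iff)
  have kc: "is_cofibrant C M (kk B)"
    unfolding kk_def by (rule cokernel_cofibrant) (use cone_props(1)[OF B(1)] ce(2)[OF cofibrant_Obj[OF B(1)]] B in auto)
  obtain h where h: "h \<in> hom C (kk B) Y" "ho.L h = ?x" using ho_strict[OF kc Y x] by blast
  have "h \<in> Weq M" using L_iso_Weq[OF h(1)] h(2) 3 by simp
  with that B h(1) show thesis by blast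
qed

end

section \<open>Suspension and loops\<close>

context pointed_model_category
begin

text \<open>An extension is found first on codomains, where the target is fibrant, and then on
  domains by lifting against \<open>p\<close>.\<close>

lemma injective_fibrantI:
  assumes p: "p \<in> Fib M" and Y: "is_fibrant C M (Cod C p)"
  shows "is_fibrant (Arr C) (injective C M) p"
proof -
  interpret I: model_category "Arr C" U "injective C M" by (rule injective_model)
  have pM [simp]: "p \<in> Mor C" using Fib_Mor[OF p] .
  show ?thesis
  proof (rule I.fibrantI)
    fix i x y h assume i: "i \<in> Cof (injective C M)" "i \<in> Weq (injective C M)" "i \<in> hom (Arr C) x y" and h: "h \<in> hom (Arr C) x p"
    have iM: "i \<in> Mor (Arr C)" "src i = x" "tgt i = y" using i(3) by (auto simp: hom_iff)
    have hM: "h \<in> Mor (Arr C)" "src h = x" "tgt h = p" using h by (auto simp: hom_iff)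
    note iD = Arr_MorD[OF iM(1), unfolded iM(2,3)] and hD = Arr_MorD[OF hM(1), unfolded hM(2,3)]
    note [simp] = iD(1-8) hD(3-8)
    have t: "ev0 i \<in> Cof M" "ev0 i \<in> Weq M" "ev1 i \<in> Cof M" "ev1 i \<in> Weq M" using i by (auto simp: levelwise_iff)
    obtain b where b: "b \<in> hom C (Cod C y) (Cod C p)" "b \<cdot> ev1 i = ev1 h"
      by (rule fibrant_ext[OF Y t(3,4), of "Cod C x" "Cod C y" "ev1 h"]) (simp_all add: hom_iff)
    note [simp] = homD[OF b(1)]
    have e: "p \<cdot> ev0 h = (b \<cdot> y) \<cdot> ev0 i"
      by (simp add: iD(9) hD(9) reassoc[OF b(2)])
    have ih: "ev0 i \<in> hom C (Dom C x) (Dom C y)" "ev0 h \<in> hom C (Dom C x) (Dom C p)" "b \<cdot> y \<in> hom C (Dom C y) (Cod C p)"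
      by (simp_all add: hom_iff)
    from lift_cof[OF t(1) p disjI1[OF t(2)] ih(1) Mor_hom[OF pM] ih(2,3) e]
    obtain a where a: "a \<in> hom C (Dom C y) (Dom C p)" "a \<cdot> ev0 i = ev0 h" "p \<cdot> a = b \<cdot> y" by blast
    show "\<exists>k\<in>hom (Arr C) y p. k \<cdot>\<^bsub>Arr C\<^esub> i = h"
      by (rule bexI[of _ "Sq y p a b"]) (use a b homD[OF a(1)] iM hM in \<open>auto simp: Arr_hom intro!: square_eqI\<close>)
  qed simp
qed

text \<open>Two families of injective trivial cofibrations serve as tests: for
  \<open>i : A \<rightarrow> B\<close>, the square from \<open>0 \<rightarrow> A\<close> to
  \<open>0 \<rightarrow> B\<close> detects fibrancy of the codomain, and the square from
  \<open>i\<close> to the identity of its codomain detects lifting of \<open>i\<close> against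
  \<open>p\<close>.\<close>

lemma injective_fibrantD:
  assumes p: "is_fibrant (Arr C) (injective C M) p"
  shows "p \<in> Fib M" "is_fibrant C M (Cod C p)" "is_fibrant C M (Dom C p)"
proof -
  interpret I: model_category "Arr C" U "injective C M" by (rule injective_model)
  have pM [simp]: "p \<in> Mor C" using I.fibrant_Obj[OF p] by simp
  show Y: "is_fibrant C M (Cod C p)"
  proof (rule fibrantI)
    fix i A B h assume i: "i \<in> Cof M" "i \<in> Weq M" "i \<in> hom C A B" and h: "h \<in> hom C A (Cod C p)"
    have [simp]: "A \<in> Obj C" "B \<in> Obj C" using hom_Obj[OF i(3)] by auto
    note [simp] = homD[OF i(3)] homD[OF h]
    let ?i = "Sq (zmap C Z A) (zmap C Z B) (Ident C Z) i"
    have "?i \<in> Cof (injective C M)" "?i \<in> Weq (injective C M)"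
      using const_levelwise(2)[OF i(3) i(1) Cof_subcat] const_levelwise(2)[OF i(3) i(2) Weq_subcat] by simp_all
    from I.fibrant_ext[OF p this, of "zmap C Z A" "zmap C Z B" "Sq (zmap C Z A) p (zmap C Z (Dom C p)) h"]
    obtain k where k: "k \<in> hom (Arr C) (zmap C Z B) p" "k \<cdot>\<^bsub>Arr C\<^esub> ?i = Sq (zmap C Z A) p (zmap C Z (Dom C p)) h"
      by (auto simp: Arr_hom)
    show "\<exists>k\<in>hom C B (Cod C p). k \<cdot> i = h"
      by (rule bexI[of _ "ev1 k"]) (use k in \<open>simp_all add: Arr_hom hom_iff[of _ C]\<close>)
  qed simp
  show "p \<in> Fib M"
  proof (rule FibI)
    fix i assume i: "i \<in> Cof M" "i \<in> Weq M"
    have iM [simp]: "i \<in> Mor C" using Cof_Mor[OF i(1)] .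
    let ?i = "Sq i (Ident C (Cod C i)) i (Ident C (Cod C i))"
    show "has_lifting C i p"
    proof (rule has_liftingI)
      fix u v assume u: "u \<in> hom C (Dom C i) (Dom C p)" and v: "v \<in> hom C (Cod C i) (Cod C p)" and e: "p \<cdot> u = v \<cdot> i"
      note [simp] = homD[OF u] homD[OF v]
      have "?i \<in> Cof (injective C M)" "?i \<in> Weq (injective C M)"
        using i Ident_Cof W_Ident by (simp_all add: levelwise_iff Arr_Mor)
      moreover have "?i \<in> hom (Arr C) i (Ident C (Cod C i))" "Sq i p u v \<in> hom (Arr C) i p" by (simp_all add: Arr_hom e)
      ultimately obtain k where k: "k \<in> hom (Arr C) (Ident C (Cod C i)) p" "k \<cdot>\<^bsub>Arr C\<^esub> ?i = Sq i p u v"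
        using I.fibrant_ext[OF p] by blast
      have kD: "ev0 k \<in> Mor C" "Dom C (ev0 k) = Cod C i" "Cod C (ev0 k) = Dom C p" "ev1 k \<in> Mor C" "Dom C (ev1 k) = Cod C i" "p \<cdot> ev0 k = ev1 k"
        "ev0 k \<cdot> i = u" "ev1 k = v"
        using k by (auto simp: Arr_hom)
      show "\<exists>h\<in>hom C (Cod C i) (Dom C p). h \<cdot> i = u \<and> p \<cdot> h = v"
        by (rule bexI[of _ "ev0 k"]) (simp_all add: hom_iff kD)
    qed
  qed simp
  then show "is_fibrant C M (Dom C p)" using Fib_fibrant[OF _ Mor_hom[OF pM] Y] by simp
qed

lemma adj_lifting:
  assumes i: "i \<in> Mor (Arr C)" and q: "q \<in> Mor (Arr C)" and l: "has_lifting (Arr C) (onmor K i) q"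
  shows "has_lifting (Arr C) i (onmor R q)"
proof (rule has_liftingI)
  interpret A: category "Arr C" by (rule category_Arr)
  note iD = Arr_MorD[OF i] and qD = Arr_MorD[OF q]
  have Ki: "onmor K i \<in> hom (Arr C) (cok_map C (src i)) (cok_map C (tgt i))" using functor_hom[OF K_functor A.Mor_hom[OF i]] by simp
  have Rq: "onmor R q \<in> hom (Arr C) (ker_map C (src q)) (ker_map C (tgt q))" using functor_hom[OF R_functor A.Mor_hom[OF q]] by simp
  have qh: "q \<in> hom (Arr C) (src q) (tgt q)" using q by (simp add: hom_iff)
  fix u v assume u: "u \<in> hom (Arr C) (Dom (Arr C) i) (Dom (Arr C) (onmor R q))" and v: "v \<in> hom (Arr C) (Cod (Arr C) i) (Cod (Arr C) (onmor R q))"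
    and e: "onmor R q \<cdot>\<^bsub>Arr C\<^esub> u = v \<cdot>\<^bsub>Arr C\<^esub> i"
  have u': "u \<in> hom (Arr C) (src i) (ker_map C (src q))" and v': "v \<in> hom (Arr C) (tgt i) (ker_map C (tgt q))"
    using u v homD[OF Rq] by auto
  obtain s where s: "s \<in> hom (Arr C) (cok_map C (src i)) (src q)" "\<Phi> (src i) (src q) s = u" using adj_surj[OF iD(1) qD(1) u'] by blast
  obtain t where t: "t \<in> hom (Arr C) (cok_map C (tgt i)) (tgt q)" "\<Phi> (tgt i) (tgt q) t = v" using adj_surj[OF iD(2) qD(2) v'] by blast
  have "q \<cdot>\<^bsub>Arr C\<^esub> s = t \<cdot>\<^bsub>Arr C\<^esub> onmor K i"
    by (rule adj_inj[OF iD(1) qD(2) A.Comp_in[OF s(1) qh] A.Comp_in[OF Ki t(1)]])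
      (simp only: adj_nat_right[OF iD(1) q s(1)] adj_nat_left[OF i qD(2) t(1)] s(2) t(2) e)
  from has_liftingE[OF l Ki qh s(1) t(1) this]
  obtain h where h: "h \<in> hom (Arr C) (cok_map C (tgt i)) (src q)" "h \<cdot>\<^bsub>Arr C\<^esub> onmor K i = s" "q \<cdot>\<^bsub>Arr C\<^esub> h = t" by blast
  have "\<Phi> (tgt i) (src q) h \<cdot>\<^bsub>Arr C\<^esub> i = u"
    using adj_nat_left[OF i qD(1) h(1)] h(2) s(2) by simp
  moreover have "onmor R q \<cdot>\<^bsub>Arr C\<^esub> \<Phi> (tgt i) (src q) h = v"
    using adj_nat_right[OF iD(2) q h(1)] h(3) t(2) by simp
  moreover have "\<Phi> (tgt i) (src q) h \<in> hom (Arr C) (tgt i) (ker_map C (src q))" using adj(8)[OF iD(2) qD(1) h(1)] .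
  ultimately show "\<exists>h\<in>hom (Arr C) (Cod (Arr C) i) (Dom (Arr C) (onmor R q)). h \<cdot>\<^bsub>Arr C\<^esub> i = u \<and> onmor R q \<cdot>\<^bsub>Arr C\<^esub> h = v"
    using homD[OF Rq] by auto
qed

text \<open>Ken Brown's lemma on the right: \<open>K\<close> preserves cofibrations, so by
  transposing lifts \<open>R\<close> sends trivial fibrations to trivial fibrations.\<close>

lemma R_Weq:
  assumes u: "u \<in> levelwise C (Weq M)" and f: "is_fibrant (Arr C) (injective C M) (src u)" "is_fibrant (Arr C) (injective C M) (tgt u)"
  shows "onmor R u \<in> levelwise C (Weq M)"
proof -
  interpret P: model_category "Arr C" U "projective C M" by (rule projective_model)
  interpret I: model_category "Arr C" U "injective C M" by (rule injective_model)
  have "onmor R u \<in> Weq (projective C M)"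
  proof (rule I.ken_brown_right[OF projective_model R_functor])
    fix q assume q: "q \<in> Fib (injective C M)" "q \<in> Weq (injective C M)"
    have qM: "q \<in> Mor (Arr C)" using I.Fib_Mor[OF q(1)] .
    show "onmor R q \<in> Weq (projective C M)"
    proof (rule P.TFibI(2))
      show "onmor R q \<in> Mor (Arr C)" using functorD(2)[OF R_functor qM] .
      fix i assume i: "i \<in> Cof (projective C M)"
      show "has_lifting (Arr C) i (onmor R q)"
        by (rule adj_lifting[OF P.Cof_Mor[OF i] qM I.lifting_cof_tfib[OF K_preserves(1)[OF i]]]) (use q in blast)
    qed
  next
    show "u \<in> Weq (injective C M)" "u \<in> hom (Arr C) (src u) (tgt u)" using u by (auto simp: levelwise_iff hom_iff)
  qed (use f in auto)
  then show ?thesis by simp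
qed

lemma kernel_fibrant:
  assumes "p \<in> Fib M" "is_fibrant C M (Cod C p)"
  shows "is_fibrant C M (Dom C (ker_map C p))"
proof -
  interpret op: pointed_model_category "op_cat C" U "op_ms M" by (rule pointed_op)
  show ?thesis using op.cokernel_cofibrant[of p] assms by (simp add: cofibrant_op cok_map_op)
qed

text \<open>\<open>Ev1\<close> has the left adjoint \<open>A \<mapsto> (0 \<rightarrow> A)\<close>,
  which preserves trivial cofibrations; it carries a lifting problem in \<open>C\<close> over to one
  in \<open>Arr C\<close>.\<close>

lemma path_ev1:
  assumes p: "path_on (Arr C) (injective C M) y V d0 d1 s" and y: "y \<in> Mor C" and V: "V \<in> Mor C"
  shows "path_on C M (Cod C y) (Cod C V) (ev1 d0) (ev1 d1) (ev1 s)"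
  unfolding path_on_def
proof (intro conjI allI impI)
  note pD = path_onD[OF p]
  have D: "ev1 d0 \<in> hom C (Cod C V) (Cod C y)" "ev1 d1 \<in> hom C (Cod C V) (Cod C y)" "ev1 s \<in> hom C (Cod C y) (Cod C V)"
    using pD(1-3) by (simp_all add: Arr_hom hom_iff[of _ C])
  then show "ev1 d0 \<in> hom C (Cod C V) (Cod C y)" "ev1 d1 \<in> hom C (Cod C V) (Cod C y)" "ev1 s \<in> hom C (Cod C y) (Cod C V)" .
  show "ev1 s \<in> Weq M" using pD(4) by (simp add: levelwise_iff)
  show "ev1 d0 \<cdot> ev1 s = Ident C (Cod C y)" "ev1 d1 \<cdot> ev1 s = Ident C (Cod C y)" using pD(5,6) by simp_all
  fix i A B u v0 v1
  assume "i \<in> Cof M \<and> i \<in> Weq M \<and> i \<in> hom C A B \<and> v0 \<in> hom C B (Cod C y) \<and> v1 \<in> hom C B (Cod C y) \<and>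
        u \<in> hom C A (Cod C V) \<and> v0 \<cdot> i = ev1 d0 \<cdot> u \<and> v1 \<cdot> i = ev1 d1 \<cdot> u"
  then have i: "i \<in> Cof M" "i \<in> Weq M" "i \<in> hom C A B" and v: "v0 \<in> hom C B (Cod C y)" "v1 \<in> hom C B (Cod C y)"
    and u: "u \<in> hom C A (Cod C V)" and e: "v0 \<cdot> i = ev1 d0 \<cdot> u" "v1 \<cdot> i = ev1 d1 \<cdot> u" by auto
  have [simp]: "A \<in> Obj C" "B \<in> Obj C" using hom_Obj[OF i(3)] by auto
  have d: "ev0 d0 \<in> Mor C" "Dom C (ev0 d0) = Dom C V" "Cod C (ev0 d0) = Dom C y" "ev0 d1 \<in> Mor C" "Dom C (ev0 d1) = Dom C V" "Cod C (ev0 d1) = Dom C y"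
    "src d0 = V" "tgt d0 = y" "src d1 = V" "tgt d1 = y"
    using pD(1,2) by (auto simp: Arr_hom)
  note [simp] = homD[OF i(3)] homD[OF v(1)] homD[OF v(2)] homD[OF u] y V d
  let ?i = "Sq (zmap C Z A) (zmap C Z B) (Ident C Z) i"
  have ic: "?i \<in> Cof (injective C M)" "?i \<in> Weq (injective C M)" "?i \<in> hom (Arr C) (zmap C Z A) (zmap C Z B)"
    using const_levelwise(2)[OF i(3) i(1) Cof_subcat] const_levelwise(2)[OF i(3) i(2) Weq_subcat] by (simp_all add: Arr_hom)
  let ?v0 = "Sq (zmap C Z B) y (zmap C Z (Dom C y)) v0" and ?v1 = "Sq (zmap C Z B) y (zmap C Z (Dom C y)) v1"
    and ?u = "Sq (zmap C Z A) V (zmap C Z (Dom C V)) u"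
  have 1: "?v0 \<in> hom (Arr C) (zmap C Z B) y" "?v1 \<in> hom (Arr C) (zmap C Z B) y" "?u \<in> hom (Arr C) (zmap C Z A) V"
    "?v0 \<cdot>\<^bsub>Arr C\<^esub> ?i = d0 \<cdot>\<^bsub>Arr C\<^esub> ?u" "?v1 \<cdot>\<^bsub>Arr C\<^esub> ?i = d1 \<cdot>\<^bsub>Arr C\<^esub> ?u"
    by (simp_all add: Arr_hom e)
  from path_lift[OF p ic 1] obtain h where h: "h \<in> hom (Arr C) (zmap C Z B) V" "h \<cdot>\<^bsub>Arr C\<^esub> ?i = ?u" "d0 \<cdot>\<^bsub>Arr C\<^esub> h = ?v0" "d1 \<cdot>\<^bsub>Arr C\<^esub> h = ?v1"
    by blast
  show "\<exists>h\<in>hom C B (Cod C V). h \<cdot> i = u \<and> ev1 d0 \<cdot> h = v0 \<and> ev1 d1 \<cdot> h = v1"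
    by (rule bexI[of _ "ev1 h"]) (use h in \<open>simp_all add: Arr_hom hom_iff[of _ C]\<close>)
qed

text \<open>\<open>Ev0\<close> has the right adjoint \<open>X \<mapsto> (X \<rightarrow> 0)\<close>,
  which preserves trivial fibrations; the argument is that of \<open>path_ev1\<close> with the
  arrows reversed.\<close>

lemma cylinder_ev0:
  assumes p: "cylinder_on (Arr C) (projective C M) x V j0 j1 s" and y: "x \<in> Mor C" and V: "V \<in> Mor C"
  shows "cylinder_on C M (Dom C x) (Dom C V) (ev0 j0) (ev0 j1) (ev0 s)"
  unfolding cylinder_on_def
proof (intro conjI allI impI)
  note pD = cylinder_onD[OF p]
  show "ev0 j0 \<in> hom C (Dom C x) (Dom C V)" "ev0 j1 \<in> hom C (Dom C x) (Dom C V)" "ev0 s \<in> hom C (Dom C V) (Dom C x)"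
    using pD(1-3) by (simp_all add: Arr_hom hom_iff[of _ C])
  show "ev0 s \<in> Weq M" using pD(4) by (simp add: levelwise_iff)
  show "ev0 s \<cdot> ev0 j0 = Ident C (Dom C x)" "ev0 s \<cdot> ev0 j1 = Ident C (Dom C x)" using pD(5,6) by simp_all
  fix q B E v u0 u1
  assume "q \<in> Fib M \<and> q \<in> Weq M \<and> q \<in> hom C E B \<and> u0 \<in> hom C (Dom C x) E \<and> u1 \<in> hom C (Dom C x) E \<and>
      v \<in> hom C (Dom C V) B \<and> q \<cdot> u0 = v \<cdot> ev0 j0 \<and> q \<cdot> u1 = v \<cdot> ev0 j1"
  then have q: "q \<in> Fib M" "q \<in> Weq M" "q \<in> hom C E B" and u: "u0 \<in> hom C (Dom C x) E" "u1 \<in> hom C (Dom C x) E" and v: "v \<in> hom C (Dom C V) B"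
    and e: "q \<cdot> u0 = v \<cdot> ev0 j0" "q \<cdot> u1 = v \<cdot> ev0 j1" by auto
  have [simp]: "B \<in> Obj C" "E \<in> Obj C" using hom_Obj[OF q(3)] by auto
  have d: "ev1 j0 \<in> Mor C" "Dom C (ev1 j0) = Cod C x" "Cod C (ev1 j0) = Cod C V" "ev1 j1 \<in> Mor C" "Dom C (ev1 j1) = Cod C x" "Cod C (ev1 j1) = Cod C V"
    "src j0 = x" "tgt j0 = V" "src j1 = x" "tgt j1 = V"
    using pD(1,2) by (auto simp: Arr_hom)
  note [simp] = homD[OF q(3)] homD[OF u(1)] homD[OF u(2)] homD[OF v] y V d
  let ?q = "Sq (zmap C E Z) (zmap C B Z) q (Ident C Z)"
  have qc: "?q \<in> Fib (projective C M)" "?q \<in> Weq (projective C M)" "?q \<in> hom (Arr C) (zmap C E Z) (zmap C B Z)"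
    using const_levelwise(3)[OF q(3) q(1) Fib_subcat] const_levelwise(3)[OF q(3) q(2) Weq_subcat] by (simp_all add: Arr_hom)
  let ?u0 = "Sq x (zmap C E Z) u0 (zmap C (Cod C x) Z)" and ?u1 = "Sq x (zmap C E Z) u1 (zmap C (Cod C x) Z)"
    and ?v = "Sq V (zmap C B Z) v (zmap C (Cod C V) Z)"
  have 1: "?u0 \<in> hom (Arr C) x (zmap C E Z)" "?u1 \<in> hom (Arr C) x (zmap C E Z)" "?v \<in> hom (Arr C) V (zmap C B Z)"
    "?q \<cdot>\<^bsub>Arr C\<^esub> ?u0 = ?v \<cdot>\<^bsub>Arr C\<^esub> j0" "?q \<cdot>\<^bsub>Arr C\<^esub> ?u1 = ?v \<cdot>\<^bsub>Arr C\<^esub> j1"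
    by (simp_all add: Arr_hom e)
  from cylinder_lift[OF p qc 1] obtain h where h: "h \<in> hom (Arr C) V (zmap C E Z)" "h \<cdot>\<^bsub>Arr C\<^esub> j0 = ?u0" "h \<cdot>\<^bsub>Arr C\<^esub> j1 = ?u1" "?q \<cdot>\<^bsub>Arr C\<^esub> h = ?v"
    by blast
  show "\<exists>h\<in>hom C (Dom C V) E. q \<cdot> h = v \<and> h \<cdot> ev0 j0 = u0 \<and> h \<cdot> ev0 j1 = u1"
    by (rule bexI[of _ "ev0 h"]) (use h in \<open>simp_all add: Arr_hom hom_iff[of _ C]\<close>)
qed

section \<open>Cones, path fibrations and adjoint maps between suspensions and loops\<close>

definition contractible :: "'a \<Rightarrow> bool" where "contractible X \<longleftrightarrow> X \<in> Obj C \<and> zmap C Z X \<in> Weq M"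

lemma contractible_zero: "contractible Z"
  using W_Ident[of Z] from_Z_eq[of "zmap C Z Z" "Ident C Z"] by (simp add: contractible_def)

lemma contractible_iff: "X \<in> Obj C \<Longrightarrow> contractible X \<longleftrightarrow> zmap C X Z \<in> Weq M"
proof -
  assume X: "X \<in> Obj C"
  have "zmap C X Z \<cdot> zmap C Z X = Ident C Z" by (rule to_Z_eq) (use X in simp_all)
  then have "zmap C X Z \<cdot> zmap C Z X \<in> Weq M" using W_Ident by simp
  then show ?thesis
    using W_left[of "zmap C Z X" "zmap C X Z"] W_right[of "zmap C X Z" "zmap C Z X"] X by (auto simp: contractible_def)
qed

lemma contractible_map: "\<lbrakk>f \<in> Mor C; contractible (Dom C f); contractible (Cod C f)\<rbrakk> \<Longrightarrow> f \<in> Weq M"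
  using contractible_Weq[OF Mor_hom] by (auto simp: contractible_def)

lemma contractible_transfer: 
  assumes "f \<in> Weq M"
  shows "contractible (Dom C f) \<longleftrightarrow> contractible (Cod C f)"
proof -
  have f: "f \<in> Mor C" using Weq_Mor assms by blast
  have "f \<cdot> zmap C Z (Dom C f) = zmap C Z (Cod C f)" using f by simp
  then show ?thesis
    using W_comp[OF _ assms, of "zmap C Z (Dom C f)"] W_right[OF assms, of "zmap C Z (Dom C f)"] f by (auto simp: contractible_def)
qed

text \<open>An arbitrary cone, of which \<open>ce\<close> is one instance; the codomain of its
  cokernel is a suspension of its domain.\<close>

definition is_cone_arrow :: "'b \<Rightarrow> bool" where
  "is_cone_arrow x \<longleftrightarrow> x \<in> Cof M \<and> is_cofibrant C M (Dom C x) \<and> contractible (Cod C x)"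

text \<open>The dual notion; the domain of its kernel is a loop object of its codomain.\<close>

definition is_path_arrow :: "'b \<Rightarrow> bool" where
  "is_path_arrow p \<longleftrightarrow> p \<in> Fib M \<and> is_fibrant C M (Cod C p) \<and> contractible (Dom C p)"

lemma cone_arrowD:
  assumes "is_cone_arrow x"
  shows "x \<in> Mor C" "x \<in> Cof M" "is_cofibrant C M (Dom C x)" "is_cofibrant C M (Cod C x)" "contractible (Cod C x)"
    "is_cofibrant C M (Cod C (cok_map C x))" "zmap C Z (Cod C x) \<in> Cof M" "zmap C Z (Cod C x) \<in> Weq M"
proof -
  show *: "x \<in> Cof M" "x \<in> Mor C" "is_cofibrant C M (Dom C x)" "contractible (Cod C x)" "zmap C Z (Cod C x) \<in> Weq M"
    using assms Cof_Mor by (auto simp: is_cone_arrow_def contractible_def)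
  show c: "is_cofibrant C M (Cod C x)" using Cof_cofibrant[OF *(1) Mor_hom[OF *(2)] *(3)] .
  show "zmap C Z (Cod C x) \<in> Cof M" using cofibrant_map[OF c Z_initial] *(2) by (simp add: hom_iff)
  show "is_cofibrant C M (Cod C (cok_map C x))" by (rule cokernel_cofibrant[OF *(1,3)])
qed

lemma path_arrowD:
  assumes "is_path_arrow p"
  shows "p \<in> Mor C" "p \<in> Fib M" "is_fibrant C M (Cod C p)" "is_fibrant C M (Dom C p)" "contractible (Dom C p)"
    "is_fibrant C M (Dom C (ker_map C p))" "zmap C (Dom C p) Z \<in> Fib M" "zmap C (Dom C p) Z \<in> Weq M"
    "is_fibrant (Arr C) (injective C M) p"
proof -
  show *: "p \<in> Fib M" "p \<in> Mor C" "is_fibrant C M (Cod C p)" "contractible (Dom C p)"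
    using assms Fib_Mor by (auto simp: is_path_arrow_def)
  show c: "is_fibrant C M (Dom C p)" using Fib_fibrant[OF *(1) Mor_hom[OF *(2)] *(3)] .
  show "zmap C (Dom C p) Z \<in> Fib M" using fibrant_map[OF c Z_terminal] *(2) by (simp add: hom_iff)
  show "zmap C (Dom C p) Z \<in> Weq M" using contractible_iff[of "Dom C p"] * by simp
  show "is_fibrant C M (Dom C (ker_map C p))" by (rule kernel_fibrant[OF *(1,3)])
  show "is_fibrant (Arr C) (injective C M) p" by (rule injective_fibrantI[OF *(1,3)])
qed

text \<open>The homotopy between the maps out of the suspension is made a map into the
  \<open>Ev1\<close> part of a path object \<open>V\<close> of the whole arrow \<open>p\<close>, and
  is then extended to a square \<open>h\<close> into \<open>V\<close>. The two adjoints arise from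
  the transpose of \<open>h\<close> by composing with the images of \<open>d0\<close> and
  \<open>d1\<close> under \<open>R\<close>; these have the same class, being retractions of the
  image of \<open>s\<close>, which is a weak equivalence.\<close>

lemma adj_loop_inj:
  assumes x: "is_cone_arrow x" and p: "is_path_arrow p"
    and k: "k1 \<in> hom (Arr C) (cok_map C x) p" "k2 \<in> hom (Arr C) (cok_map C x) p" and e: "ho.L (ev1 k1) = ho.L (ev1 k2)"
  shows "ho.L (ev0 (\<Phi> x p k1)) = ho.L (ev0 (\<Phi> x p k2))"
proof -
  interpret A: category "Arr C" by (rule category_Arr)
  interpret I: model_category "Arr C" U "injective C M" by (rule injective_model)
  interpret H: category ho.H by (rule ho.category_H)
  note xD = cone_arrowD[OF x] and pD = path_arrowD[OF p]
  note [simp] = xD(1) pD(1)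
  obtain V d0 d1 s where po: "path_on (Arr C) (injective C M) p V d0 d1 s" using I.ex_path[of p] by auto
  note poD = path_onD[OF po]
  have VM [simp]: "V \<in> Mor C" using A.hom_Obj(1)[OF poD(1)] by simp
  have po': "path_on C M (Cod C p) (Cod C V) (ev1 d0) (ev1 d1) (ev1 s)" by (rule path_ev1[OF po]) simp_all
  have k1: "ev1 k1 \<in> hom C (Cod C (cok_map C x)) (Cod C p)" "ev1 k2 \<in> hom C (Cod C (cok_map C x)) (Cod C p)"
    using k by (simp_all add: Arr_hom hom_iff[of _ C])
  have "homotopic C M (ev1 k1) (ev1 k2)" by (rule L_homotopic[OF xD(6) pD(3) k1 e])
  from homotopicE_right[OF xD(6) pD(3) this k1(1) po']
  obtain G where G: "G \<in> hom C (Cod C (cok_map C x)) (Cod C V)" "ev1 d0 \<cdot> G = ev1 k1" "ev1 d1 \<cdot> G = ev1 k2" by blast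
  note [simp] = homD[OF G(1)]
  let ?D = "Cod C (cok_map C x)"
  \<comment> \<open>The domain of \<open>cok_map C x\<close> is cofibrant and contractible, so this
    inclusion of the part on \<open>Ev1\<close> is an injective trivial cofibration, and
    \<open>G\<close> extends along it.\<close>
  let ?i = "Sq (zmap C Z ?D) (cok_map C x) (zmap C Z (Cod C x)) (Ident C ?D)"
  have DO: "?D \<in> Obj C" by simp
  have ic: "?i \<in> Cof (injective C M)" "?i \<in> Weq (injective C M)" "?i \<in> hom (Arr C) (zmap C Z ?D) (cok_map C x)"
    using xD(7,8) Ident_Cof[OF DO] W_Ident[OF DO] by (simp_all add: levelwise_iff Arr_Mor Arr_hom)
  let ?u = "Sq (zmap C Z ?D) V (zmap C Z (Dom C V)) G"
  have u: "?u \<in> hom (Arr C) (zmap C Z ?D) V" by (simp add: Arr_hom)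
  have "src k1 = cok_map C x" "tgt k1 = p" "src k2 = cok_map C x" "tgt k2 = p" "src d0 = V" "tgt d0 = p" "src d1 = V" "tgt d1 = p"
    "ev0 k1 \<in> Mor C" "Dom C (ev0 k1) = Cod C x" "Cod C (ev0 k1) = Dom C p" "ev0 k2 \<in> Mor C" "Dom C (ev0 k2) = Cod C x" "Cod C (ev0 k2) = Dom C p"
    "ev0 d0 \<in> Mor C" "Dom C (ev0 d0) = Dom C V" "Cod C (ev0 d0) = Dom C p" "ev0 d1 \<in> Mor C" "Dom C (ev0 d1) = Dom C V" "Cod C (ev0 d1) = Dom C p"
    using k poD(1,2) by (auto simp: Arr_hom)
  note [simp] = this homD[OF k1(1)] homD[OF k1(2)]
  have c: "k1 \<cdot>\<^bsub>Arr C\<^esub> ?i = d0 \<cdot>\<^bsub>Arr C\<^esub> ?u" "k2 \<cdot>\<^bsub>Arr C\<^esub> ?i = d1 \<cdot>\<^bsub>Arr C\<^esub> ?u" by (simp_all add: G)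
  from path_lift[OF po ic k u c] obtain h where h: "h \<in> hom (Arr C) (cok_map C x) V" "d0 \<cdot>\<^bsub>Arr C\<^esub> h = k1" "d1 \<cdot>\<^bsub>Arr C\<^esub> h = k2" by blast
  have d: "d0 \<in> Mor (Arr C)" "d1 \<in> Mor (Arr C)" "s \<in> Mor (Arr C)" "src s = p" "tgt s = V" using poD(1-3) by (auto simp: hom_iff)
  have Vf: "is_fibrant (Arr C) (injective C M) V"
    by (rule I.Fib_fibrant[OF I.path_TFib(1)[OF po pD(9)] poD(1) pD(9)])
  have Rs: "onmor R s \<in> levelwise C (Weq M)" by (rule R_Weq) (use poD(4) pD(9) Vf d in simp_all)
  have 1: "\<Phi> x p k1 = onmor R d0 \<cdot>\<^bsub>Arr C\<^esub> \<Phi> x V h" "\<Phi> x p k2 = onmor R d1 \<cdot>\<^bsub>Arr C\<^esub> \<Phi> x V h"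
    using adj_nat_right[OF xD(1) d(1), of h] adj_nat_right[OF xD(1) d(2), of h] h by simp_all
  have 2: "onmor R d0 \<cdot>\<^bsub>Arr C\<^esub> onmor R s = Ident (Arr C) (ker_map C p)" "onmor R d1 \<cdot>\<^bsub>Arr C\<^esub> onmor R s = Ident (Arr C) (ker_map C p)"
    using functorD(6)[OF R_functor d(3,1)] functorD(6)[OF R_functor d(3,2)] functorD(5)[OF R_functor, of p] poD(5,6) d(4,5)
    by (simp_all del: Arr_simps(4,5))
  let ?K = "Dom C (ker_map C p)"
  note Rd = R_mor(4-6)[OF d(1)] R_mor(4-6)[OF d(2)] R_mor(4-6)[OF d(3)] and ad = adj(4-6)[OF xD(1) VM h(1)]
  note [simp] = Rd[unfolded d(4,5), simplified] ad
  have w: "ev0 (onmor R s) \<in> Weq M" using Rs by (simp add: levelwise_iff)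
  have "ho.L (ev0 (onmor R d0)) \<cdot>\<^bsub>ho.H\<^esub> ho.L (ev0 (onmor R s)) = ho.L (ev0 (onmor R d1)) \<cdot>\<^bsub>ho.H\<^esub> ho.L (ev0 (onmor R s))"
    using 2 ho.L_Comp[of "ev0 (onmor R s)" "ev0 (onmor R d0)"] ho.L_Comp[of "ev0 (onmor R s)" "ev0 (onmor R d1)"] by simp
  from H.iso_cancel_right[OF ho.L_iso[OF w] this, of ?K]
  have "ho.L (ev0 (onmor R d0)) = ho.L (ev0 (onmor R d1))" by (simp add: hom_iff)
  then show ?thesis unfolding 1 by simp
qed

text \<open>Dual in method, in the projective structure: a homotopy between the adjoints lives on
  the \<open>Ev0\<close> part of a cylinder of the arrow \<open>x\<close> and extends to a square
  from that cylinder to \<open>ker p\<close>. Its transpose, restricted along the images under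
  \<open>K\<close> of the two ends, gives \<open>k1\<close> and \<open>k2\<close>.\<close>

lemma adj_loop_unique:
  assumes x: "is_cone_arrow x" and p: "is_path_arrow p"
    and k: "k1 \<in> hom (Arr C) (cok_map C x) p" "k2 \<in> hom (Arr C) (cok_map C x) p"
    and e: "ho.L (ev0 (\<Phi> x p k1)) = ho.L (ev0 (\<Phi> x p k2))"
  shows "ho.L (ev1 k1) = ho.L (ev1 k2)"
proof -
  interpret A: category "Arr C" by (rule category_Arr)
  interpret P: model_category "Arr C" U "projective C M" by (rule projective_model)
  interpret H: category ho.H by (rule ho.category_H)
  note xD = cone_arrowD[OF x] and pD = path_arrowD[OF p]
  note [simp] = xD(1) pD(1)
  note xc = projective_cofibrant[OF xD(2,3)]
  obtain V j0 j1 s where cy: "cylinder_on (Arr C) (projective C M) x V j0 j1 s" using P.ex_cylinder[of x] by auto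
  note cD = cylinder_onD[OF cy]
  have VM [simp]: "V \<in> Mor C" using A.hom_Obj(2)[OF cD(1)] by simp
  have cy': "cylinder_on C M (Dom C x) (Dom C V) (ev0 j0) (ev0 j1) (ev0 s)" by (rule cylinder_ev0[OF cy]) simp_all
  note a1 = adj[OF xD(1) pD(1) k(1)] and a2 = adj[OF xD(1) pD(1) k(2)]
  have ah: "ev0 (\<Phi> x p k1) \<in> hom C (Dom C x) (Dom C (ker_map C p))" "ev0 (\<Phi> x p k2) \<in> hom C (Dom C x) (Dom C (ker_map C p))"
    using a1 a2 by (simp_all add: hom_iff)
  have "homotopic C M (ev0 (\<Phi> x p k1)) (ev0 (\<Phi> x p k2))" by (rule L_homotopic[OF xD(3) pD(6) ah e])
  from homotopicE_left[OF xD(3) pD(6) this ah(1) cy']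
  obtain G where G: "G \<in> hom C (Dom C V) (Dom C (ker_map C p))" "G \<cdot> ev0 j0 = ev0 (\<Phi> x p k1)" "G \<cdot> ev0 j1 = ev0 (\<Phi> x p k2)" by blast
  note [simp] = homD[OF G(1)]
  let ?K = "Dom C (ker_map C p)"
  \<comment> \<open>A projective trivial fibration, because the domain of \<open>p\<close> is
    fibrant and contractible.\<close>
  let ?q = "Sq (ker_map C p) (zmap C ?K Z) (Ident C ?K) (zmap C (Dom C p) Z)"
  have KO: "?K \<in> Obj C" by simp
  have qc: "?q \<in> Fib (projective C M)" "?q \<in> Weq (projective C M)" "?q \<in> hom (Arr C) (ker_map C p) (zmap C ?K Z)"
    using pD(7,8) Ident_Fib[OF KO] W_Ident[OF KO] by (simp_all add: levelwise_iff Arr_Mor Arr_hom)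
  let ?v = "Sq V (zmap C ?K Z) G (zmap C (Cod C V) Z)"
  have v: "?v \<in> hom (Arr C) V (zmap C ?K Z)" by (simp add: Arr_hom)
  have "src j0 = x" "tgt j0 = V" "src j1 = x" "tgt j1 = V" 
    "ev1 j0 \<in> Mor C" "Dom C (ev1 j0) = Cod C x" "Cod C (ev1 j0) = Cod C V" "ev1 j1 \<in> Mor C" "Dom C (ev1 j1) = Cod C x" "Cod C (ev1 j1) = Cod C V"
    "ev0 k1 \<in> Mor C" "Dom C (ev0 k1) = Cod C x" "Cod C (ev0 k1) = Dom C p" "ev0 k2 \<in> Mor C" "Dom C (ev0 k2) = Cod C x" "Cod C (ev0 k2) = Dom C p"
    using k cD(1,2) by (auto simp: Arr_hom)
  note [simp] = this a1(1-6) a2(1-6)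
  have c: "?q \<cdot>\<^bsub>Arr C\<^esub> \<Phi> x p k1 = ?v \<cdot>\<^bsub>Arr C\<^esub> j0" "?q \<cdot>\<^bsub>Arr C\<^esub> \<Phi> x p k2 = ?v \<cdot>\<^bsub>Arr C\<^esub> j1" by (simp_all add: G)
  from cylinder_lift[OF cy qc a1(8) a2(8) v c] obtain h where
    h: "h \<in> hom (Arr C) V (ker_map C p)" "h \<cdot>\<^bsub>Arr C\<^esub> j0 = \<Phi> x p k1" "h \<cdot>\<^bsub>Arr C\<^esub> j1 = \<Phi> x p k2" by blast
  obtain h' where h': "h' \<in> hom (Arr C) (cok_map C V) p" "\<Phi> V p h' = h" using adj_surj[OF VM pD(1) h(1)] by blast
  have j: "j0 \<in> Mor (Arr C)" "j1 \<in> Mor (Arr C)" "s \<in> Mor (Arr C)" "src s = V" "tgt s = x" using cD(1-3) by (auto simp: hom_iff)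
  have Kj: "onmor K j0 \<in> hom (Arr C) (cok_map C x) (cok_map C V)" "onmor K j1 \<in> hom (Arr C) (cok_map C x) (cok_map C V)"
    using functor_hom[OF K_functor cD(1)] functor_hom[OF K_functor cD(2)] by simp_all
  have 1: "h' \<cdot>\<^bsub>Arr C\<^esub> onmor K j0 = k1"
    by (rule adj_inj[OF xD(1) pD(1) A.Comp_in[OF Kj(1) h'(1)] k(1)])
      (use adj_nat_left[OF j(1) pD(1), of h'] h h' in simp)
  have 2: "h' \<cdot>\<^bsub>Arr C\<^esub> onmor K j1 = k2"
    by (rule adj_inj[OF xD(1) pD(1) A.Comp_in[OF Kj(2) h'(1)] k(2)])
      (use adj_nat_left[OF j(2) pD(1), of h'] h h' in simp)
  note tc = P.cylinder_TCof[OF cy xc]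
  have Kj0: "onmor K j0 \<in> levelwise C (Weq M)" using K_preserves(2)[of j0] tc by simp
  have 3: "onmor K s \<cdot>\<^bsub>Arr C\<^esub> onmor K j0 = Ident (Arr C) (cok_map C x)" "onmor K s \<cdot>\<^bsub>Arr C\<^esub> onmor K j1 = Ident (Arr C) (cok_map C x)"
    using functorD(6)[OF K_functor j(1,3)] functorD(6)[OF K_functor j(2,3)] functorD(5)[OF K_functor, of x] cD(5,6) j(4,5)
    by (simp_all del: Arr_simps(4,5))
  let ?D = "Cod C (cok_map C x)"
  note Kd = K_mor(4-6)[OF j(1)] K_mor(4-6)[OF j(2)] K_mor(4-6)[OF j(3)]
  note [simp] = Kd[unfolded j(4,5), simplified]
  have e3: "ev1 (onmor K s) \<cdot> ev1 (onmor K j0) = Ident C ?D" "ev1 (onmor K s) \<cdot> ev1 (onmor K j1) = Ident C ?D" using 3 by simp_all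
  have w0: "ev1 (onmor K j0) \<in> Weq M" using Kj0 by (simp add: levelwise_iff)
  have w: "ev1 (onmor K s) \<in> Weq M"
    using W_left[OF w0, of "ev1 (onmor K s)"] e3 W_Ident[of ?D] by simp
  have "ho.L (ev1 (onmor K s)) \<cdot>\<^bsub>ho.H\<^esub> ho.L (ev1 (onmor K j0)) = ho.L (ev1 (onmor K s)) \<cdot>\<^bsub>ho.H\<^esub> ho.L (ev1 (onmor K j1))"
    using e3 ho.L_Comp[of "ev1 (onmor K j0)" "ev1 (onmor K s)"] ho.L_Comp[of "ev1 (onmor K j1)" "ev1 (onmor K s)"] by simp
  from H.iso_cancel_left[OF ho.L_iso[OF w] this, of ?D]
  have 4: "ho.L (ev1 (onmor K j0)) = ho.L (ev1 (onmor K j1))" by (simp add: hom_iff)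
  have h'm: "ev1 h' \<in> Mor C" "Dom C (ev1 h') = Cod C (cok_map C V)" using h'(1) by (auto simp: Arr_hom)
  have "ev1 k1 = ev1 h' \<cdot> ev1 (onmor K j0)" "ev1 k2 = ev1 h' \<cdot> ev1 (onmor K j1)" using 1 2 by auto
  then show ?thesis using 4 h'm by simp
qed

text \<open>The composite with \<open>ker_map C p\<close> extends from the domain of
  \<open>x\<close> over the cone, because the map from the domain of \<open>p\<close> to the zero
  object is a trivial fibration.\<close>

lemma adj_ext:
  assumes x: "is_cone_arrow x" and p: "is_path_arrow p" and a: "a \<in> hom C (Dom C x) (Dom C (ker_map C p))"
  obtains k where "k \<in> hom (Arr C) (cok_map C x) p" "ev0 (\<Phi> x p k) = a"
proof -
  note xD = cone_arrowD[OF x] and pD = path_arrowD[OF p]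
  note [simp] = xD(1) pD(1) homD[OF a]
  obtain l where l: "l \<in> hom C (Cod C x) (Dom C p)" "l \<cdot> x = ker_map C p \<cdot> a"
    by (rule lift_cof[OF xD(2) pD(7) disjI2[OF pD(8)], of "Dom C x" "Cod C x" "Dom C p" Z "ker_map C p \<cdot> a" "zmap C (Cod C x) Z"])
      (simp_all add: hom_iff)
  have "Sq x (ker_map C p) a l \<in> hom (Arr C) x (ker_map C p)" using l homD[OF l(1)] by (simp add: Arr_hom)
  from adj_surj[OF xD(1) pD(1) this] obtain k where "k \<in> hom (Arr C) (cok_map C x) p" "\<Phi> x p k = Sq x (ker_map C p) a l" by blast
  with that show thesis by simp
qed

lemma L_eq_Weq: "\<lbrakk>ho.L f = ho.L g; f \<in> Weq M; g \<in> Mor C\<rbrakk> \<Longrightarrow> g \<in> Weq M"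
  using L_iso_Weq[OF Mor_hom, of g] ho.L_iso[of f] by simp

text \<open>A third cone \<open>?y\<close> on the domain of \<open>x'\<close> receives both cones,
  and its cokernel is weakly equivalent to both of theirs. The square \<open>k'\<close> factors
  through it strictly; for \<open>k\<close> the second component does so up to homotopy, by
  \<open>adj_loop_unique\<close>. Thus the property is independent of the cone.\<close>

lemma cone_compare:
  assumes x: "is_cone_arrow x" and x': "is_cone_arrow x'" and p: "is_path_arrow p"
    and k: "k \<in> hom (Arr C) (cok_map C x) p" and k': "k' \<in> hom (Arr C) (cok_map C x') p"
    and a: "a \<in> hom C (Dom C x) (Dom C x')" "a \<in> Weq M" and e: "ev0 (\<Phi> x' p k') \<cdot> a = ev0 (\<Phi> x p k)"
  shows "ev1 k \<in> Weq M \<longleftrightarrow> ev1 k' \<in> Weq M"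
proof -
  interpret A: category "Arr C" by (rule category_Arr)
  note xD = cone_arrowD[OF x] and xD' = cone_arrowD[OF x'] and pD = path_arrowD[OF p]
  note [simp] = xD(1) xD'(1) pD(1) homD[OF a(1)]
  have xa: "x \<in> hom C (Dom C x) (Cod C x)" "x' \<cdot> a \<in> hom C (Dom C x) (Cod C x')" by (simp_all add: hom_iff)
  obtain u v where po: "is_pushout C x (x' \<cdot> a) u v" using ex_pushout[OF colimits xa] by blast
  have "u \<in> hom C (Cod C x) (Cod C u)" using po xa unfolding is_pushout_def by (auto simp: hom_iff)
  note poE = pushoutE(1,2)[OF po xa this] and u = this
  have vC: "v \<in> Cof M" using pushout_Cof[OF pushout_sym[OF po] xD(2)] .
  note [simp] = homD(1,2)[OF u] homD[OF poE(1)]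
  let ?W = "Cod C u"
  have WO: "?W \<in> Obj C" by simp
  \<comment> \<open>The pushout of \<open>x\<close> and \<open>x' \<cdot> a\<close> is a common
    target of the cones; factoring its map to the zero object embeds it by a cofibration
    \<open>c\<close> in a contractible object.\<close>
  obtain E c q where c: "c \<in> hom C ?W E" "c \<in> Cof M" and q: "q \<in> hom C E Z" "q \<in> Weq M"
  proof -
    have "zmap C ?W Z \<in> hom C ?W Z" using WO by (simp add: hom_iff)
    from factor_cof[OF this] that show thesis by blast
  qed
  note [simp] = homD[OF c(1)] homD[OF q(1)]
  have E: "contractible E"
    using contractible_transfer[OF q(2)] W_Ident[of Z] from_Z_eq[of "zmap C Z Z" "Ident C Z"] by (simp add: contractible_def)
  have EO [simp]: "E \<in> Obj C" using E by (simp add: contractible_def)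
  let ?y = "c \<cdot> (v \<cdot> x')"
  have vx: "v \<cdot> x' \<in> Cof M" using Cof_comp[OF xD'(2) vC] by simp
  have y: "?y \<in> Cof M" using Cof_comp[OF vx c(2)] by simp
  have yc: "is_cone_arrow ?y" using y xD'(3) E by (simp add: is_cone_arrow_def)
  note yD = cone_arrowD[OF yc]
  let ?m = "Sq x ?y a (c \<cdot> u)" and ?n = "Sq x' ?y (Ident C (Dom C x')) (c \<cdot> v)"
  have m: "?m \<in> Mor (Arr C)" using poE(2) by (simp add: Arr_Mor)
  have n: "?n \<in> Mor (Arr C)" by (simp add: Arr_Mor)
  have mW: "?m \<in> levelwise C (Weq M)" 
    using contractible_map[of "c \<cdot> u"] xD(5) E a(2) m by (simp add: levelwise_iff)
  have nW: "?n \<in> levelwise C (Weq M)" 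
    using contractible_map[of "c \<cdot> v"] xD'(5) E W_Ident[of "Dom C x'"] n by (simp add: levelwise_iff)
  have KmW: "onmor K ?m \<in> levelwise C (Weq M)" by (rule K_Weq[OF mW]) (use xD yD in simp_all)
  have KnW: "onmor K ?n \<in> levelwise C (Weq M)" by (rule K_Weq[OF nW]) (use xD' yD in simp_all)
  note a' = adj[OF xD'(1) pD(1) k']
  have k'M: "ev0 k' \<in> Mor C" "Dom C (ev0 k') = Cod C x'" "Cod C (ev0 k') = Dom C p" "ev1 k' \<in> Mor C" using k' by (auto simp: Arr_hom)
  have kM: "ev1 k \<in> Mor C" using k by (auto simp: Arr_hom)
  note [simp] = a'(1-6) k'M kM
  have cv: "c \<cdot> v \<in> Cof M" using Cof_comp[OF vC c(2)] by simp
  \<comment> \<open>The first component of \<open>k'\<close> extends over the larger cone since the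
    domain of \<open>p\<close> is fibrant and contractible; this makes the factorization of
    \<open>k'\<close> strict.\<close>
  obtain l where l: "l \<in> hom C E (Dom C p)" "l \<cdot> (c \<cdot> v) = ev0 k'"
    by (rule lift_cof[OF cv pD(7) disjI2[OF pD(8)], of "Cod C x'" E "Dom C p" Z "ev0 k'" "zmap C E Z"])
      (simp_all add: hom_iff)
  note [simp] = homD[OF l(1)]
  let ?r = "Sq ?y (ker_map C p) (ev0 (\<Phi> x' p k')) l"
  have lv: "l \<cdot> (c \<cdot> (v \<cdot> x')) = ev0 k' \<cdot> x'"
  proof -
    have "l \<cdot> (c \<cdot> (v \<cdot> x')) = (l \<cdot> (c \<cdot> v)) \<cdot> x'" by simp
    then show ?thesis unfolding l(2) .
  qed
  have r: "?r \<in> hom (Arr C) ?y (ker_map C p)" using lv a'(7) yD(1) by (simp add: Arr_hom)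
  obtain t where t: "t \<in> hom (Arr C) (cok_map C ?y) p" "\<Phi> ?y p t = ?r" using adj_surj[OF yD(1) pD(1) r] by blast
  have Km: "onmor K ?m \<in> hom (Arr C) (cok_map C x) (cok_map C ?y)" "onmor K ?n \<in> hom (Arr C) (cok_map C x') (cok_map C ?y)"
    using functor_hom[OF K_functor A.Mor_hom[OF m]] functor_hom[OF K_functor A.Mor_hom[OF n]] by simp_all
  have tn: "t \<cdot>\<^bsub>Arr C\<^esub> onmor K ?n = k'"
  proof (rule adj_inj[OF xD'(1) pD(1) A.Comp_in[OF Km(2) t(1)] k'])
    have "\<Phi> x' p (t \<cdot>\<^bsub>Arr C\<^esub> onmor K ?n) = ?r \<cdot>\<^bsub>Arr C\<^esub> ?n" using adj_nat_left[OF n pD(1), of t] t by simp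
    also have "\<dots> = \<Phi> x' p k'" by (rule square_eqI) (simp_all add: l(2))
    finally show "\<Phi> x' p (t \<cdot>\<^bsub>Arr C\<^esub> onmor K ?n) = \<Phi> x' p k'" .
  qed
  have tm: "ev0 (\<Phi> x p (t \<cdot>\<^bsub>Arr C\<^esub> onmor K ?m)) = ev0 (\<Phi> x p k)"
    using adj_nat_left[OF m pD(1), of t] t e by simp
  have tmh: "t \<cdot>\<^bsub>Arr C\<^esub> onmor K ?m \<in> hom (Arr C) (cok_map C x) p" by (rule A.Comp_in[OF Km(1) t(1)])
  have L: "ho.L (ev1 (t \<cdot>\<^bsub>Arr C\<^esub> onmor K ?m)) = ho.L (ev1 k)"
    by (rule adj_loop_unique[OF x p tmh k]) (simp only: tm)
  have tM: "ev1 t \<in> Mor C" "Dom C (ev1 t) = Cod C (cok_map C ?y)" using t(1) by (auto simp: Arr_hom)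
  note [simp] = tM K_mor(4-6)[OF m, simplified] K_mor(4-6)[OF n, simplified]
  have w: "ev1 (onmor K ?m) \<in> Weq M" "ev1 (onmor K ?n) \<in> Weq M" using KmW KnW by (simp_all add: levelwise_iff)
  have ek': "ev1 k' = ev1 t \<cdot> ev1 (onmor K ?n)" using tn by auto
  have "ev1 k' \<in> Weq M \<longleftrightarrow> ev1 t \<in> Weq M"
    unfolding ek' using W_comp[OF w(2), of "ev1 t"] W_left[OF w(2), of "ev1 t"] by auto
  also have "\<dots> \<longleftrightarrow> ev1 t \<cdot> ev1 (onmor K ?m) \<in> Weq M"
    using W_comp[OF w(1), of "ev1 t"] W_left[OF w(1), of "ev1 t"] by auto
  also have "\<dots> \<longleftrightarrow> ev1 k \<in> Weq M"
    using L_eq_Weq[OF L] L_eq_Weq[OF L[symmetric]] by auto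
  finally show ?thesis by blast
qed

lemma ce_cone: 
  assumes A: "is_cofibrant C M A"
  shows "is_cone_arrow (ce A)"
  using cone_props[OF A] ce[OF cofibrant_Obj[OF A]] A by (simp add: is_cone_arrow_def contractible_def)

text \<open>\<open>S\<close> is a composite of functors, and functoriality passes to
  \<open>ku\<close> along the natural isomorphism \<open>th\<close>; \<open>ku_Ident\<close> is
  obtained in the same way.\<close>

lemma ku_Comp:
  assumes f: "f \<in> hom C X Y" and g: "g \<in> hom C Y V"
  shows "ku (g \<cdot> f) = ku g \<cdot> ku f"
proof -
  note [simp] = homD[OF f] homD[OF g]
  have o: "X \<in> Obj C" "Y \<in> Obj C" "V \<in> Obj C" using hom_Obj f g by auto
  have gf [simp]: "g \<cdot> f \<in> Mor C" by simp
  note [simp] = ku(1-3)[of f] ku(1-3)[of g] ku(1-3)[OF gf] homD[OF th(1)[OF o(1)]] homD[OF th(1)[OF o(2)]] homD[OF th(1)[OF o(3)]]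
    homD[OF functor_hom[OF S_functor f]] homD[OF functor_hom[OF S_functor g]]
  have "ku (g \<cdot> f) \<cdot> th X = (ku g \<cdot> ku f) \<cdot> th X"
    using th_nat[of f] th_nat[of g] th_nat[OF gf] functorD(6)[OF S_functor, of f g] reassoc2[OF th_nat[of g], of "onmor S f"] by simp
  then show ?thesis using iso_cancel_right[OF th(3)[OF o(1)], of "ku (g \<cdot> f)" "ku g \<cdot> ku f" "kk V"] by (simp add: hom_iff)
qed

lemma ku_Ident:
  assumes X: "X \<in> Obj C"
  shows "ku (Ident C X) = Ident C (kk X)"
proof -
  note [simp] = X ku(1-3)[of "Ident C X"] homD[OF th(1)[OF X]]
  have k: "kk X \<in> Obj C" using hom_Obj[OF th(1)[OF X]] by simp
  have "ku (Ident C X) \<cdot> th X = Ident C (kk X) \<cdot> th X"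
    using th_nat[of "Ident C X"] functorD(5)[OF S_functor, of X] by simp
  then show ?thesis using iso_cancel_right[OF th(3)[OF X], of "ku (Ident C X)" "Ident C (kk X)" "kk X"] k by (simp add: hom_iff)
qed

end

section \<open>Stability for adjoint pairs of maps\<close>

context stable_model_category
begin

text \<open>Let \<open>A\<close> be a cofibrant replacement of the loop object and \<open>k0\<close>
  a square with adjoint \<open>\<pi>\<close>. The adjoint of \<open>k\<close> lifts to
  \<open>i : B \<rightarrow> A\<close>, and fullness gives \<open>r : A \<rightarrow> B\<close>
  whose suspension is \<open>ev1 k0\<close> followed by the inverse of \<open>ev1 k\<close>. In the
  homotopy category \<open>r \<cdot> i = 1\<close> by faithfulness and
  \<open>i \<cdot> r = 1\<close> by \<open>adj_loop_inj\<close>; so \<open>i\<close> is a weak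
  equivalence, and with it the adjoint of \<open>k\<close>.\<close>

lemma bifibrant_unit:
  assumes B: "is_cofibrant C M B" "is_fibrant C M B" and p: "is_path_arrow p"
    and k: "k \<in> hom (Arr C) (cok_map C (ce B)) p" and w: "ev1 k \<in> Weq M"
  shows "ev0 (\<Phi> (ce B) p k) \<in> Weq M"
proof -
  interpret A: category "Arr C" by (rule category_Arr)
  interpret H: category ho.H by (rule ho.category_H)
  note cB = ce_cone[OF B(1)] and pD = path_arrowD[OF p]
  have BO [simp]: "B \<in> Obj C" using cofibrant_Obj[OF B(1)] .
  note ceB = ce[OF BO] and aB = adj[OF ce(1)[OF BO] pD(1) k]
  let ?O = "Dom C (ker_map C p)"
  have OO: "?O \<in> Obj C" using pD(1) by simp
  obtain A \<pi> where \<pi>: "\<pi> \<in> hom C A ?O" "\<pi> \<in> Fib M" "\<pi> \<in> Weq M" "is_cofibrant C M A" using cofibrant_repl[OF OO] by blast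
  have AO [simp]: "A \<in> Obj C" using cofibrant_Obj[OF \<pi>(4)] .
  note ceA = ce[OF AO] and cA = ce_cone[OF \<pi>(4)]
  note [simp] = ceA ceB homD[OF \<pi>(1)] pD(1) aB(1-6)
  have "ev0 (\<Phi> (ce B) p k) \<in> hom C B ?O" by (simp add: hom_iff)
  from cofibrant_lift[OF B(1) \<pi>(2,3,1) this] obtain i where i: "i \<in> hom C B A" "\<pi> \<cdot> i = ev0 (\<Phi> (ce B) p k)" by blast
  have "\<pi> \<in> hom C (Dom C (ce A)) ?O" by (simp add: hom_iff)
  from adj_ext[OF cA p this] obtain k0 where k0: "k0 \<in> hom (Arr C) (cok_map C (ce A)) p" "ev0 (\<Phi> (ce A) p k0) = \<pi>" by blast
  note [simp] = homD[OF i(1)] ku(1-3)[of i]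
  have cxi: "cx i \<in> Mor (Arr C)" "src (cx i) = ce B" "tgt (cx i) = ce A" "ev0 (cx i) = i" using cEm(6)[of i] by (simp_all add: cx_def)
  have Kcxi: "onmor K (cx i) \<in> hom (Arr C) (cok_map C (ce B)) (cok_map C (ce A))"
    using functor_hom[OF K_functor A.Mor_hom[OF cxi(1)]] cxi by simp
  have kM: "ev1 k \<in> Mor C" "Dom C (ev1 k) = kk B" "Cod C (ev1 k) = Cod C p" "ev1 k0 \<in> Mor C" "Dom C (ev1 k0) = kk A" "Cod C (ev1 k0) = Cod C p"
    using k k0(1) by (auto simp: Arr_hom kk_def)
  note [simp] = kM
  have "ev0 (\<Phi> (ce B) p (k0 \<cdot>\<^bsub>Arr C\<^esub> onmor K (cx i))) = ev0 (\<Phi> (ce B) p k)"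
    using adj_nat_left[OF cxi(1) pD(1), of k0] k0 cxi i(2) by simp
  then have e1: "ho.L (ev1 k0) \<cdot>\<^bsub>ho.H\<^esub> ho.L (ku i) = ho.L (ev1 k)"
    using adj_loop_unique[OF cB p A.Comp_in[OF Kcxi k0(1)] k] ho.L_Comp[of "ku i" "ev1 k0"] by (simp add: ku_def[symmetric])
  obtain z where z: "z \<in> hom ho.H (Cod C p) (kk B)" "z \<cdot>\<^bsub>ho.H\<^esub> ho.L (ev1 k) = Ident ho.H (kk B)" "ho.L (ev1 k) \<cdot>\<^bsub>ho.H\<^esub> z = Ident ho.H (Cod C p)"
    by (rule H.iso_inverse[OF ho.L_iso[OF w]]) (rule that, simp_all)
  note [simp] = homD[OF z(1)]
  have "z \<cdot>\<^bsub>ho.H\<^esub> ho.L (ev1 k0) \<in> hom ho.H (kk A) (kk B)" by (simp add: hom_iff)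
  from ku_full[OF \<pi>(4) B this] obtain r where r: "r \<in> hom C A B" "ho.L (ku r) = z \<cdot>\<^bsub>ho.H\<^esub> ho.L (ev1 k0)" by blast
  note [simp] = homD[OF r(1)] ku(1-3)[of r]
  have ri: "ho.L (r \<cdot> i) = ho.L (Ident C B)"
  proof (rule ku_faithful[OF B(1) B(1)])
    show "r \<cdot> i \<in> hom C B B" "Ident C B \<in> hom C B B" by (simp_all add: hom_iff)
    have kB: "kk B \<in> Obj C" using Dom_Obj[OF kM(1)] by simp
    have "ho.L (ku (r \<cdot> i)) = (z \<cdot>\<^bsub>ho.H\<^esub> ho.L (ev1 k0)) \<cdot>\<^bsub>ho.H\<^esub> ho.L (ku i)"
      using ku_Comp[OF i(1) r(1)] r(2) ho.L_Comp[of "ku i" "ku r"] by simp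
    also have "\<dots> = z \<cdot>\<^bsub>ho.H\<^esub> ho.L (ev1 k)" using e1 by simp
    also have "\<dots> = ho.L (ku (Ident C B))" using z(2) ku_Ident[OF BO] ho.L_Ident[OF kB] by simp
    finally show "ho.L (ku (r \<cdot> i)) = ho.L (ku (Ident C B))" .
  qed
  have ir: "ho.L (i \<cdot> r) = ho.L (Ident C A)"
  proof -
    have cxr: "cx r \<in> Mor (Arr C)" "src (cx r) = ce A" "tgt (cx r) = ce B" "ev0 (cx r) = r" using cEm(6)[of r] by (simp_all add: cx_def)
    have Kcxr: "onmor K (cx r) \<in> hom (Arr C) (cok_map C (ce A)) (cok_map C (ce B))"
      using functor_hom[OF K_functor A.Mor_hom[OF cxr(1)]] cxr by simp
    let ?k1 = "(k0 \<cdot>\<^bsub>Arr C\<^esub> onmor K (cx i)) \<cdot>\<^bsub>Arr C\<^esub> onmor K (cx r)"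
    have h1: "k0 \<cdot>\<^bsub>Arr C\<^esub> onmor K (cx i) \<in> hom (Arr C) (cok_map C (ce B)) p" by (rule A.Comp_in[OF Kcxi k0(1)])
    have h2: "?k1 \<in> hom (Arr C) (cok_map C (ce A)) p" by (rule A.Comp_in[OF Kcxr h1])
    have a1: "\<Phi> (ce B) p (k0 \<cdot>\<^bsub>Arr C\<^esub> onmor K (cx i)) = \<Phi> (ce A) p k0 \<cdot>\<^bsub>Arr C\<^esub> cx i"
      using adj_nat_left[OF cxi(1) pD(1), of k0] k0 cxi by simp
    have a2: "\<Phi> (ce A) p ?k1 = \<Phi> (ce B) p (k0 \<cdot>\<^bsub>Arr C\<^esub> onmor K (cx i)) \<cdot>\<^bsub>Arr C\<^esub> cx r"
      using adj_nat_left[OF cxr(1) pD(1), of "k0 \<cdot>\<^bsub>Arr C\<^esub> onmor K (cx i)"] h1 cxr(2,3) by simp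
    have "ho.L (ev1 ?k1) = (ho.L (ev1 k0) \<cdot>\<^bsub>ho.H\<^esub> ho.L (ku i)) \<cdot>\<^bsub>ho.H\<^esub> ho.L (ku r)"
      using ho.L_Comp[of "ku i" "ev1 k0"] ho.L_Comp[of "ku r" "ev1 k0 \<cdot> ku i"] by (simp add: ku_def[symmetric])
    also have "\<dots> = ho.L (ev1 k) \<cdot>\<^bsub>ho.H\<^esub> (z \<cdot>\<^bsub>ho.H\<^esub> ho.L (ev1 k0))" unfolding e1 r(2) ..
    also have "\<dots> = Ident ho.H (Cod C p) \<cdot>\<^bsub>ho.H\<^esub> ho.L (ev1 k0)" by (rule H.reassoc[OF z(3)]) simp_all
    also have "\<dots> = ho.L (ev1 k0)" by (rule H.Comp_Ident_left[of _ "kk A"]) (simp add: hom_iff)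
    \<comment> \<open>The suspension of \<open>i \<cdot> r\<close> followed by \<open>ev1 k0\<close>
      is \<open>ev1 k0\<close> again, so the adjoints \<open>\<pi> \<cdot> i \<cdot> r\<close> and
      \<open>\<pi>\<close> have the same class.\<close>
    finally have "ho.L (ev0 (\<Phi> (ce A) p ?k1)) = ho.L (ev0 (\<Phi> (ce A) p k0))"
      by (rule adj_loop_inj[OF cA p h2 k0(1)])
    then have "ho.L (\<pi> \<cdot> (i \<cdot> r)) = ho.L \<pi>" using a1 a2 k0(2) cxi cxr by simp
    then have "ho.L \<pi> \<cdot>\<^bsub>ho.H\<^esub> ho.L (i \<cdot> r) = ho.L \<pi> \<cdot>\<^bsub>ho.H\<^esub> ho.L (Ident C A)"
      using ho.L_Comp[of "i \<cdot> r" \<pi>] ho.L_Comp[of "Ident C A" \<pi>] by simp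
    from H.iso_cancel_left[OF ho.L_iso[OF \<pi>(3)] this, of A] show ?thesis by (simp add: hom_iff)
  qed
  have "is_iso ho.H (ho.L i)"
    unfolding is_iso_def
    by (intro conjI bexI[of _ "ho.L r"]) (use ri ir ho.L_Ident[OF AO] ho.L_Ident[OF BO] in \<open>simp_all add: hom_iff\<close>)
  from L_iso_Weq[OF i(1) this] have "i \<in> Weq M" .
  from W_comp[OF this \<pi>(3)] show ?thesis using i(2) by simp
qed

text \<open>Essential surjectivity provides one suspension \<open>kk B\<close> weakly equivalent to
  the base, and its adjoint is a weak equivalence by \<open>bifibrant_unit\<close>. Hence both
  \<open>B\<close> and the domain of \<open>x\<close> map by weak equivalences to a cofibrant
  replacement \<open>A\<close> of the loop object, and two comparisons of cones carry the property
  from \<open>B\<close> to \<open>A\<close> and from \<open>A\<close> to \<open>x\<close>.\<close>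

theorem loop_counit:
  assumes x: "is_cone_arrow x" and p: "is_path_arrow p" and k: "k \<in> hom (Arr C) (cok_map C x) p"
    and w: "ev0 (\<Phi> x p k) \<in> Weq M"
  shows "ev1 k \<in> Weq M"
proof -
  note xD = cone_arrowD[OF x] and pD = path_arrowD[OF p]
  let ?O = "Dom C (ker_map C p)"
  have OO: "?O \<in> Obj C" using pD(1) by simp
  note ak = adj[OF xD(1) pD(1) k]
  note [simp] = pD(1) xD(1) ak(1-6)
  obtain B h where B: "is_cofibrant C M B" "is_fibrant C M B" and h: "h \<in> hom C (kk B) (Cod C p)" "h \<in> Weq M"
    using ku_ess_surj[OF pD(3)] by blast
  have BO [simp]: "B \<in> Obj C" using cofibrant_Obj[OF B(1)] .
  note cB = ce_cone[OF B(1)]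
  note [simp] = homD[OF h(1)] ce[OF BO]
  have kkB: "Cod C (cok_map C (ce B)) = kk B" by (simp add: kk_def)
  note [simp] = kkB
  obtain l where l: "l \<in> hom C (cE B) (Dom C p)" "p \<cdot> l = h \<cdot> cok_map C (ce B)"
    by (rule lift_cof[OF cone_arrowD(7)[OF cB] pD(2) disjI1[OF cone_arrowD(8)[OF cB]], of Z "cE B" "Dom C p" "Cod C p" "zmap C Z (Dom C p)" "h \<cdot> cok_map C (ce B)"])
      (use hom_Obj[OF h(1)] in \<open>simp_all add: hom_iff\<close>)
  let ?kB = "Sq (cok_map C (ce B)) p l h"
  have kB: "?kB \<in> hom (Arr C) (cok_map C (ce B)) p" using l homD[OF l(1)] by (simp add: Arr_hom)
  have gW: "ev0 (\<Phi> (ce B) p ?kB) \<in> Weq M" by (rule bifibrant_unit[OF B p kB]) (use h in simp)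
  note aB = adj[OF ce(1)[OF BO] pD(1) kB]
  obtain A \<pi> where \<pi>: "\<pi> \<in> hom C A ?O" "\<pi> \<in> Fib M" "\<pi> \<in> Weq M" "is_cofibrant C M A" using cofibrant_repl[OF OO] by blast
  have AO [simp]: "A \<in> Obj C" using cofibrant_Obj[OF \<pi>(4)] .
  note cA = ce_cone[OF \<pi>(4)]
  note [simp] = ce[OF AO] homD[OF \<pi>(1)] aB(1-6)
  have "ev0 (\<Phi> (ce B) p ?kB) \<in> hom C B ?O" "ev0 (\<Phi> x p k) \<in> hom C (Dom C x) ?O" by (simp_all add: hom_iff)
  from cofibrant_lift[OF B(1) \<pi>(2,3,1) this(1)] cofibrant_lift[OF xD(3) \<pi>(2,3,1) this(2)]
  obtain i a where i: "i \<in> hom C B A" "\<pi> \<cdot> i = ev0 (\<Phi> (ce B) p ?kB)" and a: "a \<in> hom C (Dom C x) A" "\<pi> \<cdot> a = ev0 (\<Phi> x p k)" by metis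
  note [simp] = homD[OF i(1)] homD[OF a(1)]
  have ia: "i \<in> Weq M" "a \<in> Weq M" using W_right[OF \<pi>(3), of i] W_right[OF \<pi>(3), of a] i a gW w by simp_all
  have "\<pi> \<in> hom C (Dom C (ce A)) ?O" by (simp add: hom_iff)
  from adj_ext[OF cA p this] obtain k0 where k0: "k0 \<in> hom (Arr C) (cok_map C (ce A)) p" "ev0 (\<Phi> (ce A) p k0) = \<pi>" by blast
  have "ev1 k0 \<in> Weq M"
    using cone_compare[OF cB cA p kB k0(1) _ ia(1)] h(2) i k0(2) by simp
  then show ?thesis
    using cone_compare[OF x cA p k k0(1) _ ia(2)] a k0(2) by simp
qed

text \<open>For \<open>bifibrant_unit\<close> the domain has to be fibrant as well. Replace it along
  \<open>j\<close>, extend the adjoint over the replacement, and compare the cones.\<close>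

theorem loop_unit:
  assumes x: "is_cone_arrow x" and p: "is_path_arrow p" and k: "k \<in> hom (Arr C) (cok_map C x) p"
    and w: "ev1 k \<in> Weq M"
  shows "ev0 (\<Phi> x p k) \<in> Weq M"
proof -
  note xD = cone_arrowD[OF x] and pD = path_arrowD[OF p]
  let ?O = "Dom C (ker_map C p)"
  note ak = adj[OF xD(1) pD(1) k]
  note [simp] = pD(1) xD(1) ak(1-6)
  have "Dom C x \<in> Obj C" by simp
  from fibrant_repl[OF this] obtain B j where j: "j \<in> hom C (Dom C x) B" "j \<in> Cof M" "j \<in> Weq M" and Bf: "is_fibrant C M B" by blast
  have Bc: "is_cofibrant C M B" using Cof_cofibrant[OF j(2,1) xD(3)] .
  have BO: "B \<in> Obj C" using cofibrant_Obj[OF Bc] .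
  note [simp] = homD[OF j(1)] ce[OF BO]
  note cB = ce_cone[OF Bc]
  have "ev0 (\<Phi> x p k) \<in> hom C (Dom C x) ?O" by (simp add: hom_iff)
  from fibrant_ext[OF pD(6) j(2,3,1) this] obtain a where a: "a \<in> hom C B ?O" "a \<cdot> j = ev0 (\<Phi> x p k)" by blast
  have "a \<in> hom C (Dom C (ce B)) ?O" using a by simp
  from adj_ext[OF cB p this] obtain k0 where k0: "k0 \<in> hom (Arr C) (cok_map C (ce B)) p" "ev0 (\<Phi> (ce B) p k0) = a" by blast
  have "ev1 k0 \<in> Weq M"
    using cone_compare[OF x cB p k k0(1) _ j(3)] w j a k0(2) by simp
  from bifibrant_unit[OF Bc Bf p k0(1) this] have "a \<in> Weq M" using k0(2) by simp
  from W_comp[OF j(3) this] show ?thesis using a homD[OF a(1)] by simp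
qed

end

section \<open>Homotopy fibres\<close>

context pointed_model_category
begin

sublocale I: model_category "Arr C" U "injective C M"
  by (rule injective_model)

text \<open>
  \<open>hf\<close>, \<open>hm\<close>: the homotopy fibre functor; \<open>eta\<close>: the map from the fibre to the homotopy fibre;
  \<open>un x\<close> (below): the map from the domain of \<open>x\<close> to the homotopy fibre of the cokernel of \<open>x\<close>.
\<close>

definition hf :: "'b \<Rightarrow> 'a" where "hf g = Dom C (ker_map C (I.fobj g))"
definition hm :: "'b square \<Rightarrow> 'b" where "hm s = ev0 (onmor R (I.fmor s))"

lemma rep:
  assumes g: "g \<in> Mor C"
  shows "I.fobj g \<in> Mor C" "I.frep g \<in> hom (Arr C) g (I.fobj g)" "I.frep g \<in> Mor (Arr C)" "src (I.frep g) = g" "tgt (I.frep g) = I.fobj g"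
    "ev0 (I.frep g) \<in> Weq M" "ev1 (I.frep g) \<in> Weq M" "ev0 (I.frep g) \<in> Mor C" "ev1 (I.frep g) \<in> Mor C"
    "Dom C (ev0 (I.frep g)) = Dom C g" "Cod C (ev0 (I.frep g)) = Dom C (I.fobj g)"
    "Dom C (ev1 (I.frep g)) = Cod C g" "Cod C (ev1 (I.frep g)) = Cod C (I.fobj g)"
    "is_fibrant (Arr C) (injective C M) (I.fobj g)"
    "I.fobj g \<in> Fib M" "is_fibrant C M (Cod C (I.fobj g))" "is_fibrant C M (Dom C (I.fobj g))"
    "ker_map C (I.fobj g) \<in> Mor C" "Dom C (ker_map C (I.fobj g)) = hf g" "Cod C (ker_map C (I.fobj g)) = Dom C (I.fobj g)"
proof -
  have gO: "g \<in> Obj (Arr C)" using g by simp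
  note f = I.frep[OF gO]
  show j: "I.frep g \<in> Mor (Arr C)" "src (I.frep g) = g" "tgt (I.frep g) = I.fobj g" using f by simp_all
  note D = Arr_MorD[OF j(1), unfolded j(2,3)]
  show "I.fobj g \<in> Mor C" "ev0 (I.frep g) \<in> Mor C" "ev1 (I.frep g) \<in> Mor C"
    "Dom C (ev0 (I.frep g)) = Dom C g" "Cod C (ev0 (I.frep g)) = Dom C (I.fobj g)"
    "Dom C (ev1 (I.frep g)) = Cod C g" "Cod C (ev1 (I.frep g)) = Cod C (I.fobj g)" by (fact D)+
  show "ev0 (I.frep g) \<in> Weq M" "ev1 (I.frep g) \<in> Weq M" using f(5) by (simp_all add: levelwise_iff)
  show "I.frep g \<in> hom (Arr C) g (I.fobj g)" using j by (simp add: hom_iff)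
  show F: "is_fibrant (Arr C) (injective C M) (I.fobj g)" by (fact f(6))
  show "I.fobj g \<in> Fib M" "is_fibrant C M (Cod C (I.fobj g))" "is_fibrant C M (Dom C (I.fobj g))" using injective_fibrantD[OF F] by auto
  show "ker_map C (I.fobj g) \<in> Mor C" "Dom C (ker_map C (I.fobj g)) = hf g" "Cod C (ker_map C (I.fobj g)) = Dom C (I.fobj g)"
    using ker_simps[OF D(2)] by (simp_all add: hf_def)
qed

lemma repm:
  assumes s: "s \<in> Mor (Arr C)"
  shows "I.fmor s \<in> Mor (Arr C)" "src (I.fmor s) = I.fobj (src s)" "tgt (I.fmor s) = I.fobj (tgt s)"
    "I.fmor s \<cdot>\<^bsub>Arr C\<^esub> I.frep (src s) = I.frep (tgt s) \<cdot>\<^bsub>Arr C\<^esub> s"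
    "ev0 (I.fmor s) \<in> Mor C" "Dom C (ev0 (I.fmor s)) = Dom C (I.fobj (src s))" "Cod C (ev0 (I.fmor s)) = Dom C (I.fobj (tgt s))"
    "ev1 (I.fmor s) \<in> Mor C" "Dom C (ev1 (I.fmor s)) = Cod C (I.fobj (src s))" "Cod C (ev1 (I.fmor s)) = Cod C (I.fobj (tgt s))"
    "ev0 (I.fmor s) \<cdot> ev0 (I.frep (src s)) = ev0 (I.frep (tgt s)) \<cdot> ev0 s"
    "ev1 (I.fmor s) \<cdot> ev1 (I.frep (src s)) = ev1 (I.frep (tgt s)) \<cdot> ev1 s"
proof -
  show m: "I.fmor s \<in> Mor (Arr C)" "src (I.fmor s) = I.fobj (src s)" "tgt (I.fmor s) = I.fobj (tgt s)"
    using I.fmor(1-3)[OF s] by simp_all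
  show e: "I.fmor s \<cdot>\<^bsub>Arr C\<^esub> I.frep (src s) = I.frep (tgt s) \<cdot>\<^bsub>Arr C\<^esub> s" using I.fmor_frep[OF s] by simp
  then show "ev0 (I.fmor s) \<cdot> ev0 (I.frep (src s)) = ev0 (I.frep (tgt s)) \<cdot> ev0 s"
    "ev1 (I.fmor s) \<cdot> ev1 (I.frep (src s)) = ev1 (I.frep (tgt s)) \<cdot> ev1 s" by simp_all
  show "ev0 (I.fmor s) \<in> Mor C" "Dom C (ev0 (I.fmor s)) = Dom C (I.fobj (src s))" "Cod C (ev0 (I.fmor s)) = Dom C (I.fobj (tgt s))"
    "ev1 (I.fmor s) \<in> Mor C" "Dom C (ev1 (I.fmor s)) = Cod C (I.fobj (src s))" "Cod C (ev1 (I.fmor s)) = Cod C (I.fobj (tgt s))"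
    using Arr_MorD(3-8)[OF m(1)] m(2,3) by simp_all
qed

lemma hm:
  assumes s: "s \<in> Mor (Arr C)"
  shows "hm s \<in> Mor C" "Dom C (hm s) = hf (src s)" "Cod C (hm s) = hf (tgt s)"
    "ker_map C (I.fobj (tgt s)) \<cdot> hm s = ev0 (I.fmor s) \<cdot> ker_map C (I.fobj (src s))"
  using R_mor(4-7)[OF repm(1)[OF s]] repm(2,3)[OF s] by (simp_all add: hm_def hf_def)

lemma hm_Comp:
  assumes "s \<in> Mor (Arr C)" "t \<in> Mor (Arr C)" "tgt s = src t"
  shows "hm (t \<cdot>\<^bsub>Arr C\<^esub> s) = hm t \<cdot> hm s"
proof -
  have e: "I.fmor (t \<cdot>\<^bsub>Arr C\<^esub> s) = I.fmor t \<cdot>\<^bsub>Arr C\<^esub> I.fmor s" by (rule I.fmor_Comp) (use assms in simp_all)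
  have "onmor R (I.fmor t \<cdot>\<^bsub>Arr C\<^esub> I.fmor s) = onmor R (I.fmor t) \<cdot>\<^bsub>Arr C\<^esub> onmor R (I.fmor s)"
    by (rule functorD(6)[OF R_functor]) (use repm[OF assms(1)] repm[OF assms(2)] assms(3) in simp_all)
  then show ?thesis unfolding hm_def e by simp
qed

lemma hm_Weq:
  assumes s: "s \<in> levelwise C (Weq M)"
  shows "hm s \<in> Weq M"
proof -
  have sM: "s \<in> Mor (Arr C)" using s by (simp add: levelwise_iff)
  have "I.fmor s \<in> levelwise C (Weq M)" using I.fmor_Weq[of s] s by simp
  then have "onmor R (I.fmor s) \<in> levelwise C (Weq M)"
    by (rule R_Weq) (simp_all add: repm(2,3)[OF sM] rep(14) Arr_MorD(1,2)[OF sM])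
  then show ?thesis by (simp add: levelwise_iff hm_def)
qed

definition eta :: "'b \<Rightarrow> 'b" where "eta g = ev0 (onmor R (I.frep g))"

lemma eta:
  assumes g: "g \<in> Mor C"
  shows "eta g \<in> Mor C" "Dom C (eta g) = Dom C (ker_map C g)" "Cod C (eta g) = hf g"
  using R_mor(4-6)[OF rep(3)[OF g]] rep(4,5)[OF g] by (simp_all add: eta_def hf_def)

lemma eta_Weq:
  assumes g: "is_fibrant (Arr C) (injective C M) g"
  shows "eta g \<in> Weq M"
proof -
  have gM: "g \<in> Mor C" using I.fibrant_Obj[OF g] by simp
  have "onmor R (I.frep g) \<in> levelwise C (Weq M)"
    by (rule R_Weq) (use rep[OF gM] g in \<open>simp_all add: levelwise_iff\<close>)
  then show ?thesis by (simp add: levelwise_iff eta_def)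
qed

lemma eta_nat:
  assumes s: "s \<in> Mor (Arr C)"
  shows "hm s \<cdot> eta (src s) = eta (tgt s) \<cdot> ev0 (onmor R s)"
proof -
  note sD = Arr_MorD(1,2)[OF s]
  note r1 = rep(3-5)[OF sD(1)] and r2 = rep(3-5)[OF sD(2)]
  have "onmor R (I.fmor s) \<cdot>\<^bsub>Arr C\<^esub> onmor R (I.frep (src s)) = onmor R (I.frep (tgt s)) \<cdot>\<^bsub>Arr C\<^esub> onmor R s"
    using functorD(6)[OF R_functor r1(1) repm(1)[OF s]] functorD(6)[OF R_functor s r2(1)] repm[OF s] r1 r2 by simp
  then show ?thesis by (simp add: hm_def eta_def)
qed

lemma kernel_unique:
  assumes k: "is_kernel C p k"
  obtains \<theta> where "is_iso C \<theta>" "\<theta> \<in> hom C (Dom C k) (Dom C (ker_map C p))" "ker_map C p \<cdot> \<theta> = k"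
proof -
  note kM = kernel_Mor[OF k] and kz = kernel_zero[OF k]
  note [simp] = kM kz(1)
  have kp: "is_kernel C p (ker_map C p)" by (rule ker) simp
  obtain a where a: "a \<in> Mor C" "Cod C a = Dom C (ker_map C p)" "Dom C a = Dom C k" "ker_map C p \<cdot> a = k"
    using kernel_ex[OF kp, of k] kz(2) by auto
  obtain b where b: "b \<in> Mor C" "Cod C b = Dom C k" "Dom C b = Dom C (ker_map C p)" "k \<cdot> b = ker_map C p"
    using kernel_ex[OF k, of "ker_map C p"] by auto
  note [simp] = a(1-3) b(1-3)
  have "a \<cdot> b = Ident C (Dom C (ker_map C p))" by (rule kernel_mono[OF kp]) (simp_all add: reassoc[OF a(4)] b(4))
  moreover have "b \<cdot> a = Ident C (Dom C k)" by (rule kernel_mono[OF k]) (simp_all add: reassoc[OF b(4)] a(4))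
  ultimately have "is_iso C a" unfolding is_iso_def by (intro conjI bexI[of _ b]) (simp_all add: hom_iff)
  then show thesis by (rule that) (simp_all add: hom_iff a(4))
qed

text \<open>Compare \<open>p\<close> with the map from its domain to the zero object: this is a
  levelwise weak equivalence between injectively fibrant arrows, and the identity is a kernel of the
  second arrow.\<close>

lemma kernel_contractible_base:
  assumes p: "p \<in> Fib M" "is_fibrant C M (Cod C p)" and c: "contractible (Cod C p)" and k: "is_kernel C p k"
  shows "k \<in> Weq M"
proof -
  have pM [simp]: "p \<in> Mor C" using Fib_Mor[OF p(1)] .
  have X: "is_fibrant C M (Dom C p)" using Fib_fibrant[OF p(1) Mor_hom[OF pM] p(2)] .
  let ?q = "zmap C (Dom C p) Z"
  have q: "?q \<in> Fib M" using fibrant_map[OF X Z_terminal] by (simp add: hom_iff)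
  have ZF: "is_fibrant C M Z" using Z_terminal Ident_Fib[of Z] by (auto simp: is_fibrant_def hom_iff intro!: exI[of _ Z] exI[of _ "Ident C Z"])
  let ?s = "Sq p ?q (Ident C (Dom C p)) (zmap C (Cod C p) Z)"
  have s: "?s \<in> levelwise C (Weq M)" "?s \<in> Mor (Arr C)"
    using c contractible_iff[of "Cod C p"] W_Ident[of "Dom C p"] by (simp_all add: levelwise_iff Arr_Mor)
  have "onmor R ?s \<in> levelwise C (Weq M)"
    by (rule R_Weq[OF s(1)]) (simp_all add: injective_fibrantI p q ZF)
  then have w: "ev0 (onmor R ?s) \<in> Weq M" unfolding levelwise_iff by blast
  have r: "ev0 (onmor R ?s) \<in> Mor C" "Dom C (ev0 (onmor R ?s)) = Dom C (ker_map C p)" "Cod C (ev0 (onmor R ?s)) = Dom C (ker_map C ?q)"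
    "ker_map C ?q \<cdot> ev0 (onmor R ?s) = ker_map C p" using R_mor(4-7)[OF s(2)] by simp_all
  have "is_kernel C ?q (Ident C (Dom C p))"
  proof -
    have "\<exists>!h. h \<in> hom C Y (Dom C p) \<and> Ident C (Dom C p) \<cdot> h = g" if g: "g \<in> hom C Y (Dom C p)" for Y g
    proof (rule ex1I[of _ g])
      fix h assume "h \<in> hom C Y (Dom C p) \<and> Ident C (Dom C p) \<cdot> h = g"
      then show "h = g" using Comp_Ident_left[of h Y "Dom C p"] by simp
    qed (use g Comp_Ident_left[OF g] in simp)
    then show ?thesis unfolding is_kernel_def by simp
  qed
  from kernel_unique[OF this] obtain \<theta> where t: "is_iso C \<theta>" "\<theta> \<in> hom C (Dom C (Ident C (Dom C p))) (Dom C (ker_map C ?q))" "ker_map C ?q \<cdot> \<theta> = Ident C (Dom C p)"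
    by blast
  note [simp] = homD[OF t(2), simplified]
  have kq: "ker_map C ?q \<in> Weq M"
    using W_left[OF iso_Weq[OF t(1)], of "ker_map C ?q"] t(3) W_Ident[of "Dom C p"] by simp
  have kp: "ker_map C p \<in> Weq M" using W_comp[OF w kq] r(3,4) by simp
  obtain \<theta> where t: "is_iso C \<theta>" "\<theta> \<in> hom C (Dom C k) (Dom C (ker_map C p))" "ker_map C p \<cdot> \<theta> = k" using kernel_unique[OF k] by blast
  show ?thesis using W_comp[OF iso_Weq[OF t(1)] kp] t homD[OF t(2)] by simp
qed

text \<open>Maps into the kernel are maps into the domain of \<open>p\<close> that \<open>p\<close>
  kills, so the map from the kernel to the zero object inherits lifting against every cofibration
  from \<open>p\<close>.\<close>

lemma kernel_TFib:
  assumes p: "p \<in> Fib M" "p \<in> Weq M"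
  shows "contractible (Dom C (ker_map C p))"
proof -
  have pM [simp]: "p \<in> Mor C" using Fib_Mor[OF p(1)] .
  let ?k = "Dom C (ker_map C p)"
  have kO: "?k \<in> Obj C" by simp
  have "zmap C ?k Z \<in> Weq M"
  proof (rule TFibI(2))
    fix i assume i: "i \<in> Cof M"
    have iM [simp]: "i \<in> Mor C" using Cof_Mor[OF i] .
    show "has_lifting C i (zmap C ?k Z)"
    proof (rule has_liftingI)
      fix u v assume u: "u \<in> hom C (Dom C i) (Dom C (zmap C ?k Z))" and v: "v \<in> hom C (Cod C i) (Cod C (zmap C ?k Z))"
      note [simp] = homD[OF u, simplified] homD[OF v, simplified]
      obtain h where h: "h \<in> hom C (Cod C i) (Dom C p)" "h \<cdot> i = ker_map C p \<cdot> u" "p \<cdot> h = zmap C (Cod C i) (Cod C p)"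
        by (rule lift_cof[OF i p(1) disjI2[OF p(2)] Mor_hom[OF iM] Mor_hom[OF pM], of "ker_map C p \<cdot> u" "zmap C (Cod C i) (Cod C p)"])
          (simp_all add: hom_iff reassoc[OF ker_simps(3)])
      note [simp] = homD[OF h(1)]
      obtain l where l: "l \<in> Mor C" "Cod C l = ?k" "Dom C l = Dom C h" "ker_map C p \<cdot> l = h"
        using kernel_ex[OF ker[OF pM], of h] h(3) by auto
      note [simp] = l(1-3)
      have "l \<cdot> i = u" by (rule kernel_mono[OF ker[OF pM]]) (simp_all add: reassoc[OF l(4)] h)
      moreover have "zmap C ?k Z \<cdot> l = v" by (rule to_Z_eq) simp_all
      ultimately show "\<exists>h\<in>hom C (Cod C i) (Dom C (zmap C ?k Z)). h \<cdot> i = u \<and> zmap C ?k Z \<cdot> h = v"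
        by (intro bexI[of _ l]) (simp_all add: hom_iff)
    qed
  qed simp
  then show ?thesis using contractible_iff[OF kO] by simp
qed

lemma hf_contractible_base:
  assumes g: "g \<in> Mor C" and c: "contractible (Cod C g)"
  shows "ker_map C (I.fobj g) \<in> Weq M"
  by (rule kernel_contractible_base[OF rep(15,16)[OF g] _ ker[OF rep(1)[OF g]]])
    (use contractible_transfer[OF rep(7)[OF g]] rep[OF g] c in simp)

lemma hf_Weq:
  assumes g: "g \<in> Weq M"
  shows "contractible (hf g)"
proof -
  have gM: "g \<in> Mor C" using Weq_Mor[OF g] .
  note r = rep[OF gM]
  have e: "I.fobj g \<cdot> ev0 (I.frep g) = ev1 (I.frep g) \<cdot> g" using Arr_MorD(9)[OF r(3)] r(4,5) by simp
  have "I.fobj g \<cdot> ev0 (I.frep g) \<in> Weq M" unfolding e using W_comp[OF g r(7)] r by simp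
  then have "I.fobj g \<in> Weq M" using W_left[OF r(6), of "I.fobj g"] by (simp add: r(1,8,11))
  from kernel_TFib[OF r(15) this] show ?thesis by (simp add: hf_def)
qed

definition un :: "'b \<Rightarrow> 'b" where "un x = ev0 (\<Phi> x (I.fobj (cok_map C x)) (I.frep (cok_map C x)))"

lemma un:
  assumes x: "x \<in> Mor C"
  shows "un x \<in> Mor C" "Dom C (un x) = Dom C x" "Cod C (un x) = hf (cok_map C x)"
    "ker_map C (I.fobj (cok_map C x)) \<cdot> un x = ev0 (I.frep (cok_map C x)) \<cdot> x"
proof -
  note r = rep[OF cok_simps(1)[OF x]]
  show "un x \<in> Mor C" "Dom C (un x) = Dom C x" "Cod C (un x) = hf (cok_map C x)"
    "ker_map C (I.fobj (cok_map C x)) \<cdot> un x = ev0 (I.frep (cok_map C x)) \<cdot> x"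
    using adj(4-7)[OF x r(1,2)] by (simp_all add: un_def hf_def)
qed

lemma un_nat:
  assumes s: "s \<in> Mor (Arr C)"
  shows "un (tgt s) \<cdot> ev0 s = hm (onmor K s) \<cdot> un (src s)"
proof -
  note sD = Arr_MorD(1,2)[OF s]
  note r1 = rep[OF cok_simps(1)[OF sD(1)]] and r2 = rep[OF cok_simps(1)[OF sD(2)]]
  have KM: "onmor K s \<in> Mor (Arr C)" using functorD(2)[OF K_functor s] .
  note Ke = K_mor(1,2)[OF s]
  note m = repm[OF KM, unfolded Ke]
  have "\<Phi> (tgt s) (I.fobj (cok_map C (tgt s))) (I.frep (cok_map C (tgt s))) \<cdot>\<^bsub>Arr C\<^esub> s
      = \<Phi> (src s) (I.fobj (cok_map C (tgt s))) (I.frep (cok_map C (tgt s)) \<cdot>\<^bsub>Arr C\<^esub> onmor K s)"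
    using adj_nat_left[OF s r2(1,2)] by simp
  also have "\<dots> = \<Phi> (src s) (I.fobj (cok_map C (tgt s))) (I.fmor (onmor K s) \<cdot>\<^bsub>Arr C\<^esub> I.frep (cok_map C (src s)))"
    unfolding m(4) ..
  also have "\<dots> = onmor R (I.fmor (onmor K s)) \<cdot>\<^bsub>Arr C\<^esub> \<Phi> (src s) (I.fobj (cok_map C (src s))) (I.frep (cok_map C (src s)))"
    using adj_nat_right[OF sD(1) m(1), of "I.frep (cok_map C (src s))"] r1(2) m(2,3) by simp
  finally show ?thesis by (simp add: un_def hm_def)
qed

text \<open>The quotient map of an identity is at once zero and epi, so its target is isomorphic to
  the zero object.\<close>

lemma cok_Ident_contractible:
  assumes X: "X \<in> Obj C"
  shows "contractible (Cod C (cok_map C (Ident C X)))"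
proof -
  let ?q = "cok_map C (Ident C X)"
  note c = cok_simps[OF Ident_Mor[OF X]]
  note [simp] = c(1,2) X
  have DO: "Cod C ?q \<in> Obj C" by simp
  have q: "?q = zmap C X (Cod C ?q)" using c(3) by simp
  have "zmap C Z (Cod C ?q) \<cdot> zmap C (Cod C ?q) Z = Ident C (Cod C ?q)"
  proof (rule cokernel_epi[OF cok[OF Ident_Mor[OF X]]])
    show "(zmap C Z (Cod C ?q) \<cdot> zmap C (Cod C ?q) Z) \<cdot> ?q = Ident C (Cod C ?q) \<cdot> ?q"
      using DO q by simp
  qed (use DO in simp_all)
  moreover have "zmap C (Cod C ?q) Z \<cdot> zmap C Z (Cod C ?q) = Ident C Z" by (rule to_Z_eq) (use DO in simp_all)
  ultimately have "is_iso C (zmap C Z (Cod C ?q))"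
    unfolding is_iso_def by (intro conjI bexI[of _ "zmap C (Cod C ?q) Z"]) (use DO in \<open>simp_all add: hom_iff\<close>)
  from iso_Weq[OF this] show ?thesis using DO by (simp add: contractible_def)
qed

text \<open>The quotient is contractible, so the inclusion of the homotopy fibre is a weak
  equivalence; composed with it, \<open>un\<close> becomes the replacement map of
  \<open>X\<close>.\<close>

lemma un_Ident:
  assumes X: "X \<in> Obj C"
  shows "un (Ident C X) \<in> Weq M"
proof -
  let ?q = "cok_map C (Ident C X)"
  note i = Ident_Mor[OF X]
  note [simp] = un(1-3)[OF i] rep[OF cok_simps(1)[OF i]] X
  have w: "ker_map C (I.fobj ?q) \<in> Weq M" by (rule hf_contractible_base) (use cok_Ident_contractible[OF X] in simp_all)
  have "ker_map C (I.fobj ?q) \<cdot> un (Ident C X) \<in> Weq M" using un(4)[OF i] by simp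
  then show ?thesis using W_right[OF w, of "un (Ident C X)"] by simp
qed

lemma cok_from_zero_iso:
  assumes X: "X \<in> Obj C"
  shows "is_iso C (cok_map C (zmap C Z X))"
proof -
  let ?f = "zmap C Z X"
  let ?q = "cok_map C ?f"
  have f: "?f \<in> Mor C" using X by simp
  note [simp] = cok_simps(1,2)[OF f] X
  obtain h where h: "h \<in> Mor C" "Dom C h = Cod C ?q" "Cod C h = Cod C (Ident C X)" "h \<cdot> ?q = Ident C X"
    using cokernel_ex[OF cok[OF f], of "Ident C X"] by auto
  note [simp] = h(1-3)
  have "?q \<cdot> h = Ident C (Cod C ?q)" by (rule cokernel_epi[OF cok[OF f]]) (use h(4) in simp_all)
  then show ?thesis unfolding is_iso_def by (intro conjI bexI[of _ h]) (use h(4) in \<open>simp_all add: hom_iff\<close>)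
qed

text \<open>Taking fibres commutes with taking fibres, and the map of base objects has contractible fibre.\<close>

lemma fibre_of_kernels:
  assumes t: "t \<in> hom (Arr C) p p'" and p: "is_fibrant (Arr C) (injective C M) p" "is_fibrant (Arr C) (injective C M) p'"
    and w: "ev1 t \<in> Weq M"
  shows "Sq (ev0 (onmor R t)) (ev0 t) (ker_map C p) (ker_map C p') \<in> Mor (Arr C)"
    "hm (Sq (ev0 (onmor R t)) (ev0 t) (ker_map C p) (ker_map C p')) \<in> Weq M"
proof -
  have tM: "t \<in> Mor (Arr C)" "src t = p" "tgt t = p'" using t by (auto simp: hom_iff)
  note tD = Arr_MorD[OF tM(1), unfolded tM(2,3)] and Rt = R_mor[OF tM(1), unfolded tM(2,3)]
  note [simp] = tD(1-8) Rt(4-6)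
  note pF = injective_fibrantD[OF p(1)] and pF' = injective_fibrantD[OF p(2)]
  let ?kap = "Sq (ev0 (onmor R t)) (ev0 t) (ker_map C p) (ker_map C p')"
  show kap: "?kap \<in> Mor (Arr C)" using Rt(7) by (simp add: Arr_Mor)
  have et: "ev0 t \<in> hom C (Dom C p) (Dom C p')" by (simp add: hom_iff)
  \<comment> \<open>Replace the map of total objects by a fibration \<open>g\<close>, so that the
    remaining fibres can be taken strictly.\<close>
  from factor_tcof[OF et] obtain G i g where i: "i \<in> hom C (Dom C p) G" "i \<in> Weq M" and g: "g \<in> hom C G (Dom C p')" "g \<in> Fib M"
    and eg: "ev0 t = g \<cdot> i" by blast
  note [simp] = homD[OF i(1)] homD[OF g(1)]
  let ?pG = "p' \<cdot> g"
  have pG: "?pG \<in> Fib M" using Fib_comp[OF g(2) pF'(1)] by simp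
  have pGf: "is_fibrant (Arr C) (injective C M) ?pG" by (rule injective_fibrantI[OF pG]) (simp add: pF')
  have gf: "is_fibrant (Arr C) (injective C M) g" by (rule injective_fibrantI[OF g(2)]) (simp add: pF')
  let ?a = "Sq p ?pG i (ev1 t)" and ?b = "Sq ?pG p' g (Ident C (Cod C p'))"
  have a: "?a \<in> Mor (Arr C)" using tD(9) eg by (simp add: Arr_Mor)
  have b: "?b \<in> Mor (Arr C)" by (simp add: Arr_Mor)
  have aW: "?a \<in> levelwise C (Weq M)" using a i w by (simp add: levelwise_iff)
  have RaW: "onmor R ?a \<in> levelwise C (Weq M)" by (rule R_Weq[OF aW]) (simp_all add: p pGf)
  note Ra = R_mor[OF a, simplified] and Rb = R_mor[OF b, simplified]
  define n where "n = ev0 (onmor R ?a)"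
  define h where "h = ev0 (onmor R ?b)"
  have n: "n \<in> Mor C" "Dom C n = Dom C (ker_map C p)" "Cod C n = Dom C (ker_map C ?pG)" "ker_map C ?pG \<cdot> n = i \<cdot> ker_map C p" "n \<in> Weq M"
    using Ra RaW by (simp_all add: n_def levelwise_iff)
  have h: "h \<in> Mor C" "Dom C h = Dom C (ker_map C ?pG)" "Cod C h = Dom C (ker_map C p')" "ker_map C p' \<cdot> h = g \<cdot> ker_map C ?pG"
    using Rb by (simp_all add: h_def)
  note [simp] = n(1-3) h(1-3)
  have pGM [simp]: "?pG \<in> Mor C" by simp
  have hn: "h \<cdot> n = ev0 (onmor R t)"
    by (rule kernel_mono[OF ker[OF tD(2)]]) (simp_all add: reassoc2[OF h(4)] n(4) Rt(7) eg)
  \<comment> \<open>The map \<open>h\<close> is the pullback of \<open>g\<close> along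
    \<open>ker_map C p'\<close>: a lift against \<open>g\<close> lands in the kernel and gives the
    lift against \<open>h\<close>.\<close>
  have hF: "h \<in> Fib M"
  proof (rule FibI)
    fix c assume c: "c \<in> Cof M" "c \<in> Weq M"
    have cM [simp]: "c \<in> Mor C" using Cof_Mor[OF c(1)] .
    show "has_lifting C c h"
    proof (rule has_liftingI)
      fix u v assume u: "u \<in> hom C (Dom C c) (Dom C h)" and v: "v \<in> hom C (Cod C c) (Cod C h)" and e: "h \<cdot> u = v \<cdot> c"
      note [simp] = homD[OF u, simplified] homD[OF v, simplified]
      obtain l where l: "l \<in> hom C (Cod C c) G" "l \<cdot> c = ker_map C ?pG \<cdot> u" "g \<cdot> l = ker_map C p' \<cdot> v"
        by (rule lift_cof[OF c(1) g(2) disjI1[OF c(2)] Mor_hom[OF cM] g(1), of "ker_map C ?pG \<cdot> u" "ker_map C p' \<cdot> v"])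
          (simp_all add: hom_iff reassoc2[OF h(4)[symmetric]] e)
      note [simp] = homD[OF l(1)]
      have "?pG \<cdot> l = zmap C (Dom C l) (Cod C ?pG)" by (simp add: l(3) reassoc[OF ker_simps(3)])
      then obtain l' where l': "l' \<in> Mor C" "Cod C l' = Dom C (ker_map C ?pG)" "Dom C l' = Cod C c" "ker_map C ?pG \<cdot> l' = l"
        using kernel_ex[OF ker[OF pGM], of l] by auto
      note [simp] = l'(1-3)
      have "l' \<cdot> c = u" by (rule kernel_mono[OF ker[OF pGM]]) (simp_all add: reassoc[OF l'(4)] l(2))
      moreover have "h \<cdot> l' = v" by (rule kernel_mono[OF ker[OF tD(2)]]) (simp_all add: reassoc2[OF h(4)] l'(4) l(3))
      ultimately show "\<exists>k\<in>hom C (Cod C c) (Dom C h). k \<cdot> c = u \<and> h \<cdot> k = v"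
        by (intro bexI[of _ l']) (simp_all add: hom_iff)
    qed
  qed simp
  have hf: "is_fibrant (Arr C) (injective C M) h"
    by (rule injective_fibrantI[OF hF]) (simp add: kernel_fibrant[OF pF'(1,2)])
  let ?kG = "Sq h g (ker_map C ?pG) (ker_map C p')"
  have kG: "?kG \<in> Mor (Arr C)" using h(4) by (simp add: Arr_Mor)
  define m where "m = ev0 (onmor R ?kG)"
  have m: "m \<in> Mor C" "Dom C m = Dom C (ker_map C h)" "Cod C m = Dom C (ker_map C g)" "ker_map C g \<cdot> m = ker_map C ?pG \<cdot> ker_map C h"
    using R_mor[OF kG] by (simp_all add: m_def)
  note [simp] = m(1-3)
  have "?pG \<cdot> ker_map C g = zmap C (Dom C (ker_map C g)) (Cod C ?pG)" by simp
  \<comment> \<open>The kernel of \<open>g\<close> maps to the kernel of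
    \<open>p' \<cdot> g\<close>, and from there to the kernel of \<open>h\<close>; this is the
    inverse of \<open>m\<close>.\<close>
  then obtain m1 where m1: "m1 \<in> Mor C" "Cod C m1 = Dom C (ker_map C ?pG)" "Dom C m1 = Dom C (ker_map C g)" "ker_map C ?pG \<cdot> m1 = ker_map C g"
    using kernel_ex[OF ker[OF pGM], of "ker_map C g"] by auto
  note [simp] = m1(1-3)
  have "h \<cdot> m1 = zmap C (Dom C (ker_map C g)) (Dom C (ker_map C p'))"
    by (rule kernel_mono[OF ker[OF tD(2)]]) (simp_all add: reassoc2[OF h(4)] m1(4))
  then obtain m2 where m2: "m2 \<in> Mor C" "Cod C m2 = Dom C (ker_map C h)" "Dom C m2 = Dom C (ker_map C g)" "ker_map C h \<cdot> m2 = m1"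
    using kernel_ex[OF ker[OF h(1)], of m1] by auto
  note [simp] = m2(1-3)
  have gM: "g \<in> Mor C" by simp
  have "m \<cdot> m2 = Ident C (Dom C (ker_map C g))"
    by (rule kernel_mono[OF ker[OF gM]]) (simp_all add: reassoc2[OF m(4)] m2(4) m1(4))
  moreover have "m2 \<cdot> m = Ident C (Dom C (ker_map C h))"
  proof (rule kernel_mono[OF ker[OF h(1)]])
    show "ker_map C h \<cdot> (m2 \<cdot> m) = ker_map C h \<cdot> Ident C (Dom C (ker_map C h))"
      by (rule kernel_mono[OF ker[OF pGM]]) (simp_all add: reassoc[OF m2(4)] reassoc[OF m1(4)] m(4))
  qed simp_all
  ultimately have "is_iso C m" unfolding is_iso_def by (intro conjI bexI[of _ m2]) (simp_all add: hom_iff)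
  then have mW: "m \<in> Weq M" by (rule iso_Weq)
  note [simp] = eta[OF h(1)] eta[OF gM] hm(1-3)[OF kG] hm(1-3)[OF kap]
  have "eta g \<cdot> m \<in> Weq M" using W_comp[OF mW eta_Weq[OF gf]] by simp
  then have "hm ?kG \<cdot> eta h \<in> Weq M" using eta_nat[OF kG] by (simp add: m_def)
  then have kGW: "hm ?kG \<in> Weq M" using W_left[OF eta_Weq[OF hf], of "hm ?kG"] by simp
  \<comment> \<open>Both squares are levelwise weak equivalences; they replace the map of fibres by
    \<open>h\<close> and \<open>ev0 t\<close> by \<open>g\<close>, so the claim moves from
    \<open>?kG\<close> to \<open>?kap\<close>.\<close>
  let ?s = "Sq (ev0 (onmor R t)) h n (Ident C (Dom C (ker_map C p')))" and ?s' = "Sq (ev0 t) g i (Ident C (Dom C p'))"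
  have s: "?s \<in> Mor (Arr C)" "?s \<in> levelwise C (Weq M)" using hn n(5) W_Ident by (simp_all add: levelwise_iff Arr_Mor)
  have s': "?s' \<in> Mor (Arr C)" "?s' \<in> levelwise C (Weq M)" using eg i(2) W_Ident by (simp_all add: levelwise_iff Arr_Mor)
  note [simp] = hm(1-3)[OF s(1)] hm(1-3)[OF s'(1)]
  have "?kG \<cdot>\<^bsub>Arr C\<^esub> ?s = ?s' \<cdot>\<^bsub>Arr C\<^esub> ?kap" by (rule square_eqI) (simp_all add: n(4))
  then have "hm ?kG \<cdot> hm ?s = hm ?s' \<cdot> hm ?kap"
    using hm_Comp[OF s(1) kG] hm_Comp[OF kap s'(1)] by simp
  moreover have "hm ?kG \<cdot> hm ?s \<in> Weq M" using W_comp[OF hm_Weq[OF s(2)] kGW] by simp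
  ultimately show "hm ?kap \<in> Weq M" using W_right[OF hm_Weq[OF s'(2)], of "hm ?kap"] by simp
qed

text \<open>By saturation this reduces to isomorphisms in the homotopy category.\<close>

lemma Weq_two_of_six:
  assumes "g \<cdot> f \<in> Weq M" "h \<cdot> g \<in> Weq M" "f \<in> hom C X Y" "g \<in> hom C Y V" "h \<in> hom C V V'"
  shows "f \<in> Weq M"
proof -
  interpret H: category ho.H by (rule ho.category_H)
  note [simp] = homD[OF assms(3)] homD[OF assms(4)] homD[OF assms(5)]
  have "is_iso ho.H (ho.L g \<cdot>\<^bsub>ho.H\<^esub> ho.L f)" "is_iso ho.H (ho.L h \<cdot>\<^bsub>ho.H\<^esub> ho.L g)"
    using ho.L_iso[OF assms(1)] ho.L_iso[OF assms(2)] ho.L_Comp[of f g] ho.L_Comp[of g h] by simp_all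
  from H.iso_two_of_six[OF this] have "is_iso ho.H (ho.L f)" by simp
  from L_iso_Weq[OF assms(3) this] show ?thesis .
qed

text \<open>The square is a projective cofibration, and the cokernel is left Quillen.\<close>

lemma cok_map_Cof:
  assumes f: "f \<in> hom C A B" and c: "c \<in> Cof M" "c \<in> hom C B E"
  shows "ev1 (onmor K (Sq f (c \<cdot> f) (Ident C A) c)) \<in> Cof M"
proof -
  have [simp]: "A \<in> Obj C" using hom_Obj[OF f] by simp
  note [simp] = homD[OF f] homD[OF c(2)]
  let ?s = "Sq f (c \<cdot> f) (Ident C A) c"
  have s: "?s \<in> Mor (Arr C)" by (simp add: Arr_Mor)
  have "?s \<in> Cof (projective C M)"
  proof -
    have "has_lifting (Arr C) ?s p" if p: "p \<in> levelwise C (Fib M)" "p \<in> levelwise C (Weq M)" for p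
    proof (rule has_liftingI)
      have pM: "p \<in> Mor (Arr C)" and t: "ev1 p \<in> Fib M" "ev1 p \<in> Weq M" using p by (auto simp: levelwise_iff)
      note pD = Arr_MorD[OF pM]
      fix u v assume u: "u \<in> hom (Arr C) (Dom (Arr C) ?s) (Dom (Arr C) p)" and v: "v \<in> hom (Arr C) (Cod (Arr C) ?s) (Cod (Arr C) p)"
        and e: "p \<cdot>\<^bsub>Arr C\<^esub> u = v \<cdot>\<^bsub>Arr C\<^esub> ?s"
      have u': "src u = f" "tgt u = src p" "ev0 u \<in> Mor C" "Dom C (ev0 u) = A" "Cod C (ev0 u) = Dom C (src p)" 
        "ev1 u \<in> Mor C" "Dom C (ev1 u) = B" "Cod C (ev1 u) = Cod C (src p)" "src p \<cdot> ev0 u = ev1 u \<cdot> f" 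
        and v': "src v = c \<cdot> f" "tgt v = tgt p" "ev0 v \<in> Mor C" "Dom C (ev0 v) = A" "Cod C (ev0 v) = Dom C (tgt p)"
        "ev1 v \<in> Mor C" "Dom C (ev1 v) = E" "Cod C (ev1 v) = Cod C (tgt p)"
        using u v by (auto simp: Arr_hom)
      note [simp] = pD(1-8) u'(3-8) v'(3-8)
      have e': "ev0 p \<cdot> ev0 u = ev0 v" "ev1 p \<cdot> ev1 u = ev1 v \<cdot> c" using e by simp_all
      obtain l where l: "l \<in> hom C E (Cod C (src p))" "l \<cdot> c = ev1 u" "ev1 p \<cdot> l = ev1 v"
        by (rule lift_cof[OF c(1) t(1) disjI2[OF t(2)] c(2), of "Cod C (src p)" "Cod C (tgt p)" "ev1 u" "ev1 v"])
          (simp_all add: hom_iff e')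
      note [simp] = homD[OF l(1)]
      show "\<exists>h\<in>hom (Arr C) (Cod (Arr C) ?s) (Dom (Arr C) p). h \<cdot>\<^bsub>Arr C\<^esub> ?s = u \<and> p \<cdot>\<^bsub>Arr C\<^esub> h = v"
        by (rule bexI[of _ "Sq (c \<cdot> f) (src p) (ev0 u) l"])
          (auto intro!: square_eqI simp: Arr_hom u' v' l e' reassoc[OF l(2)])
    qed
    then show ?thesis using s by simp
  qed
  from K_preserves(1)[OF this] show ?thesis by (simp add: levelwise_iff)
qed

end

section \<open>Cofibre sequences are fibre sequences\<close>

context stable_model_category
begin

text \<open>The fibrant replacement of the quotient map of a cone has contractible domain, so it is
  a path fibration, and \<open>loop_unit\<close> applies to the replacement square.\<close>

lemma un_cone:
  assumes x: "is_cone_arrow x"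
  shows "un x \<in> Weq M"
proof -
  note xD = cone_arrowD[OF x]
  note r = rep[OF cok_simps(1)[OF xD(1)]]
  have p: "is_path_arrow (I.fobj (cok_map C x))"
    using r contractible_transfer[OF r(6)] xD(1,5) by (simp add: is_path_arrow_def)
  show ?thesis unfolding un_def by (rule loop_unit[OF x p r(2,7)])
qed

text \<open>A cube of arrows, with homotopy fibres of cokernels taken at each vertex. One layer
  consists of \<open>f\<close>, \<open>0 \<rightarrow> D\<close> and the identities of
  \<open>B\<close> and \<open>D\<close>, where \<open>D\<close> is the quotient; the other layer
  consists of cones, for which \<open>un_cone\<close> applies. The homotopy fibres of the edges
  \<open>P v0\<close>, \<open>P w0\<close>, \<open>P w1\<close> are then related by
  two-out-of-six.\<close>

lemma un_Weq:
  assumes fc: "f \<in> Cof M" and A: "is_cofibrant C M (Dom C f)"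
  shows "un f \<in> Weq M"
proof -
  have fM [simp]: "f \<in> Mor C" using Cof_Mor[OF fc] .
  let ?A = "Dom C f" and ?B = "Cod C f"
  have AO [simp]: "?A \<in> Obj C" "?B \<in> Obj C" by simp_all
  define q where "q = cok_map C f"
  define D where "D = Cod C q"
  have q [simp]: "q \<in> Mor C" "Dom C q = ?B" "Cod C q = D" and qf: "q \<cdot> f = zmap C ?A D" by (simp_all add: q_def D_def)
  have DO [simp]: "D \<in> Obj C" using Cod_Obj[OF q(1)] by simp
  have Dc: "is_cofibrant C M D" using cokernel_cofibrant[OF fc A] by (simp add: D_def q_def)
  have Bc: "is_cofibrant C M ?B" using Cof_cofibrant[OF fc Mor_hom[OF fM] A] .
  have ZI: "contractible Z" by (rule contractible_zero)
  have Zc: "is_cofibrant C M Z" using Z_initial Ident_Cof[of Z] by (auto simp: is_cofibrant_def hom_iff intro!: exI[of _ Z] exI[of _ "Ident C Z"])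
  have bz: "zmap C ?B Z \<in> hom C ?B Z" by (simp add: hom_iff)
  \<comment> \<open>A cone on the codomain of \<open>f\<close>; composed with \<open>f\<close> it
    becomes a cone on the domain.\<close>
  from factor_cof[OF bz] obtain E c r where c: "c \<in> hom C ?B E" "c \<in> Cof M" and r: "r \<in> hom C E Z" "r \<in> Weq M" by blast
  note [simp] = homD[OF c(1)] homD[OF r(1)]
  have E: "contractible E" using contractible_transfer[OF r(2)] ZI by simp
  have EO [simp]: "E \<in> Obj C" using E by (simp add: contractible_def)
  let ?f1 = "c \<cdot> f"
  have f1: "?f1 \<in> Cof M" using Cof_comp[OF fc c(2)] by simp
  define q1 where "q1 = cok_map C ?f1"
  define D1 where "D1 = Cod C q1"
  have q1 [simp]: "q1 \<in> Mor C" "Dom C q1 = E" "Cod C q1 = D1" and q1f: "q1 \<cdot> (c \<cdot> f) = zmap C ?A D1"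
    using cok_simps[of ?f1] by (simp_all add: q1_def D1_def)
  let ?m00 = "Sq f ?f1 (Ident C ?A) c"
  have m00: "?m00 \<in> Mor (Arr C)" by (simp add: Arr_Mor)
  define d where "d = ev1 (onmor K ?m00)"
  have d [simp]: "d \<in> Mor C" "Dom C d = D" "Cod C d = D1" and dq: "d \<cdot> q = q1 \<cdot> c"
    using K_mor(4-7)[OF m00] by (simp_all add: d_def q_def q1_def D_def D1_def)
  have dC: "d \<in> Cof M" unfolding d_def by (rule cok_map_Cof[OF Mor_hom[OF fM] c(2,1)])
  have d1z: "zmap C D1 Z \<in> hom C D1 Z" using Cod_Obj[OF q1(1)] by (simp add: hom_iff)
  \<comment> \<open>The map \<open>d\<close> from \<open>D\<close> to the quotient \<open>D1\<close>
    of \<open>E\<close> by the domain of \<open>f\<close> is a cofibration, so a cone on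
    \<open>D1\<close> restricts to one on \<open>D\<close>.\<close>
  from factor_cof[OF d1z] obtain E3 e r3 where e: "e \<in> hom C D1 E3" "e \<in> Cof M" and r3: "r3 \<in> hom C E3 Z" "r3 \<in> Weq M" by blast
  note [simp] = homD[OF e(1)] homD[OF r3(1)]
  have E3: "contractible E3" using contractible_transfer[OF r3(2)] ZI by simp
  have E3O [simp]: "E3 \<in> Obj C" using E3 by (simp add: contractible_def)
  define e3 where "e3 = e \<cdot> d"
  define g where "g = e \<cdot> q1"
  have e3 [simp]: "e3 \<in> Mor C" "Dom C e3 = D" "Cod C e3 = E3" and g [simp]: "g \<in> Mor C" "Dom C g = E" "Cod C g = E3"
    by (simp_all add: e3_def g_def)
  have e3C: "e3 \<in> Cof M" using Cof_comp[OF dC e(2)] by (simp add: e3_def)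
  have e3q: "e3 \<cdot> q = g \<cdot> c" by (simp add: e3_def g_def dq)
  have D1O: "D1 \<in> Obj C" using Cod_Obj[OF q1(1)] by simp
  have gf: "g \<cdot> (c \<cdot> f) = zmap C ?A E3" using q1f D1O by (simp add: g_def)
  have cones: "is_cone_arrow ?f1" "is_cone_arrow c" "is_cone_arrow (zmap C Z E3)" "is_cone_arrow e3"
    using f1 A E c(2) Bc e3C Dc E3 Zc cofibrant_map[OF Cof_cofibrant[OF e3C Mor_hom[OF e3(1)]] Z_initial, of "zmap C Z E3"]
    by (simp_all add: is_cone_arrow_def hom_iff)
  \<comment> \<open>The layers have the vertices \<open>f\<close>, \<open>?x01\<close>,
    \<open>?x10\<close>, \<open>?x11\<close> and \<open>c \<cdot> f\<close>, \<open>c\<close>,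
    \<open>?y10\<close>, \<open>e3\<close>. The edges named \<open>a\<close> and \<open>v\<close>
    lie in the first layer, those named \<open>b\<close> and \<open>w\<close> in the second; the
    \<open>m\<close> edges lead from the first to the second.\<close>
  let ?x01 = "Ident C ?B" and ?x10 = "zmap C Z D" and ?x11 = "Ident C D" and ?y10 = "zmap C Z E3"
  define a0 where "a0 = Sq f ?x01 f (Ident C ?B)"
  define a1 where "a1 = Sq ?x10 ?x11 (zmap C Z D) (Ident C D)"
  define v0 where "v0 = Sq f ?x10 (zmap C ?A Z) q"
  define v1 where "v1 = Sq ?x01 ?x11 q q"
  define b0 where "b0 = Sq ?f1 c f (Ident C E)"
  define b1 where "b1 = Sq ?y10 e3 (zmap C Z D) (Ident C E3)"
  define w0 where "w0 = Sq ?f1 ?y10 (zmap C ?A Z) g"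
  define w1 where "w1 = Sq c e3 q g"
  define m0 where "m0 = ?m00"
  define m01 where "m01 = Sq ?x01 c (Ident C ?B) c"
  define m10 where "m10 = Sq ?x10 ?y10 (Ident C Z) e3"
  define m11 where "m11 = Sq ?x11 e3 (Ident C D) e3"
  note defs = a0_def a1_def v0_def v1_def b0_def b1_def w0_def w1_def m0_def m01_def m10_def m11_def
  have M: "a0 \<in> Mor (Arr C)" "a1 \<in> Mor (Arr C)" "v0 \<in> Mor (Arr C)" "v1 \<in> Mor (Arr C)" "b0 \<in> Mor (Arr C)" "b1 \<in> Mor (Arr C)"
    "w0 \<in> Mor (Arr C)" "w1 \<in> Mor (Arr C)" "m0 \<in> Mor (Arr C)" "m01 \<in> Mor (Arr C)" "m10 \<in> Mor (Arr C)" "m11 \<in> Mor (Arr C)"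
    by (simp_all add: defs Arr_Mor qf gf e3q)
  have ends: "src a0 = f" "tgt a0 = ?x01" "src a1 = ?x10" "tgt a1 = ?x11" "src v0 = f" "tgt v0 = ?x10" "src v1 = ?x01" "tgt v1 = ?x11"
    "src b0 = ?f1" "tgt b0 = c" "src b1 = ?y10" "tgt b1 = e3" "src w0 = ?f1" "tgt w0 = ?y10" "src w1 = c" "tgt w1 = e3"
    "src m0 = f" "tgt m0 = ?f1" "src m01 = ?x01" "tgt m01 = c" "src m10 = ?x10" "tgt m10 = ?y10" "src m11 = ?x11" "tgt m11 = e3"
    by (simp_all add: defs)
  have cube: "v1 \<cdot>\<^bsub>Arr C\<^esub> a0 = a1 \<cdot>\<^bsub>Arr C\<^esub> v0" "w0 \<cdot>\<^bsub>Arr C\<^esub> m0 = m10 \<cdot>\<^bsub>Arr C\<^esub> v0" "w1 \<cdot>\<^bsub>Arr C\<^esub> b0 = b1 \<cdot>\<^bsub>Arr C\<^esub> w0"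
    "w1 \<cdot>\<^bsub>Arr C\<^esub> m01 = m11 \<cdot>\<^bsub>Arr C\<^esub> v1" "b0 \<cdot>\<^bsub>Arr C\<^esub> m0 = m01 \<cdot>\<^bsub>Arr C\<^esub> a0" "b1 \<cdot>\<^bsub>Arr C\<^esub> m10 = m11 \<cdot>\<^bsub>Arr C\<^esub> a1"
    by (simp_all add: defs qf e3q)
  define P where "P = (\<lambda>s. hm (onmor K s))"
  have KM: "onmor K s \<in> Mor (Arr C)" "src (onmor K s) = cok_map C (src s)" "tgt (onmor K s) = cok_map C (tgt s)" if "s \<in> Mor (Arr C)" for s
    using functorD(2)[OF K_functor that] K_mor(1,2)[OF that] by auto
  have P: "P s \<in> Mor C" "Dom C (P s) = hf (cok_map C (src s))" "Cod C (P s) = hf (cok_map C (tgt s))" if "s \<in> Mor (Arr C)" for s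
    using hm(1-3)[OF KM(1)[OF that]] KM(2,3)[OF that] by (simp_all add: P_def)
  have PC: "P (t \<cdot>\<^bsub>Arr C\<^esub> s) = P t \<cdot> P s" if "s \<in> Mor (Arr C)" "t \<in> Mor (Arr C)" "tgt s = src t" for s t
    using functorD(6)[OF K_functor that(1,2)] hm_Comp[OF KM(1)[OF that(1)] KM(1)[OF that(2)]] that KM by (simp add: P_def del: Arr_simps(5)) 
  have Pcube: "P v1 \<cdot> P a0 = P a1 \<cdot> P v0" "P w0 \<cdot> P m0 = P m10 \<cdot> P v0" "P w1 \<cdot> P b0 = P b1 \<cdot> P w0"
    "P w1 \<cdot> P m01 = P m11 \<cdot> P v1" "P b0 \<cdot> P m0 = P m01 \<cdot> P a0" "P b1 \<cdot> P m10 = P m11 \<cdot> P a1"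
    using cube by (simp_all add: PC[symmetric] M ends del: Arr_simps(5))
  note [simp] = P[OF M(1), unfolded ends] P[OF M(2), unfolded ends] P[OF M(3), unfolded ends] P[OF M(4), unfolded ends]
    P[OF M(5), unfolded ends] P[OF M(6), unfolded ends] P[OF M(7), unfolded ends] P[OF M(8), unfolded ends]
    P[OF M(9), unfolded ends] P[OF M(10), unfolded ends] P[OF M(11), unfolded ends] P[OF M(12), unfolded ends]
  have un_P: "un (tgt s) \<cdot> ev0 s = P s \<cdot> un (src s)" if "s \<in> Mor (Arr C)" for s
    using un_nat[OF that] by (simp add: P_def)
  have f1M: "?f1 \<in> Mor C" and cM: "c \<in> Mor C" and xM: "?x01 \<in> Mor C" "?x10 \<in> Mor C" "?x11 \<in> Mor C" "?y10 \<in> Mor C" by simp_all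
  note [simp] = un(1-3)[OF fM] un(1-3)[OF f1M] un(1-3)[OF cM] un(1-3)[OF xM(1)] un(1-3)[OF xM(2)] un(1-3)[OF xM(3)] un(1-3)[OF xM(4)] un(1-3)[OF e3(1)]
  let ?a = "zmap C ?A Z"
  \<comment> \<open>Faces of the cube as squares between the maps \<open>P v0\<close>,
    \<open>P v1\<close>, \<open>P w0\<close>, \<open>P w1\<close> of homotopy fibres. The square
    \<open>ua\<close> leads from the map \<open>?A \<rightarrow> 0\<close> to \<open>P v0\<close> by
    the maps \<open>un\<close>.\<close>
  define ua where "ua = Sq ?a (P v0) (un f) (un ?x10)"
  define al where "al = Sq (P v0) (P v1) (P a0) (P a1)"
  define be where "be = Sq (P v0) (P w0) (P m0) (P m10)"
  define ga where "ga = Sq (P w0) (P w1) (P b0) (P b1)"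
  define de where "de = Sq (P v1) (P w1) (P m01) (P m11)"
  have v0a: "ev0 v0 = ?a" by (simp add: v0_def)
  have N: "ua \<in> Mor (Arr C)" "al \<in> Mor (Arr C)" "be \<in> Mor (Arr C)" "ga \<in> Mor (Arr C)" "de \<in> Mor (Arr C)"
    using un_P[OF M(3)] Pcube by (simp_all add: Arr_Mor ua_def al_def be_def ga_def de_def ends v0a)
  have Nends: "src ua = ?a" "tgt ua = P v0" "src al = P v0" "tgt al = P v1" "src be = P v0" "tgt be = P w0" "src ga = P w0" "tgt ga = P w1"
    "src de = P v1" "tgt de = P w1" by (simp_all add: ua_def al_def be_def ga_def de_def)
  have "P m0 \<cdot> un f = un ?f1" "P m10 \<cdot> un ?x10 = un ?y10" "P m01 \<cdot> un ?x01 = un c" "P m11 \<cdot> un ?x11 = un e3"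
    using un_P[OF M(9)] un_P[OF M(11)] un_P[OF M(10)] un_P[OF M(12)] by (simp_all add: ends) (simp_all add: m0_def m10_def m01_def m11_def)
  note mu = this
  \<comment> \<open>After composing with \<open>be\<close> the two components are \<open>un\<close>
    of the cones \<open>c \<cdot> f\<close> and \<open>0 \<rightarrow> E3\<close>.\<close>
  have be_ua: "be \<cdot>\<^bsub>Arr C\<^esub> ua \<in> levelwise C (Weq M)"
    using I.Comp_Mor[OF N(1,3)] un_cone[OF cones(1)] un_cone[OF cones(3)] mu by (simp add: levelwise_iff Nends) (simp add: be_def ua_def mu)
  have "P m01 \<in> Weq M" "P m11 \<in> Weq M"
    using W_left[OF un_Ident[of ?B], of "P m01"] W_left[OF un_Ident[of D], of "P m11"] mu un_cone[OF cones(2)] un_cone[OF cones(4)] by simp_all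
  then have de_W: "de \<in> levelwise C (Weq M)" using N(5) by (simp add: levelwise_iff de_def)
  have ga_be: "ga \<cdot>\<^bsub>Arr C\<^esub> be = de \<cdot>\<^bsub>Arr C\<^esub> al" using Pcube by (simp add: ga_def be_def de_def al_def)
  \<comment> \<open>The homotopy fibre of \<open>P v0\<close> is that of the map of total objects,
    since the map of bases is a weak equivalence. On total objects \<open>a0\<close> and
    \<open>a1\<close> give identities up to replacement, and over the identity arrows the fibre
    inclusions are weak equivalences because quotients of identities are contractible.\<close>
  have al_W: "hm al \<in> Weq M"
  proof -
    let ?p00 = "I.fobj q" and ?p10 = "I.fobj (cok_map C ?x10)" and ?p01 = "I.fobj (cok_map C ?x01)" and ?p11 = "I.fobj (cok_map C ?x11)"
    note k00 = rep[OF q(1)] and k10 = rep[OF cok_simps(1)[OF xM(2)]] and k01 = rep[OF cok_simps(1)[OF xM(1)]] and k11 = rep[OF cok_simps(1)[OF xM(3)]]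
    note [simp] = k00(1,8-13,18-20) k10(1,8-13,18-20) k01(1,8-13,18-20) k11(1,8-13,18-20) 
    have Kv0: "onmor K v0 \<in> Mor (Arr C)" "src (onmor K v0) = q" "tgt (onmor K v0) = cok_map C ?x10"
      and Kv1: "onmor K v1 \<in> Mor (Arr C)" "src (onmor K v1) = cok_map C ?x01" "tgt (onmor K v1) = cok_map C ?x11"
      and Ka0: "onmor K a0 \<in> Mor (Arr C)" "src (onmor K a0) = q" "tgt (onmor K a0) = cok_map C ?x01"
      and Ka1: "onmor K a1 \<in> Mor (Arr C)" "src (onmor K a1) = cok_map C ?x10" "tgt (onmor K a1) = cok_map C ?x11"
      using KM[OF M(3)] KM[OF M(4)] KM[OF M(1)] KM[OF M(2)] by (simp_all add: ends q_def)
    note f0 = repm[OF Kv0(1), unfolded Kv0(2,3)] and f1 = repm[OF Kv1(1), unfolded Kv1(2,3)]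
      and g0 = repm[OF Ka0(1), unfolded Ka0(2,3)] and g1 = repm[OF Ka1(1), unfolded Ka1(2,3)]
    note [simp] = f0(5-10) f1(5-10) g0(5-10) g1(5-10)
    have kv0: "ev1 (onmor K v0) \<in> Mor C" "Dom C (ev1 (onmor K v0)) = D" "Cod C (ev1 (onmor K v0)) = Cod C (cok_map C ?x10)"
      "ev1 (onmor K v0) \<cdot> q = cok_map C ?x10 \<cdot> q"
      using K_mor(4-7)[OF M(3)] by (simp_all add: ends q_def[symmetric]) (simp_all add: v0_def)
    have "ev1 (onmor K v0) = cok_map C ?x10"
      by (rule cokernel_epi[OF cok[OF fM], folded q_def]) (use kv0 in simp_all)
    then have wv0: "ev1 (onmor K v0) \<in> Weq M" using iso_Weq[OF cok_from_zero_iso[OF DO]] by simp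
    have "ev1 (I.fmor (onmor K v0)) \<cdot> ev1 (I.frep q) \<in> Weq M"
      unfolding f0(12) using W_comp[OF wv0 k10(7)] kv0 by simp
    then have w0: "ev1 (I.fmor (onmor K v0)) \<in> Weq M" using W_left[OF k00(7), of "ev1 (I.fmor (onmor K v0))"] by simp
    have th: "I.fmor (onmor K v0) \<in> hom (Arr C) ?p00 ?p10" using f0 by (simp add: hom_iff)
    let ?V0 = "ev0 (I.fmor (onmor K v0))" and ?V1 = "ev0 (I.fmor (onmor K v1))"
    let ?kap = "Sq (P v0) ?V0 (ker_map C ?p00) (ker_map C ?p10)"
    have kap: "?kap \<in> Mor (Arr C)" "hm ?kap \<in> Weq M"
      using fibre_of_kernels[OF th k00(14) k10(14) w0] by (simp_all add: P_def hm_def)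
    let ?kap' = "Sq (P v1) ?V1 (ker_map C ?p01) (ker_map C ?p11)"
    have "ker_map C ?p11 \<cdot> P v1 = ?V1 \<cdot> ker_map C ?p01" using hm(4)[OF Kv1(1)] Kv1(2,3) by (simp add: P_def)
    then have kap': "?kap' \<in> Mor (Arr C)" by (simp add: Arr_Mor)
    have kw: "ker_map C ?p01 \<in> Weq M" "ker_map C ?p11 \<in> Weq M"
      by (rule hf_contractible_base, use cok_Ident_contractible[OF AO(2)] in simp_all)
        (rule hf_contractible_base, use cok_Ident_contractible[OF DO] in simp_all)
    have kapW': "?kap' \<in> levelwise C (Weq M)" using kap' kw by (simp add: levelwise_iff)
    let ?Ma = "Sq ?V0 ?V1 (ev0 (I.fmor (onmor K a0))) (ev0 (I.fmor (onmor K a1)))"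
    have "I.fmor (onmor K v1 \<cdot>\<^bsub>Arr C\<^esub> onmor K a0) = I.fmor (onmor K a1 \<cdot>\<^bsub>Arr C\<^esub> onmor K v0)"
      using cube(1) functorD(6)[OF K_functor M(1,4)] functorD(6)[OF K_functor M(3,2)] ends by (simp del: Arr_simps(5))
    then have "I.fmor (onmor K v1) \<cdot>\<^bsub>Arr C\<^esub> I.fmor (onmor K a0) = I.fmor (onmor K a1) \<cdot>\<^bsub>Arr C\<^esub> I.fmor (onmor K v0)"
      using I.fmor_Comp[OF Ka0(1) Kv1(1)] I.fmor_Comp[OF Kv0(1) Ka1(1)] Ka0 Kv1 Kv0 Ka1 by (simp del: Arr_simps(5))
    then have Ma: "?Ma \<in> Mor (Arr C)" by (simp add: Arr_Mor)
    have "ev0 (I.fmor (onmor K a0)) \<cdot> ev0 (I.frep q) \<in> Weq M" "ev0 (I.fmor (onmor K a1)) \<cdot> ev0 (I.frep (cok_map C ?x10)) \<in> Weq M"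
      unfolding g0(11) g1(11) K_mor(3)[OF M(1)] K_mor(3)[OF M(2)] using k01(6) k11(6) by (simp_all add: a0_def a1_def)
    then have "ev0 (I.fmor (onmor K a0)) \<in> Weq M" "ev0 (I.fmor (onmor K a1)) \<in> Weq M"
      using W_left[OF k00(6), of "ev0 (I.fmor (onmor K a0))"] W_left[OF k10(6), of "ev0 (I.fmor (onmor K a1))"] by simp_all
    then have MaW: "?Ma \<in> levelwise C (Weq M)" using Ma by (simp add: levelwise_iff)
    have "?kap' \<cdot>\<^bsub>Arr C\<^esub> al = ?Ma \<cdot>\<^bsub>Arr C\<^esub> ?kap"
      using hm(4)[OF Ka0(1)] hm(4)[OF Ka1(1)] Ka0 Ka1 by (simp add: al_def P_def)
    then have "hm ?kap' \<cdot> hm al = hm ?Ma \<cdot> hm ?kap"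
      using hm_Comp[OF N(2) kap'] hm_Comp[OF kap(1) Ma] by (simp add: Nends)
    moreover have "hm ?Ma \<cdot> hm ?kap \<in> Weq M" using W_comp[OF kap(2) hm_Weq[OF MaW]] hm[OF kap(1)] hm[OF Ma] by simp
    ultimately show ?thesis using W_right[OF hm_Weq[OF kapW'], of "hm al"] hm[OF N(2)] hm[OF kap'] by (simp add: Nends)
  qed
  \<comment> \<open>The middle map of the two-out-of-six argument is \<open>hm be\<close>: preceded
    by \<open>hm ua\<close> it is known from cones, and followed by \<open>hm ga\<close> it equals
    \<open>hm de \<cdot> hm al\<close>.\<close>
  have "hm ua \<in> Weq M"
  proof (rule Weq_two_of_six)
    show "hm be \<cdot> hm ua \<in> Weq M" using hm_Weq[OF be_ua] hm_Comp[OF N(1,3)] by (simp add: Nends)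
    have "hm de \<cdot> hm al \<in> Weq M" using W_comp[OF al_W hm_Weq[OF de_W]] hm[OF N(2)] hm[OF N(5)] by (simp add: Nends)
    then show "hm ga \<cdot> hm be \<in> Weq M" using hm_Comp[OF N(3,4)] hm_Comp[OF N(2,5)] ga_be by (simp add: Nends del: Arr_simps(5))
    show "hm ua \<in> hom C (hf ?a) (hf (P v0))" "hm be \<in> hom C (hf (P v0)) (hf (P w0))" "hm ga \<in> hom C (hf (P w0)) (hf (P w1))"
      using hm(1-3)[OF N(1)] hm(1-3)[OF N(3)] hm(1-3)[OF N(4)] by (simp_all add: hom_iff Nends)
  qed
  note hua = this hm[OF N(1), unfolded Nends] repm[OF N(1), unfolded Nends]
  have aM: "?a \<in> Mor C" and vM: "P v0 \<in> Mor C" by simp_all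
  \<comment> \<open>Back from fibres to objects: the targets of \<open>?a\<close> and of
    \<open>P v0\<close> are contractible, so both homotopy fibres are weakly equivalent to the
    domains, and \<open>hm ua\<close> turns into \<open>un f\<close>.\<close>
  have "contractible (hf (cok_map C ?x10))" by (rule hf_Weq[OF iso_Weq[OF cok_from_zero_iso[OF DO]]])
  then have k: "ker_map C (I.fobj ?a) \<in> Weq M" "ker_map C (I.fobj (P v0)) \<in> Weq M"
    using hf_contractible_base[OF aM] hf_contractible_base[OF vM] ZI by simp_all
  note ra = rep[OF aM] and rv = rep[OF vM]
  note [simp] = ra(1,8-13,18-20) rv(1,8-13,18-20) hua(2-4) hua(10-12)
  have "ker_map C (I.fobj (P v0)) \<cdot> hm ua \<in> Weq M" using W_comp[OF hua(1) k(2)] by simp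
  then have "ev0 (I.fmor ua) \<cdot> ker_map C (I.fobj ?a) \<in> Weq M" unfolding hua(5) .
  then have "ev0 (I.fmor ua) \<in> Weq M" using W_left[OF k(1), of "ev0 (I.fmor ua)"] by simp
  then have "ev0 (I.fmor ua) \<cdot> ev0 (I.frep ?a) \<in> Weq M" using W_comp[OF ra(6)] by simp
  then have "ev0 (I.frep (P v0)) \<cdot> un f \<in> Weq M" unfolding hua(16) by (simp add: ua_def)
  then show ?thesis using W_right[OF rv(6), of "un f"] by simp
qed

end

section \<open>The Quillen equivalence\<close>

context category
begin

lemma pullback_mono:
  assumes pb: "is_pullback C p q a b" and p: "p \<in> hom C X Y" and q: "q \<in> hom C V Y"
    and h: "h \<in> Mor C" "h' \<in> Mor C" "Dom C h = Dom C h'" "Cod C h = Dom C a" "Cod C h' = Dom C a"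
    and e: "a \<cdot> h = a \<cdot> h'" "b \<cdot> h = b \<cdot> h'"
  shows "h = h'"
proof -
  note ab = pullback_hom[OF pb p q]
  note E = pullbackE[OF pb p q ab(1)]
  note [simp] = homD[OF p] homD[OF q] homD[OF ab(1), simplified] homD[OF ab(2)] h
  have u: "a \<cdot> h' \<in> hom C (Dom C h') X" "b \<cdot> h' \<in> hom C (Dom C h') V" "p \<cdot> (a \<cdot> h') = q \<cdot> (b \<cdot> h')"
    by (simp_all add: hom_iff reassoc2[OF E(2)])
  have "h \<in> hom C (Dom C h') (Dom C a) \<and> a \<cdot> h = a \<cdot> h' \<and> b \<cdot> h = b \<cdot> h'"
    "h' \<in> hom C (Dom C h') (Dom C a) \<and> a \<cdot> h' = a \<cdot> h' \<and> b \<cdot> h' = b \<cdot> h'"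
    using e by (simp_all add: hom_iff)
  with E(3)[OF u] show ?thesis by blast
qed

lemma pullback_ex:
  assumes pb: "is_pullback C p q a b" and p: "p \<in> hom C X Y" and q: "q \<in> hom C V Y"
    and u: "u \<in> hom C W X" "v \<in> hom C W V" "p \<cdot> u = q \<cdot> v"
  obtains h where "h \<in> hom C W (Dom C a)" "a \<cdot> h = u" "b \<cdot> h = v"
  using pullbackE(3)[OF pb p q pullback_hom(1)[OF pb p q] u] by blast

end

context pointed_model_category
begin

text \<open>A map into the pullback that \<open>b\<close> kills is the same as a map into
  \<open>X\<close> that \<open>p\<close> kills.\<close>

lemma pullback_kernel:
  assumes pb: "is_pullback C p q a b" and p: "p \<in> hom C X Y" and q: "q \<in> hom C V Y"
  obtains k where "k \<in> hom C (Dom C (ker_map C p)) (Dom C a)" "a \<cdot> k = ker_map C p"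
    "b \<cdot> k = zmap C (Dom C (ker_map C p)) V" "is_kernel C b k"
proof -
  note ab = pullback_hom[OF pb p q]
  note E = pullbackE[OF pb p q ab(1)]
  note [simp] = homD[OF p] homD[OF q] homD[OF ab(1), simplified] homD[OF ab(2)]
  have VO [simp]: "V \<in> Obj C" "Y \<in> Obj C" using hom_Obj[OF q] by auto
  have pM: "p \<in> Mor C" by simp
  let ?F = "Dom C (ker_map C p)"
  have FO [simp]: "?F \<in> Obj C" by simp
  have "ker_map C p \<in> hom C ?F X" "zmap C ?F V \<in> hom C ?F V" "p \<cdot> ker_map C p = q \<cdot> zmap C ?F V" by (simp_all add: hom_iff)
  from pullback_ex[OF pb p q this] obtain k
    where k: "k \<in> hom C ?F (Dom C a)" "a \<cdot> k = ker_map C p" "b \<cdot> k = zmap C ?F V" by blast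
  note [simp] = homD[OF k(1)]
  have "\<exists>!h. h \<in> hom C W ?F \<and> k \<cdot> h = g" if g: "g \<in> hom C W (Dom C b)" "b \<cdot> g = zmap C W (Cod C b)" for W g
  proof -
    note [simp] = homD[OF g(1), simplified]
    have WO [simp]: "W \<in> Obj C" using hom_Obj[OF g(1)] by simp
    have "p \<cdot> (a \<cdot> g) = zmap C W Y" using g(2) by (simp add: reassoc2[OF E(2)])
    then obtain h where h: "h \<in> Mor C" "Cod C h = ?F" "Dom C h = W" "ker_map C p \<cdot> h = a \<cdot> g"
      using kernel_ex[OF ker[OF pM], of "a \<cdot> g"] by auto
    note [simp] = h(1-3)
    show ?thesis
    proof (rule ex1I[of _ h])
      have "k \<cdot> h = g"
        by (rule pullback_mono[OF pb p q]) (use g(2) in \<open>simp_all add: reassoc[OF k(2)] reassoc[OF k(3)] h(4)\<close>)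
      then show "h \<in> hom C W ?F \<and> k \<cdot> h = g" by (simp add: hom_iff)
      fix h' assume h': "h' \<in> hom C W ?F \<and> k \<cdot> h' = g"
      note [simp] = homD[OF conjunct1[OF h']]
      have "ker_map C p \<cdot> h' = ker_map C p \<cdot> h"
        unfolding h(4) conjunct2[OF h', symmetric] by (simp add: reassoc[OF k(2)])
      then show "h' = h" by (rule kernel_mono[OF ker[OF pM]]) simp_all
    qed
  qed
  then have "is_kernel C b k" unfolding is_kernel_def using k(3) by simp
  with k that show thesis by blast
qed

text \<open>Replacing the base \<open>Y\<close> of \<open>p : X \<rightarrow> Y\<close> by the pullback along a path fibration \<open>\<pi>\<close> over \<open>Y\<close>
  identifies the fibre of \<open>p\<close> with \<open>P\<close>, which in turn fibres over \<open>X\<close> with fibre \<open>\<Omega> Y\<close>.\<close>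

lemma path_pullback:
  assumes p: "is_fibrant (Arr C) (injective C M) p"
    and \<pi>: "\<pi> \<in> hom C E (Cod C p)" "\<pi> \<in> Fib M" "contractible E"
  obtains P a b k l where "is_pullback C p \<pi> a b" "a \<in> hom C P (Dom C p)" "b \<in> hom C P E" "a \<in> Fib M"
    "k \<in> hom C (Dom C (ker_map C p)) P" "a \<cdot> k = ker_map C p" "b \<cdot> k = zmap C (Dom C (ker_map C p)) E" "k \<in> Weq M"
    "l \<in> hom C (Dom C (ker_map C \<pi>)) P" "a \<cdot> l = zmap C (Dom C (ker_map C \<pi>)) (Dom C p)" "b \<cdot> l = ker_map C \<pi>"
    "is_kernel C a l"
proof -
  note pF = injective_fibrantD[OF p]
  have ph: "p \<in> hom C (Dom C p) (Cod C p)" using Fib_Mor[OF pF(1)] by (simp add: hom_iff)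
  from ex_pullback[OF limits ph \<pi>(1)] obtain a b where pb: "is_pullback C p \<pi> a b" by blast
  note ab = pullback_hom[OF pb ph \<pi>(1)]
  have aF: "a \<in> Fib M" by (rule pullback_Fib[OF pb \<pi>(2)])
  have bF: "b \<in> Fib M" by (rule pullback_Fib[OF pullback_sym[OF pb] pF(1)])
  note [simp] = homD[OF ab(1), simplified] homD[OF ab(2)]
  from pullback_kernel[OF pb ph \<pi>(1)] obtain k where k: "k \<in> hom C (Dom C (ker_map C p)) (Dom C a)" "a \<cdot> k = ker_map C p"
    "b \<cdot> k = zmap C (Dom C (ker_map C p)) E" "is_kernel C b k" by blast
  from pullback_kernel[OF pullback_sym[OF pb] \<pi>(1) ph] obtain l
    where l: "l \<in> hom C (Dom C (ker_map C \<pi>)) (Dom C b)" "b \<cdot> l = ker_map C \<pi>"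
    "a \<cdot> l = zmap C (Dom C (ker_map C \<pi>)) (Dom C p)" "is_kernel C a l" by blast
  have E: "is_fibrant C M E" by (rule Fib_fibrant[OF \<pi>(2,1) pF(2)])
  have "k \<in> Weq M" by (rule kernel_contractible_base[OF bF _ _ k(4)]) (use E \<pi>(3) in simp_all)
  then show thesis using that[OF pb ab aF k(1-3) _ _ l(3,2,4)] l(1) by simp
qed

text \<open>Factor the map from the zero object. The trivial cofibration \<open>z\<close> stays in
  the conclusion because maps between path fibrations are constructed by lifting along it.\<close>

lemma path_fibration_ex:
  assumes Y: "Y \<in> Obj C"
  obtains E z \<pi> where "z \<in> hom C Z E" "z \<in> Cof M" "z \<in> Weq M" "\<pi> \<in> hom C E Y" "\<pi> \<in> Fib M"
    "\<pi> \<cdot> z = zmap C Z Y" "contractible E"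
proof -
  have "zmap C Z Y \<in> hom C Z Y" using Y by (simp add: hom_iff)
  from factor_tcof[OF this] obtain E z \<pi> where z: "z \<in> hom C Z E" "z \<in> Cof M" "z \<in> Weq M" "\<pi> \<in> hom C E Y" "\<pi> \<in> Fib M"
    "zmap C Z Y = \<pi> \<cdot> z" by metis
  then have "contractible E" using contractible_transfer[OF z(3)] homD[OF z(1)] contractible_zero by simp
  then show thesis by (rule that[OF z(1-5) z(6)[symmetric]])
qed

text \<open>Two families of projective trivial fibrations serve as tests: for a trivial fibration
  \<open>p : B \<rightarrow> A\<close> of \<open>C\<close>, the square from
  \<open>B \<rightarrow> 0\<close> to \<open>A \<rightarrow> 0\<close> detects cofibrancy of the
  domain, and the square from the identity of \<open>B\<close> to \<open>p\<close> detects lifting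
  of \<open>f\<close> against \<open>p\<close>.\<close>

lemma projective_cofibrantD:
  assumes f: "is_cofibrant (Arr C) (projective C M) f"
  shows "f \<in> Cof M" "is_cofibrant C M (Dom C f)"
proof -
  interpret P: model_category "Arr C" U "projective C M" by (rule projective_model)
  have fM [simp]: "f \<in> Mor C" using P.cofibrant_Obj[OF f] by simp
  have lift: "\<exists>k \<in> hom (Arr C) f x. s \<cdot>\<^bsub>Arr C\<^esub> k = h"
    if s: "s \<in> hom (Arr C) x y" "ev0 s \<in> Fib M" "ev1 s \<in> Fib M" "ev0 s \<in> Weq M" "ev1 s \<in> Weq M"
      and h: "h \<in> hom (Arr C) f y" for s x y h
  proof -
    have sM: "s \<in> Mor (Arr C)" using homD[OF s(1)] by simp
    have "s \<in> Fib (projective C M)" "s \<in> Weq (projective C M)" using s sM by (simp_all add: levelwise_iff)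
    from P.cofibrant_lift[OF f this s(1) h] show ?thesis by blast
  qed
  show "is_cofibrant C M (Dom C f)"
  proof (rule cofibrantI)
    fix p A B h assume p: "p \<in> Fib M" "p \<in> Weq M" "p \<in> hom C B A" and h: "h \<in> hom C (Dom C f) A"
    note [simp] = homD[OF p(3)] homD[OF h]
    have o [simp]: "A \<in> Obj C" "B \<in> Obj C" using hom_Obj[OF p(3)] by auto
    let ?s = "Sq (zmap C B Z) (zmap C A Z) p (Ident C Z)" and ?h = "Sq f (zmap C A Z) h (zmap C (Cod C f) Z)"
    have "?s \<in> hom (Arr C) (zmap C B Z) (zmap C A Z)" "?h \<in> hom (Arr C) f (zmap C A Z)" by (simp_all add: Arr_hom)
    from lift[OF this(1) _ _ _ _ this(2)] obtain k where k: "k \<in> hom (Arr C) f (zmap C B Z)" "?s \<cdot>\<^bsub>Arr C\<^esub> k = ?h"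
      using p Ident_Fib W_Ident by auto
    have "ev0 k \<in> hom C (Dom C f) B" "p \<cdot> ev0 k = h" using k by (auto simp: Arr_hom hom_iff[of _ C])
    then show "\<exists>k\<in>hom C (Dom C f) B. p \<cdot> k = h" by blast
  qed simp
  show "f \<in> Cof M"
  proof (rule CofI)
    fix p assume p: "p \<in> Fib M" "p \<in> Weq M"
    have pM [simp]: "p \<in> Mor C" using Fib_Mor[OF p(1)] .
    show "has_lifting C f p"
    proof (rule has_liftingI)
      fix u v assume u: "u \<in> hom C (Dom C f) (Dom C p)" and v: "v \<in> hom C (Cod C f) (Cod C p)" and e: "p \<cdot> u = v \<cdot> f"
      note [simp] = homD[OF u] homD[OF v]
      let ?s = "Sq (Ident C (Dom C p)) p (Ident C (Dom C p)) p"
      have "?s \<in> hom (Arr C) (Ident C (Dom C p)) p" "Sq f p u v \<in> hom (Arr C) f p" using e by (simp_all add: Arr_hom)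
      from lift[OF this(1) _ _ _ _ this(2)] obtain k where k: "k \<in> hom (Arr C) f (Ident C (Dom C p))" "?s \<cdot>\<^bsub>Arr C\<^esub> k = Sq f p u v"
        using p Ident_Fib W_Ident by auto
      note kD = Arr_MorD[OF homD(1)[OF k(1)]]
      have ks: "src k = f" "tgt k = Ident C (Dom C p)" using homD(2,3)[OF k(1)] by simp_all
      note [simp] = kD(3-8)[unfolded ks, simplified]
      have "ev1 k \<in> hom C (Cod C f) (Dom C p)" by (simp add: hom_iff)
      moreover have "ev1 k \<cdot> f = u" "p \<cdot> ev1 k = v" using k(2) kD(9) by (simp_all add: ks)
      ultimately show "\<exists>h\<in>hom C (Cod C f) (Dom C p). h \<cdot> f = u \<and> p \<cdot> h = v" by blast
    qed
  qed simp
qed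

end

context stable_model_category
begin

text \<open>The pullbacks \<open>P1\<close> and \<open>P\<close> along path fibrations are weakly
  equivalent to the fibres of \<open>p1\<close> and \<open>p\<close>, and the loop objects of the
  bases are the fibres of \<open>a1\<close> and \<open>a\<close>. So the hypotheses yield a weak
  equivalence \<open>\<omega>\<close> of loop objects; applying \<open>loop_counit\<close> over both
  bases to one cone \<open>y\<close> carries it back to the bases.\<close>

lemma base_Weq:
  assumes t: "t \<in> hom (Arr C) p1 p"
    and f: "is_fibrant (Arr C) (injective C M) p1" "is_fibrant (Arr C) (injective C M) p"
    and w: "ev0 t \<in> Weq M" "ev0 (onmor R t) \<in> Weq M"
  shows "ev1 t \<in> Weq M"
proof -
  have tM: "t \<in> Mor (Arr C)" "src t = p1" "tgt t = p" using t by (auto simp: hom_iff)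
  note tD = Arr_MorD[OF tM(1), unfolded tM(2,3)] and Rt = R_mor(4-7)[OF tM(1), unfolded tM(2,3)]
  note pF1 = injective_fibrantD[OF f(1)] and pF = injective_fibrantD[OF f(2)]
  note [simp] = tD(1-8) Rt(1-3)
  have o [simp]: "Cod C p1 \<in> Obj C" "Cod C p \<in> Obj C" "Dom C p1 \<in> Obj C" "Dom C p \<in> Obj C" by simp_all
  have ph: "p1 \<in> hom C (Dom C p1) (Cod C p1)" "p \<in> hom C (Dom C p) (Cod C p)" by (simp_all add: hom_iff)
  from path_fibration_ex[OF o(1)] obtain E1 z1 \<pi>1 where z1: "z1 \<in> hom C Z E1" "z1 \<in> Cof M" "z1 \<in> Weq M"
    and \<pi>1: "\<pi>1 \<in> hom C E1 (Cod C p1)" "\<pi>1 \<in> Fib M" and \<pi>z1: "\<pi>1 \<cdot> z1 = zmap C Z (Cod C p1)" and E1: "contractible E1" by blast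
  from path_fibration_ex[OF o(2)] obtain E z \<pi> where z: "z \<in> hom C Z E" "z \<in> Cof M" "z \<in> Weq M"
    and \<pi>: "\<pi> \<in> hom C E (Cod C p)" "\<pi> \<in> Fib M" and \<pi>z: "\<pi> \<cdot> z = zmap C Z (Cod C p)" and E: "contractible E" by blast
  note [simp] = homD[OF z1(1)] homD[OF z(1)] homD[OF \<pi>1(1)] homD[OF \<pi>(1)]
  have EO [simp]: "E1 \<in> Obj C" "E \<in> Obj C" using E1 E by (simp_all add: contractible_def)
  \<comment> \<open>A map of the chosen path fibrations over \<open>ev1 t\<close>; it exists because
    \<open>z1\<close> is a trivial cofibration.\<close>
  obtain \<phi> where ph\<phi>: "\<phi> \<in> hom C E1 E" and \<phi>: "\<pi> \<cdot> \<phi> = ev1 t \<cdot> \<pi>1"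
    by (rule lift_cof[OF z1(2) \<pi>(2) disjI1[OF z1(3)] z1(1) \<pi>(1), of "zmap C Z E" "ev1 t \<cdot> \<pi>1"])
      (simp_all add: hom_iff \<pi>z1)
  note [simp] = homD[OF ph\<phi>]
  obtain P1 a1 b1 k1 l1
    where pb1: "is_pullback C p1 \<pi>1 a1 b1" and a1: "a1 \<in> hom C P1 (Dom C p1)" and b1: "b1 \<in> hom C P1 E1" and a1F: "a1 \<in> Fib M"
    and k1: "k1 \<in> hom C (Dom C (ker_map C p1)) P1" "a1 \<cdot> k1 = ker_map C p1" "b1 \<cdot> k1 = zmap C (Dom C (ker_map C p1)) E1" "k1 \<in> Weq M"
    and l1: "l1 \<in> hom C (Dom C (ker_map C \<pi>1)) P1" "a1 \<cdot> l1 = zmap C (Dom C (ker_map C \<pi>1)) (Dom C p1)" "b1 \<cdot> l1 = ker_map C \<pi>1"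
      "is_kernel C a1 l1"
    by (rule path_pullback[OF f(1) \<pi>1 E1]) (rule that)
  obtain P a b k l
    where pb: "is_pullback C p \<pi> a b" and a: "a \<in> hom C P (Dom C p)" and b: "b \<in> hom C P E" and aF: "a \<in> Fib M"
    and k: "k \<in> hom C (Dom C (ker_map C p)) P" "a \<cdot> k = ker_map C p" "b \<cdot> k = zmap C (Dom C (ker_map C p)) E" "k \<in> Weq M"
    and l: "l \<in> hom C (Dom C (ker_map C \<pi>)) P" "a \<cdot> l = zmap C (Dom C (ker_map C \<pi>)) (Dom C p)" "b \<cdot> l = ker_map C \<pi>"
      "is_kernel C a l"
    by (rule path_pullback[OF f(2) \<pi> E]) (rule that)
  note [simp] = homD[OF a1] homD[OF b1] homD[OF k1(1)] homD[OF l1(1)] homD[OF a] homD[OF b] homD[OF k(1)] homD[OF l(1)]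
  note E1' = pullbackE(2)[OF pb1 ph(1) \<pi>1(1) a1]
  have "p \<cdot> (ev0 t \<cdot> a1) = \<pi> \<cdot> (\<phi> \<cdot> b1)"
    by (simp add: reassoc2[OF tD(9)] reassoc2[OF \<phi>] E1')
  moreover have "ev0 t \<cdot> a1 \<in> hom C P1 (Dom C p)" "\<phi> \<cdot> b1 \<in> hom C P1 E" by (simp_all add: hom_iff)
  ultimately obtain \<psi> where ps: "\<psi> \<in> hom C P1 (Dom C a)" and \<psi>: "a \<cdot> \<psi> = ev0 t \<cdot> a1" "b \<cdot> \<psi> = \<phi> \<cdot> b1"
    using pullback_ex[OF pb ph(2) \<pi>(1)] by blast
  note [simp] = homD[OF ps, simplified]
  let ?r = "ev0 (onmor R t)"
  have "\<psi> \<cdot> k1 = k \<cdot> ?r"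
    by (rule pullback_mono[OF pb ph(2) \<pi>(1)])
      (simp_all add: reassoc2[OF \<psi>(1)] reassoc2[OF \<psi>(2)] reassoc[OF k(2)] reassoc[OF k(3)] k1(2,3) Rt(4))
  then have "\<psi> \<cdot> k1 \<in> Weq M" using W_comp[OF w(2) k(4)] by simp
  then have \<psi>W: "\<psi> \<in> Weq M" using W_left[OF k1(4), of \<psi>] by simp
  let ?s = "Sq a1 a \<psi> (ev0 t)" and ?T = "Sq \<pi>1 \<pi> \<phi> (ev1 t)"
  have sM: "?s \<in> Mor (Arr C)" and TM: "?T \<in> Mor (Arr C)" using \<psi>(1) \<phi> by (simp_all add: Arr_Mor)
  have sW: "?s \<in> levelwise C (Weq M)" using sM \<psi>W w(1) by (simp add: levelwise_iff)
  have "onmor R ?s \<in> levelwise C (Weq M)"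
    by (rule R_Weq[OF sW]) (use injective_fibrantI[OF a1F] injective_fibrantI[OF aF] pF1(3) pF(3) in simp_all)
  then have xW: "ev0 (onmor R ?s) \<in> Weq M" unfolding levelwise_iff by blast
  define x where "x = ev0 (onmor R ?s)"
  define \<omega> where "\<omega> = ev0 (onmor R ?T)"
  have x: "x \<in> Mor C" "Dom C x = Dom C (ker_map C a1)" "Cod C x = Dom C (ker_map C a)" "ker_map C a \<cdot> x = \<psi> \<cdot> ker_map C a1" "x \<in> Weq M"
    using R_mor(4-7)[OF sM] xW unfolding x_def by simp_all
  have om: "\<omega> \<in> Mor C" "Dom C \<omega> = Dom C (ker_map C \<pi>1)" "Cod C \<omega> = Dom C (ker_map C \<pi>)" "ker_map C \<pi> \<cdot> \<omega> = \<phi> \<cdot> ker_map C \<pi>1"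
    using R_mor(4-7)[OF TM] unfolding \<omega>_def by simp_all
  note [simp] = x(1-3) om(1-3)
  have lo: "l \<cdot> \<omega> = \<psi> \<cdot> l1"
    by (rule pullback_mono[OF pb ph(2) \<pi>(1)])
      (simp_all add: reassoc2[OF \<psi>(1)] reassoc2[OF \<psi>(2)] reassoc[OF l(2)] reassoc[OF l(3)] l1(2,3) om(4))
  from kernel_unique[OF l(4)] obtain \<theta> where th: "is_iso C \<theta>" "\<theta> \<in> hom C (Dom C l) (Dom C (ker_map C a))" "ker_map C a \<cdot> \<theta> = l" by blast
  from kernel_unique[OF l1(4)] obtain \<theta>1 where th1: "is_iso C \<theta>1" "\<theta>1 \<in> hom C (Dom C l1) (Dom C (ker_map C a1))" "ker_map C a1 \<cdot> \<theta>1 = l1" by blast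
  note [simp] = homD[OF th(2), simplified] homD[OF th1(2), simplified]
  have aM: "a \<in> Mor C" by simp
  have "\<theta> \<cdot> \<omega> = x \<cdot> \<theta>1"
    by (rule kernel_mono[OF ker[OF aM]]) (simp_all add: reassoc[OF th(3)] reassoc2[OF x(4)] th1(3) lo)
  then have "\<theta> \<cdot> \<omega> \<in> Weq M" using W_comp[OF iso_Weq[OF th1(1)] x(5)] by simp
  then have oW: "\<omega> \<in> Weq M" using W_right[OF iso_Weq[OF th(1)], of \<omega>] by simp
  have p\<pi>: "is_path_arrow \<pi>1" "is_path_arrow \<pi>" using \<pi>1 \<pi> E1 E pF1(2) pF(2) by (simp_all add: is_path_arrow_def)
  have "Dom C (ker_map C \<pi>1) \<in> Obj C" by simp
  \<comment> \<open>A cone \<open>y\<close> on a cofibrant replacement \<open>V\<close> of the loop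
    object of the first base, taken as the left factor of
    \<open>ker_map C \<pi>1 \<cdot> \<rho>\<close>. By this choice \<open>\<rho>\<close> is the
    adjoint of a square \<open>m\<close> from \<open>cok y\<close> to \<open>\<pi>1\<close>.\<close>
  from cofibrant_repl[OF this] obtain V \<rho> where \<rho>: "\<rho> \<in> hom C V (Dom C (ker_map C \<pi>1))" "\<rho> \<in> Fib M" "\<rho> \<in> Weq M" and V: "is_cofibrant C M V" by blast
  note [simp] = homD[OF \<rho>(1)]
  have "ker_map C \<pi>1 \<cdot> \<rho> \<in> hom C V E1" by (simp add: hom_iff)
  from factor_cof[OF this] obtain G y e where y: "y \<in> hom C V G" "y \<in> Cof M" and e: "e \<in> hom C G E1" "e \<in> Weq M" and ey: "ker_map C \<pi>1 \<cdot> \<rho> = e \<cdot> y" by blast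
  note [simp] = homD[OF y(1)] homD[OF e(1)]
  have yc: "is_cone_arrow y" using y V contractible_transfer[OF e(2)] E1 by (simp add: is_cone_arrow_def)
  have yM: "y \<in> Mor C" and \<pi>M: "\<pi>1 \<in> Mor C" by simp_all
  have "Sq y (ker_map C \<pi>1) \<rho> e \<in> hom (Arr C) y (ker_map C \<pi>1)" using ey by (simp add: Arr_hom)
  from adj_surj[OF yM \<pi>M this] obtain m where m: "m \<in> hom (Arr C) (cok_map C y) \<pi>1" "\<Phi> y \<pi>1 m = Sq y (ker_map C \<pi>1) \<rho> e" by blast
  have m1: "ev1 m \<in> Weq M" by (rule loop_counit[OF yc p\<pi>(1) m(1)]) (use m(2) \<rho>(3) in simp)
  have Th: "?T \<in> hom (Arr C) \<pi>1 \<pi>" using TM by (simp add: hom_iff)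
  \<comment> \<open>By naturality the composite with \<open>?T\<close> has adjoint
    \<open>\<omega> \<cdot> \<rho>\<close>, again a weak equivalence; two-out-of-three then isolates
    \<open>ev1 t\<close>.\<close>
  have "\<Phi> y \<pi> (?T \<cdot>\<^bsub>Arr C\<^esub> m) = onmor R ?T \<cdot>\<^bsub>Arr C\<^esub> \<Phi> y \<pi>1 m"
    using adj_nat_right[OF yM TM, of m] m(1) by simp
  then have "ev0 (\<Phi> y \<pi> (?T \<cdot>\<^bsub>Arr C\<^esub> m)) = \<omega> \<cdot> \<rho>" by (simp add: \<omega>_def m(2))
  then have "ev0 (\<Phi> y \<pi> (?T \<cdot>\<^bsub>Arr C\<^esub> m)) \<in> Weq M" using W_comp[OF \<rho>(3) oW] by simp
  from loop_counit[OF yc p\<pi>(2) I.Comp_in[OF m(1) Th] this] have "ev1 t \<cdot> ev1 m \<in> Weq M" by simp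
  moreover have "Cod C (ev1 m) = Cod C p1" using m(1) by (auto simp: Arr_hom)
  ultimately show ?thesis using W_left[OF m1, of "ev1 t"] by simp
qed

text \<open>Extend \<open>h\<close> to a square \<open>h'\<close> out of the injectively fibrant
  replacement of \<open>cok f\<close>. On adjoints this splits off the weak equivalence
  \<open>un f\<close>, so that \<open>h'\<close> and its map of fibres remain: one direction is
  \<open>R_Weq\<close>, the other is \<open>base_Weq\<close>.\<close>

lemma adjoint_Weq_iff:
  assumes f: "is_cofibrant (Arr C) (projective C M) f" and p: "is_fibrant (Arr C) (injective C M) p"
    and h: "h \<in> hom (Arr C) (cok_map C f) p"
  shows "h \<in> levelwise C (Weq M) \<longleftrightarrow> \<Phi> f p h \<in> levelwise C (Weq M)"
proof -
  note fc = projective_cofibrantD[OF f]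
  have fM [simp]: "f \<in> Mor C" using Cof_Mor[OF fc(1)] .
  have pM [simp]: "p \<in> Mor C" using I.fibrant_Obj[OF p] by simp
  let ?q = "cok_map C f"
  have qM: "?q \<in> Mor C" by simp
  note r = rep[OF qM]
  have qO: "?q \<in> Obj (Arr C)" by simp
  from I.fibrant_ext[OF p I.frep(4,5)[OF qO] r(2) h] obtain h' where h': "h' \<in> hom (Arr C) (I.fobj ?q) p" "h' \<cdot>\<^bsub>Arr C\<^esub> I.frep ?q = h" by blast
  have h'M: "h' \<in> Mor (Arr C)" "src h' = I.fobj ?q" "tgt h' = p" using h'(1) by (auto simp: hom_iff)
  have hM: "h \<in> Mor (Arr C)" using h by (auto simp: hom_iff)
  note h'D = Arr_MorD[OF h'M(1), unfolded h'M(2,3)] and Rh = R_mor(4-6)[OF h'M(1), unfolded h'M(2,3)]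
  note ah = adj[OF fM pM h]
  note u = un[OF fM]
  have e: "ev0 h = ev0 h' \<cdot> ev0 (I.frep ?q)" "ev1 h = ev1 h' \<cdot> ev1 (I.frep ?q)" using h'(2) by auto
  have "\<Phi> f p h = onmor R h' \<cdot>\<^bsub>Arr C\<^esub> \<Phi> f (I.fobj ?q) (I.frep ?q)"
    using adj_nat_right[OF fM h'M(1), of "I.frep ?q"] r(2) h'(2) by (simp add: h'M del: Arr_simps(5))
  then have e0: "ev0 (\<Phi> f p h) = ev0 (onmor R h') \<cdot> un f" by (simp add: un_def)
  have uW: "un f \<in> Weq M" by (rule un_Weq[OF fc])
  have c: "Cod C (un f) = Dom C (ev0 (onmor R h'))" using u(3) Rh(2) by (simp add: hf_def)
  have i0: "ev0 h \<in> Weq M \<longleftrightarrow> ev0 h' \<in> Weq M"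
    unfolding e using W_comp[OF r(6), of "ev0 h'"] W_left[OF r(6), of "ev0 h'"] h'D(3,5) r(11) by auto
  have i1: "ev1 h \<in> Weq M \<longleftrightarrow> ev1 h' \<in> Weq M"
    unfolding e using W_comp[OF r(7), of "ev1 h'"] W_left[OF r(7), of "ev1 h'"] h'D(4,7) r(13) by auto
  have iR: "ev0 (\<Phi> f p h) \<in> Weq M \<longleftrightarrow> ev0 (onmor R h') \<in> Weq M"
    unfolding e0 using W_comp[OF uW, of "ev0 (onmor R h')"] W_left[OF uW, of "ev0 (onmor R h')"] c Rh(1) by auto
  have "ev0 (onmor R h') \<in> Weq M" if "ev0 h' \<in> Weq M" "ev1 h' \<in> Weq M"
  proof -
    have "h' \<in> levelwise C (Weq M)" using that h'M by (simp add: levelwise_iff)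
    then have "onmor R h' \<in> levelwise C (Weq M)" by (rule R_Weq) (simp_all add: h'M(2,3) r(14) p)
    then show ?thesis unfolding levelwise_iff by blast
  qed
  moreover have "ev1 h' \<in> Weq M" if "ev0 h' \<in> Weq M" "ev0 (onmor R h') \<in> Weq M"
    by (rule base_Weq[OF h'(1) r(14) p that])
  moreover have "\<Phi> f p h \<in> Mor (Arr C)" using ah(8) by (auto simp: hom_iff)
  ultimately show ?thesis unfolding levelwise_iff ah(3) i0 i1 iR using hM by blast
qed

end

theorem theorem4p3:
  fixes C :: "('o, 'm) cat" and U :: "'u::infinite itself" and M :: "'m model_structure"
  assumes "stable_model_category C U M"
  shows "quillen_equivalence (Arr C) (Arr C) U (projective C M) (injective C M)
           (cokernel_functor C) (kernel_functor C) (cok_ker_adj C)"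
proof -
  interpret stable_model_category C U M by (rule assms)
  have a: "quillen_adjunction (Arr C) (Arr C) U (projective C M) (injective C M)
      (cokernel_functor C) (kernel_functor C) (cok_ker_adj C)"
    by (intro quillen_adjunction.intro quillen_adjunction_axioms.intro projective_model injective_model
        cok_ker_adjunction K_preserves)
  show ?thesis
  proof (rule quillen_equivalence.intro[OF a], unfold_locales)
    fix f p h assume "is_cofibrant (Arr C) (projective C M) f" "is_fibrant (Arr C) (injective C M) p"
      and "h \<in> hom (Arr C) (onobj (cokernel_functor C) f) p"
    then show "h \<in> Weq (injective C M) \<longleftrightarrow> cok_ker_adj C f p h \<in> Weq (projective C M)"
      using adjoint_Weq_iff by simp
  qed
qed

end
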